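(* For each $k=1,2,3,4$ the functor $\mathsf{Pt}_k:\mathsf{EL}_k\to\mathsf{ET}_k$ is a right adjoint of the functor $\overline{\Omega}_k:\mathsf{ET}_k\to\mathsf{EL}_k$, where $\mathsf{EL}_k$ (resp. $\mathsf{ET}_k$) is the category of étale localic (resp. étale topological) categories and their morphisms of type $k$. The component $\eta_C=(\eta_{C,1},\eta_{C,0})$ of the unit $\eta$ of each of these adjunctions is single-valued, and $\eta_{C,i}(a)(B)=1$ if and only if $a\in B$, for $i=0,1$, $a\in C_i$ and $B\in\Omega(C_i)$.
   Context: **Locales.** A locale $X$ has frame $O(X)$; a locale map $f:X\to Y$ is given by a frame map $f^*:O(Y)\to O(X)$. It is semiopen if $f^*$ preserves arbitrary meets, with $f_!$ the left adjoint of $f^*$; open if moreover $f_!(a\wedge f^*(b))=f_!(a)\wedge b$; étale if it is open and there is $B\subseteq O(X)$ with $\bigvee B=1$ such that $O(Y)\to b^{\downarrow}$, $x\mapsto f^*(x)\wedge b$, is surjective for each $b\in B$. $\Omega(X)$ is the frame (and the locale) of opens of a space $X$; for a continuous $f$, $\Omega(f)$ is the locale map given by $f^{-1}$. $\mathsf{pt}(L)$ is the set of frame maps $O(L)\to\mathbf 2=\{0,1\}$ with open sets $X_a=\{p:p(a)=1\}$, $a\in O(L)$; $\mathsf{pt}(\varphi)(p)=p\varphi^*$. **Étale categories.** A localic (resp. topological) category $C=(C_1,C_0,u,d,r,m)$ is an internal category in locales (resp. spaces): $u:C_0\to C_1$, $d,r:C_1\to C_0$, $m:C_1\times_{C_0}C_1\to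 C_1$, where $C_1\times_{C_0}C_1$ is the pullback with $d\pi_1=r\pi_2$ (for spaces, $\{(a,b):d(a)=r(b)\}$), $du=ru=\mathrm{id}$, $rm=r\pi_1$, $dm=d\pi_2$, and unit and associativity laws. It is étale if $u,m$ are open and $d,r$ are étale (resp. local homeomorphisms). **Restriction quantal frames.** An Ehresmann quantal frame is a unital quantale $Q$ (unit $e$) whose lattice is a frame, with join-preserving maps $\lambda,\rho:Q\to e^{\downarrow}$ satisfying $\lambda(a)=\rho(a)=a$ for $a\le e$; $a=\rho(a)a=a\lambda(a)$; $\lambda(ab)=\lambda(\lambda(a)b)$, $\rho(ab)=\rho(a\rho(b))$. A partial isometry is $a\in Q$ such that every $b\le a$ has the form $b=ga=af$ with $f,g\le e$. A restriction quantal frame is an Ehresmann quantal frame in which $1$ is a join of partial isometries and these are closed under multiplication. A morphism of restriction quantal frames preserves arbitrary joins, multiplication, unit, $\lambda,\rho$, and maps partial isometries to partial isometries; it is proper if it preserves the top, and a $\wedge$-morphism if it preserves non-empty finite meets. Types: 1 morphisms; 2 proper morphisms; 3 $\wedge$-morphisms; 4 proper $\wedge$-morphisms. For an étale localic category $C$, $\mathcal O(C)$ is the restriction quantal frame $O(C_1)$ with $ab=m_!(a\otimes b)$ where $a\otimes b=\pi_1^*(a)\wedge\pi_2^*(b)$, $e=u_!(1)$, $\lambda=u_!d_!$, $\rho=u_!r_!$; its partial isometries are called local bisections of $C$. **$\mathsf{EL}_k$.** A morphism $f_1:C\to D$ of type $k$ of étale localic categories is, by definition, a morphism $f_1^*:\mathcal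 O(D)\to\mathcal O(C)$ of restriction quantal frames of type $k$ taken in the opposite direction. Put $f_0^*=d_!f_1^*u_!$, a frame map defining $f_0:C_0\to D_0$. **$\mathsf{ET}_k$.** A relational covering morphism $f=(f_1,f_0):C\to D$ of étale topological categories consists of a continuous $f_0:C_0\to D_0$ and a function $f_1:C_1\to\mathcal P(D_1)$ (power set) such that: (RM1) $b\in f_1(a)$ implies $d(b)=f_0d(a)$ and $r(b)=f_0r(a)$; (RM2) if $(a,b)\in C_1\times_{C_0}C_1$, $(s,t)\in D_1\times_{D_0}D_1$, $s\in f_1(a)$, $t\in f_1(b)$, then $st\in f_1(ab)$; (RM3) if $d(a)=d(b)$ or $r(a)=r(b)$, and $f_1(a)\cap f_1(b)\ne\varnothing$, then $a=b$; (RM4) if $p=f_0(q)$ and $d(s)=p$ (resp. $r(s)=p$) with $q\in C_0$, $s\in D_1$, there is $t\in C_1$ with $d(t)=q$ (resp. $r(t)=q$) and $s\in f_1(t)$; (RM5) $f_1^{-1}(A)=\{x\in C_1:f_1(x)\cap A\ne\varnothing\}$ is open for every open $A\subseteq D_1$; (RM6) $uf_0(t)\in f_1u(t)$ for $t\in C_0$. Composition: $(gf)_1(a)=\bigcup_{b\in f_1(a)}g_1(b)$, $(gf)_0=g_0f_0$. Type 1: all relational covering morphisms; type 2: at least single-valued ($|f_1(c)|\ge1$ for all $c$); type 3: at most single-valued ($|f_1(c)|\le1$); type 4: single-valued ($|f_1(c)|=1$); a one-element set is identified with its element. **The functors.** $\overline\Omega(C)=(\Omega(C_1),\Omega(C_0))$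 with structure maps $\Omega(u),\Omega(d),\Omega(r),\Omega(m)$, and $\overline\Omega(f)$ is given by $f_1^{-1}:\mathcal O(\overline\Omega(D))\to\mathcal O(\overline\Omega(C))$. $\mathsf{Pt}(C)=(\mathsf{pt}(C_1),\mathsf{pt}(C_0))$ with structure maps $\mathsf{pt}(u),\mathsf{pt}(d),\mathsf{pt}(r),\mathsf{pt}(m)$ (using the canonical homeomorphism $\mathsf{pt}(C_1\times_{C_0}C_1)\cong\mathsf{pt}(C_1)\times_{\mathsf{pt}(C_0)}\mathsf{pt}(C_1)$), and $\mathsf{Pt}(f_1)=(\mathsf{pt}'(f_1),\mathsf{pt}(f_0))$, where for $q\in\mathsf{pt}(C_1)$, $\mathsf{pt}'(f_1)(q)$ is the set of all $p_c$, for $c$ a local bisection of $D$ with $qf_1^*(c)=1$, $p_c$ being the unique point $p\in\mathsf{pt}(D_1)$ with $p(c)=1$ and $pd^*=qd^*f_0^*$. $\mathsf{Pt}_k$, $\overline\Omega_k$ are the restrictions to morphisms of type $k$. *)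

theory Defs
  imports "HOL-Analysis.Analysis" "HOL-Algebra.Group"
begin

section \<open>Frames and locales\<close>

locale frame = complete_lattice L for L (structure) +
  assumes meet_Sup_distrib:
    "\<lbrakk>x \<in> carrier L; A \<subseteq> carrier L\<rbrakk> \<Longrightarrow> x \<sqinter> \<Squnion>A = \<Squnion>((\<lambda>a. x \<sqinter> a) ` A)"

text \<open>
  A locale is identified with its frame, and a locale map \<open>f : X \<rightarrow> Y\<close> with its frame map
  \<open>f\<^sup>*\<close>, an element of \<open>frame_hom Y X\<close>. Frame maps are extensional functions, so that equality
  of maps is equality of functions.
\<close>

definition frame_hom :: "('a, 'm) gorder_scheme \<Rightarrow> ('b, 'n) gorder_scheme \<Rightarrow> ('a \<Rightarrow> 'b) set" where
  "frame_hom L M = {h \<in> carrier L \<rightarrow>\<^sub>E carrier M.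
     (\<forall>A\<subseteq>carrier L. h (\<Squnion>\<^bsub>L\<^esub>A) = \<Squnion>\<^bsub>M\<^esub>(h ` A)) \<and>
     h \<top>\<^bsub>L\<^esub> = \<top>\<^bsub>M\<^esub> \<and>
     (\<forall>x\<in>carrier L. \<forall>y\<in>carrier L. h (x \<sqinter>\<^bsub>L\<^esub> y) = h x \<sqinter>\<^bsub>M\<^esub> h y)}"

text \<open>The left adjoint \<open>f\<^sub>! : O(X) \<rightarrow> O(Y)\<close> of the frame map \<open>f : O(Y) \<rightarrow> O(X)\<close>.\<close>

definition left_adj :: "('a, 'm) gorder_scheme \<Rightarrow> ('b, 'n) gorder_scheme \<Rightarrow> ('b \<Rightarrow> 'a) \<Rightarrow> 'a \<Rightarrow> 'b" where
  "left_adj X Y f a =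
     (THE y. y \<in> carrier Y \<and> (\<forall>z\<in>carrier Y. y \<sqsubseteq>\<^bsub>Y\<^esub> z \<longleftrightarrow> a \<sqsubseteq>\<^bsub>X\<^esub> f z))"

definition semiopen_loc :: "('a, 'm) gorder_scheme \<Rightarrow> ('b, 'n) gorder_scheme \<Rightarrow> ('b \<Rightarrow> 'a) \<Rightarrow> bool" where
  "semiopen_loc X Y f \<longleftrightarrow> f \<in> frame_hom Y X \<and>
     (\<forall>A\<subseteq>carrier Y. f (\<Sqinter>\<^bsub>Y\<^esub>A) = \<Sqinter>\<^bsub>X\<^esub>(f ` A))"

definition open_loc :: "('a, 'm) gorder_scheme \<Rightarrow> ('b, 'n) gorder_scheme \<Rightarrow> ('b \<Rightarrow> 'a) \<Rightarrow> bool" where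
  "open_loc X Y f \<longleftrightarrow> semiopen_loc X Y f \<and>
     (\<forall>a\<in>carrier X. \<forall>b\<in>carrier Y.
        left_adj X Y f (a \<sqinter>\<^bsub>X\<^esub> f b) = left_adj X Y f a \<sqinter>\<^bsub>Y\<^esub> b)"

definition etale_loc :: "('a, 'm) gorder_scheme \<Rightarrow> ('b, 'n) gorder_scheme \<Rightarrow> ('b \<Rightarrow> 'a) \<Rightarrow> bool" where
  "etale_loc X Y f \<longleftrightarrow> open_loc X Y f \<and>
     (\<exists>B\<subseteq>carrier X. \<Squnion>\<^bsub>X\<^esub>B = \<top>\<^bsub>X\<^esub> \<and>
        (\<forall>b\<in>B. (\<lambda>x. f x \<sqinter>\<^bsub>X\<^esub> b) ` carrier Y = {a \<in> carrier X. a \<sqsubseteq>\<^bsub>X\<^esub> b}))"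

text \<open>
  The pullback of locale maps \<open>f : X \<rightarrow> Z\<close> and \<open>g : Y \<rightarrow> Z\<close>, i.e. the pushout of frames. It is
  the frame presented by generators \<open>a \<otimes> b\<close> (\<open>a \<in> O(X)\<close>, \<open>b \<in> O(Y)\<close>) that preserve finite meets
  jointly and joins in each variable, subject to \<open>f\<^sup>*(z) \<otimes> 1 = 1 \<otimes> g\<^sup>*(z)\<close>. As usual it is
  realized by the ideals of the corresponding coverage on \<open>O(X) \<times> O(Y)\<close>; an ideal \<open>I\<close> stands
  for the join of all \<open>a \<otimes> b\<close> with \<open>(a, b) \<in> I\<close>.
\<close>

definition pb_ideal ::
  "('a, 'm) gorder_scheme \<Rightarrow> ('z \<Rightarrow> 'a) \<Rightarrow> ('z, 'k) gorder_scheme \<Rightarrow> ('z \<Rightarrow> 'b) \<Rightarrow>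
   ('b, 'n) gorder_scheme \<Rightarrow> ('a \<times> 'b) set \<Rightarrow> bool" where
  "pb_ideal X f Z g Y I \<longleftrightarrow> I \<subseteq> carrier X \<times> carrier Y \<and>
     (\<forall>a b a' b'. (a, b) \<in> I \<and> a' \<in> carrier X \<and> b' \<in> carrier Y \<and> a' \<sqsubseteq>\<^bsub>X\<^esub> a \<and> b' \<sqsubseteq>\<^bsub>Y\<^esub> b
        \<longrightarrow> (a', b') \<in> I) \<and>
     (\<forall>A\<subseteq>carrier X. \<forall>b\<in>carrier Y. A \<times> {b} \<subseteq> I \<longrightarrow> (\<Squnion>\<^bsub>X\<^esub>A, b) \<in> I) \<and>
     (\<forall>a\<in>carrier X. \<forall>B\<subseteq>carrier Y. {a} \<times> B \<subseteq> I \<longrightarrow> (a, \<Squnion>\<^bsub>Y\<^esub>B) \<in> I) \<and>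
     (\<forall>a\<in>carrier X. \<forall>b\<in>carrier Y. \<forall>z\<in>carrier Z.
        (a \<sqinter>\<^bsub>X\<^esub> f z, b) \<in> I \<longleftrightarrow> (a, b \<sqinter>\<^bsub>Y\<^esub> g z) \<in> I)"

definition pb_loc ::
  "('a, 'm) gorder_scheme \<Rightarrow> ('z \<Rightarrow> 'a) \<Rightarrow> ('z, 'k) gorder_scheme \<Rightarrow> ('z \<Rightarrow> 'b) \<Rightarrow>
   ('b, 'n) gorder_scheme \<Rightarrow> ('a \<times> 'b) set gorder" where
  "pb_loc X f Z g Y = \<lparr>carrier = {I. pb_ideal X f Z g Y I}, eq = (=), le = (\<subseteq>)\<rparr>"

definition pb_proj1 ::
  "('a, 'm) gorder_scheme \<Rightarrow> ('z \<Rightarrow> 'a) \<Rightarrow> ('z, 'k) gorder_scheme \<Rightarrow> ('z \<Rightarrow> 'b) \<Rightarrow>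
   ('b, 'n) gorder_scheme \<Rightarrow> 'a \<Rightarrow> ('a \<times> 'b) set" where
  "pb_proj1 X f Z g Y = (\<lambda>a\<in>carrier X. \<Inter>{I. pb_ideal X f Z g Y I \<and> (a, \<top>\<^bsub>Y\<^esub>) \<in> I})"

definition pb_proj2 ::
  "('a, 'm) gorder_scheme \<Rightarrow> ('z \<Rightarrow> 'a) \<Rightarrow> ('z, 'k) gorder_scheme \<Rightarrow> ('z \<Rightarrow> 'b) \<Rightarrow>
   ('b, 'n) gorder_scheme \<Rightarrow> 'b \<Rightarrow> ('a \<times> 'b) set" where
  "pb_proj2 X f Z g Y = (\<lambda>b\<in>carrier Y. \<Inter>{I. pb_ideal X f Z g Y I \<and> (\<top>\<^bsub>X\<^esub>, b) \<in> I})"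

text \<open>The frame map of the locale map \<open>\<langle>h, k\<rangle> : W \<rightarrow> X \<times>\<^sub>Z Y\<close> with components \<open>h\<close> and \<open>k\<close>.\<close>

definition pb_pair ::
  "('w, 'l) gorder_scheme \<Rightarrow> ('a \<times> 'b) set gorder \<Rightarrow> ('a \<Rightarrow> 'w) \<Rightarrow> ('b \<Rightarrow> 'w) \<Rightarrow>
   ('a \<times> 'b) set \<Rightarrow> 'w" where
  "pb_pair W P h k = (\<lambda>I\<in>carrier P. \<Squnion>\<^bsub>W\<^esub>((\<lambda>(a, b). h a \<sqinter>\<^bsub>W\<^esub> k b) ` I))"


section \<open>Etale localic categories\<close>

text \<open>The fields \<open>ls_u\<close>, \<open>ls_d\<close>, \<open>ls_r\<close>, \<open>ls_m\<close> are the frame maps \<open>u\<^sup>*\<close>, \<open>d\<^sup>*\<close>, \<open>r\<^sup>*\<close>, \<open>m\<^sup>*\<close>.\<close>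

record ('a, 'b) loc_cat =
  L1 :: "'a gorder"
  L0 :: "'b gorder"
  ls_u :: "'a \<Rightarrow> 'b"
  ls_d :: "'b \<Rightarrow> 'a"
  ls_r :: "'b \<Rightarrow> 'a"
  ls_m :: "'a \<Rightarrow> ('a \<times> 'a) set"

definition L2 :: "('a, 'b) loc_cat \<Rightarrow> ('a \<times> 'a) set gorder" where
  "L2 C = pb_loc (L1 C) (ls_d C) (L0 C) (ls_r C) (L1 C)"

definition lpr1 :: "('a, 'b) loc_cat \<Rightarrow> 'a \<Rightarrow> ('a \<times> 'a) set" where
  "lpr1 C = pb_proj1 (L1 C) (ls_d C) (L0 C) (ls_r C) (L1 C)"

definition lpr2 :: "('a, 'b) loc_cat \<Rightarrow> 'a \<Rightarrow> ('a \<times> 'a) set" where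
  "lpr2 C = pb_proj2 (L1 C) (ls_d C) (L0 C) (ls_r C) (L1 C)"

text \<open>
  The locale of composable triples \<open>(x, y, z)\<close>, as the pullback of \<open>d\<pi>\<^sub>2 : C\<^sub>1 \<times> C\<^sub>1 \<rightarrow> C\<^sub>0\<close>
  and \<open>r : C\<^sub>1 \<rightarrow> C\<^sub>0\<close>, with its projections \<open>(x, y)\<close> and \<open>z\<close>.
\<close>

definition L3 :: "('a, 'b) loc_cat \<Rightarrow> (('a \<times> 'a) set \<times> 'a) set gorder" where
  "L3 C = pb_loc (L2 C) (\<lambda>x. lpr2 C (ls_d C x)) (L0 C) (ls_r C) (L1 C)"

definition lpr12 :: "('a, 'b) loc_cat \<Rightarrow> ('a \<times> 'a) set \<Rightarrow> (('a \<times> 'a) set \<times> 'a) set" where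
  "lpr12 C = pb_proj1 (L2 C) (\<lambda>x. lpr2 C (ls_d C x)) (L0 C) (ls_r C) (L1 C)"

definition lpr3 :: "('a, 'b) loc_cat \<Rightarrow> 'a \<Rightarrow> (('a \<times> 'a) set \<times> 'a) set" where
  "lpr3 C = pb_proj2 (L2 C) (\<lambda>x. lpr2 C (ls_d C x)) (L0 C) (ls_r C) (L1 C)"

text \<open>
  All equations between locale maps are written for the frame maps, so compositions appear in
  the reversed order; the last three are \<open>m\<langle>1, ud\<rangle> = 1\<close>, \<open>m\<langle>ur, 1\<rangle> = 1\<close> and
  \<open>m\<langle>m(x, y), z\<rangle> = m\<langle>x, m(y, z)\<rangle>\<close>.
\<close>

definition localic_category :: "('a, 'b) loc_cat \<Rightarrow> bool" where
  "localic_category C \<longleftrightarrow>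
     frame (L1 C) \<and> frame (L0 C) \<and>
     ls_u C \<in> frame_hom (L1 C) (L0 C) \<and>
     ls_d C \<in> frame_hom (L0 C) (L1 C) \<and>
     ls_r C \<in> frame_hom (L0 C) (L1 C) \<and>
     ls_m C \<in> frame_hom (L1 C) (L2 C) \<and>
     (\<forall>x\<in>carrier (L0 C). ls_u C (ls_d C x) = x) \<and>
     (\<forall>x\<in>carrier (L0 C). ls_u C (ls_r C x) = x) \<and>
     (\<forall>x\<in>carrier (L0 C). ls_m C (ls_r C x) = lpr1 C (ls_r C x)) \<and>
     (\<forall>x\<in>carrier (L0 C). ls_m C (ls_d C x) = lpr2 C (ls_d C x)) \<and>
     (\<forall>a\<in>carrier (L1 C).
        pb_pair (L1 C) (L2 C) (\<lambda>b. b) (\<lambda>b. ls_d C (ls_u C b)) (ls_m C a) = a) \<and>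
     (\<forall>a\<in>carrier (L1 C).
        pb_pair (L1 C) (L2 C) (\<lambda>b. ls_r C (ls_u C b)) (\<lambda>b. b) (ls_m C a) = a) \<and>
     (\<forall>a\<in>carrier (L1 C).
        pb_pair (L3 C) (L2 C) (\<lambda>b. lpr12 C (ls_m C b)) (lpr3 C) (ls_m C a) =
        pb_pair (L3 C) (L2 C) (\<lambda>b. lpr12 C (lpr1 C b))
          (\<lambda>b. pb_pair (L3 C) (L2 C) (\<lambda>c. lpr12 C (lpr2 C c)) (lpr3 C) (ls_m C b)) (ls_m C a))"

definition etale_localic_category :: "('a, 'b) loc_cat \<Rightarrow> bool" where
  "etale_localic_category C \<longleftrightarrow> localic_category C \<and>
     open_loc (L0 C) (L1 C) (ls_u C) \<and> open_loc (L2 C) (L1 C) (ls_m C) \<and>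
     etale_loc (L1 C) (L0 C) (ls_d C) \<and> etale_loc (L1 C) (L0 C) (ls_r C)"


section \<open>Etale topological categories\<close>

definition local_homeomorphism :: "'a topology \<Rightarrow> 'b topology \<Rightarrow> ('a \<Rightarrow> 'b) \<Rightarrow> bool" where
  "local_homeomorphism X Y f \<longleftrightarrow> continuous_map X Y f \<and>
     (\<forall>x\<in>topspace X. \<exists>U. openin X U \<and> x \<in> U \<and> openin Y (f ` U) \<and>
        homeomorphic_map (subtopology X U) (subtopology Y (f ` U)) f)"

record ('a, 'b) top_cat =
  T1 :: "'a topology"
  T0 :: "'b topology"
  ts_u :: "'b \<Rightarrow> 'a"
  ts_d :: "'a \<Rightarrow> 'b"
  ts_r :: "'a \<Rightarrow> 'b"
  ts_m :: "'a \<times> 'a \<Rightarrow> 'a"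

definition composable :: "('a, 'b) top_cat \<Rightarrow> ('a \<times> 'a) set" where
  "composable C = {(a, b). a \<in> topspace (T1 C) \<and> b \<in> topspace (T1 C) \<and> ts_d C a = ts_r C b}"

definition T2 :: "('a, 'b) top_cat \<Rightarrow> ('a \<times> 'a) topology" where
  "T2 C = subtopology (prod_topology (T1 C) (T1 C)) (composable C)"

definition topological_category :: "('a, 'b) top_cat \<Rightarrow> bool" where
  "topological_category C \<longleftrightarrow>
     continuous_map (T0 C) (T1 C) (ts_u C) \<and>
     continuous_map (T1 C) (T0 C) (ts_d C) \<and>
     continuous_map (T1 C) (T0 C) (ts_r C) \<and>
     continuous_map (T2 C) (T1 C) (ts_m C) \<and>
     (\<forall>x\<in>topspace (T0 C). ts_d C (ts_u C x) = x \<and> ts_r C (ts_u C x) = x) \<and>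
     (\<forall>(a, b)\<in>composable C.
        ts_r C (ts_m C (a, b)) = ts_r C a \<and> ts_d C (ts_m C (a, b)) = ts_d C b) \<and>
     (\<forall>a\<in>topspace (T1 C).
        ts_m C (a, ts_u C (ts_d C a)) = a \<and> ts_m C (ts_u C (ts_r C a), a) = a) \<and>
     (\<forall>a b c. (a, b) \<in> composable C \<and> (b, c) \<in> composable C \<longrightarrow>
        ts_m C (ts_m C (a, b), c) = ts_m C (a, ts_m C (b, c)))"

definition etale_topological_category :: "('a, 'b) top_cat \<Rightarrow> bool" where
  "etale_topological_category C \<longleftrightarrow> topological_category C \<and>
     open_map (T0 C) (T1 C) (ts_u C) \<and> open_map (T2 C) (T1 C) (ts_m C) \<and>
     local_homeomorphism (T1 C) (T0 C) (ts_d C) \<and> local_homeomorphism (T1 C) (T0 C) (ts_r C)"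


section \<open>Restriction quantal frames\<close>

record 'a quantal = "'a gorder" +
  qmult :: "'a \<Rightarrow> 'a \<Rightarrow> 'a" (infixl \<open>\<odot>\<index>\<close> 75)
  qunit :: 'a (\<open>\<e>\<index>\<close>)
  qlam :: "'a \<Rightarrow> 'a" (\<open>\<lambda>\<^sub>q\<index>\<close>)
  qrho :: "'a \<Rightarrow> 'a" (\<open>\<rho>\<^sub>q\<index>\<close>)

locale ehresmann_quantal_frame = frame Q for Q (structure) +
  assumes unital: "monoid \<lparr>carrier = carrier Q, monoid.mult = (\<odot>), one = \<e>\<rparr>"
    and mult_Sup: "\<lbrakk>a \<in> carrier Q; S \<subseteq> carrier Q\<rbrakk> \<Longrightarrow> a \<odot> \<Squnion>S = \<Squnion>((\<lambda>s. a \<odot> s) ` S)"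
    and Sup_mult: "\<lbrakk>a \<in> carrier Q; S \<subseteq> carrier Q\<rbrakk> \<Longrightarrow> \<Squnion>S \<odot> a = \<Squnion>((\<lambda>s. s \<odot> a) ` S)"
    and lam_closed: "a \<in> carrier Q \<Longrightarrow> \<lambda>\<^sub>q a \<in> carrier Q \<and> \<lambda>\<^sub>q a \<sqsubseteq> \<e>"
    and rho_closed: "a \<in> carrier Q \<Longrightarrow> \<rho>\<^sub>q a \<in> carrier Q \<and> \<rho>\<^sub>q a \<sqsubseteq> \<e>"
    and lam_Sup: "S \<subseteq> carrier Q \<Longrightarrow> \<lambda>\<^sub>q (\<Squnion>S) = \<Squnion>(\<lambda>\<^sub>q ` S)"
    and rho_Sup: "S \<subseteq> carrier Q \<Longrightarrow> \<rho>\<^sub>q (\<Squnion>S) = \<Squnion>(\<rho>\<^sub>q ` S)"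
    and lam_rho_below_unit: "\<lbrakk>a \<in> carrier Q; a \<sqsubseteq> \<e>\<rbrakk> \<Longrightarrow> \<lambda>\<^sub>q a = a \<and> \<rho>\<^sub>q a = a"
    and rho_mult: "a \<in> carrier Q \<Longrightarrow> \<rho>\<^sub>q a \<odot> a = a"
    and mult_lam: "a \<in> carrier Q \<Longrightarrow> a \<odot> \<lambda>\<^sub>q a = a"
    and lam_mult_eq: "\<lbrakk>a \<in> carrier Q; b \<in> carrier Q\<rbrakk> \<Longrightarrow> \<lambda>\<^sub>q (a \<odot> b) = \<lambda>\<^sub>q (\<lambda>\<^sub>q a \<odot> b)"
    and rho_mult_eq: "\<lbrakk>a \<in> carrier Q; b \<in> carrier Q\<rbrakk> \<Longrightarrow> \<rho>\<^sub>q (a \<odot> b) = \<rho>\<^sub>q (a \<odot> \<rho>\<^sub>q b)"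

definition partial_isometries :: "('a, 'm) quantal_scheme \<Rightarrow> 'a set" where
  "partial_isometries Q = {a \<in> carrier Q.
     \<forall>b\<in>carrier Q. b \<sqsubseteq>\<^bsub>Q\<^esub> a \<longrightarrow>
       (\<exists>f\<in>carrier Q. \<exists>g\<in>carrier Q. f \<sqsubseteq>\<^bsub>Q\<^esub> \<e>\<^bsub>Q\<^esub> \<and> g \<sqsubseteq>\<^bsub>Q\<^esub> \<e>\<^bsub>Q\<^esub> \<and>
          b = g \<odot>\<^bsub>Q\<^esub> a \<and> b = a \<odot>\<^bsub>Q\<^esub> f)}"

locale restriction_quantal_frame = ehresmann_quantal_frame Q for Q (structure) +
  assumes top_Sup_partial_isometries: "\<exists>S\<subseteq>partial_isometries Q. \<top> = \<Squnion>S"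
    and partial_isometries_mult:
      "\<lbrakk>a \<in> partial_isometries Q; b \<in> partial_isometries Q\<rbrakk> \<Longrightarrow> a \<odot> b \<in> partial_isometries Q"

definition rqf_hom ::
  "nat \<Rightarrow> ('a, 'm) quantal_scheme \<Rightarrow> ('b, 'n) quantal_scheme \<Rightarrow> ('a \<Rightarrow> 'b) set" where
  "rqf_hom k Q R = {h \<in> carrier Q \<rightarrow>\<^sub>E carrier R.
     restriction_quantal_frame Q \<and> restriction_quantal_frame R \<and>
     (\<forall>A\<subseteq>carrier Q. h (\<Squnion>\<^bsub>Q\<^esub>A) = \<Squnion>\<^bsub>R\<^esub>(h ` A)) \<and>
     (\<forall>a\<in>carrier Q. \<forall>b\<in>carrier Q. h (a \<odot>\<^bsub>Q\<^esub> b) = h a \<odot>\<^bsub>R\<^esub> h b) \<and>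
     h \<e>\<^bsub>Q\<^esub> = \<e>\<^bsub>R\<^esub> \<and>
     (\<forall>a\<in>carrier Q. h (\<lambda>\<^sub>q\<^bsub>Q\<^esub> a) = \<lambda>\<^sub>q\<^bsub>R\<^esub> (h a)) \<and>
     (\<forall>a\<in>carrier Q. h (\<rho>\<^sub>q\<^bsub>Q\<^esub> a) = \<rho>\<^sub>q\<^bsub>R\<^esub> (h a)) \<and>
     h ` partial_isometries Q \<subseteq> partial_isometries R \<and>
     (k \<in> {2, 4} \<longrightarrow> h \<top>\<^bsub>Q\<^esub> = \<top>\<^bsub>R\<^esub>) \<and>
     (k \<in> {3, 4} \<longrightarrow>
        (\<forall>a\<in>carrier Q. \<forall>b\<in>carrier Q. h (a \<sqinter>\<^bsub>Q\<^esub> b) = h a \<sqinter>\<^bsub>R\<^esub> h b))}"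

definition quantal_of :: "('a, 'b) loc_cat \<Rightarrow> 'a quantal" where
  "quantal_of C = \<lparr>carrier = carrier (L1 C), eq = eq (L1 C), le = le (L1 C),
     qmult = (\<lambda>a b. left_adj (L2 C) (L1 C) (ls_m C) (lpr1 C a \<sqinter>\<^bsub>L2 C\<^esub> lpr2 C b)),
     qunit = left_adj (L0 C) (L1 C) (ls_u C) \<top>\<^bsub>L0 C\<^esub>,
     qlam = (\<lambda>a. left_adj (L0 C) (L1 C) (ls_u C) (left_adj (L1 C) (L0 C) (ls_d C) a)),
     qrho = (\<lambda>a. left_adj (L0 C) (L1 C) (ls_u C) (left_adj (L1 C) (L0 C) (ls_r C) a))\<rparr>"

abbreviation local_bisections :: "('a, 'b) loc_cat \<Rightarrow> 'a set" where
  "local_bisections C \<equiv> partial_isometries (quantal_of C)"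


section \<open>The categories of type \<open>k\<close>\<close>

text \<open>
  A morphism \<open>f : C \<rightarrow> D\<close> of etale localic categories is represented by
  \<open>f\<^sub>1\<^sup>* : O(D) \<rightarrow> O(C)\<close>, and \<open>EL_obj_map\<close> computes \<open>f\<^sub>0\<^sup>*\<close> from it. In both categories
  composition is written in the usual order, with \<open>EL_comp E g f\<close> for \<open>f : C \<rightarrow> D\<close> and
  \<open>g : D \<rightarrow> E\<close>; the extra argument makes the composite extensional.
\<close>

definition EL_hom :: "nat \<Rightarrow> ('a, 'b) loc_cat \<Rightarrow> ('c, 'd) loc_cat \<Rightarrow> ('c \<Rightarrow> 'a) set" where
  "EL_hom k C D = rqf_hom k (quantal_of D) (quantal_of C)"

definition EL_id :: "('a, 'b) loc_cat \<Rightarrow> 'a \<Rightarrow> 'a" where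
  "EL_id C = (\<lambda>a\<in>carrier (L1 C). a)"

definition EL_comp :: "('e, 'f) loc_cat \<Rightarrow> ('e \<Rightarrow> 'c) \<Rightarrow> ('c \<Rightarrow> 'a) \<Rightarrow> 'e \<Rightarrow> 'a" where
  "EL_comp E g f = compose (carrier (L1 E)) f g"

definition EL_obj_map :: "('a, 'b) loc_cat \<Rightarrow> ('c, 'd) loc_cat \<Rightarrow> ('c \<Rightarrow> 'a) \<Rightarrow> 'd \<Rightarrow> 'b" where
  "EL_obj_map C D f = (\<lambda>x\<in>carrier (L0 D).
     left_adj (L1 C) (L0 C) (ls_d C) (f (left_adj (L0 D) (L1 D) (ls_u D) x)))"

definition relational_covering ::
  "('a, 'b) top_cat \<Rightarrow> ('c, 'd) top_cat \<Rightarrow> ('a \<Rightarrow> 'c set) \<Rightarrow> ('b \<Rightarrow> 'd) \<Rightarrow> bool" where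
  "relational_covering C D f1 f0 \<longleftrightarrow>
     f1 \<in> topspace (T1 C) \<rightarrow>\<^sub>E Pow (topspace (T1 D)) \<and>
     f0 \<in> extensional (topspace (T0 C)) \<and> continuous_map (T0 C) (T0 D) f0 \<and>
     (\<forall>a\<in>topspace (T1 C). \<forall>b\<in>f1 a. ts_d D b = f0 (ts_d C a) \<and> ts_r D b = f0 (ts_r C a)) \<and>
     (\<forall>(a, b)\<in>composable C. \<forall>(s, t)\<in>composable D.
        s \<in> f1 a \<and> t \<in> f1 b \<longrightarrow> ts_m D (s, t) \<in> f1 (ts_m C (a, b))) \<and>
     (\<forall>a\<in>topspace (T1 C). \<forall>b\<in>topspace (T1 C).
        (ts_d C a = ts_d C b \<or> ts_r C a = ts_r C b) \<and> f1 a \<inter> f1 b \<noteq> {} \<longrightarrow> a = b) \<and>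
     (\<forall>q\<in>topspace (T0 C). \<forall>s\<in>topspace (T1 D).
        (ts_d D s = f0 q \<longrightarrow> (\<exists>t\<in>topspace (T1 C). ts_d C t = q \<and> s \<in> f1 t)) \<and>
        (ts_r D s = f0 q \<longrightarrow> (\<exists>t\<in>topspace (T1 C). ts_r C t = q \<and> s \<in> f1 t))) \<and>
     (\<forall>A. openin (T1 D) A \<longrightarrow> openin (T1 C) {x \<in> topspace (T1 C). f1 x \<inter> A \<noteq> {}}) \<and>
     (\<forall>t\<in>topspace (T0 C). ts_u D (f0 t) \<in> f1 (ts_u C t))"

definition ET_hom ::
  "nat \<Rightarrow> ('a, 'b) top_cat \<Rightarrow> ('c, 'd) top_cat \<Rightarrow> (('a \<Rightarrow> 'c set) \<times> ('b \<Rightarrow> 'd)) set" where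
  "ET_hom k C D = {(f1, f0). relational_covering C D f1 f0 \<and>
     (k \<in> {2, 4} \<longrightarrow> (\<forall>c\<in>topspace (T1 C). f1 c \<noteq> {})) \<and>
     (k \<in> {3, 4} \<longrightarrow> (\<forall>c\<in>topspace (T1 C). \<forall>s\<in>f1 c. \<forall>t\<in>f1 c. s = t))}"

definition ET_id :: "('a, 'b) top_cat \<Rightarrow> ('a \<Rightarrow> 'a set) \<times> ('b \<Rightarrow> 'b)" where
  "ET_id C = (\<lambda>a\<in>topspace (T1 C). {a}, \<lambda>x\<in>topspace (T0 C). x)"

definition ET_comp ::
  "('a, 'b) top_cat \<Rightarrow> ('c \<Rightarrow> 'e set) \<times> ('d \<Rightarrow> 'f) \<Rightarrow> ('a \<Rightarrow> 'c set) \<times> ('b \<Rightarrow> 'd) \<Rightarrow>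
   ('a \<Rightarrow> 'e set) \<times> ('b \<Rightarrow> 'f)" where
  "ET_comp C g f =
     (\<lambda>a\<in>topspace (T1 C). \<Union>b\<in>fst f a. fst g b, compose (topspace (T0 C)) (snd g) (snd f))"


section \<open>The functor from spaces to locales\<close>

definition opens :: "'a topology \<Rightarrow> 'a set gorder" where
  "opens X = \<lparr>carrier = {U. openin X U}, eq = (=), le = (\<subseteq>)\<rparr>"

definition opens_map :: "'a topology \<Rightarrow> 'b topology \<Rightarrow> ('a \<Rightarrow> 'b) \<Rightarrow> 'b set \<Rightarrow> 'a set" where
  "opens_map X Y f = (\<lambda>V\<in>{V. openin Y V}. {x \<in> topspace X. f x \<in> V})"

definition opens_L2 :: "('a, 'b) top_cat \<Rightarrow> ('a set \<times> 'a set) set gorder" where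
  "opens_L2 C = pb_loc (opens (T1 C)) (opens_map (T1 C) (T0 C) (ts_d C)) (opens (T0 C))
     (opens_map (T1 C) (T0 C) (ts_r C)) (opens (T1 C))"

text \<open>
  The frame map of the canonical comparison
  \<open>\<Omega>(C\<^sub>1 \<times> C\<^sub>1) \<rightarrow> \<Omega>(C\<^sub>1) \<times> \<Omega>(C\<^sub>1)\<close> (pullbacks over the objects), which is an isomorphism when
  \<open>d\<close> or \<open>r\<close> is a local homeomorphism; through it \<open>\<Omega>(m)\<close> becomes a map from the localic pullback.
\<close>

definition opens_comparison :: "('a, 'b) top_cat \<Rightarrow> ('a set \<times> 'a set) set \<Rightarrow> ('a \<times> 'a) set" where
  "opens_comparison C = pb_pair (opens (T2 C)) (opens_L2 C)
     (opens_map (T2 C) (T1 C) fst) (opens_map (T2 C) (T1 C) snd)"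

definition Omega :: "('a, 'b) top_cat \<Rightarrow> ('a set, 'b set) loc_cat" where
  "Omega C = \<lparr>L1 = opens (T1 C), L0 = opens (T0 C),
     ls_u = opens_map (T0 C) (T1 C) (ts_u C),
     ls_d = opens_map (T1 C) (T0 C) (ts_d C),
     ls_r = opens_map (T1 C) (T0 C) (ts_r C),
     ls_m = (\<lambda>V\<in>{V. openin (T1 C) V}.
       inv_into (carrier (opens_L2 C)) (opens_comparison C)
         (opens_map (T2 C) (T1 C) (ts_m C) V))\<rparr>"

definition Omega_map ::
  "('a, 'b) top_cat \<Rightarrow> ('c, 'd) top_cat \<Rightarrow> ('a \<Rightarrow> 'c set) \<times> ('b \<Rightarrow> 'd) \<Rightarrow> 'c set \<Rightarrow> 'a set" where
  "Omega_map C D f =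
     (\<lambda>A\<in>{A. openin (T1 D) A}. {x \<in> topspace (T1 C). fst f x \<inter> A \<noteq> {}})"


section \<open>The functor from locales to spaces\<close>

text \<open>A point \<open>p\<close> is a predicate, \<open>p a\<close> meaning \<open>p(a) = 1\<close>.\<close>

definition two_frame :: "bool gorder" where
  "two_frame = \<lparr>carrier = UNIV, eq = (=), le = (\<le>)\<rparr>"

definition pt :: "('a, 'm) gorder_scheme \<Rightarrow> ('a \<Rightarrow> bool) set" where
  "pt L = frame_hom L two_frame"

definition pt_space :: "('a, 'm) gorder_scheme \<Rightarrow> ('a \<Rightarrow> bool) topology" where
  "pt_space L = topology (\<lambda>U. \<exists>a\<in>carrier L. U = {p \<in> pt L. p a})"

text \<open>\<open>pt(f)\<close> for a locale map \<open>f\<close> into \<open>Y\<close> with frame map \<open>f\<close>.\<close>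

definition pt_map :: "('b, 'n) gorder_scheme \<Rightarrow> ('b \<Rightarrow> 'a) \<Rightarrow> ('a \<Rightarrow> bool) \<Rightarrow> 'b \<Rightarrow> bool" where
  "pt_map Y f p = compose (carrier Y) p f"

definition pt_comparison ::
  "('a, 'b) loc_cat \<Rightarrow> (('a \<times> 'a) set \<Rightarrow> bool) \<Rightarrow> ('a \<Rightarrow> bool) \<times> ('a \<Rightarrow> bool)" where
  "pt_comparison C s = (pt_map (L1 C) (lpr1 C) s, pt_map (L1 C) (lpr2 C) s)"

definition Pt :: "('a, 'b) loc_cat \<Rightarrow> ('a \<Rightarrow> bool, 'b \<Rightarrow> bool) top_cat" where
  "Pt C = \<lparr>T1 = pt_space (L1 C), T0 = pt_space (L0 C),
     ts_u = pt_map (L1 C) (ls_u C),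
     ts_d = pt_map (L0 C) (ls_d C),
     ts_r = pt_map (L0 C) (ls_r C),
     ts_m = (\<lambda>pq. pt_map (L1 C) (ls_m C) (inv_into (pt (L2 C)) (pt_comparison C) pq))\<rparr>"

definition Pt_point ::
  "('a, 'b) loc_cat \<Rightarrow> ('c, 'd) loc_cat \<Rightarrow> ('c \<Rightarrow> 'a) \<Rightarrow> ('a \<Rightarrow> bool) \<Rightarrow> 'c \<Rightarrow> 'c \<Rightarrow> bool" where
  "Pt_point C D f q c = (THE p. p \<in> pt (L1 D) \<and> p c \<and>
     pt_map (L0 D) (ls_d D) p =
       pt_map (L0 D) (EL_obj_map C D f) (pt_map (L0 C) (ls_d C) q))"

definition Pt_map ::
  "('a, 'b) loc_cat \<Rightarrow> ('c, 'd) loc_cat \<Rightarrow> ('c \<Rightarrow> 'a) \<Rightarrow>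
   (('a \<Rightarrow> bool) \<Rightarrow> ('c \<Rightarrow> bool) set) \<times> (('b \<Rightarrow> bool) \<Rightarrow> ('d \<Rightarrow> bool))" where
  "Pt_map C D f =
     (\<lambda>q\<in>pt (L1 C). {Pt_point C D f q c |c. c \<in> local_bisections D \<and> q (f c)},
      \<lambda>q\<in>pt (L0 C). pt_map (L0 D) (EL_obj_map C D f) q)"


section \<open>The unit\<close>

definition unit_map ::
  "('a, 'b) top_cat \<Rightarrow> ('a \<Rightarrow> ('a set \<Rightarrow> bool) set) \<times> ('b \<Rightarrow> ('b set \<Rightarrow> bool))" where
  "unit_map C =
     (\<lambda>a\<in>topspace (T1 C). {\<lambda>B\<in>{B. openin (T1 C) B}. a \<in> B},
      \<lambda>x\<in>topspace (T0 C). \<lambda>B\<in>{B. openin (T0 C) B}. x \<in> B)"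

end

theory Submission
  imports Defs
begin

text \<open>
  The argument refines the adjunction between spaces and locales; the additional ingredients are
  the product of opens and the local bisections.

  Let \<open>C\<close> be an etale localic category. Since \<open>m\<close> is open, \<open>m\<^sup>*(c)\<close> is the ideal of all pairs
  \<open>(a, b)\<close> with \<open>ab \<le> c\<close> (\<open>mult_le_iff\<close>). In this form the laws of \<open>C\<close> become identities
  for the product of \<open>O(C\<^sub>1)\<close>: the unit laws say that \<open>e = u\<^sub>!(1)\<close> is a unit (\<open>mult_E\<close>,
  \<open>E_mult\<close>), and the associative law for \<open>m\<close> is associativity of the product
  (\<open>associativity_iff\<close>). Because \<open>d\<close> and \<open>r\<close> are etale, \<open>O(C\<^sub>1)\<close> is generated by the elements
  on which \<open>d\<close> and \<open>r\<close> restrict to isomorphisms with opens of \<open>C\<^sub>0\<close>. These elements are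
  the local bisections (\<open>bisection_iff\<close>) and they are closed under products, so that \<open>O(C)\<close> is
  a restriction quantal frame.

  For an etale topological category \<open>C\<close>, the localic pullback of \<open>\<Omega>(d)\<close> and \<open>\<Omega>(r)\<close> is the
  frame of opens of the space of composable pairs (\<open>box_in_ideal\<close>). Then the product of opens is
  the elementwise product, the local bisections of \<open>\<Omega>(C)\<close> are the opens on which \<open>d\<close> and \<open>r\<close>
  are injective, and \<open>f\<^sub>1\<^sup>-\<^sup>1\<close> is a morphism of restriction quantal frames for every relational
  covering morphism \<open>f\<close> (\<open>Omega_map_hom\<close>).

  On points, an element \<open>c\<close> on which \<open>d\<close> is an isomorphism with \<open>d\<^sub>!(c)\<close> behaves like a local
  section: \<open>d\<close> is a bijection from the points in \<open>c\<close> to the points in \<open>d\<^sub>!(c)\<close>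
  (\<open>section_pt_unique\<close>, \<open>section_pt_lift\<close>). This makes \<open>Pt(C)\<close> etale, and it shows that a point
  \<open>p\<close> belongs to \<open>Pt(f)(q)\<close> if and only if \<open>p\<close> lies over \<open>f\<^sub>0(d(q))\<close> and \<open>f\<^sup>*\<close> takes every
  neighbourhood of \<open>p\<close> to a neighbourhood of \<open>q\<close> (\<open>Pt_map_fst\<close>). The central formula is
  \<open>f_iff_above\<close>: \<open>q\<close> lies in \<open>f\<^sup>*(a)\<close> if and only if some \<open>p \<in> Pt(f)(q)\<close> lies in \<open>a\<close>.
  Through it, preservation of the top means that \<open>Pt(f)\<close> is at least single-valued, and
  preservation of binary meets makes it at most single-valued.

  The unit takes a point of a space to its neighbourhood filter, and the counit takes
  \<open>a \<in> O(L\<^sub>1)\<close> to the open set of all points in \<open>a\<close>. Given \<open>f : C \<rightarrow> Pt(L)\<close>, naturality of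
  the unit and one triangle identity show that the composite of \<open>\<Omega>(f)\<close> with the counit is a
  solution \<open>g\<close> of \<open>Pt(g) \<eta> = f\<close>. It is the only one, since by \<open>f_iff_above\<close> every solution
  satisfies \<open>x \<in> g\<^sup>*(a)\<close> if and only if some point in \<open>f(x)\<close> lies in \<open>a\<close>.
\<close>

section \<open>Frames and left adjoints\<close>

context frame
begin

lemma le_meet_iff:
  "\<lbrakk>x \<in> carrier L; y \<in> carrier L; z \<in> carrier L\<rbrakk> \<Longrightarrow> z \<sqsubseteq> x \<sqinter> y \<longleftrightarrow> z \<sqsubseteq> x \<and> z \<sqsubseteq> y"
  by (meson le_trans meet_closed meet_left meet_right meet_le)

lemma Sup_le_iff: "\<lbrakk>A \<subseteq> carrier L; z \<in> carrier L\<rbrakk> \<Longrightarrow> \<Squnion>A \<sqsubseteq> z \<longleftrightarrow> (\<forall>a\<in>A. a \<sqsubseteq> z)"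
  by (meson le_trans subsetD sup_closed sup_least sup_upper)

lemma le_Inf_iff: "\<lbrakk>A \<subseteq> carrier L; z \<in> carrier L\<rbrakk> \<Longrightarrow> z \<sqsubseteq> \<Sqinter>A \<longleftrightarrow> (\<forall>a\<in>A. z \<sqsubseteq> a)"
  by (meson le_trans subsetD inf_closed inf_greatest inf_lower)

lemma eq_by_upper:
  assumes "x \<in> carrier L" "y \<in> carrier L" "\<And>z. z \<in> carrier L \<Longrightarrow> x \<sqsubseteq> z \<longleftrightarrow> y \<sqsubseteq> z"
  shows "x = y"
  using assms by (meson le_antisym le_refl)

lemma eq_by_lower:
  assumes "x \<in> carrier L" "y \<in> carrier L" "\<And>z. z \<in> carrier L \<Longrightarrow> z \<sqsubseteq> x \<longleftrightarrow> z \<sqsubseteq> y"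
  shows "x = y"
  using assms by (meson le_antisym le_refl)

lemma meet_absorb: "\<lbrakk>x \<sqsubseteq> y; x \<in> carrier L; y \<in> carrier L\<rbrakk> \<Longrightarrow> x \<sqinter> y = x"
  by (meson le_antisym le_refl meet_closed meet_left meet_le)

lemma meet_absorb2: "\<lbrakk>x \<sqsubseteq> y; x \<in> carrier L; y \<in> carrier L\<rbrakk> \<Longrightarrow> y \<sqinter> x = x"
  using meet_absorb meet_comm by metis

lemma Sup_meet_distrib:
  "\<lbrakk>x \<in> carrier L; A \<subseteq> carrier L\<rbrakk> \<Longrightarrow> \<Squnion>A \<sqinter> x = \<Squnion>((\<lambda>a. a \<sqinter> x) ` A)"
  using meet_Sup_distrib[of x A] by (simp add: meet_comm[of L x])

lemma meet_mono:
  "\<lbrakk>x \<sqsubseteq> x'; y \<sqsubseteq> y'; x \<in> carrier L; y \<in> carrier L; x' \<in> carrier L; y' \<in> carrier L\<rbrakk>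
    \<Longrightarrow> x \<sqinter> y \<sqsubseteq> x' \<sqinter> y'"
  using le_trans[OF meet_left, of x y x'] le_trans[OF meet_right, of x y y'] by (simp add: le_meet_iff)

lemma meet_idem [simp]: "x \<in> carrier L \<Longrightarrow> x \<sqinter> x = x"
  by (simp add: meet_absorb)

lemma meet_top [simp]: "x \<in> carrier L \<Longrightarrow> x \<sqinter> \<top> = x" "x \<in> carrier L \<Longrightarrow> \<top> \<sqinter> x = x"
  by (simp_all add: meet_absorb meet_absorb2)

lemma meet_lcomm:
  "\<lbrakk>x \<in> carrier L; y \<in> carrier L; z \<in> carrier L\<rbrakk> \<Longrightarrow> x \<sqinter> (y \<sqinter> z) = y \<sqinter> (x \<sqinter> z)"
  by (metis meet_assoc meet_comm)

lemmas meet_ac = meet_assoc meet_comm meet_lcomm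

end

text \<open>
  Both the opens of a space and the ideals presenting a pullback are families of sets ordered by
  inclusion, with intersections as finite meets; they differ in how the join \<open>J A\<close> is formed.
\<close>

locale set_frame =
  fixes F :: "'s set set" and J :: "'s set set \<Rightarrow> 's set"
  assumes J_closed: "A \<subseteq> F \<Longrightarrow> J A \<in> F"
    and J_upper: "\<lbrakk>A \<subseteq> F; a \<in> A\<rbrakk> \<Longrightarrow> a \<subseteq> J A"
    and J_least: "\<lbrakk>A \<subseteq> F; z \<in> F; \<And>a. a \<in> A \<Longrightarrow> a \<subseteq> z\<rbrakk> \<Longrightarrow> J A \<subseteq> z"
    and Int_closed: "\<lbrakk>x \<in> F; y \<in> F\<rbrakk> \<Longrightarrow> x \<inter> y \<in> F"
    and Int_J: "\<lbrakk>x \<in> F; A \<subseteq> F\<rbrakk> \<Longrightarrow> x \<inter> J A \<subseteq> J ((\<inter>) x ` A)"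
begin

abbreviation S where "S \<equiv> \<lparr>carrier = F, eq = (=), le = (\<subseteq>)\<rparr>"

lemma complete: "complete_lattice S"
proof -
  interpret partial_order S by unfold_locales auto
  have lub: "least S (J A) (Upper S A)" if "A \<subseteq> F" for A
  proof (rule least_UpperI)
    fix y assume "y \<in> Upper S A"
    then have "y \<in> F" "\<forall>a\<in>A. a \<subseteq> y" using that by (auto simp: Upper_def)
    then show "J A \<sqsubseteq>\<^bsub>S\<^esub> y" using J_least[OF that] by simp
  qed (use that J_closed J_upper in auto)
  have glb: "greatest S (J {z\<in>F. \<forall>a\<in>A. z \<subseteq> a}) (Lower S A)" if A: "A \<subseteq> F" for A
  proof -
    let ?B = "{z\<in>F. \<forall>a\<in>A. z \<subseteq> a}"
    have B: "?B \<subseteq> F" by blast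
    show ?thesis
    proof (rule greatest_LowerI)
      fix a assume a: "a \<in> A"
      have "J ?B \<subseteq> a" by (rule J_least[OF B]) (use A a in auto)
      then show "J ?B \<sqsubseteq>\<^bsub>S\<^esub> a" by simp
    next
      fix y assume "y \<in> Lower S A"
      then have "y \<in> ?B" using A by (auto simp: Lower_def)
      then show "y \<sqsubseteq>\<^bsub>S\<^esub> J ?B" using J_upper[OF B] by simp
    qed (use A J_closed[OF B] in auto)
  qed
  show ?thesis
    by unfold_locales (use lub glb in auto)
qed

lemma Sup_eq: "A \<subseteq> F \<Longrightarrow> \<Squnion>\<^bsub>S\<^esub>A = J A"
proof -
  interpret complete_lattice S by (rule complete)
  assume A: "A \<subseteq> F"
  show ?thesis
    using sup_closed[of A] sup_upper[of A] sup_least[of A "J A"] J_closed[OF A] J_upper[OF A]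
      J_least[OF A, of "\<Squnion>\<^bsub>S\<^esub>A"] A by auto
qed

lemma meet_eq: "\<lbrakk>x \<in> F; y \<in> F\<rbrakk> \<Longrightarrow> x \<sqinter>\<^bsub>S\<^esub> y = x \<inter> y"
proof -
  interpret complete_lattice S by (rule complete)
  assume "x \<in> F" "y \<in> F"
  then show ?thesis
    using meet_left[of x y] meet_right[of x y] meet_le[of "x \<inter> y" x y] Int_closed by auto
qed

lemma frame: "frame S"
proof -
  interpret complete_lattice S by (rule complete)
  show ?thesis
  proof unfold_locales
    fix x A assume x: "x \<in> carrier S" and A: "A \<subseteq> carrier S"
    have im: "(\<lambda>a. x \<sqinter>\<^bsub>S\<^esub> a) ` A = (\<inter>) x ` A"
      by (rule image_cong) (use x A meet_eq in auto)
    have c: "(\<inter>) x ` A \<subseteq> F" using x A Int_closed by auto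
    have "J ((\<inter>) x ` A) \<subseteq> x \<inter> J A"
      by (rule J_least[OF c Int_closed[OF _ J_closed]]) (use x A J_upper[of A] in auto)
    then show "x \<sqinter>\<^bsub>S\<^esub> \<Squnion>\<^bsub>S\<^esub>A = \<Squnion>\<^bsub>S\<^esub>((\<lambda>a. x \<sqinter>\<^bsub>S\<^esub> a) ` A)"
      unfolding im using x A c Int_J[of x A] by (simp add: Sup_eq meet_eq J_closed subset_antisym)
  qed
qed

lemma top_eq: "\<lbrakk>t \<in> F; \<And>x. x \<in> F \<Longrightarrow> x \<subseteq> t\<rbrakk> \<Longrightarrow> \<top>\<^bsub>S\<^esub> = t"
proof -
  interpret complete_lattice S by (rule complete)
  assume "t \<in> F" "\<And>x. x \<in> F \<Longrightarrow> x \<subseteq> t"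
  then show ?thesis using top_higher[of t] top_closed by auto
qed

end

lemma frame_homD:
  assumes "h \<in> frame_hom L M"
  shows "h \<in> carrier L \<rightarrow>\<^sub>E carrier M"
    "x \<in> carrier L \<Longrightarrow> h x \<in> carrier M"
    "A \<subseteq> carrier L \<Longrightarrow> h (\<Squnion>\<^bsub>L\<^esub>A) = \<Squnion>\<^bsub>M\<^esub>(h ` A)"
    "h \<top>\<^bsub>L\<^esub> = \<top>\<^bsub>M\<^esub>"
    "\<lbrakk>x \<in> carrier L; y \<in> carrier L\<rbrakk> \<Longrightarrow> h (x \<sqinter>\<^bsub>L\<^esub> y) = h x \<sqinter>\<^bsub>M\<^esub> h y"
  using assms by (auto simp: frame_hom_def)

lemma frame_hom_mono:
  assumes "frame L" "frame M" "h \<in> frame_hom L M" "x \<in> carrier L" "y \<in> carrier L" "x \<sqsubseteq>\<^bsub>L\<^esub> y"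
  shows "h x \<sqsubseteq>\<^bsub>M\<^esub> h y"
proof -
  interpret L: frame L by fact
  interpret M: frame M by fact
  have "h x = h x \<sqinter>\<^bsub>M\<^esub> h y"
    using frame_homD(5)[OF assms(3,4,5)] L.meet_absorb[OF assms(6,4,5)] by simp
  then show ?thesis
    by (metis M.meet_right assms(3,4,5) frame_homD(2))
qed

lemma left_adj_eqI:
  assumes "frame Y" "y \<in> carrier Y" "\<And>z. z \<in> carrier Y \<Longrightarrow> y \<sqsubseteq>\<^bsub>Y\<^esub> z \<longleftrightarrow> a \<sqsubseteq>\<^bsub>X\<^esub> f z"
  shows "left_adj X Y f a = y"
  unfolding left_adj_def
proof (rule the_equality)
  interpret Y: frame Y by fact
  fix y' assume "y' \<in> carrier Y \<and> (\<forall>z\<in>carrier Y. (y' \<sqsubseteq>\<^bsub>Y\<^esub> z) = (a \<sqsubseteq>\<^bsub>X\<^esub> f z))"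
  then show "y' = y" using Y.eq_by_upper[of y' y] assms by blast
qed (use assms in blast)

text \<open>
  Right adjoints preserve meets. In the applications \<open>l\<close> is a direct image.
\<close>

lemma semiopen_locI:
  assumes "frame X" "frame Y" "f \<in> frame_hom Y X" "l \<in> carrier X \<rightarrow> carrier Y"
    and adj: "\<And>a z. \<lbrakk>a \<in> carrier X; z \<in> carrier Y\<rbrakk> \<Longrightarrow> l a \<sqsubseteq>\<^bsub>Y\<^esub> z \<longleftrightarrow> a \<sqsubseteq>\<^bsub>X\<^esub> f z"
  shows "semiopen_loc X Y f"
proof -
  interpret X: frame X by fact
  interpret Y: frame Y by fact
  note fc = frame_homD(2)[OF assms(3)]
  have "f (\<Sqinter>\<^bsub>Y\<^esub>A) = \<Sqinter>\<^bsub>X\<^esub>(f ` A)" if A: "A \<subseteq> carrier Y" for A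
  proof (rule X.eq_by_lower)
    have fA: "f ` A \<subseteq> carrier X" using A fc by auto
    show "f (\<Sqinter>\<^bsub>Y\<^esub>A) \<in> carrier X" "\<Sqinter>\<^bsub>X\<^esub>(f ` A) \<in> carrier X" using A fc fA by auto
    fix z assume z: "z \<in> carrier X"
    then have lz: "l z \<in> carrier Y" using assms(4) by auto
    have "z \<sqsubseteq>\<^bsub>X\<^esub> f (\<Sqinter>\<^bsub>Y\<^esub>A) \<longleftrightarrow> (\<forall>a\<in>A. l z \<sqsubseteq>\<^bsub>Y\<^esub> a)"
      using adj[OF z, of "\<Sqinter>\<^bsub>Y\<^esub>A"] A lz by (simp add: Y.le_Inf_iff)
    also have "\<dots> \<longleftrightarrow> (\<forall>a\<in>f ` A. z \<sqsubseteq>\<^bsub>X\<^esub> a)" by (simp add: adj[OF z subsetD[OF A]])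
    also have "\<dots> \<longleftrightarrow> z \<sqsubseteq>\<^bsub>X\<^esub> \<Sqinter>\<^bsub>X\<^esub>(f ` A)"
      using z fA by (simp add: X.le_Inf_iff)
    finally show "z \<sqsubseteq>\<^bsub>X\<^esub> f (\<Sqinter>\<^bsub>Y\<^esub>A) \<longleftrightarrow> z \<sqsubseteq>\<^bsub>X\<^esub> \<Sqinter>\<^bsub>X\<^esub>(f ` A)" .
  qed
  then show ?thesis using assms(3) by (auto simp: semiopen_loc_def)
qed

locale open_frame_map = X: frame X + Y: frame Y
  for X :: "('a, 'm) gorder_scheme" and Y :: "('b, 'n) gorder_scheme" +
  fixes f :: "'b \<Rightarrow> 'a"
  assumes open_loc: "open_loc X Y f"
begin

abbreviation sh where "sh \<equiv> left_adj X Y f"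

lemma hom: "f \<in> frame_hom Y X"
  using open_loc by (simp add: open_loc_def semiopen_loc_def)

lemmas f_closed [simp] = frame_homD(2)[OF hom]
lemmas f_Sup = frame_homD(3)[OF hom]
lemmas f_top [simp] = frame_homD(4)[OF hom]
lemmas f_meet = frame_homD(5)[OF hom]
lemmas f_mono = frame_hom_mono[OF Y.frame_axioms X.frame_axioms hom]

text \<open>
  The left adjoint at \<open>a\<close> is the meet of all \<open>z\<close> with \<open>a \<le> f(z)\<close>; this is where preservation
  of arbitrary meets is used.
\<close>

lemma sh_adj:
  assumes a: "a \<in> carrier X"
  shows "sh a \<in> carrier Y \<and> (\<forall>z\<in>carrier Y. sh a \<sqsubseteq>\<^bsub>Y\<^esub> z \<longleftrightarrow> a \<sqsubseteq>\<^bsub>X\<^esub> f z)"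
proof -
  let ?A = "{z \<in> carrier Y. a \<sqsubseteq>\<^bsub>X\<^esub> f z}"
  let ?y = "\<Sqinter>\<^bsub>Y\<^esub>?A"
  have A: "?A \<subseteq> carrier Y" by blast
  then have y: "?y \<in> carrier Y" by simp
  have "f ?y = \<Sqinter>\<^bsub>X\<^esub>(f ` ?A)"
    using open_loc A by (auto simp: open_loc_def semiopen_loc_def)
  moreover have "a \<sqsubseteq>\<^bsub>X\<^esub> \<Sqinter>\<^bsub>X\<^esub>(f ` ?A)"
    by (rule X.inf_greatest) (use a in auto)
  ultimately have ay: "a \<sqsubseteq>\<^bsub>X\<^esub> f ?y" by simp
  have "?y \<sqsubseteq>\<^bsub>Y\<^esub> z \<longleftrightarrow> a \<sqsubseteq>\<^bsub>X\<^esub> f z" if z: "z \<in> carrier Y" for z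
    using Y.inf_lower[OF A, of z] X.le_trans[OF ay f_mono[OF y z]] a y z by auto
  then show ?thesis
    using left_adj_eqI[OF Y.frame_axioms y, where X = X and f = f and a = a] y by simp
qed

lemma sh_closed [simp]: "a \<in> carrier X \<Longrightarrow> sh a \<in> carrier Y"
  using sh_adj by blast

lemma sh_le_iff: "\<lbrakk>a \<in> carrier X; z \<in> carrier Y\<rbrakk> \<Longrightarrow> sh a \<sqsubseteq>\<^bsub>Y\<^esub> z \<longleftrightarrow> a \<sqsubseteq>\<^bsub>X\<^esub> f z"
  using sh_adj by blast

lemma le_f_sh: "a \<in> carrier X \<Longrightarrow> a \<sqsubseteq>\<^bsub>X\<^esub> f (sh a)"
  using sh_le_iff[of a "sh a"] by simp

lemma sh_f_le: "z \<in> carrier Y \<Longrightarrow> sh (f z) \<sqsubseteq>\<^bsub>Y\<^esub> z"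
  using sh_le_iff[of "f z" z] by simp

lemma sh_mono: "\<lbrakk>a \<sqsubseteq>\<^bsub>X\<^esub> b; a \<in> carrier X; b \<in> carrier X\<rbrakk> \<Longrightarrow> sh a \<sqsubseteq>\<^bsub>Y\<^esub> sh b"
  using X.le_trans[OF _ le_f_sh, of a b] by (simp add: sh_le_iff)

lemma sh_Sup: "A \<subseteq> carrier X \<Longrightarrow> sh (\<Squnion>\<^bsub>X\<^esub>A) = \<Squnion>\<^bsub>Y\<^esub>(sh ` A)"
proof (rule Y.eq_by_upper)
  assume A: "A \<subseteq> carrier X"
  then have sA: "sh ` A \<subseteq> carrier Y" by auto
  show "sh (\<Squnion>\<^bsub>X\<^esub>A) \<in> carrier Y" "\<Squnion>\<^bsub>Y\<^esub>(sh ` A) \<in> carrier Y" using A sA by auto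
  fix z assume z: "z \<in> carrier Y"
  show "sh (\<Squnion>\<^bsub>X\<^esub>A) \<sqsubseteq>\<^bsub>Y\<^esub> z \<longleftrightarrow> \<Squnion>\<^bsub>Y\<^esub>(sh ` A) \<sqsubseteq>\<^bsub>Y\<^esub> z"
    using A sA z by (auto simp: sh_le_iff X.Sup_le_iff Y.Sup_le_iff subset_iff)
qed

lemma frobenius: "\<lbrakk>a \<in> carrier X; b \<in> carrier Y\<rbrakk> \<Longrightarrow> sh (a \<sqinter>\<^bsub>X\<^esub> f b) = sh a \<sqinter>\<^bsub>Y\<^esub> b"
  using open_loc by (auto simp: open_loc_def)

lemma frobenius': "\<lbrakk>a \<in> carrier X; b \<in> carrier Y\<rbrakk> \<Longrightarrow> sh (f b \<sqinter>\<^bsub>X\<^esub> a) = b \<sqinter>\<^bsub>Y\<^esub> sh a"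
  using frobenius meet_comm by metis

end

lemma open_locI:
  assumes "frame X" "frame Y" "f \<in> frame_hom Y X" "l \<in> carrier X \<rightarrow> carrier Y"
    and adj: "\<And>a z. \<lbrakk>a \<in> carrier X; z \<in> carrier Y\<rbrakk> \<Longrightarrow> l a \<sqsubseteq>\<^bsub>Y\<^esub> z \<longleftrightarrow> a \<sqsubseteq>\<^bsub>X\<^esub> f z"
    and frob: "\<And>a b. \<lbrakk>a \<in> carrier X; b \<in> carrier Y\<rbrakk> \<Longrightarrow> l (a \<sqinter>\<^bsub>X\<^esub> f b) = l a \<sqinter>\<^bsub>Y\<^esub> b"
  shows "open_loc X Y f" "\<And>a. a \<in> carrier X \<Longrightarrow> left_adj X Y f a = l a"
proof -
  interpret X: frame X by fact
  show l: "left_adj X Y f a = l a" if "a \<in> carrier X" for a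
    by (rule left_adj_eqI[OF assms(2)]) (use assms(4) adj that in auto)
  show "open_loc X Y f"
    unfolding open_loc_def
    using semiopen_locI[OF assms(1-4) adj] l frob frame_homD(2)[OF assms(3)] by simp
qed

section \<open>Pullbacks of locales\<close>

locale pullback = X: frame X + Y: frame Y
  for X :: "('a, 'm) gorder_scheme" and Y :: "('b, 'n) gorder_scheme" +
  fixes Z :: "('z, 'k) gorder_scheme" and f :: "'z \<Rightarrow> 'a" and g :: "'z \<Rightarrow> 'b"
  assumes f_in: "f \<in> carrier Z \<rightarrow> carrier X" and g_in: "g \<in> carrier Z \<rightarrow> carrier Y"
begin

abbreviation ideal where "ideal \<equiv> pb_ideal X f Z g Y"
abbreviation P where "P \<equiv> pb_loc X f Z g Y"

definition gen :: "('a \<times> 'b) set \<Rightarrow> ('a \<times> 'b) set" where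
  "gen S = \<Inter>{I. ideal I \<and> S \<subseteq> I}"

abbreviation tens where "tens a b \<equiv> gen {(a, b)}"

lemma fz [simp]: "z \<in> carrier Z \<Longrightarrow> f z \<in> carrier X" using f_in by auto
lemma gz [simp]: "z \<in> carrier Z \<Longrightarrow> g z \<in> carrier Y" using g_in by auto

lemma idealI:
  assumes "I \<subseteq> carrier X \<times> carrier Y"
    and "\<And>a b a' b'. \<lbrakk>(a, b) \<in> I; a' \<in> carrier X; b' \<in> carrier Y; a' \<sqsubseteq>\<^bsub>X\<^esub> a; b' \<sqsubseteq>\<^bsub>Y\<^esub> b\<rbrakk>
      \<Longrightarrow> (a', b') \<in> I"
    and "\<And>A b. \<lbrakk>A \<subseteq> carrier X; b \<in> carrier Y; \<And>a. a \<in> A \<Longrightarrow> (a, b) \<in> I\<rbrakk> \<Longrightarrow> (\<Squnion>\<^bsub>X\<^esub>A, b) \<in> I"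
    and "\<And>a B. \<lbrakk>a \<in> carrier X; B \<subseteq> carrier Y; \<And>b. b \<in> B \<Longrightarrow> (a, b) \<in> I\<rbrakk> \<Longrightarrow> (a, \<Squnion>\<^bsub>Y\<^esub>B) \<in> I"
    and "\<And>a b z. \<lbrakk>a \<in> carrier X; b \<in> carrier Y; z \<in> carrier Z\<rbrakk> \<Longrightarrow>
      (a \<sqinter>\<^bsub>X\<^esub> f z, b) \<in> I \<longleftrightarrow> (a, b \<sqinter>\<^bsub>Y\<^esub> g z) \<in> I"
  shows "ideal I"
  unfolding pb_ideal_def
proof (intro conjI)
  show "I \<subseteq> carrier X \<times> carrier Y" by fact
  show "\<forall>a b a' b'. (a, b) \<in> I \<and> a' \<in> carrier X \<and> b' \<in> carrier Y \<and> a' \<sqsubseteq>\<^bsub>X\<^esub> a \<and> b' \<sqsubseteq>\<^bsub>Y\<^esub> b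
        \<longrightarrow> (a', b') \<in> I"
    using assms(2) by blast
  show "\<forall>A\<subseteq>carrier X. \<forall>b\<in>carrier Y. A \<times> {b} \<subseteq> I \<longrightarrow> (\<Squnion>\<^bsub>X\<^esub>A, b) \<in> I"
    using assms(3) by (auto simp: subset_iff)
  show "\<forall>a\<in>carrier X. \<forall>B\<subseteq>carrier Y. {a} \<times> B \<subseteq> I \<longrightarrow> (a, \<Squnion>\<^bsub>Y\<^esub>B) \<in> I"
    using assms(4) by (auto simp: subset_iff)
  show "\<forall>a\<in>carrier X. \<forall>b\<in>carrier Y. \<forall>z\<in>carrier Z.
        ((a \<sqinter>\<^bsub>X\<^esub> f z, b) \<in> I) = ((a, b \<sqinter>\<^bsub>Y\<^esub> g z) \<in> I)"
    using assms(5) by blast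
qed

lemma idealD:
  assumes "ideal I"
  shows "(a, b) \<in> I \<Longrightarrow> a \<in> carrier X" "(a, b) \<in> I \<Longrightarrow> b \<in> carrier Y"
    and "\<lbrakk>(a, b) \<in> I; a' \<in> carrier X; b' \<in> carrier Y; a' \<sqsubseteq>\<^bsub>X\<^esub> a; b' \<sqsubseteq>\<^bsub>Y\<^esub> b\<rbrakk> \<Longrightarrow> (a', b') \<in> I"
    and "\<lbrakk>A \<subseteq> carrier X; b \<in> carrier Y; \<And>a. a \<in> A \<Longrightarrow> (a, b) \<in> I\<rbrakk> \<Longrightarrow> (\<Squnion>\<^bsub>X\<^esub>A, b) \<in> I"
    and "\<lbrakk>a \<in> carrier X; B \<subseteq> carrier Y; \<And>b. b \<in> B \<Longrightarrow> (a, b) \<in> I\<rbrakk> \<Longrightarrow> (a, \<Squnion>\<^bsub>Y\<^esub>B) \<in> I"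
    and "\<lbrakk>a \<in> carrier X; b \<in> carrier Y; z \<in> carrier Z\<rbrakk> \<Longrightarrow>
      (a \<sqinter>\<^bsub>X\<^esub> f z, b) \<in> I \<longleftrightarrow> (a, b \<sqinter>\<^bsub>Y\<^esub> g z) \<in> I"
proof -
  note D = assms[unfolded pb_ideal_def]
  note D2 = D[THEN conjunct2]
  note D3 = D2[THEN conjunct2]
  note D4 = D3[THEN conjunct2]
  show "(a, b) \<in> I \<Longrightarrow> a \<in> carrier X" "(a, b) \<in> I \<Longrightarrow> b \<in> carrier Y" using D[THEN conjunct1] by auto
  show "\<lbrakk>(a, b) \<in> I; a' \<in> carrier X; b' \<in> carrier Y; a' \<sqsubseteq>\<^bsub>X\<^esub> a; b' \<sqsubseteq>\<^bsub>Y\<^esub> b\<rbrakk> \<Longrightarrow> (a', b') \<in> I"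
    using D2[THEN conjunct1, rule_format, of a b a' b'] by simp
  show "\<lbrakk>A \<subseteq> carrier X; b \<in> carrier Y; \<And>a. a \<in> A \<Longrightarrow> (a, b) \<in> I\<rbrakk> \<Longrightarrow> (\<Squnion>\<^bsub>X\<^esub>A, b) \<in> I"
    using D3[THEN conjunct1, rule_format, of A b] by auto
  show "\<lbrakk>a \<in> carrier X; B \<subseteq> carrier Y; \<And>b. b \<in> B \<Longrightarrow> (a, b) \<in> I\<rbrakk> \<Longrightarrow> (a, \<Squnion>\<^bsub>Y\<^esub>B) \<in> I"
    using D4[THEN conjunct1, rule_format, of a B] by auto
  show "\<lbrakk>a \<in> carrier X; b \<in> carrier Y; z \<in> carrier Z\<rbrakk> \<Longrightarrow>
      (a \<sqinter>\<^bsub>X\<^esub> f z, b) \<in> I \<longleftrightarrow> (a, b \<sqinter>\<^bsub>Y\<^esub> g z) \<in> I"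
    using D4[THEN conjunct2, rule_format, of a b z] by simp
qed

lemma ideal_sub: "ideal I \<Longrightarrow> I \<subseteq> carrier X \<times> carrier Y"
  by (simp add: pb_ideal_def)

lemma ideal_whole: "ideal (carrier X \<times> carrier Y)"
  by (rule idealI) auto

lemma ideal_Inter: "\<lbrakk>\<I> \<noteq> {}; \<And>I. I \<in> \<I> \<Longrightarrow> ideal I\<rbrakk> \<Longrightarrow> ideal (\<Inter>\<I>)"
proof (rule idealI)
  assume ne: "\<I> \<noteq> {}" and i: "\<And>I. I \<in> \<I> \<Longrightarrow> ideal I"
  show "\<Inter>\<I> \<subseteq> carrier X \<times> carrier Y"
  proof -
    obtain I where I: "I \<in> \<I>" using ne by blast
    then have "I \<subseteq> carrier X \<times> carrier Y" using idealD(1,2)[OF i[OF I]] by auto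
    then show ?thesis using I by blast
  qed
  show "(a', b') \<in> \<Inter>\<I>" if "(a, b) \<in> \<Inter>\<I>" "a' \<in> carrier X" "b' \<in> carrier Y"
    "a' \<sqsubseteq>\<^bsub>X\<^esub> a" "b' \<sqsubseteq>\<^bsub>Y\<^esub> b" for a b a' b'
    using that by (auto intro: idealD(3)[OF i, of _ a b])
  show "(\<Squnion>\<^bsub>X\<^esub>A, b) \<in> \<Inter>\<I>" if "A \<subseteq> carrier X" "b \<in> carrier Y" "\<And>a. a \<in> A \<Longrightarrow> (a, b) \<in> \<Inter>\<I>" for A b
    using that by (auto intro!: idealD(4)[OF i])
  show "(a, \<Squnion>\<^bsub>Y\<^esub>B) \<in> \<Inter>\<I>" if "a \<in> carrier X" "B \<subseteq> carrier Y" "\<And>b. b \<in> B \<Longrightarrow> (a, b) \<in> \<Inter>\<I>" for a B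
    using that by (auto intro!: idealD(5)[OF i])
  show "(a \<sqinter>\<^bsub>X\<^esub> f z, b) \<in> \<Inter>\<I> \<longleftrightarrow> (a, b \<sqinter>\<^bsub>Y\<^esub> g z) \<in> \<Inter>\<I>"
    if "a \<in> carrier X" "b \<in> carrier Y" "z \<in> carrier Z" for a b z
    using that idealD(6)[OF i] by auto
qed

lemma ideal_Int: "\<lbrakk>ideal I; ideal K\<rbrakk> \<Longrightarrow> ideal (I \<inter> K)"
  using ideal_Inter[of "{I, K}"] by auto

lemma ideal_gen: "S \<subseteq> carrier X \<times> carrier Y \<Longrightarrow> ideal (gen S)"
  unfolding gen_def using ideal_whole by (intro ideal_Inter) auto

lemma gen_le_iff: "ideal I \<Longrightarrow> gen S \<subseteq> I \<longleftrightarrow> S \<subseteq> I"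
  unfolding gen_def by auto

lemma gen_upper: "S \<subseteq> gen S"
  unfolding gen_def by auto

text \<open>
  The Heyting implication by the generator \<open>x \<otimes> y\<close>. It gives the distributive law of the frame
  of ideals from the universal property of \<open>gen\<close> alone.
\<close>

lemma ideal_residual:
  assumes M: "ideal M" and x: "x \<in> carrier X" and y: "y \<in> carrier Y"
  shows "ideal {(a, b). a \<in> carrier X \<and> b \<in> carrier Y \<and> (a \<sqinter>\<^bsub>X\<^esub> x, b \<sqinter>\<^bsub>Y\<^esub> y) \<in> M}" (is "ideal ?R")
proof (rule idealI)
  show "?R \<subseteq> carrier X \<times> carrier Y" by auto
  show "(a', b') \<in> ?R" if "(a, b) \<in> ?R" "a' \<in> carrier X" "b' \<in> carrier Y"
    "a' \<sqsubseteq>\<^bsub>X\<^esub> a" "b' \<sqsubseteq>\<^bsub>Y\<^esub> b" for a b a' b'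
    using that idealD(3)[OF M, of "a \<sqinter>\<^bsub>X\<^esub> x" "b \<sqinter>\<^bsub>Y\<^esub> y" "a' \<sqinter>\<^bsub>X\<^esub> x" "b' \<sqinter>\<^bsub>Y\<^esub> y"] x y
    by (simp add: X.meet_mono Y.meet_mono)
  show "(\<Squnion>\<^bsub>X\<^esub>A, b) \<in> ?R" if A: "A \<subseteq> carrier X" and b: "b \<in> carrier Y"
    and *: "\<And>a. a \<in> A \<Longrightarrow> (a, b) \<in> ?R" for A b
    using A b x y * by (auto simp: X.Sup_meet_distrib intro!: idealD(4)[OF M])
  show "(a, \<Squnion>\<^bsub>Y\<^esub>B) \<in> ?R" if a: "a \<in> carrier X" and B: "B \<subseteq> carrier Y"
    and *: "\<And>b. b \<in> B \<Longrightarrow> (a, b) \<in> ?R" for a B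
    using a B x y * by (auto simp: Y.Sup_meet_distrib intro!: idealD(5)[OF M])
  show "(a \<sqinter>\<^bsub>X\<^esub> f z, b) \<in> ?R \<longleftrightarrow> (a, b \<sqinter>\<^bsub>Y\<^esub> g z) \<in> ?R"
    if a: "a \<in> carrier X" and b: "b \<in> carrier Y" and z: "z \<in> carrier Z" for a b z
  proof -
    have "a \<sqinter>\<^bsub>X\<^esub> f z \<sqinter>\<^bsub>X\<^esub> x = a \<sqinter>\<^bsub>X\<^esub> x \<sqinter>\<^bsub>X\<^esub> f z" "b \<sqinter>\<^bsub>Y\<^esub> g z \<sqinter>\<^bsub>Y\<^esub> y = b \<sqinter>\<^bsub>Y\<^esub> y \<sqinter>\<^bsub>Y\<^esub> g z"
      using a b x y z by (simp_all add: X.meet_ac Y.meet_ac)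
    then show ?thesis
      using idealD(6)[OF M, of "a \<sqinter>\<^bsub>X\<^esub> x" "b \<sqinter>\<^bsub>Y\<^esub> y" z] a b x y z by simp
  qed
qed

text \<open>
  For a fixed \<open>(x, y) \<in> I\<close> the residual of \<open>M\<close> by \<open>x \<otimes> y\<close> is an ideal, so it contains
  \<open>gen S\<close> as soon as it contains \<open>S\<close>.
\<close>

lemma Int_gen_subset:
  assumes I: "ideal I" and S: "S \<subseteq> carrier X \<times> carrier Y" and M: "ideal M"
    and IS: "\<And>a b x y. \<lbrakk>(a, b) \<in> S; (x, y) \<in> I\<rbrakk> \<Longrightarrow> (a \<sqinter>\<^bsub>X\<^esub> x, b \<sqinter>\<^bsub>Y\<^esub> y) \<in> M"
  shows "I \<inter> gen S \<subseteq> M"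
proof (rule subrelI)
  fix x y assume "(x, y) \<in> I \<inter> gen S"
  then have xI: "(x, y) \<in> I" and xG: "(x, y) \<in> gen S" by auto
  have c: "x \<in> carrier X" "y \<in> carrier Y" using idealD(1,2)[OF I xI] by auto
  let ?R = "{(a, b). a \<in> carrier X \<and> b \<in> carrier Y \<and> (a \<sqinter>\<^bsub>X\<^esub> x, b \<sqinter>\<^bsub>Y\<^esub> y) \<in> M}"
  have "S \<subseteq> ?R" using S IS[OF _ xI] by blast
  then have "gen S \<subseteq> ?R" using gen_le_iff[OF ideal_residual[OF M c]] by blast
  then have "(x, y) \<in> ?R" using xG by blast
  then show "(x, y) \<in> M" using c by simp
qed

sublocale P: set_frame "{I. ideal I}" "\<lambda>\<A>. gen (\<Union>\<A>)"
proof
  fix \<A> assume A: "\<A> \<subseteq> {I. ideal I}"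
  then have c: "\<Union>\<A> \<subseteq> carrier X \<times> carrier Y" using ideal_sub by blast
  show "gen (\<Union>\<A>) \<in> {I. ideal I}" using ideal_gen[OF c] by simp
  show "a \<in> \<A> \<Longrightarrow> a \<subseteq> gen (\<Union>\<A>)" for a using gen_upper by fast
  show "gen (\<Union>\<A>) \<subseteq> z" if "z \<in> {I. ideal I}" "\<And>a. a \<in> \<A> \<Longrightarrow> a \<subseteq> z" for z
    using that gen_le_iff by auto
  fix I assume I: "I \<in> {I. ideal I}"
  have IA: "(\<inter>) I ` \<A> \<subseteq> {I. ideal I}" using A I ideal_Int by auto
  then have "\<Union>((\<inter>) I ` \<A>) \<subseteq> carrier X \<times> carrier Y" using ideal_sub by blast
  note M = ideal_gen[OF this]
  show "I \<inter> gen (\<Union>\<A>) \<subseteq> gen (\<Union>((\<inter>) I ` \<A>))"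
  proof (rule Int_gen_subset[OF _ c M])
    fix a b x y assume ab: "(a, b) \<in> \<Union>\<A>" and xy: "(x, y) \<in> I"
    then obtain K where K: "K \<in> \<A>" "(a, b) \<in> K" "ideal K" using A by auto
    have i: "ideal I" using I by simp
    have "(a \<sqinter>\<^bsub>X\<^esub> x, b \<sqinter>\<^bsub>Y\<^esub> y) \<in> I \<inter> K"
      using idealD(1,2)[OF K(3,2)] idealD(1,2)[OF i xy]
        idealD(3)[OF i xy, of "a \<sqinter>\<^bsub>X\<^esub> x" "b \<sqinter>\<^bsub>Y\<^esub> y"] idealD(3)[OF K(3,2), of "a \<sqinter>\<^bsub>X\<^esub> x" "b \<sqinter>\<^bsub>Y\<^esub> y"]
      by (simp add: X.meet_left Y.meet_left X.meet_right Y.meet_right)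
    then show "(a \<sqinter>\<^bsub>X\<^esub> x, b \<sqinter>\<^bsub>Y\<^esub> y) \<in> gen (\<Union>((\<inter>) I ` \<A>))"
      using gen_upper[of "\<Union>((\<inter>) I ` \<A>)"] K(1) by blast
  qed (use I in auto)
qed (use ideal_Int in auto)

lemma P_eq: "P = \<lparr>carrier = {I. ideal I}, eq = (=), le = (\<subseteq>)\<rparr>"
  by (simp add: pb_loc_def)

sublocale PF: frame P
  unfolding P_eq by (rule P.frame)

lemma carrier_P [simp]: "carrier P = {I. ideal I}" and le_P [simp]: "le P = (\<subseteq>)"
  by (simp_all add: pb_loc_def)

lemma meet_P: "\<lbrakk>ideal I; ideal K\<rbrakk> \<Longrightarrow> I \<sqinter>\<^bsub>P\<^esub> K = I \<inter> K"
  unfolding P_eq by (rule P.meet_eq) auto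

lemma top_P: "\<top>\<^bsub>P\<^esub> = carrier X \<times> carrier Y"
  unfolding P_eq by (rule P.top_eq) (use ideal_whole ideal_sub in auto)

lemma ideal_tens: "\<lbrakk>a \<in> carrier X; b \<in> carrier Y\<rbrakk> \<Longrightarrow> ideal (tens a b)"
  by (simp add: ideal_gen)

lemma tens_le_iff: "ideal I \<Longrightarrow> tens a b \<subseteq> I \<longleftrightarrow> (a, b) \<in> I"
  by (simp add: gen_le_iff)

lemma in_tens: "(a, b) \<in> tens a b"
  using gen_upper by auto

lemma tens_top: "tens \<top>\<^bsub>X\<^esub> \<top>\<^bsub>Y\<^esub> = carrier X \<times> carrier Y"
proof
  have i: "ideal (tens \<top>\<^bsub>X\<^esub> \<top>\<^bsub>Y\<^esub>)" by (simp add: ideal_tens)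
  show "tens \<top>\<^bsub>X\<^esub> \<top>\<^bsub>Y\<^esub> \<subseteq> carrier X \<times> carrier Y" by (rule ideal_sub[OF i])
  show "carrier X \<times> carrier Y \<subseteq> tens \<top>\<^bsub>X\<^esub> \<top>\<^bsub>Y\<^esub>"
    using idealD(3)[OF i in_tens] by auto
qed

abbreviation pr1 where "pr1 \<equiv> pb_proj1 X f Z g Y"
abbreviation pr2 where "pr2 \<equiv> pb_proj2 X f Z g Y"

lemma pr1_eq: "a \<in> carrier X \<Longrightarrow> pr1 a = tens a \<top>\<^bsub>Y\<^esub>"
  by (simp add: pb_proj1_def gen_def)

lemma pr2_eq: "b \<in> carrier Y \<Longrightarrow> pr2 b = tens \<top>\<^bsub>X\<^esub> b"
  by (simp add: pb_proj2_def gen_def)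

lemma tens_Int:
  assumes "a \<in> carrier X" "b \<in> carrier Y" "a' \<in> carrier X" "b' \<in> carrier Y"
  shows "tens a b \<inter> tens a' b' = tens (a \<sqinter>\<^bsub>X\<^esub> a') (b \<sqinter>\<^bsub>Y\<^esub> b')"
proof
  have M: "ideal (tens (a \<sqinter>\<^bsub>X\<^esub> a') (b \<sqinter>\<^bsub>Y\<^esub> b'))" using assms by (simp add: ideal_tens)
  let ?R = "{(x, y). x \<in> carrier X \<and> y \<in> carrier Y \<and>
    (x \<sqinter>\<^bsub>X\<^esub> a', y \<sqinter>\<^bsub>Y\<^esub> b') \<in> tens (a \<sqinter>\<^bsub>X\<^esub> a') (b \<sqinter>\<^bsub>Y\<^esub> b')}"
  have R: "tens a b \<subseteq> ?R"
    using assms in_tens by (subst tens_le_iff[OF ideal_residual[OF M assms(3,4)]]) simp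
  show "tens a b \<inter> tens a' b' \<subseteq> tens (a \<sqinter>\<^bsub>X\<^esub> a') (b \<sqinter>\<^bsub>Y\<^esub> b')"
    by (rule Int_gen_subset[OF ideal_tens _ M]) (use R assms in \<open>auto simp: meet_comm[of X a'] meet_comm[of Y b'] \<close>)
  show "tens (a \<sqinter>\<^bsub>X\<^esub> a') (b \<sqinter>\<^bsub>Y\<^esub> b') \<subseteq> tens a b \<inter> tens a' b'"
    using assms idealD(3)[OF ideal_tens in_tens]
    by (subst tens_le_iff) (auto simp: ideal_Int ideal_tens X.meet_left Y.meet_left X.meet_right Y.meet_right)
qed

lemma pr_Int: "\<lbrakk>a \<in> carrier X; b \<in> carrier Y\<rbrakk> \<Longrightarrow> pr1 a \<inter> pr2 b = tens a b"
  by (simp add: pr1_eq pr2_eq tens_Int)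

lemma pr_closed [simp]: "a \<in> carrier X \<Longrightarrow> ideal (pr1 a)" "b \<in> carrier Y \<Longrightarrow> ideal (pr2 b)"
  by (simp_all add: pr1_eq pr2_eq ideal_tens)

lemma pr_meet: "\<lbrakk>a \<in> carrier X; b \<in> carrier Y\<rbrakk> \<Longrightarrow> pr1 a \<sqinter>\<^bsub>P\<^esub> pr2 b = tens a b"
  by (simp add: meet_P pr_Int)

lemma pr1_le_iff: "\<lbrakk>ideal I; a \<in> carrier X\<rbrakk> \<Longrightarrow> pr1 a \<subseteq> I \<longleftrightarrow> (a, \<top>\<^bsub>Y\<^esub>) \<in> I"
  by (simp add: pr1_eq tens_le_iff)

lemma pr2_le_iff: "\<lbrakk>ideal I; b \<in> carrier Y\<rbrakk> \<Longrightarrow> pr2 b \<subseteq> I \<longleftrightarrow> (\<top>\<^bsub>X\<^esub>, b) \<in> I"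
  by (simp add: pr2_eq tens_le_iff)

lemma pr1_hom: "pr1 \<in> frame_hom X P"
  unfolding frame_hom_def
proof (intro CollectI conjI allI ballI impI)
  show "pr1 \<in> carrier X \<rightarrow>\<^sub>E carrier P"
    using pr_closed by (auto simp: pb_proj1_def)
  show "pr1 (\<Squnion>\<^bsub>X\<^esub>A) = \<Squnion>\<^bsub>P\<^esub>(pr1 ` A)" if A: "A \<subseteq> carrier X" for A
  proof (rule PF.eq_by_upper)
    have pA: "pr1 ` A \<subseteq> carrier P" using A by auto
    show "pr1 (\<Squnion>\<^bsub>X\<^esub>A) \<in> carrier P" "\<Squnion>\<^bsub>P\<^esub>(pr1 ` A) \<in> carrier P"
      using A pA PF.sup_closed by (simp, blast)
    fix I assume I: "I \<in> carrier P"
    then have i: "ideal I" by simp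
    have "pr1 (\<Squnion>\<^bsub>X\<^esub>A) \<subseteq> I \<longleftrightarrow> (\<Squnion>\<^bsub>X\<^esub>A, \<top>\<^bsub>Y\<^esub>) \<in> I"
      using A by (simp add: pr1_eq tens_le_iff[OF i])
    also have "\<dots> \<longleftrightarrow> (\<forall>a\<in>A. (a, \<top>\<^bsub>Y\<^esub>) \<in> I)"
      using idealD(4)[OF i A] idealD(3)[OF i, of "\<Squnion>\<^bsub>X\<^esub>A"] A X.sup_upper[OF A]
      by (meson Y.le_refl Y.top_closed subsetD)
    also have "\<dots> \<longleftrightarrow> (\<forall>a\<in>A. pr1 a \<subseteq> I)"
      by (intro ball_cong refl pr1_le_iff[OF i, symmetric]) (use A in blast)
    also have "\<dots> \<longleftrightarrow> \<Squnion>\<^bsub>P\<^esub>(pr1 ` A) \<subseteq> I"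
      using PF.Sup_le_iff[OF pA I] by simp
    finally show "pr1 (\<Squnion>\<^bsub>X\<^esub>A) \<sqsubseteq>\<^bsub>P\<^esub> I \<longleftrightarrow> \<Squnion>\<^bsub>P\<^esub>(pr1 ` A) \<sqsubseteq>\<^bsub>P\<^esub> I" by simp
  qed
  show "pr1 \<top>\<^bsub>X\<^esub> = \<top>\<^bsub>P\<^esub>"
    using tens_top by (simp add: pr1_eq top_P)
  show "pr1 (x \<sqinter>\<^bsub>X\<^esub> y) = pr1 x \<sqinter>\<^bsub>P\<^esub> pr1 y" if "x \<in> carrier X" "y \<in> carrier X" for x y
    using that by (simp add: pr1_eq meet_P ideal_tens tens_Int)
qed

lemma pr2_hom: "pr2 \<in> frame_hom Y P"
  unfolding frame_hom_def
proof (intro CollectI conjI allI ballI impI)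
  show "pr2 \<in> carrier Y \<rightarrow>\<^sub>E carrier P"
    using pr_closed by (auto simp: pb_proj2_def)
  show "pr2 (\<Squnion>\<^bsub>Y\<^esub>A) = \<Squnion>\<^bsub>P\<^esub>(pr2 ` A)" if A: "A \<subseteq> carrier Y" for A
  proof (rule PF.eq_by_upper)
    have pA: "pr2 ` A \<subseteq> carrier P" using A by auto
    show "pr2 (\<Squnion>\<^bsub>Y\<^esub>A) \<in> carrier P" "\<Squnion>\<^bsub>P\<^esub>(pr2 ` A) \<in> carrier P"
      using A pA PF.sup_closed by (simp, blast)
    fix I assume I: "I \<in> carrier P"
    then have i: "ideal I" by simp
    have "pr2 (\<Squnion>\<^bsub>Y\<^esub>A) \<subseteq> I \<longleftrightarrow> (\<top>\<^bsub>X\<^esub>, \<Squnion>\<^bsub>Y\<^esub>A) \<in> I"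
      using A by (simp add: pr2_eq tens_le_iff[OF i])
    also have "\<dots> \<longleftrightarrow> (\<forall>a\<in>A. (\<top>\<^bsub>X\<^esub>, a) \<in> I)"
      using idealD(5)[OF i _ A] idealD(3)[OF i, of _ "\<Squnion>\<^bsub>Y\<^esub>A"] A Y.sup_upper[OF A]
      by (meson X.le_refl X.top_closed subsetD)
    also have "\<dots> \<longleftrightarrow> (\<forall>a\<in>A. pr2 a \<subseteq> I)"
      by (intro ball_cong refl pr2_le_iff[OF i, symmetric]) (use A in blast)
    also have "\<dots> \<longleftrightarrow> \<Squnion>\<^bsub>P\<^esub>(pr2 ` A) \<subseteq> I"
      using PF.Sup_le_iff[OF pA I] by simp
    finally show "pr2 (\<Squnion>\<^bsub>Y\<^esub>A) \<sqsubseteq>\<^bsub>P\<^esub> I \<longleftrightarrow> \<Squnion>\<^bsub>P\<^esub>(pr2 ` A) \<sqsubseteq>\<^bsub>P\<^esub> I" by simp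
  qed
  show "pr2 \<top>\<^bsub>Y\<^esub> = \<top>\<^bsub>P\<^esub>"
    using tens_top by (simp add: pr2_eq top_P)
  show "pr2 (x \<sqinter>\<^bsub>Y\<^esub> y) = pr2 x \<sqinter>\<^bsub>P\<^esub> pr2 y" if "x \<in> carrier Y" "y \<in> carrier Y" for x y
    using that by (simp add: pr2_eq meet_P ideal_tens tens_Int)
qed

lemma ideal_Sup_left_iff:
  assumes I: "ideal I" and A: "A \<subseteq> carrier X" and b: "b \<in> carrier Y"
  shows "(\<Squnion>\<^bsub>X\<^esub>A, b) \<in> I \<longleftrightarrow> (\<forall>a\<in>A. (a, b) \<in> I)"
proof (intro iffI ballI)
  fix a assume h: "(\<Squnion>\<^bsub>X\<^esub>A, b) \<in> I" and a: "a \<in> A"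
  show "(a, b) \<in> I"
    by (rule idealD(3)[OF I h]) (use a A b X.sup_upper[OF A] in auto)
qed (simp add: idealD(4)[OF I A b])

lemma ideal_Sup_right_iff:
  assumes I: "ideal I" and a: "a \<in> carrier X" and B: "B \<subseteq> carrier Y"
  shows "(a, \<Squnion>\<^bsub>Y\<^esub>B) \<in> I \<longleftrightarrow> (\<forall>b\<in>B. (a, b) \<in> I)"
proof (intro iffI ballI)
  fix b assume h: "(a, \<Squnion>\<^bsub>Y\<^esub>B) \<in> I" and b: "b \<in> B"
  show "(a, b) \<in> I"
    by (rule idealD(3)[OF I h]) (use a B b Y.sup_upper[OF B] in auto)
qed (simp add: idealD(5)[OF I a B])

lemma ideal_le_iff: "\<lbrakk>ideal I; ideal K\<rbrakk> \<Longrightarrow> I \<subseteq> K \<longleftrightarrow> (\<forall>(a, b)\<in>I. tens a b \<subseteq> K)"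
  by (auto simp: tens_le_iff)

lemma ideal_as_Sup: "ideal I \<Longrightarrow> \<Squnion>\<^bsub>P\<^esub>((\<lambda>(a, b). tens a b) ` I) = I"
proof (rule PF.eq_by_upper)
  assume I: "ideal I"
  have c: "(\<lambda>(a, b). tens a b) ` I \<subseteq> carrier P"
    using ideal_sub[OF I] by (auto simp: ideal_tens)
  show "\<Squnion>\<^bsub>P\<^esub>((\<lambda>(a, b). tens a b) ` I) \<in> carrier P" by (rule PF.sup_closed[OF c])
  show "I \<in> carrier P" using I by simp
  fix K assume K: "K \<in> carrier P"
  show "(\<Squnion>\<^bsub>P\<^esub>((\<lambda>(a, b). tens a b) ` I) \<sqsubseteq>\<^bsub>P\<^esub> K) = (I \<sqsubseteq>\<^bsub>P\<^esub> K)"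
    using PF.Sup_le_iff[OF c K] ideal_le_iff[OF I] K by auto
qed

end

section \<open>Points and etale maps\<close>

lemma two_frame_Sup: "\<Squnion>\<^bsub>two_frame\<^esub>A \<longleftrightarrow> (\<exists>a\<in>A. a)"
proof -
  have "least two_frame x (Upper two_frame A) \<longleftrightarrow> x = (\<exists>a\<in>A. a)" for x
    unfolding least_def Upper_def two_frame_def by auto
  then show ?thesis unfolding sup_def by (simp only: some_eq_trivial)
qed

lemma two_frame_meet: "x \<sqinter>\<^bsub>two_frame\<^esub> y \<longleftrightarrow> x \<and> y"
proof -
  have "greatest two_frame z (Lower two_frame {x, y}) \<longleftrightarrow> z = (x \<and> y)" for z
    unfolding greatest_def Lower_def two_frame_def by auto
  then show ?thesis unfolding meet_def inf_def by (simp only: some_eq_trivial)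
qed

lemma two_frame_top: "\<top>\<^bsub>two_frame\<^esub>"
proof -
  have "greatest two_frame z (carrier two_frame) \<longleftrightarrow> z = True" for z
    unfolding greatest_def two_frame_def by auto
  then show ?thesis unfolding top_def by (simp only: some_eq_trivial)
qed

lemma carrier_two_frame: "carrier two_frame = UNIV"
  by (simp add: two_frame_def)

lemma pt_iff:
  "p \<in> pt L \<longleftrightarrow> p \<in> extensional (carrier L) \<and>
     (\<forall>A\<subseteq>carrier L. p (\<Squnion>\<^bsub>L\<^esub>A) \<longleftrightarrow> (\<exists>a\<in>A. p a)) \<and> p \<top>\<^bsub>L\<^esub> \<and>
     (\<forall>x\<in>carrier L. \<forall>y\<in>carrier L. p (x \<sqinter>\<^bsub>L\<^esub> y) \<longleftrightarrow> p x \<and> p y)"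
  unfolding pt_def frame_hom_def
  by (simp add: two_frame_Sup two_frame_meet two_frame_top PiE_def carrier_two_frame)

lemma ptI:
  assumes "p \<in> extensional (carrier L)"
    and "\<And>A. A \<subseteq> carrier L \<Longrightarrow> p (\<Squnion>\<^bsub>L\<^esub>A) \<longleftrightarrow> (\<exists>a\<in>A. p a)" and "p \<top>\<^bsub>L\<^esub>"
    and "\<And>x y. \<lbrakk>x \<in> carrier L; y \<in> carrier L\<rbrakk> \<Longrightarrow> p (x \<sqinter>\<^bsub>L\<^esub> y) \<longleftrightarrow> p x \<and> p y"
  shows "p \<in> pt L"
  using assms unfolding pt_iff by simp

lemma
  assumes "p \<in> pt L"
  shows pt_Sup: "A \<subseteq> carrier L \<Longrightarrow> p (\<Squnion>\<^bsub>L\<^esub>A) \<longleftrightarrow> (\<exists>a\<in>A. p a)"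
    and pt_top: "p \<top>\<^bsub>L\<^esub>"
    and pt_meet: "\<lbrakk>x \<in> carrier L; y \<in> carrier L\<rbrakk> \<Longrightarrow> p (x \<sqinter>\<^bsub>L\<^esub> y) \<longleftrightarrow> p x \<and> p y"
    and pt_ext: "p \<in> extensional (carrier L)"
  using assms unfolding pt_iff by simp_all

lemma pt_eqI: "\<lbrakk>p \<in> pt L; q \<in> pt L; \<And>x. x \<in> carrier L \<Longrightarrow> p x = q x\<rbrakk> \<Longrightarrow> p = q"
  by (rule extensionalityI[OF pt_ext pt_ext])

lemma pt_mono:
  assumes "frame L" "p \<in> pt L" "x \<sqsubseteq>\<^bsub>L\<^esub> y" "x \<in> carrier L" "y \<in> carrier L" "p x"
  shows "p y"
  using pt_meet[OF assms(2,4,5)] frame.meet_absorb[OF assms(1,3-5)] assms(6) by simp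

lemma pt_map_apply [simp]: "y \<in> carrier Y \<Longrightarrow> pt_map Y h p y = p (h y)"
  by (simp add: pt_map_def compose_def)

lemma pt_map_in_pt:
  assumes "frame Y" "h \<in> frame_hom Y X" "p \<in> pt X"
  shows "pt_map Y h p \<in> pt Y"
proof (rule ptI)
  interpret Y: frame Y by fact
  note h = frame_homD[OF assms(2)]
  show "pt_map Y h p \<in> extensional (carrier Y)" by (simp add: pt_map_def)
  show "pt_map Y h p (\<Squnion>\<^bsub>Y\<^esub>A) \<longleftrightarrow> (\<exists>a\<in>A. pt_map Y h p a)" if A: "A \<subseteq> carrier Y" for A
  proof -
    have "h ` A \<subseteq> carrier X" using A h(2) by auto
    then have "pt_map Y h p (\<Squnion>\<^bsub>Y\<^esub>A) \<longleftrightarrow> (\<exists>a\<in>A. p (h a))"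
      using A h(3)[OF A] pt_Sup[OF assms(3), of "h ` A"] by simp
    also have "\<dots> \<longleftrightarrow> (\<exists>a\<in>A. pt_map Y h p a)" by (rule bex_cong) (use A in auto)
    finally show ?thesis .
  qed
  show "pt_map Y h p \<top>\<^bsub>Y\<^esub>" using h(4) pt_top[OF assms(3)] by simp
  show "pt_map Y h p (x \<sqinter>\<^bsub>Y\<^esub> y) \<longleftrightarrow> pt_map Y h p x \<and> pt_map Y h p y"
    if "x \<in> carrier Y" "y \<in> carrier Y" for x y
    using that h(2,5) pt_meet[OF assms(3)] by simp
qed

lemma openin_pt_space:
  assumes "frame L"
  shows "openin (pt_space L) U \<longleftrightarrow> (\<exists>a\<in>carrier L. U = {p \<in> pt L. p a})"
proof -
  interpret frame L by fact
  have "istopology (\<lambda>U. \<exists>a\<in>carrier L. U = {p \<in> pt L. p a})"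
    unfolding istopology_def
  proof (intro conjI allI impI)
    fix S T assume "\<exists>a\<in>carrier L. S = {p \<in> pt L. p a}" "\<exists>a\<in>carrier L. T = {p \<in> pt L. p a}"
    then obtain a b where ab: "a \<in> carrier L" "b \<in> carrier L" "S = {p \<in> pt L. p a}" "T = {p \<in> pt L. p b}"
      by blast
    then have "S \<inter> T = {p \<in> pt L. p (a \<sqinter>\<^bsub>L\<^esub> b)}" using pt_meet[OF _ ab(1,2)] by auto
    then show "\<exists>a\<in>carrier L. S \<inter> T = {p \<in> pt L. p a}" using ab(1,2) by (intro bexI[of _ "a \<sqinter>\<^bsub>L\<^esub> b"]) simp_all
  next
    fix \<K> assume K: "\<forall>S\<in>\<K>. \<exists>a\<in>carrier L. S = {p \<in> pt L. p a}"
    let ?A = "{a \<in> carrier L. {p \<in> pt L. p a} \<in> \<K>}"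
    have A: "?A \<subseteq> carrier L" by blast
    have "\<Union>\<K> = {p \<in> pt L. \<exists>a\<in>?A. p a}"
    proof (intro equalityI subsetI)
      fix x assume "x \<in> \<Union>\<K>"
      then obtain S where S: "S \<in> \<K>" "x \<in> S" by blast
      then obtain a where "a \<in> carrier L" "S = {p \<in> pt L. p a}" using K by blast
      then show "x \<in> {p \<in> pt L. \<exists>a\<in>?A. p a}" using S by blast
    qed blast
    also have "\<dots> = {p \<in> pt L. p (\<Squnion>\<^bsub>L\<^esub>?A)}" using pt_Sup[OF _ A] by auto
    finally show "\<exists>a\<in>carrier L. \<Union>\<K> = {p \<in> pt L. p a}" using sup_closed[OF A] by blast
  qed
  then show ?thesis unfolding pt_space_def by (simp add: topology_inverse')
qed

lemma topspace_pt_space: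
  assumes "frame L" shows "topspace (pt_space L) = pt L"
proof
  interpret frame L by fact
  show "topspace (pt_space L) \<subseteq> pt L"
    using openin_pt_space[OF assms, of "topspace (pt_space L)"] by auto
  have "{p \<in> pt L. p \<top>\<^bsub>L\<^esub>} = pt L" using pt_top by blast
  then have "openin (pt_space L) (pt L)" unfolding openin_pt_space[OF assms] by (metis top_closed)
  then show "pt L \<subseteq> topspace (pt_space L)" by (rule openin_subset)
qed

lemma continuous_pt_map:
  assumes "frame X" "frame Y" "h \<in> frame_hom Y X"
  shows "continuous_map (pt_space X) (pt_space Y) (pt_map Y h)"
  unfolding continuous_map_def topspace_pt_space[OF assms(1)] topspace_pt_space[OF assms(2)]
proof (intro conjI allI impI)
  show "pt_map Y h \<in> pt X \<rightarrow> pt Y" using pt_map_in_pt[OF assms(2,3)] by auto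
  fix U assume "openin (pt_space Y) U"
  then obtain a where a: "a \<in> carrier Y" "U = {p \<in> pt Y. p a}"
    using openin_pt_space[OF assms(2)] by blast
  have "{x \<in> pt X. pt_map Y h x \<in> U} = {p \<in> pt X. p (h a)}"
    using a pt_map_in_pt[OF assms(2,3)] by auto
  then show "openin (pt_space X) {x \<in> pt X. pt_map Y h x \<in> U}"
    using openin_pt_space[OF assms(1)] frame_homD(2)[OF assms(3) a(1)] by blast
qed

text \<open>
  A point of a pullback is a pair of points with the same image: the pair \<open>(p, q)\<close> takes an
  ideal to 1 if and only if it takes one of its generators to 1.
\<close>

context pullback
begin

definition pair_pt :: "('a \<Rightarrow> bool) \<Rightarrow> ('b \<Rightarrow> bool) \<Rightarrow> ('a \<times> 'b) set \<Rightarrow> bool" where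
  "pair_pt p q = (\<lambda>I\<in>carrier P. \<exists>(a, b)\<in>I. p a \<and> q b)"

lemma pair_pt_apply: "ideal I \<Longrightarrow> pair_pt p q I \<longleftrightarrow> (\<exists>(a, b)\<in>I. p a \<and> q b)"
  by (simp add: pair_pt_def)

text \<open>
  The largest ideal outside the pair \<open>(p, q)\<close>. Its last closure condition expresses that \<open>p\<close>
  and \<open>q\<close> have the same image.
\<close>

lemma ideal_avoid:
  assumes p: "p \<in> pt X" and q: "q \<in> pt Y" and pq: "\<And>z. z \<in> carrier Z \<Longrightarrow> p (f z) = q (g z)"
  shows "ideal {(a, b). a \<in> carrier X \<and> b \<in> carrier Y \<and> \<not> (p a \<and> q b)}" (is "ideal ?N")
proof (rule idealI)
  show "?N \<subseteq> carrier X \<times> carrier Y" by auto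
  show "(a', b') \<in> ?N" if "(a, b) \<in> ?N" "a' \<in> carrier X" "b' \<in> carrier Y"
    "a' \<sqsubseteq>\<^bsub>X\<^esub> a" "b' \<sqsubseteq>\<^bsub>Y\<^esub> b" for a b a' b'
    using that pt_mono[OF X.frame_axioms p, of a' a] pt_mono[OF Y.frame_axioms q, of b' b] by auto
  show "(\<Squnion>\<^bsub>X\<^esub>A, b) \<in> ?N" if A: "A \<subseteq> carrier X" and b: "b \<in> carrier Y"
    and *: "\<And>a. a \<in> A \<Longrightarrow> (a, b) \<in> ?N" for A b
    using A b pt_Sup[OF p A] * by auto
  show "(a, \<Squnion>\<^bsub>Y\<^esub>B) \<in> ?N" if a: "a \<in> carrier X" and B: "B \<subseteq> carrier Y"
    and *: "\<And>b. b \<in> B \<Longrightarrow> (a, b) \<in> ?N" for a B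
    using a B pt_Sup[OF q B] * by auto
  show "(a \<sqinter>\<^bsub>X\<^esub> f z, b) \<in> ?N \<longleftrightarrow> (a, b \<sqinter>\<^bsub>Y\<^esub> g z) \<in> ?N"
    if a: "a \<in> carrier X" and b: "b \<in> carrier Y" and z: "z \<in> carrier Z" for a b z
    using a b z pt_meet[OF p, of a "f z"] pt_meet[OF q, of b "g z"] pq[OF z] by auto
qed

lemma pair_pt:
  assumes p: "p \<in> pt X" and q: "q \<in> pt Y" and pq: "\<And>z. z \<in> carrier Z \<Longrightarrow> p (f z) = q (g z)"
  shows "pair_pt p q \<in> pt P"
proof (rule ptI)
  show "pair_pt p q \<in> extensional (carrier P)" by (simp add: pair_pt_def)
  let ?N = "{(a, b). a \<in> carrier X \<and> b \<in> carrier Y \<and> \<not> (p a \<and> q b)}"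
  have N: "ideal ?N" by (rule ideal_avoid[OF p q pq])
  have iff: "pair_pt p q I \<longleftrightarrow> \<not> I \<subseteq> ?N" if "ideal I" for I
    using ideal_sub[OF that] by (auto simp: pair_pt_apply[OF that])
  show "pair_pt p q (\<Squnion>\<^bsub>P\<^esub>\<A>) \<longleftrightarrow> (\<exists>I\<in>\<A>. pair_pt p q I)" if A: "\<A> \<subseteq> carrier P" for \<A>
  proof -
    have "ideal (\<Squnion>\<^bsub>P\<^esub>\<A>)" using PF.sup_closed[OF A] by simp
    then have "pair_pt p q (\<Squnion>\<^bsub>P\<^esub>\<A>) \<longleftrightarrow> \<not> \<Squnion>\<^bsub>P\<^esub>\<A> \<subseteq> ?N" by (rule iff)
    also have "\<dots> \<longleftrightarrow> (\<exists>I\<in>\<A>. \<not> I \<subseteq> ?N)" using PF.Sup_le_iff[OF A, of ?N] N by simp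
    also have "\<dots> \<longleftrightarrow> (\<exists>I\<in>\<A>. pair_pt p q I)"
      by (rule bex_cong[OF refl], subst iff) (use A in auto)
    finally show ?thesis .
  qed
  show "pair_pt p q \<top>\<^bsub>P\<^esub>"
    using pt_top[OF p] pt_top[OF q] by (auto simp: pair_pt_apply[OF ideal_whole] top_P)
  show "pair_pt p q (I \<sqinter>\<^bsub>P\<^esub> K) \<longleftrightarrow> pair_pt p q I \<and> pair_pt p q K"
    if "I \<in> carrier P" "K \<in> carrier P" for I K
  proof -
    have i: "ideal I" "ideal K" "ideal (I \<inter> K)" using that ideal_Int by auto
    have "\<exists>(a, b)\<in>I \<inter> K. p a \<and> q b" if h: "(a, b) \<in> I" "p a" "q b" "(a', b') \<in> K" "p a'" "q b'" for a b a' b'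
    proof -
      have c: "a \<in> carrier X" "b \<in> carrier Y" "a' \<in> carrier X" "b' \<in> carrier Y"
        using idealD(1,2)[OF i(1) h(1)] idealD(1,2)[OF i(2) h(4)] by auto
      have "(a \<sqinter>\<^bsub>X\<^esub> a', b \<sqinter>\<^bsub>Y\<^esub> b') \<in> I \<inter> K"
        using c idealD(3)[OF i(1) h(1), of "a \<sqinter>\<^bsub>X\<^esub> a'" "b \<sqinter>\<^bsub>Y\<^esub> b'"]
          idealD(3)[OF i(2) h(4), of "a \<sqinter>\<^bsub>X\<^esub> a'" "b \<sqinter>\<^bsub>Y\<^esub> b'"]
        by (simp add: X.meet_left Y.meet_left X.meet_right Y.meet_right)
      moreover have "p (a \<sqinter>\<^bsub>X\<^esub> a')" "q (b \<sqinter>\<^bsub>Y\<^esub> b')"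
        using h c pt_meet[OF p] pt_meet[OF q] by auto
      ultimately show ?thesis by blast
    qed
    then show ?thesis
      unfolding meet_P[OF i(1,2)] pair_pt_apply[OF i(1)] pair_pt_apply[OF i(2)] pair_pt_apply[OF i(3)]
      by fast
  qed
qed

lemma pair_pt_tens:
  assumes p: "p \<in> pt X" and q: "q \<in> pt Y" and pq: "\<And>z. z \<in> carrier Z \<Longrightarrow> p (f z) = q (g z)"
    and ab: "a \<in> carrier X" "b \<in> carrier Y"
  shows "pair_pt p q (tens a b) \<longleftrightarrow> p a \<and> q b"
proof
  assume "p a \<and> q b"
  then show "pair_pt p q (tens a b)"
    using in_tens[of a b] by (auto simp: pair_pt_apply[OF ideal_tens[OF ab]])
next
  assume s: "pair_pt p q (tens a b)"
  show "p a \<and> q b"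
  proof (rule ccontr)
    assume "\<not> (p a \<and> q b)"
    then have "tens a b \<subseteq> {(a, b). a \<in> carrier X \<and> b \<in> carrier Y \<and> \<not> (p a \<and> q b)}"
      using ab tens_le_iff[OF ideal_avoid[OF p q pq]] by simp
    then show False using s by (auto simp: pair_pt_apply[OF ideal_tens[OF ab]])
  qed
qed

lemma pt_map_pr_pair_pt:
  assumes p: "p \<in> pt X" and q: "q \<in> pt Y" and pq: "\<And>z. z \<in> carrier Z \<Longrightarrow> p (f z) = q (g z)"
  shows "pt_map X pr1 (pair_pt p q) = p" "pt_map Y pr2 (pair_pt p q) = q"
proof -
  note pp = pair_pt[OF assms]
  show "pt_map X pr1 (pair_pt p q) = p"
  proof (rule pt_eqI[OF pt_map_in_pt[OF X.frame_axioms pr1_hom pp] p])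
    fix x assume x: "x \<in> carrier X"
    then show "pt_map X pr1 (pair_pt p q) x = p x"
      using pair_pt_tens[OF p q pq x Y.top_closed] pt_top[OF q] by (simp add: pr1_eq)
  qed
  show "pt_map Y pr2 (pair_pt p q) = q"
  proof (rule pt_eqI[OF pt_map_in_pt[OF Y.frame_axioms pr2_hom pp] q])
    fix x assume x: "x \<in> carrier Y"
    then show "pt_map Y pr2 (pair_pt p q) x = q x"
      using pair_pt_tens[OF p q pq X.top_closed x] pt_top[OF p] by (simp add: pr2_eq)
  qed
qed

lemma pair_pt_pt_map:
  assumes s: "s \<in> pt P"
  shows "pair_pt (pt_map X pr1 s) (pt_map Y pr2 s) = s"
proof (rule extensionalityI[OF _ pt_ext[OF s]])
  show "pair_pt (pt_map X pr1 s) (pt_map Y pr2 s) \<in> extensional (carrier P)" by (simp add: pair_pt_def)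
  fix I assume "I \<in> carrier P"
  then have I: "ideal I" by simp
  have c: "(\<lambda>(a, b). tens a b) ` I \<subseteq> carrier P"
    using ideal_sub[OF I] by (auto simp: ideal_tens)
  have "s I \<longleftrightarrow> (\<exists>(a, b)\<in>I. s (tens a b))"
    using pt_Sup[OF s c] ideal_as_Sup[OF I] by auto
  also have "\<dots> \<longleftrightarrow> (\<exists>(a, b)\<in>I. pt_map X pr1 s a \<and> pt_map Y pr2 s b)"
  proof (rule bex_cong[OF refl], clarify)
    fix a b assume "(a, b) \<in> I"
    then have ab: "a \<in> carrier X" "b \<in> carrier Y" using idealD(1,2)[OF I] by auto
    show "s (tens a b) \<longleftrightarrow> pt_map X pr1 s a \<and> pt_map Y pr2 s b"
      using ab pt_meet[OF s, of "pr1 a" "pr2 b"] by (simp add: pr_meet)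
  qed
  finally show "pair_pt (pt_map X pr1 s) (pt_map Y pr2 s) I = s I"
    by (simp add: pair_pt_apply[OF I])
qed

end

locale etale_frame_map = open_frame_map +
  assumes etale_loc: "etale_loc X Y f"
begin

text \<open>
  A section is an element \<open>b\<close> on which the map restricts to an isomorphism with the open \<open>f\<^sub>!(b)\<close>:
  every element below \<open>b\<close> is the restriction of some \<open>f\<^sup>*(z)\<close>, and then \<open>z = f\<^sub>!(a)\<close> will do.
\<close>

definition sect :: "'a \<Rightarrow> bool" where
  "sect b \<longleftrightarrow> b \<in> carrier X \<and> (\<forall>a\<in>carrier X. a \<sqsubseteq>\<^bsub>X\<^esub> b \<longrightarrow> a = b \<sqinter>\<^bsub>X\<^esub> f (sh a))"

lemma sectionD:
  assumes "sect b"
  shows "b \<in> carrier X" "\<lbrakk>a \<in> carrier X; a \<sqsubseteq>\<^bsub>X\<^esub> b\<rbrakk> \<Longrightarrow> b \<sqinter>\<^bsub>X\<^esub> f (sh a) = a"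
  using assms by (auto simp: sect_def)

lemma sectionI:
  assumes b: "b \<in> carrier X"
    and ex: "\<And>a. \<lbrakk>a \<in> carrier X; a \<sqsubseteq>\<^bsub>X\<^esub> b\<rbrakk> \<Longrightarrow> \<exists>z\<in>carrier Y. a = b \<sqinter>\<^bsub>X\<^esub> f z"
  shows "sect b"
  unfolding sect_def
proof (intro conjI ballI impI)
  fix a assume a: "a \<in> carrier X" and ab: "a \<sqsubseteq>\<^bsub>X\<^esub> b"
  obtain z where z: "z \<in> carrier Y" "a = b \<sqinter>\<^bsub>X\<^esub> f z" using ex[OF a ab] by blast
  show "a = b \<sqinter>\<^bsub>X\<^esub> f (sh a)"
  proof (rule X.le_antisym)
    show "a \<sqsubseteq>\<^bsub>X\<^esub> b \<sqinter>\<^bsub>X\<^esub> f (sh a)" using a b ab by (simp add: X.le_meet_iff le_f_sh)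
    have "sh a \<sqsubseteq>\<^bsub>Y\<^esub> z" using a b z by (simp add: sh_le_iff X.meet_right)
    then have "f (sh a) \<sqsubseteq>\<^bsub>X\<^esub> f z" using a z by (simp add: f_mono)
    then show "b \<sqinter>\<^bsub>X\<^esub> f (sh a) \<sqsubseteq>\<^bsub>X\<^esub> a"
      using X.meet_mono[of b b "f (sh a)" "f z"] a b z by simp
  qed (use a b in auto)
qed (rule b)

lemma section_down:
  assumes s: "sect b" and a: "a \<in> carrier X" "a \<sqsubseteq>\<^bsub>X\<^esub> b"
  shows "sect a"
proof (rule sectionI[OF a(1)])
  note b = sectionD(1)[OF s]
  fix c assume c: "c \<in> carrier X" "c \<sqsubseteq>\<^bsub>X\<^esub> a"
  have "c \<sqsubseteq>\<^bsub>X\<^esub> b" using X.le_trans[OF c(2) a(2)] a b c by simp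
  then have "b \<sqinter>\<^bsub>X\<^esub> f (sh c) = c" using sectionD(2)[OF s c(1)] by simp
  then have "a \<sqinter>\<^bsub>X\<^esub> f (sh c) = a \<sqinter>\<^bsub>X\<^esub> c"
    using X.meet_absorb[OF a(2) a(1) b] X.meet_assoc[OF a(1) b, of "f (sh c)"] c by simp
  then show "\<exists>z\<in>carrier Y. c = a \<sqinter>\<^bsub>X\<^esub> f z"
    using X.meet_absorb2[OF c(2,1) a(1)] c(1) by (intro bexI[of _ "sh c"]) simp_all
qed

text \<open>
  The members of a cover witnessing etaleness are sections, and so is everything below them; the
  distributive law then cuts \<open>a\<close> into sections.
\<close>

lemma Sup_sections:
  assumes a: "a \<in> carrier X"
  shows "\<Squnion>\<^bsub>X\<^esub>{s. sect s \<and> s \<sqsubseteq>\<^bsub>X\<^esub> a} = a"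
proof -
  obtain B where B: "B \<subseteq> carrier X" "\<Squnion>\<^bsub>X\<^esub>B = \<top>\<^bsub>X\<^esub>"
    and sur: "\<And>b. b \<in> B \<Longrightarrow> (\<lambda>x. f x \<sqinter>\<^bsub>X\<^esub> b) ` carrier Y = {a \<in> carrier X. a \<sqsubseteq>\<^bsub>X\<^esub> b}"
    using etale_loc[unfolded etale_loc_def, THEN conjunct2] by (elim exE conjE) simp
  have sec: "sect b" if b: "b \<in> B" for b
  proof (rule sectionI)
    show "b \<in> carrier X" using b B by auto
    fix a assume "a \<in> carrier X" "a \<sqsubseteq>\<^bsub>X\<^esub> b"
    then have "a \<in> (\<lambda>x. f x \<sqinter>\<^bsub>X\<^esub> b) ` carrier Y" using sur[OF b] by simp
    then show "\<exists>z\<in>carrier Y. a = b \<sqinter>\<^bsub>X\<^esub> f z" by (auto simp: meet_comm[of X b])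
  qed
  let ?S = "{s. sect s \<and> s \<sqsubseteq>\<^bsub>X\<^esub> a}"
  have S: "?S \<subseteq> carrier X" using sectionD(1) by blast
  show ?thesis
  proof (rule X.le_antisym)
    show "\<Squnion>\<^bsub>X\<^esub>?S \<sqsubseteq>\<^bsub>X\<^esub> a" using S a by (simp add: X.Sup_le_iff)
    have im: "(\<lambda>b. a \<sqinter>\<^bsub>X\<^esub> b) ` B \<subseteq> ?S"
      using B(1) a by (auto intro!: section_down[OF sec] X.meet_left X.meet_right simp: subset_iff)
    have "a = \<Squnion>\<^bsub>X\<^esub>((\<lambda>b. a \<sqinter>\<^bsub>X\<^esub> b) ` B)"
      using X.meet_Sup_distrib[OF a B(1)] B(2) a by simp
    also have "\<dots> \<sqsubseteq>\<^bsub>X\<^esub> \<Squnion>\<^bsub>X\<^esub>?S"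
      using im S X.sup_upper[OF S] by (subst X.Sup_le_iff) (auto simp: subset_iff)
    finally show "a \<sqsubseteq>\<^bsub>X\<^esub> \<Squnion>\<^bsub>X\<^esub>?S" .
  qed (use S a in auto)
qed

lemma pt_section:
  assumes p: "p \<in> pt X" and a: "a \<in> carrier X" "p a"
  obtains s where "sect s" "s \<sqsubseteq>\<^bsub>X\<^esub> a" "p s"
proof -
  have S: "{s. sect s \<and> s \<sqsubseteq>\<^bsub>X\<^esub> a} \<subseteq> carrier X" using sectionD(1) by blast
  show thesis using pt_Sup[OF p S] Sup_sections[OF a(1)] a(2) that by auto
qed

text \<open>
  Everything below \<open>s\<close> is of the form \<open>s \<and> f\<^sup>*(z)\<close>, so a point in \<open>s\<close> is determined by its
  values on the image of \<open>f\<^sup>*\<close>.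
\<close>

lemma section_pt_unique:
  assumes s: "sect s" and p: "p \<in> pt X" "p s" and q: "q \<in> pt X" "q s"
    and eq: "pt_map Y f p = pt_map Y f q"
  shows "p = q"
proof (rule pt_eqI[OF p(1) q(1)])
  note c = sectionD(1)[OF s]
  fix a assume a: "a \<in> carrier X"
  have e: "s \<sqinter>\<^bsub>X\<^esub> f (sh (s \<sqinter>\<^bsub>X\<^esub> a)) = s \<sqinter>\<^bsub>X\<^esub> a"
    by (rule sectionD(2)[OF s]) (use a c in \<open>simp_all add: X.meet_left\<close>)
  have "p (f (sh (s \<sqinter>\<^bsub>X\<^esub> a))) = q (f (sh (s \<sqinter>\<^bsub>X\<^esub> a)))"
    using fun_cong[OF eq, of "sh (s \<sqinter>\<^bsub>X\<^esub> a)"] a c by simp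
  then show "p a = q a"
    using pt_meet[OF p(1) c, of a] pt_meet[OF q(1) c, of a]
      pt_meet[OF p(1) c, of "f (sh (s \<sqinter>\<^bsub>X\<^esub> a))"] pt_meet[OF q(1) c, of "f (sh (s \<sqinter>\<^bsub>X\<^esub> a))"]
      e a c p(2) q(2) by simp
qed

text \<open>
  The isomorphism of \<open>s\<close> with \<open>f\<^sub>!(s)\<close> on points: \<open>p(a) = q(f\<^sub>!(s \<and> a))\<close>. Frobenius
  reciprocity is what makes \<open>p\<close> preserve binary meets.
\<close>

lemma section_pt_lift:
  assumes s: "sect s" and q: "q \<in> pt Y" "q (sh s)"
  obtains p where "p \<in> pt X" "p s" "pt_map Y f p = q"
proof -
  note c [simp] = sectionD(1)[OF s]
  define p where "p = (\<lambda>a\<in>carrier X. q (sh (s \<sqinter>\<^bsub>X\<^esub> a)))"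
  have p_apply: "p a = q (sh (s \<sqinter>\<^bsub>X\<^esub> a))" if "a \<in> carrier X" for a using that by (simp add: p_def)
  have rep: "s \<sqinter>\<^bsub>X\<^esub> f (sh (s \<sqinter>\<^bsub>X\<^esub> a)) = s \<sqinter>\<^bsub>X\<^esub> a" if "a \<in> carrier X" for a
    by (rule sectionD(2)[OF s]) (use that in \<open>simp_all add: X.meet_left\<close>)
  have pp: "p \<in> pt X"
  proof (rule ptI)
    show "p \<in> extensional (carrier X)" by (simp add: p_def)
    show "p (\<Squnion>\<^bsub>X\<^esub>A) \<longleftrightarrow> (\<exists>a\<in>A. p a)" if A: "A \<subseteq> carrier X" for A
    proof -
      have sA: "(\<lambda>a. s \<sqinter>\<^bsub>X\<^esub> a) ` A \<subseteq> carrier X" using A by auto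
      have "sh (s \<sqinter>\<^bsub>X\<^esub> \<Squnion>\<^bsub>X\<^esub>A) = \<Squnion>\<^bsub>Y\<^esub>(sh ` (\<lambda>a. s \<sqinter>\<^bsub>X\<^esub> a) ` A)"
        using sh_Sup[OF sA] X.meet_Sup_distrib[OF c A] by simp
      moreover have "sh ` (\<lambda>a. s \<sqinter>\<^bsub>X\<^esub> a) ` A \<subseteq> carrier Y" using sA by auto
      ultimately have "p (\<Squnion>\<^bsub>X\<^esub>A) \<longleftrightarrow> (\<exists>a\<in>A. q (sh (s \<sqinter>\<^bsub>X\<^esub> a)))"
        using pt_Sup[OF q(1), of "sh ` (\<lambda>a. s \<sqinter>\<^bsub>X\<^esub> a) ` A"] A by (simp add: p_apply)
      also have "\<dots> \<longleftrightarrow> (\<exists>a\<in>A. p a)" by (rule bex_cong[OF refl]) (use A p_apply in auto)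
      finally show ?thesis .
    qed
    show "p \<top>\<^bsub>X\<^esub>" using q(2) by (simp add: p_apply)
    show "p (x \<sqinter>\<^bsub>X\<^esub> y) \<longleftrightarrow> p x \<and> p y" if x: "x \<in> carrier X" and y: "y \<in> carrier X" for x y
    proof -
      let ?z = "sh (s \<sqinter>\<^bsub>X\<^esub> y)"
      have "s \<sqinter>\<^bsub>X\<^esub> (x \<sqinter>\<^bsub>X\<^esub> y) = x \<sqinter>\<^bsub>X\<^esub> (s \<sqinter>\<^bsub>X\<^esub> y)"
        using x y by (simp add: X.meet_ac)
      also have "\<dots> = x \<sqinter>\<^bsub>X\<^esub> (s \<sqinter>\<^bsub>X\<^esub> f ?z)" using rep[OF y] by simp
      also have "\<dots> = (s \<sqinter>\<^bsub>X\<^esub> x) \<sqinter>\<^bsub>X\<^esub> f ?z" using x y by (simp add: X.meet_ac)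
      finally have "sh (s \<sqinter>\<^bsub>X\<^esub> (x \<sqinter>\<^bsub>X\<^esub> y)) = sh (s \<sqinter>\<^bsub>X\<^esub> x) \<sqinter>\<^bsub>Y\<^esub> ?z"
        using x y by (simp add: frobenius)
      then show ?thesis using x y pt_meet[OF q(1)] by (simp add: p_apply)
    qed
  qed
  moreover have "p s" using q(2) by (simp add: p_apply)
  moreover have "pt_map Y f p = q"
  proof (rule pt_eqI[OF pt_map_in_pt[OF Y.frame_axioms hom pp] q(1)])
    fix z assume z: "z \<in> carrier Y"
    then show "pt_map Y f p z = q z"
      using q(2) pt_meet[OF q(1), of "sh s" z] by (simp add: p_apply frobenius)
  qed
  ultimately show thesis using that by blast
qed

text \<open>
  A point in \<open>f\<^sub>!(a)\<close> lies in \<open>f\<^sub>!(s)\<close> for some section \<open>s\<close> below \<open>a\<close>, and it lifts into \<open>s\<close>.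
\<close>

lemma pt_map_image:
  assumes a: "a \<in> carrier X"
  shows "pt_map Y f ` {p \<in> pt X. p a} = {q \<in> pt Y. q (sh a)}"
proof (intro equalityI subsetI)
  fix q assume "q \<in> pt_map Y f ` {p \<in> pt X. p a}"
  then obtain p where p: "p \<in> pt X" "p a" "q = pt_map Y f p" by blast
  then have "p (f (sh a))" using pt_mono[OF X.frame_axioms p(1) le_f_sh[OF a]] a by simp
  then show "q \<in> {q \<in> pt Y. q (sh a)}"
    using p a pt_map_in_pt[OF Y.frame_axioms hom p(1)] by simp
next
  fix q assume "q \<in> {q \<in> pt Y. q (sh a)}"
  then have q: "q \<in> pt Y" "q (sh a)" by auto
  let ?S = "{s. sect s \<and> s \<sqsubseteq>\<^bsub>X\<^esub> a}"
  have S: "?S \<subseteq> carrier X" using sectionD(1) by blast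
  then have shS: "sh ` ?S \<subseteq> carrier Y" by auto
  have "sh a = \<Squnion>\<^bsub>Y\<^esub>(sh ` ?S)" using sh_Sup[OF S] Sup_sections[OF a] by simp
  then obtain s where s: "sect s" "s \<sqsubseteq>\<^bsub>X\<^esub> a" "q (sh s)"
    using q(2) pt_Sup[OF q(1) shS] by auto
  obtain p where p: "p \<in> pt X" "p s" "pt_map Y f p = q"
    using section_pt_lift[OF s(1) q(1) s(3)] by blast
  then have "p a" using pt_mono[OF X.frame_axioms p(1) s(2)] sectionD(1)[OF s(1)] a by simp
  then show "q \<in> pt_map Y f ` {p \<in> pt X. p a}" using p by blast
qed

end

lemma local_homeomorphismI:
  assumes f: "continuous_map X Y f" "open_map X Y f"
    and inj: "\<And>x. x \<in> topspace X \<Longrightarrow> \<exists>U. openin X U \<and> x \<in> U \<and> inj_on f U"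
  shows "local_homeomorphism X Y f"
  unfolding local_homeomorphism_def
proof (intro conjI ballI f(1))
  fix x assume "x \<in> topspace X"
  then obtain U where U: "openin X U" "x \<in> U" "inj_on f U" using inj by blast
  have fU: "openin Y (f ` U)" using f(2) U(1) by (auto simp: open_map_def)
  have sub: "U \<subseteq> topspace X" "f ` U \<subseteq> topspace Y" using U(1) fU openin_subset by auto
  have "homeomorphic_map (subtopology X U) (subtopology Y (f ` U)) f"
  proof (rule bijective_open_imp_homeomorphic_map)
    show "continuous_map (subtopology X U) (subtopology Y (f ` U)) f"
      using continuous_map_from_subtopology[OF f(1)] sub by (auto simp: continuous_map_in_subtopology)
    show "open_map (subtopology X U) (subtopology Y (f ` U)) f"
      using f(2) U(1) fU by (auto simp: open_map_def openin_open_subtopology)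
    show "f ` topspace (subtopology X U) = topspace (subtopology Y (f ` U))"
      "inj_on f (topspace (subtopology X U))"
      using sub U(3) by (auto simp: Int_absorb1)
  qed
  then show "\<exists>U. openin X U \<and> x \<in> U \<and> openin Y (f ` U) \<and>
      homeomorphic_map (subtopology X U) (subtopology Y (f ` U)) f"
    using U fU by blast
qed

lemma
  assumes lh: "local_homeomorphism X Y f"
  shows local_homeomorphism_open_map: "open_map X Y f"
    and local_homeomorphism_inj: "x \<in> topspace X \<Longrightarrow> \<exists>U. openin X U \<and> x \<in> U \<and> inj_on f U"
    and local_homeomorphism_continuous: "continuous_map X Y f"
proof -
  show "continuous_map X Y f" using lh by (simp add: local_homeomorphism_def)
  have ex: "\<exists>U. openin X U \<and> x \<in> U \<and> openin Y (f ` U) \<and>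
      homeomorphic_map (subtopology X U) (subtopology Y (f ` U)) f" if "x \<in> topspace X" for x
    using lh that by (auto simp: local_homeomorphism_def)
  show "\<exists>U. openin X U \<and> x \<in> U \<and> inj_on f U" if "x \<in> topspace X"
  proof -
    obtain U where U: "openin X U" "x \<in> U" "homeomorphic_map (subtopology X U) (subtopology Y (f ` U)) f"
      using ex[OF \<open>x \<in> topspace X\<close>] by blast
    have "inj_on f U"
      using homeomorphic_imp_injective_map[OF U(3)] openin_subset[OF U(1)] by (simp add: Int_absorb1)
    then show ?thesis using U by blast
  qed
  show "open_map X Y f"
    unfolding open_map_def
  proof (intro allI impI)
    fix V assume V: "openin X V"
    show "openin Y (f ` V)"
    proof (subst openin_subopen, rule ballI)
      fix y assume "y \<in> f ` V"
      then obtain x where x: "x \<in> V" "y = f x" by blast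
      then have "x \<in> topspace X" using openin_subset[OF V] by blast
      then obtain U where U: "openin X U" "x \<in> U" "openin Y (f ` U)"
        "homeomorphic_map (subtopology X U) (subtopology Y (f ` U)) f"
        using ex by blast
      have "openin (subtopology X U) (V \<inter> U)"
        using V U(1) by (simp add: openin_open_subtopology openin_Int)
      then have "openin (subtopology Y (f ` U)) (f ` (V \<inter> U))"
        using homeomorphic_imp_open_map[OF U(4)] by (simp add: open_map_def)
      then have "openin Y (f ` (V \<inter> U))" using U(3) by (simp add: openin_open_subtopology)
      then show "\<exists>T. openin Y T \<and> y \<in> T \<and> T \<subseteq> f ` V" using x U(2) by blast
    qed
  qed
qed

lemma (in etale_frame_map) local_homeomorphism_pt_map:
  "local_homeomorphism (pt_space X) (pt_space Y) (pt_map Y f)"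
proof (rule local_homeomorphismI)
  note oX = openin_pt_space[OF X.frame_axioms] and oY = openin_pt_space[OF Y.frame_axioms]
  show "continuous_map (pt_space X) (pt_space Y) (pt_map Y f)"
    by (rule continuous_pt_map[OF X.frame_axioms Y.frame_axioms hom])
  show "open_map (pt_space X) (pt_space Y) (pt_map Y f)"
    unfolding open_map_def oX oY
  proof (intro allI impI)
    fix U assume "\<exists>a\<in>carrier X. U = {p \<in> pt X. p a}"
    then obtain a where a: "a \<in> carrier X" "U = {p \<in> pt X. p a}" by blast
    show "\<exists>b\<in>carrier Y. pt_map Y f ` U = {p \<in> pt Y. p b}"
      unfolding a(2) pt_map_image[OF a(1)] using sh_closed[OF a(1)] by blast
  qed
  fix p assume "p \<in> topspace (pt_space X)"
  then have p: "p \<in> pt X" by (simp add: topspace_pt_space[OF X.frame_axioms])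
  obtain s where s: "sect s" "p s"
    using pt_section[OF p X.top_closed pt_top[OF p]] by blast
  have "inj_on (pt_map Y f) {q \<in> pt X. q s}"
    using section_pt_unique[OF s(1)] by (auto simp: inj_on_def)
  then show "\<exists>U. openin (pt_space X) U \<and> p \<in> U \<and> inj_on (pt_map Y f) U"
    using sectionD(1)[OF s(1)] p s(2) unfolding oX by (intro exI[of _ "{q \<in> pt X. q s}"]) blast
qed

section \<open>The quantale of an etale localic category\<close>

abbreviation order1 :: "('a, 'b) loc_cat \<Rightarrow> 'a \<Rightarrow> 'a \<Rightarrow> bool" (infixl \<open>\<sqsubseteq>\<^sub>1\<index>\<close> 50) where
  "x \<sqsubseteq>\<^sub>1\<^bsub>C\<^esub> y \<equiv> x \<sqsubseteq>\<^bsub>L1 C\<^esub> y"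

abbreviation meet1 :: "('a, 'b) loc_cat \<Rightarrow> 'a \<Rightarrow> 'a \<Rightarrow> 'a" (infixl \<open>\<sqinter>\<^sub>1\<index>\<close> 70) where
  "x \<sqinter>\<^sub>1\<^bsub>C\<^esub> y \<equiv> x \<sqinter>\<^bsub>L1 C\<^esub> y"

abbreviation Sup1 :: "('a, 'b) loc_cat \<Rightarrow> 'a set \<Rightarrow> 'a" (\<open>\<Squnion>\<^sub>1\<index>_\<close> [90] 90) where
  "\<Squnion>\<^sub>1\<^bsub>C\<^esub> A \<equiv> \<Squnion>\<^bsub>L1 C\<^esub> A"

abbreviation mult :: "('a, 'b) loc_cat \<Rightarrow> 'a \<Rightarrow> 'a \<Rightarrow> 'a" (infixl \<open>\<star>\<index>\<close> 75) where
  "x \<star>\<^bsub>C\<^esub> y \<equiv> x \<odot>\<^bsub>quantal_of C\<^esub> y"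

text \<open>
  These laws suffice to define the product of \<open>O(C\<^sub>1)\<close> and to express the associative law of \<open>m\<close> as
  an identity for it, so associativity can afterwards be checked in that form.
\<close>

locale unital_localic =
  fixes C :: "('a, 'b) loc_cat" (structure)
  assumes frame1: "frame (L1 C)" and frame0: "frame (L0 C)"
    and etale_d: "etale_loc (L1 C) (L0 C) (ls_d C)"
    and etale_r: "etale_loc (L1 C) (L0 C) (ls_r C)"
    and open_u: "open_loc (L0 C) (L1 C) (ls_u C)"
    and open_m: "open_loc (L2 C) (L1 C) (ls_m C)"
    and u_d: "z \<in> carrier (L0 C) \<Longrightarrow> ls_u C (ls_d C z) = z"
    and u_r: "z \<in> carrier (L0 C) \<Longrightarrow> ls_u C (ls_r C z) = z"
    and m_r: "z \<in> carrier (L0 C) \<Longrightarrow> ls_m C (ls_r C z) = lpr1 C (ls_r C z)"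
    and m_d: "z \<in> carrier (L0 C) \<Longrightarrow> ls_m C (ls_d C z) = lpr2 C (ls_d C z)"
    and m_1_ud: "a \<in> carrier (L1 C) \<Longrightarrow>
      pb_pair (L1 C) (L2 C) (\<lambda>b. b) (\<lambda>b. ls_d C (ls_u C b)) (ls_m C a) = a"
    and m_ur_1: "a \<in> carrier (L1 C) \<Longrightarrow>
      pb_pair (L1 C) (L2 C) (\<lambda>b. ls_r C (ls_u C b)) (\<lambda>b. b) (ls_m C a) = a"
begin

sublocale F1: frame "L1 C" by (rule frame1)
sublocale F0: frame "L0 C" by (rule frame0)

sublocale d: etale_frame_map "L1 C" "L0 C" "ls_d C"
  using etale_d by unfold_locales (auto simp: etale_loc_def)

sublocale r: etale_frame_map "L1 C" "L0 C" "ls_r C"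
  using etale_r by unfold_locales (auto simp: etale_loc_def)

sublocale u: open_frame_map "L0 C" "L1 C" "ls_u C"
  using open_u by unfold_locales

sublocale P2: pullback "L1 C" "L1 C" "L0 C" "ls_d C" "ls_r C"
  by unfold_locales auto

lemma L2_eq: "L2 C = P2.P" and lpr1_eq: "lpr1 C = P2.pr1" and lpr2_eq: "lpr2 C = P2.pr2"
  by (simp_all add: L2_def lpr1_def lpr2_def)

lemma carrier_L2 [simp]: "carrier (L2 C) = {I. P2.ideal I}" and le_L2 [simp]: "le (L2 C) = (\<subseteq>)"
  by (simp_all add: L2_eq)

sublocale m: open_frame_map "L2 C" "L1 C" "ls_m C"
proof -
  interpret F2: frame "L2 C" unfolding L2_eq by (rule P2.PF.frame_axioms)
  show "open_frame_map (L2 C) (L1 C) (ls_m C)" by unfold_locales (rule open_m)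
qed

lemma m_ideal: "a \<in> carrier (L1 C) \<Longrightarrow> P2.ideal (ls_m C a)"
  using m.f_closed by simp

lemma mult_eq:
  "\<lbrakk>a \<in> carrier (L1 C); b \<in> carrier (L1 C)\<rbrakk> \<Longrightarrow> a \<star> b = m.sh (P2.tens a b)"
  unfolding quantal_of_def lpr1_eq lpr2_eq L2_eq by (simp add: P2.pr_meet)

lemma mult_closed [simp]:
  "\<lbrakk>a \<in> carrier (L1 C); b \<in> carrier (L1 C)\<rbrakk> \<Longrightarrow> a \<star> b \<in> carrier (L1 C)"
  by (simp add: mult_eq P2.ideal_tens)

text \<open>
  The adjunction between \<open>m\<^sub>!\<close> and \<open>m\<^sup>*\<close>, evaluated on generators. It turns the closure
  conditions on the ideal \<open>m\<^sup>*(c)\<close> into rules for products.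
\<close>

lemma mult_le_iff:
  "\<lbrakk>a \<in> carrier (L1 C); b \<in> carrier (L1 C); c \<in> carrier (L1 C)\<rbrakk>
    \<Longrightarrow> a \<star> b \<sqsubseteq>\<^sub>1 c \<longleftrightarrow> (a, b) \<in> ls_m C c"
  using m.sh_le_iff[of "P2.tens a b" c] P2.tens_le_iff[OF m_ideal, of c a b]
  by (simp add: mult_eq P2.ideal_tens)

lemma in_m_mult: "\<lbrakk>a \<in> carrier (L1 C); b \<in> carrier (L1 C)\<rbrakk> \<Longrightarrow> (a, b) \<in> ls_m C (a \<star> b)"
  using mult_le_iff[of a b "a \<star> b"] by simp

lemma mult_mono:
  assumes c: "a \<in> carrier (L1 C)" "b \<in> carrier (L1 C)" "a' \<in> carrier (L1 C)" "b' \<in> carrier (L1 C)"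
    and "a' \<sqsubseteq>\<^sub>1 a" "b' \<sqsubseteq>\<^sub>1 b"
  shows "a' \<star> b' \<sqsubseteq>\<^sub>1 a \<star> b"
  using P2.idealD(3)[OF m_ideal in_m_mult[OF c(1,2)], of a' b'] assms by (simp add: mult_le_iff)

lemma Sup_mult:
  assumes A: "A \<subseteq> carrier (L1 C)" and b: "b \<in> carrier (L1 C)"
  shows "\<Squnion>\<^sub>1A \<star> b = \<Squnion>\<^sub>1((\<lambda>a. a \<star> b) ` A)"
proof (rule F1.eq_by_upper)
  have c: "(\<lambda>a. a \<star> b) ` A \<subseteq> carrier (L1 C)" using A b by auto
  show "\<Squnion>\<^sub>1A \<star> b \<in> carrier (L1 C)" "\<Squnion>\<^sub>1((\<lambda>a. a \<star> b) ` A) \<in> carrier (L1 C)" using A b c by auto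
  fix x assume x: "x \<in> carrier (L1 C)"
  have "\<Squnion>\<^sub>1A \<star> b \<sqsubseteq>\<^sub>1 x \<longleftrightarrow> (\<forall>a\<in>A. (a, b) \<in> ls_m C x)"
    using P2.ideal_Sup_left_iff[OF m_ideal[OF x] A b] A b x by (simp add: mult_le_iff)
  also have "\<dots> \<longleftrightarrow> (\<forall>a\<in>A. a \<star> b \<sqsubseteq>\<^sub>1 x)"
    by (rule ball_cong[OF refl], subst mult_le_iff) (use A b x in auto)
  also have "\<dots> \<longleftrightarrow> \<Squnion>\<^sub>1((\<lambda>a. a \<star> b) ` A) \<sqsubseteq>\<^sub>1 x" using F1.Sup_le_iff[OF c x] by simp
  finally show "\<Squnion>\<^sub>1A \<star> b \<sqsubseteq>\<^sub>1 x \<longleftrightarrow> \<Squnion>\<^sub>1((\<lambda>a. a \<star> b) ` A) \<sqsubseteq>\<^sub>1 x" .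
qed

lemma mult_Sup:
  assumes B: "B \<subseteq> carrier (L1 C)" and a: "a \<in> carrier (L1 C)"
  shows "a \<star> \<Squnion>\<^sub>1B = \<Squnion>\<^sub>1((\<lambda>b. a \<star> b) ` B)"
proof (rule F1.eq_by_upper)
  have c: "(\<lambda>b. a \<star> b) ` B \<subseteq> carrier (L1 C)" using B a by auto
  show "a \<star> \<Squnion>\<^sub>1B \<in> carrier (L1 C)" "\<Squnion>\<^sub>1((\<lambda>b. a \<star> b) ` B) \<in> carrier (L1 C)" using B a c by auto
  fix x assume x: "x \<in> carrier (L1 C)"
  have "a \<star> \<Squnion>\<^sub>1B \<sqsubseteq>\<^sub>1 x \<longleftrightarrow> (\<forall>b\<in>B. (a, b) \<in> ls_m C x)"
    using P2.ideal_Sup_right_iff[OF m_ideal[OF x] a B] B a x by (simp add: mult_le_iff)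
  also have "\<dots> \<longleftrightarrow> (\<forall>b\<in>B. a \<star> b \<sqsubseteq>\<^sub>1 x)"
    by (rule ball_cong[OF refl], subst mult_le_iff) (use B a x in auto)
  also have "\<dots> \<longleftrightarrow> \<Squnion>\<^sub>1((\<lambda>b. a \<star> b) ` B) \<sqsubseteq>\<^sub>1 x" using F1.Sup_le_iff[OF c x] by simp
  finally show "a \<star> \<Squnion>\<^sub>1B \<sqsubseteq>\<^sub>1 x \<longleftrightarrow> \<Squnion>\<^sub>1((\<lambda>b. a \<star> b) ` B) \<sqsubseteq>\<^sub>1 x" .
qed

lemma mult_balance:
  assumes "a \<in> carrier (L1 C)" "b \<in> carrier (L1 C)" "z \<in> carrier (L0 C)"
  shows "(a \<sqinter>\<^sub>1 ls_d C z) \<star> b = a \<star> (b \<sqinter>\<^sub>1 ls_r C z)"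
  by (rule F1.eq_by_upper) (use assms P2.idealD(6)[OF m_ideal] in \<open>simp_all add: mult_le_iff\<close>)

text \<open>
  Frobenius reciprocity for \<open>m\<close>, combined with \<open>rm = r\<pi>\<^sub>1\<close> here and with \<open>dm = d\<pi>\<^sub>2\<close> in the
  next lemma.
\<close>

lemma mult_meet_r:
  assumes "a \<in> carrier (L1 C)" "b \<in> carrier (L1 C)" "z \<in> carrier (L0 C)"
  shows "(a \<sqinter>\<^sub>1 ls_r C z) \<star> b = (a \<star> b) \<sqinter>\<^sub>1 ls_r C z"
proof -
  have "P2.tens (a \<sqinter>\<^sub>1 ls_r C z) b = P2.tens a b \<sqinter>\<^bsub>L2 C\<^esub> ls_m C (ls_r C z)"
    using assms P2.tens_Int[of a b "ls_r C z" "\<top>\<^bsub>L1 C\<^esub>"]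
    by (simp add: m_r lpr1_eq L2_eq P2.meet_P P2.pr1_eq P2.ideal_tens)
  then show ?thesis using assms by (simp add: mult_eq m.frobenius P2.ideal_tens)
qed

lemma mult_meet_d:
  assumes "a \<in> carrier (L1 C)" "b \<in> carrier (L1 C)" "z \<in> carrier (L0 C)"
  shows "a \<star> (b \<sqinter>\<^sub>1 ls_d C z) = (a \<star> b) \<sqinter>\<^sub>1 ls_d C z"
proof -
  have "P2.tens a (b \<sqinter>\<^sub>1 ls_d C z) = P2.tens a b \<sqinter>\<^bsub>L2 C\<^esub> ls_m C (ls_d C z)"
    using assms P2.tens_Int[of a b "\<top>\<^bsub>L1 C\<^esub>" "ls_d C z"]
    by (simp add: m_d lpr2_eq L2_eq P2.meet_P P2.pr2_eq P2.ideal_tens)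
  then show ?thesis using assms by (simp add: mult_eq m.frobenius P2.ideal_tens)
qed

lemma m_sh_eq:
  assumes I: "P2.ideal I"
  shows "m.sh I = \<Squnion>\<^sub>1((\<lambda>(a, b). a \<star> b) ` I)"
proof -
  have c: "(\<lambda>(a, b). P2.tens a b) ` I \<subseteq> carrier (L2 C)"
    using P2.ideal_sub[OF I] by (auto simp: P2.ideal_tens)
  have "m.sh I = m.sh (\<Squnion>\<^bsub>L2 C\<^esub>((\<lambda>(a, b). P2.tens a b) ` I))"
    using P2.ideal_as_Sup[OF I] by (simp add: L2_eq)
  also have "\<dots> = \<Squnion>\<^sub>1(m.sh ` (\<lambda>(a, b). P2.tens a b) ` I)" by (rule m.sh_Sup[OF c])
  also have "m.sh ` (\<lambda>(a, b). P2.tens a b) ` I = (\<lambda>(a, b). a \<star> b) ` I"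
    unfolding image_image by (rule image_cong[OF refl]) (use P2.ideal_sub[OF I] in \<open>auto simp: mult_eq\<close>)
  finally show ?thesis .
qed

text \<open>
  By Frobenius reciprocity \<open>c = ab \<and> c\<close> is the direct image under \<open>m\<close> of
  \<open>(a \<otimes> b) \<and> m\<^sup>*(c)\<close>, and every ideal is the join of its generators.
\<close>

lemma below_mult:
  assumes a: "a \<in> carrier (L1 C)" and b: "b \<in> carrier (L1 C)" and c: "c \<in> carrier (L1 C)"
    and le: "c \<sqsubseteq>\<^sub>1 a \<star> b"
  shows "c = \<Squnion>\<^sub>1((\<lambda>(x, y). x \<star> y) `
    {(x, y). x \<in> carrier (L1 C) \<and> y \<in> carrier (L1 C) \<and> x \<sqsubseteq>\<^sub>1 a \<and> y \<sqsubseteq>\<^sub>1 b \<and> x \<star> y \<sqsubseteq>\<^sub>1 c})"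
    (is "_ = \<Squnion>\<^sub>1(_ ` ?S)")
proof (rule F1.le_antisym)
  let ?I = "P2.tens a b \<inter> ls_m C c"
  have I: "P2.ideal ?I" using P2.ideal_Int[OF P2.ideal_tens[OF a b] m_ideal[OF c]] .
  have S: "(\<lambda>(x, y). x \<star> y) ` ?S \<subseteq> carrier (L1 C)" by auto
  have "c = (a \<star> b) \<sqinter>\<^sub>1 c" using F1.meet_absorb2[OF le] a b c by simp
  also have "\<dots> = m.sh (P2.tens a b \<sqinter>\<^bsub>L2 C\<^esub> ls_m C c)"
    using a b c by (simp add: mult_eq m.frobenius P2.ideal_tens)
  also have "\<dots> = m.sh ?I" using a b c by (simp add: L2_eq P2.meet_P P2.ideal_tens m_ideal)
  also have "\<dots> = \<Squnion>\<^sub>1((\<lambda>(x, y). x \<star> y) ` ?I)" by (rule m_sh_eq[OF I])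
  also have "\<dots> \<sqsubseteq>\<^sub>1 \<Squnion>\<^sub>1((\<lambda>(x, y). x \<star> y) ` ?S)"
  proof (rule F1.sup_least)
    show "(\<lambda>(x, y). x \<star> y) ` ?I \<subseteq> carrier (L1 C)" using P2.ideal_sub[OF I] by auto
    show "\<Squnion>\<^sub>1((\<lambda>(x, y). x \<star> y) ` ?S) \<in> carrier (L1 C)" using S by simp
    fix w assume "w \<in> (\<lambda>(x, y). x \<star> y) ` ?I"
    then obtain x y where xy: "(x, y) \<in> P2.tens a b" "(x, y) \<in> ls_m C c" "w = x \<star> y" by auto
    note xc = P2.idealD(1,2)[OF m_ideal[OF c] xy(2)]
    have "P2.tens x y = P2.tens x y \<inter> P2.tens a b"
      using xy(1) P2.tens_le_iff[OF P2.ideal_tens[OF a b]] by auto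
    also have "\<dots> = P2.tens (x \<sqinter>\<^sub>1 a) (y \<sqinter>\<^sub>1 b)" using xc a b by (rule P2.tens_Int)
    finally have w: "w = (x \<sqinter>\<^sub>1 a) \<star> (y \<sqinter>\<^sub>1 b)" using xy(3) xc a b by (simp add: mult_eq)
    moreover have "w \<sqsubseteq>\<^sub>1 c" using xy(2,3) xc c by (simp add: mult_le_iff)
    ultimately have "w \<in> (\<lambda>(x, y). x \<star> y) ` ?S"
      using xc a b by (intro image_eqI[of _ _ "(x \<sqinter>\<^sub>1 a, y \<sqinter>\<^sub>1 b)"]) (auto simp: F1.meet_right)
    then show "w \<sqsubseteq>\<^sub>1 \<Squnion>\<^sub>1((\<lambda>(x, y). x \<star> y) ` ?S)" using F1.sup_upper[OF S] by simp
  qed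
  finally show "c \<sqsubseteq>\<^sub>1 \<Squnion>\<^sub>1((\<lambda>(x, y). x \<star> y) ` ?S)" .
  show "\<Squnion>\<^sub>1((\<lambda>(x, y). x \<star> y) ` ?S) \<sqsubseteq>\<^sub>1 c"
    using S c by (subst F1.Sup_le_iff) auto
  show "\<Squnion>\<^sub>1((\<lambda>(x, y). x \<star> y) ` ?S) \<in> carrier (L1 C)" using S by simp
qed (rule c)

text \<open>
  The next two identities say that the projections of the pullback are open with the expected
  direct images, i.e. they are the Beck--Chevalley condition for the pullback square.
\<close>

lemma d_sh_mult:
  assumes a: "a \<in> carrier (L1 C)" and b: "b \<in> carrier (L1 C)"
  shows "d.sh (a \<star> b) = d.sh (b \<sqinter>\<^sub>1 ls_r C (d.sh a))"
proof (rule F0.eq_by_upper)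
  fix z assume z: "z \<in> carrier (L0 C)"
  let ?w = "ls_d C z"
  have w: "?w \<in> carrier (L1 C)" using z by simp
  \<comment> \<open>It will turn out that this is \<open>\<pi>\<^sub>2\<^sup>*(w)\<close>.\<close>
  let ?K = "{(x, y). x \<in> carrier (L1 C) \<and> y \<in> carrier (L1 C) \<and> y \<sqinter>\<^sub>1 ls_r C (d.sh x) \<sqsubseteq>\<^sub>1 ?w}"
  have K: "P2.ideal ?K"
  proof (rule P2.idealI)
    show "?K \<subseteq> carrier (L1 C) \<times> carrier (L1 C)" by auto
    show "(x', y') \<in> ?K" if xy: "(x, y) \<in> ?K" and x': "x' \<in> carrier (L1 C)" "y' \<in> carrier (L1 C)"
      and le: "x' \<sqsubseteq>\<^sub>1 x" "y' \<sqsubseteq>\<^sub>1 y" for x y x' y'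
    proof -
      have c: "x \<in> carrier (L1 C)" "y \<in> carrier (L1 C)" using xy by auto
      have "ls_r C (d.sh x') \<sqsubseteq>\<^sub>1 ls_r C (d.sh x)"
        using c x' le by (simp add: r.f_mono d.sh_mono)
      then have "y' \<sqinter>\<^sub>1 ls_r C (d.sh x') \<sqsubseteq>\<^sub>1 y \<sqinter>\<^sub>1 ls_r C (d.sh x)"
        using c x' le by (simp add: F1.meet_mono)
      then show ?thesis using xy x' c w F1.le_trans[of "y' \<sqinter>\<^sub>1 ls_r C (d.sh x')" "y \<sqinter>\<^sub>1 ls_r C (d.sh x)" ?w] by simp
    qed
    show "(\<Squnion>\<^sub>1A, y) \<in> ?K" if A: "A \<subseteq> carrier (L1 C)" and y: "y \<in> carrier (L1 C)"
      and *: "\<And>x. x \<in> A \<Longrightarrow> (x, y) \<in> ?K" for A y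
    proof -
      have A1: "d.sh ` A \<subseteq> carrier (L0 C)" and A2: "ls_r C ` d.sh ` A \<subseteq> carrier (L1 C)"
        and A3: "(\<lambda>a. y \<sqinter>\<^sub>1 a) ` ls_r C ` d.sh ` A \<subseteq> carrier (L1 C)" using A y by auto
      have "y \<sqinter>\<^sub>1 ls_r C (d.sh (\<Squnion>\<^sub>1A)) = \<Squnion>\<^sub>1((\<lambda>a. y \<sqinter>\<^sub>1 a) ` ls_r C ` d.sh ` A)"
        using d.sh_Sup[OF A] r.f_Sup[OF A1] F1.meet_Sup_distrib[OF y A2] by simp
      then show ?thesis using F1.Sup_le_iff[OF A3 w] A y * by auto
    qed
    show "(x, \<Squnion>\<^sub>1B) \<in> ?K" if x: "x \<in> carrier (L1 C)" and B: "B \<subseteq> carrier (L1 C)"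
      and *: "\<And>y. y \<in> B \<Longrightarrow> (x, y) \<in> ?K" for x B
    proof -
      have B1: "(\<lambda>y. y \<sqinter>\<^sub>1 ls_r C (d.sh x)) ` B \<subseteq> carrier (L1 C)" using B x by auto
      show ?thesis using F1.Sup_meet_distrib[OF _ B] F1.Sup_le_iff[OF B1 w] B x * by auto
    qed
    show "(x \<sqinter>\<^sub>1 ls_d C v, y) \<in> ?K \<longleftrightarrow> (x, y \<sqinter>\<^sub>1 ls_r C v) \<in> ?K"
      if "x \<in> carrier (L1 C)" "y \<in> carrier (L1 C)" "v \<in> carrier (L0 C)" for x y v
      using that by (simp add: d.frobenius r.f_meet F1.meet_ac)
  qed
  let ?b = "b \<sqinter>\<^sub>1 ls_r C (d.sh a)"
  have "d.sh (a \<star> b) \<sqsubseteq>\<^bsub>L0 C\<^esub> z \<longleftrightarrow> (a, b) \<in> P2.pr2 ?w"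
    using a b z by (simp add: d.sh_le_iff mult_le_iff m_d lpr2_eq)
  also have "\<dots> \<longleftrightarrow> ?b \<sqsubseteq>\<^sub>1 ?w"
  proof
    assume "(a, b) \<in> P2.pr2 ?w"
    moreover have "P2.pr2 ?w \<subseteq> ?K"
      using w F1.meet_left[OF w] by (subst P2.pr2_le_iff[OF K]) auto
    ultimately show "?b \<sqsubseteq>\<^sub>1 ?w" by auto
  next
    assume le: "?b \<sqsubseteq>\<^sub>1 ?w"
    have i: "P2.ideal (P2.pr2 ?w)" using w by simp
    have "(\<top>\<^bsub>L1 C\<^esub>, ?w) \<in> P2.pr2 ?w" using w P2.in_tens by (simp add: P2.pr2_eq)
    then have "(a, ?b) \<in> P2.pr2 ?w" using P2.idealD(3)[OF i _ _ _ _ le] a b by simp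
    then show "(a, b) \<in> P2.pr2 ?w"
      using P2.idealD(6)[OF i a b, of "d.sh a"] F1.meet_absorb[OF d.le_f_sh[OF a]] a by simp
  qed
  also have "\<dots> \<longleftrightarrow> d.sh ?b \<sqsubseteq>\<^bsub>L0 C\<^esub> z" using a b z by (simp add: d.sh_le_iff)
  finally show "d.sh (a \<star> b) \<sqsubseteq>\<^bsub>L0 C\<^esub> z \<longleftrightarrow> d.sh ?b \<sqsubseteq>\<^bsub>L0 C\<^esub> z" .
qed (use a b in auto)

lemma r_sh_mult:
  assumes a: "a \<in> carrier (L1 C)" and b: "b \<in> carrier (L1 C)"
  shows "r.sh (a \<star> b) = r.sh (a \<sqinter>\<^sub>1 ls_d C (r.sh b))"
proof (rule F0.eq_by_upper)
  fix z assume z: "z \<in> carrier (L0 C)"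
  let ?w = "ls_r C z"
  have w: "?w \<in> carrier (L1 C)" using z by simp
  \<comment> \<open>It will turn out that this is \<open>\<pi>\<^sub>1\<^sup>*(w)\<close>.\<close>
  let ?K = "{(y, x). y \<in> carrier (L1 C) \<and> x \<in> carrier (L1 C) \<and> y \<sqinter>\<^sub>1 ls_d C (r.sh x) \<sqsubseteq>\<^sub>1 ?w}"
  have K: "P2.ideal ?K"
  proof (rule P2.idealI)
    show "?K \<subseteq> carrier (L1 C) \<times> carrier (L1 C)" by auto
    show "(y', x') \<in> ?K" if xy: "(y, x) \<in> ?K" and x': "y' \<in> carrier (L1 C)" "x' \<in> carrier (L1 C)"
      and le: "y' \<sqsubseteq>\<^sub>1 y" "x' \<sqsubseteq>\<^sub>1 x" for x y x' y'
    proof -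
      have c: "x \<in> carrier (L1 C)" "y \<in> carrier (L1 C)" using xy by auto
      have "ls_d C (r.sh x') \<sqsubseteq>\<^sub>1 ls_d C (r.sh x)"
        using c x' le by (simp add: d.f_mono r.sh_mono)
      then have "y' \<sqinter>\<^sub>1 ls_d C (r.sh x') \<sqsubseteq>\<^sub>1 y \<sqinter>\<^sub>1 ls_d C (r.sh x)"
        using c x' le by (simp add: F1.meet_mono)
      then show ?thesis using xy x' c w F1.le_trans[of "y' \<sqinter>\<^sub>1 ls_d C (r.sh x')" "y \<sqinter>\<^sub>1 ls_d C (r.sh x)" ?w] by simp
    qed
    show "(y, \<Squnion>\<^sub>1A) \<in> ?K" if y: "y \<in> carrier (L1 C)" and A: "A \<subseteq> carrier (L1 C)"
      and *: "\<And>x. x \<in> A \<Longrightarrow> (y, x) \<in> ?K" for A y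
    proof -
      have A1: "r.sh ` A \<subseteq> carrier (L0 C)" and A2: "ls_d C ` r.sh ` A \<subseteq> carrier (L1 C)"
        and A3: "(\<lambda>a. y \<sqinter>\<^sub>1 a) ` ls_d C ` r.sh ` A \<subseteq> carrier (L1 C)" using A y by auto
      have "y \<sqinter>\<^sub>1 ls_d C (r.sh (\<Squnion>\<^sub>1A)) = \<Squnion>\<^sub>1((\<lambda>a. y \<sqinter>\<^sub>1 a) ` ls_d C ` r.sh ` A)"
        using r.sh_Sup[OF A] d.f_Sup[OF A1] F1.meet_Sup_distrib[OF y A2] by simp
      then show ?thesis using F1.Sup_le_iff[OF A3 w] A y * by auto
    qed
    show "(\<Squnion>\<^sub>1B, x) \<in> ?K" if B: "B \<subseteq> carrier (L1 C)" and x: "x \<in> carrier (L1 C)"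
      and *: "\<And>y. y \<in> B \<Longrightarrow> (y, x) \<in> ?K" for x B
    proof -
      have B1: "(\<lambda>y. y \<sqinter>\<^sub>1 ls_d C (r.sh x)) ` B \<subseteq> carrier (L1 C)" using B x by auto
      show ?thesis using F1.Sup_meet_distrib[OF _ B] F1.Sup_le_iff[OF B1 w] B x * by auto
    qed
    show "(y \<sqinter>\<^sub>1 ls_d C v, x) \<in> ?K \<longleftrightarrow> (y, x \<sqinter>\<^sub>1 ls_r C v) \<in> ?K"
      if "y \<in> carrier (L1 C)" "x \<in> carrier (L1 C)" "v \<in> carrier (L0 C)" for x y v
      using that by (simp add: r.frobenius d.f_meet F1.meet_ac)
  qed
  let ?a = "a \<sqinter>\<^sub>1 ls_d C (r.sh b)"
  have "r.sh (a \<star> b) \<sqsubseteq>\<^bsub>L0 C\<^esub> z \<longleftrightarrow> (a, b) \<in> P2.pr1 ?w"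
    using a b z by (simp add: r.sh_le_iff mult_le_iff m_r lpr1_eq)
  also have "\<dots> \<longleftrightarrow> ?a \<sqsubseteq>\<^sub>1 ?w"
  proof
    assume "(a, b) \<in> P2.pr1 ?w"
    moreover have "P2.pr1 ?w \<subseteq> ?K"
      using w F1.meet_left[OF w] by (subst P2.pr1_le_iff[OF K]) auto
    ultimately show "?a \<sqsubseteq>\<^sub>1 ?w" by auto
  next
    assume le: "?a \<sqsubseteq>\<^sub>1 ?w"
    have i: "P2.ideal (P2.pr1 ?w)" using w by simp
    have "(?w, \<top>\<^bsub>L1 C\<^esub>) \<in> P2.pr1 ?w" using w P2.in_tens by (simp add: P2.pr1_eq)
    then have "(?a, b) \<in> P2.pr1 ?w" using P2.idealD(3)[OF i _ _ _ le] a b by simp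
    then show "(a, b) \<in> P2.pr1 ?w"
      using P2.idealD(6)[OF i a b, of "r.sh b"] F1.meet_absorb[OF r.le_f_sh[OF b]] b by simp
  qed
  also have "\<dots> \<longleftrightarrow> r.sh ?a \<sqsubseteq>\<^bsub>L0 C\<^esub> z" using a b z by (simp add: r.sh_le_iff)
  finally show "r.sh (a \<star> b) \<sqsubseteq>\<^bsub>L0 C\<^esub> z \<longleftrightarrow> r.sh ?a \<sqsubseteq>\<^bsub>L0 C\<^esub> z" .
qed (use a b in auto)

subsection \<open>Units\<close>

abbreviation E where "E \<equiv> u.sh \<top>\<^bsub>L0 C\<^esub>"

lemma qunit_eq: "\<e>\<^bsub>quantal_of C\<^esub> = E"
  by (simp add: quantal_of_def)

lemma u_sh_u: "a \<in> carrier (L1 C) \<Longrightarrow> u.sh (ls_u C a) = a \<sqinter>\<^sub>1 E"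
  using u.frobenius'[of "\<top>\<^bsub>L0 C\<^esub>" a] by simp

lemma u_E [simp]: "ls_u C E = \<top>\<^bsub>L0 C\<^esub>"
  using u.le_f_sh[of "\<top>\<^bsub>L0 C\<^esub>"] F0.top_higher[of "ls_u C E"] by (intro F0.le_antisym) simp_all

lemma u_sh_d: "z \<in> carrier (L0 C) \<Longrightarrow> u.sh z = E \<sqinter>\<^sub>1 ls_d C z"
  using u_sh_u[of "ls_d C z"] by (simp add: u_d meet_comm)

lemma u_sh_r: "z \<in> carrier (L0 C) \<Longrightarrow> u.sh z = E \<sqinter>\<^sub>1 ls_r C z"
  using u_sh_u[of "ls_r C z"] by (simp add: u_r meet_comm)

lemma u_u_sh [simp]: "z \<in> carrier (L0 C) \<Longrightarrow> ls_u C (u.sh z) = z"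
  using arg_cong[OF u_sh_d[of z], of "ls_u C"] by (simp add: u.f_meet u_d)

lemma u_sh_le_E: "z \<in> carrier (L0 C) \<Longrightarrow> u.sh z \<sqsubseteq>\<^sub>1 E"
  by (rule u.sh_mono) simp_all

lemma below_E: "\<lbrakk>a \<in> carrier (L1 C); a \<sqsubseteq>\<^sub>1 E\<rbrakk> \<Longrightarrow> u.sh (ls_u C a) = a"
  by (simp add: u_sh_u F1.meet_absorb)

lemma d_sh_u_sh [simp]: "z \<in> carrier (L0 C) \<Longrightarrow> d.sh (u.sh z) = z"
  by (rule F0.eq_by_upper) (simp_all add: d.sh_le_iff u.sh_le_iff u_d)

lemma r_sh_u_sh [simp]: "z \<in> carrier (L0 C) \<Longrightarrow> r.sh (u.sh z) = z"
  by (rule F0.eq_by_upper) (simp_all add: r.sh_le_iff u.sh_le_iff u_r)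

text \<open>
  The unit law writes \<open>a\<close> as the join of all \<open>x \<and> d\<^sup>*(u\<^sup>*(y))\<close> with \<open>xy \<le> a\<close>. Multiplying
  such an element by \<open>e\<close> gives \<open>x(e \<and> r\<^sup>*(u\<^sup>*(y))) = x(e \<and> y)\<close>, which is below \<open>a\<close> again.
\<close>

lemma mult_E:
  assumes a: "a \<in> carrier (L1 C)"
  shows "a \<star> E = a"
proof -
  let ?h = "\<lambda>(x, y). x \<sqinter>\<^sub>1 ls_d C (ls_u C y)"
  have rep: "\<Squnion>\<^sub>1(?h ` ls_m C x) = x" if x: "x \<in> carrier (L1 C)" for x
    using m_1_ud[OF x] x m_ideal by (simp add: pb_pair_def)
  have sub: "?h ` ls_m C x \<subseteq> carrier (L1 C)" if "x \<in> carrier (L1 C)" for x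
    using P2.ideal_sub[OF m_ideal[OF that]] by auto
  show ?thesis
  proof (rule F1.le_antisym)
    have "(a, E) \<in> ls_m C (a \<star> E)" using a by (intro in_m_mult) simp_all
    then have "a \<in> ?h ` ls_m C (a \<star> E)" using a by (intro image_eqI[of _ _ "(a, E)"]) simp_all
    then have "a \<sqsubseteq>\<^sub>1 \<Squnion>\<^sub>1(?h ` ls_m C (a \<star> E))" using a by (intro F1.sup_upper[OF sub]) simp_all
    then show "a \<sqsubseteq>\<^sub>1 a \<star> E" using a rep[of "a \<star> E"] by simp
    have "(\<Squnion>\<^sub>1(?h ` ls_m C a), E) \<in> ls_m C a"
    proof (rule P2.idealD(4)[OF m_ideal[OF a] sub[OF a]])
      fix w assume "w \<in> ?h ` ls_m C a"
      then obtain x y where xy: "(x, y) \<in> ls_m C a" "w = x \<sqinter>\<^sub>1 ls_d C (ls_u C y)" by auto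
      note c = P2.idealD(1,2)[OF m_ideal[OF a] xy(1)]
      have "E \<sqinter>\<^sub>1 ls_r C (ls_u C y) = y \<sqinter>\<^sub>1 E"
        using c u_sh_r[of "ls_u C y"] by (simp add: u_sh_u)
      then have "(x, E \<sqinter>\<^sub>1 ls_r C (ls_u C y)) \<in> ls_m C a"
        using P2.idealD(3)[OF m_ideal[OF a] xy(1), of x "y \<sqinter>\<^sub>1 E"] c by (simp add: F1.meet_left)
      then show "(w, E) \<in> ls_m C a"
        using P2.idealD(6)[OF m_ideal[OF a] c(1), of E "ls_u C y"] c xy(2) by simp
    qed simp
    then show "a \<star> E \<sqsubseteq>\<^sub>1 a" using rep[OF a] a by (simp add: mult_le_iff)
  qed (use a in auto)
qed

lemma E_mult:
  assumes a: "a \<in> carrier (L1 C)"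
  shows "E \<star> a = a"
proof -
  let ?h = "\<lambda>(x, y). ls_r C (ls_u C x) \<sqinter>\<^sub>1 y"
  have rep: "\<Squnion>\<^sub>1(?h ` ls_m C x) = x" if x: "x \<in> carrier (L1 C)" for x
    using m_ur_1[OF x] x m_ideal by (simp add: pb_pair_def)
  have sub: "?h ` ls_m C x \<subseteq> carrier (L1 C)" if "x \<in> carrier (L1 C)" for x
    using P2.ideal_sub[OF m_ideal[OF that]] by auto
  show ?thesis
  proof (rule F1.le_antisym)
    have "(E, a) \<in> ls_m C (E \<star> a)" using a by (intro in_m_mult) simp_all
    then have "a \<in> ?h ` ls_m C (E \<star> a)" using a by (intro image_eqI[of _ _ "(E, a)"]) simp_all
    then have "a \<sqsubseteq>\<^sub>1 \<Squnion>\<^sub>1(?h ` ls_m C (E \<star> a))" using a by (intro F1.sup_upper[OF sub]) simp_all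
    then show "a \<sqsubseteq>\<^sub>1 E \<star> a" using a rep[of "E \<star> a"] by simp
    have "(E, \<Squnion>\<^sub>1(?h ` ls_m C a)) \<in> ls_m C a"
    proof (rule P2.idealD(5)[OF m_ideal[OF a] _ sub[OF a]])
      fix w assume "w \<in> ?h ` ls_m C a"
      then obtain x y where xy: "(x, y) \<in> ls_m C a" "w = ls_r C (ls_u C x) \<sqinter>\<^sub>1 y" by auto
      note c = P2.idealD(1,2)[OF m_ideal[OF a] xy(1)]
      have "E \<sqinter>\<^sub>1 ls_d C (ls_u C x) = x \<sqinter>\<^sub>1 E"
        using c u_sh_d[of "ls_u C x"] by (simp add: u_sh_u)
      then have "(E \<sqinter>\<^sub>1 ls_d C (ls_u C x), y) \<in> ls_m C a"
        using P2.idealD(3)[OF m_ideal[OF a] xy(1), of "x \<sqinter>\<^sub>1 E" y] c by (simp add: F1.meet_left)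
      then show "(E, w) \<in> ls_m C a"
        using P2.idealD(6)[OF m_ideal[OF a] _ c(2), of E "ls_u C x"] c xy(2)
        by (simp add: meet_comm[of "L1 C" y])
    qed simp
    then show "E \<star> a \<sqsubseteq>\<^sub>1 a" using rep[OF a] a by (simp add: mult_le_iff)
  qed (use a in auto)
qed

lemma mult_u_sh: "\<lbrakk>a \<in> carrier (L1 C); z \<in> carrier (L0 C)\<rbrakk> \<Longrightarrow> a \<star> u.sh z = a \<sqinter>\<^sub>1 ls_d C z"
  using mult_balance[of a E z] mult_E[of "a \<sqinter>\<^sub>1 ls_d C z"] u_sh_r[of z] by simp

lemma u_sh_mult: "\<lbrakk>a \<in> carrier (L1 C); z \<in> carrier (L0 C)\<rbrakk> \<Longrightarrow> u.sh z \<star> a = a \<sqinter>\<^sub>1 ls_r C z"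
  using mult_balance[of E a z] E_mult[of "a \<sqinter>\<^sub>1 ls_r C z"] u_sh_d[of z] by simp

end

subsection \<open>Associativity\<close>

text \<open>
  The associative law for \<open>m\<close> equates two ideals on \<open>O(C\<^sub>1 \<times> C\<^sub>1) \<times> O(C\<^sub>1)\<close>. Openness of \<open>m\<close>
  makes both of them explicit, and the law becomes associativity of the product of \<open>O(C\<^sub>1)\<close>.
\<close>

context unital_localic
begin

lemma lpr2_d: "z \<in> carrier (L0 C) \<Longrightarrow> lpr2 C (ls_d C z) = ls_m C (ls_d C z)"
  by (simp add: m_d)

sublocale P3: pullback "L2 C" "L1 C" "L0 C" "\<lambda>x. lpr2 C (ls_d C x)" "ls_r C"
  by unfold_locales (auto simp: lpr2_eq)

lemma L3_eq: "L3 C = P3.P" and lpr12_eq: "lpr12 C = P3.pr1" and lpr3_eq: "lpr3 C = P3.pr2"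
  by (simp_all add: L3_def lpr12_def lpr3_def)

abbreviation assoc_left where
  "assoc_left x \<equiv> pb_pair (L3 C) (L2 C) (\<lambda>b. lpr12 C (ls_m C b)) (lpr3 C) (ls_m C x)"

abbreviation assoc_right where
  "assoc_right x \<equiv> pb_pair (L3 C) (L2 C) (\<lambda>b. lpr12 C (lpr1 C b))
     (\<lambda>b. pb_pair (L3 C) (L2 C) (\<lambda>c. lpr12 C (lpr2 C c)) (lpr3 C) (ls_m C b)) (ls_m C x)"

lemma ideal_left:
  assumes x: "x \<in> carrier (L1 C)"
  shows "P3.ideal {(I, c). P2.ideal I \<and> c \<in> carrier (L1 C) \<and> m.sh I \<star> c \<sqsubseteq>\<^sub>1 x}" (is "P3.ideal ?J")
proof (rule P3.idealI)
  have sh: "m.sh I \<in> carrier (L1 C)" if "P2.ideal I" for I using that by simp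
  show "?J \<subseteq> carrier (L2 C) \<times> carrier (L1 C)" by auto
  show "(I', c') \<in> ?J" if J: "(I, c) \<in> ?J" and I': "I' \<in> carrier (L2 C)" and c': "c' \<in> carrier (L1 C)"
    and le: "I' \<sqsubseteq>\<^bsub>L2 C\<^esub> I" "c' \<sqsubseteq>\<^sub>1 c" for I c I' c'
  proof -
    have I: "P2.ideal I" "c \<in> carrier (L1 C)" "m.sh I \<star> c \<sqsubseteq>\<^sub>1 x" using J by auto
    have "m.sh I' \<sqsubseteq>\<^sub>1 m.sh I" using m.sh_mono[OF le(1)] I' I by simp
    then have "m.sh I' \<star> c' \<sqsubseteq>\<^sub>1 m.sh I \<star> c" using I I' c' le by (intro mult_mono) auto
    then have "m.sh I' \<star> c' \<sqsubseteq>\<^sub>1 x"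
      using F1.le_trans[of "m.sh I' \<star> c'" "m.sh I \<star> c" x] I I' c' x by simp
    then show ?thesis using I' c' by simp
  qed
  show "(\<Squnion>\<^bsub>L2 C\<^esub>A, c) \<in> ?J" if A: "A \<subseteq> carrier (L2 C)" and c: "c \<in> carrier (L1 C)"
    and *: "\<And>I. I \<in> A \<Longrightarrow> (I, c) \<in> ?J" for A c
  proof -
    have A1: "m.sh ` A \<subseteq> carrier (L1 C)" using A by auto
    have A2: "(\<lambda>a. a \<star> c) ` m.sh ` A \<subseteq> carrier (L1 C)" using A1 c by auto
    have "m.sh (\<Squnion>\<^bsub>L2 C\<^esub>A) \<star> c = \<Squnion>\<^sub>1((\<lambda>a. a \<star> c) ` m.sh ` A)"
      using m.sh_Sup[OF A] Sup_mult[OF A1 c] by simp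
    then have "m.sh (\<Squnion>\<^bsub>L2 C\<^esub>A) \<star> c \<sqsubseteq>\<^sub>1 x" using F1.Sup_le_iff[OF A2 x] * by auto
    moreover have "\<Squnion>\<^bsub>L2 C\<^esub>A \<in> carrier (L2 C)" by (rule m.X.sup_closed[OF A])
    ultimately show ?thesis using c by simp
  qed
  show "(I, \<Squnion>\<^sub>1B) \<in> ?J" if I: "I \<in> carrier (L2 C)" and B: "B \<subseteq> carrier (L1 C)"
    and *: "\<And>b. b \<in> B \<Longrightarrow> (I, b) \<in> ?J" for I B
  proof -
    have c: "m.sh I \<in> carrier (L1 C)" using I by simp
    have B1: "(\<lambda>b. m.sh I \<star> b) ` B \<subseteq> carrier (L1 C)" using B c by auto
    have "m.sh I \<star> \<Squnion>\<^sub>1B \<sqsubseteq>\<^sub>1 x" using mult_Sup[OF B c] F1.Sup_le_iff[OF B1 x] * by auto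
    then show ?thesis using I B by simp
  qed
  show "(I \<sqinter>\<^bsub>L2 C\<^esub> lpr2 C (ls_d C z), c) \<in> ?J \<longleftrightarrow> (I, c \<sqinter>\<^sub>1 ls_r C z) \<in> ?J"
    if I: "I \<in> carrier (L2 C)" and c: "c \<in> carrier (L1 C)" and z: "z \<in> carrier (L0 C)" for I c z
  proof -
    have "m.sh (I \<sqinter>\<^bsub>L2 C\<^esub> ls_m C (ls_d C z)) = m.sh I \<sqinter>\<^sub>1 ls_d C z"
      using m.frobenius[of I "ls_d C z"] I z by simp
    moreover have "I \<sqinter>\<^bsub>L2 C\<^esub> ls_m C (ls_d C z) \<in> carrier (L2 C)"
      using I z by (intro m.X.meet_closed) (simp_all add: m_ideal)
    ultimately show ?thesis
      using I c z mult_balance[of "m.sh I" c z] by (simp add: lpr2_d)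
  qed
qed

text \<open>
  The slice at \<open>c\<close> of the right-hand side of the associative law: the pairs \<open>(I, c)\<close> in
  \<open>assoc_right x\<close> will be those with \<open>I\<close> contained in this ideal.
\<close>

lemma ideal_divide:
  assumes x: "x \<in> carrier (L1 C)" and c: "c \<in> carrier (L1 C)"
  shows "P2.ideal {(a, b). a \<in> carrier (L1 C) \<and> b \<in> carrier (L1 C) \<and> a \<star> (b \<star> c) \<sqsubseteq>\<^sub>1 x}"
    (is "P2.ideal ?D")
proof (rule P2.idealI)
  show "?D \<subseteq> carrier (L1 C) \<times> carrier (L1 C)" by auto
  show "(a', b') \<in> ?D" if D: "(a, b) \<in> ?D" and c': "a' \<in> carrier (L1 C)" "b' \<in> carrier (L1 C)"
    and le: "a' \<sqsubseteq>\<^sub>1 a" "b' \<sqsubseteq>\<^sub>1 b" for a b a' b'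
  proof -
    have ab: "a \<in> carrier (L1 C)" "b \<in> carrier (L1 C)" "a \<star> (b \<star> c) \<sqsubseteq>\<^sub>1 x" using D by auto
    have "b' \<star> c \<sqsubseteq>\<^sub>1 b \<star> c" using ab c' le c by (intro mult_mono) auto
    then have "a' \<star> (b' \<star> c) \<sqsubseteq>\<^sub>1 a \<star> (b \<star> c)" using ab c' le c by (intro mult_mono) auto
    then show ?thesis
      using F1.le_trans[of "a' \<star> (b' \<star> c)" "a \<star> (b \<star> c)" x] ab c' c x by simp
  qed
  show "(\<Squnion>\<^sub>1A, b) \<in> ?D" if A: "A \<subseteq> carrier (L1 C)" and b: "b \<in> carrier (L1 C)"
    and *: "\<And>a. a \<in> A \<Longrightarrow> (a, b) \<in> ?D" for A b
  proof -
    have bc: "b \<star> c \<in> carrier (L1 C)" using b c by simp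
    have A1: "(\<lambda>a. a \<star> (b \<star> c)) ` A \<subseteq> carrier (L1 C)" using A bc by auto
    have "\<Squnion>\<^sub>1A \<star> (b \<star> c) \<sqsubseteq>\<^sub>1 x" using Sup_mult[OF A bc] F1.Sup_le_iff[OF A1 x] * by auto
    then show ?thesis using A b by simp
  qed
  show "(a, \<Squnion>\<^sub>1B) \<in> ?D" if a: "a \<in> carrier (L1 C)" and B: "B \<subseteq> carrier (L1 C)"
    and *: "\<And>b. b \<in> B \<Longrightarrow> (a, b) \<in> ?D" for a B
  proof -
    have B1: "(\<lambda>b. b \<star> c) ` B \<subseteq> carrier (L1 C)" using B c by auto
    have B2: "(\<lambda>b. a \<star> b) ` (\<lambda>b. b \<star> c) ` B \<subseteq> carrier (L1 C)" using B1 a by auto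
    have "a \<star> (\<Squnion>\<^sub>1B \<star> c) \<sqsubseteq>\<^sub>1 x"
      using Sup_mult[OF B c] mult_Sup[OF B1 a] F1.Sup_le_iff[OF B2 x] * by auto
    then show ?thesis using B a by simp
  qed
  show "(a \<sqinter>\<^sub>1 ls_d C z, b) \<in> ?D \<longleftrightarrow> (a, b \<sqinter>\<^sub>1 ls_r C z) \<in> ?D"
    if "a \<in> carrier (L1 C)" "b \<in> carrier (L1 C)" "z \<in> carrier (L0 C)" for a b z
    using that c by (simp add: mult_balance mult_meet_r)
qed

lemma ideal_right:
  assumes x: "x \<in> carrier (L1 C)"
  shows "P3.ideal {(I, c). P2.ideal I \<and> c \<in> carrier (L1 C) \<and> (\<forall>(a, b)\<in>I. a \<star> (b \<star> c) \<sqsubseteq>\<^sub>1 x)}"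
    (is "P3.ideal ?J")
proof -
  define D where "D c = {(a, b). a \<in> carrier (L1 C) \<and> b \<in> carrier (L1 C) \<and> a \<star> (b \<star> c) \<sqsubseteq>\<^sub>1 x}" for c
  have D: "P2.ideal (D c)" if "c \<in> carrier (L1 C)" for c
    unfolding D_def by (rule ideal_divide[OF x that])
  have J: "(I, c) \<in> ?J \<longleftrightarrow> P2.ideal I \<and> c \<in> carrier (L1 C) \<and> I \<subseteq> D c" for I c
    using P2.ideal_sub[of I] unfolding D_def by auto
  have D_iff: "(a, b) \<in> D c \<longleftrightarrow> a \<star> (b \<star> c) \<sqsubseteq>\<^sub>1 x"
    if "a \<in> carrier (L1 C)" "b \<in> carrier (L1 C)" for a b c using that by (simp add: D_def)
  show ?thesis
  proof (rule P3.idealI)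
    show "?J \<subseteq> carrier (L2 C) \<times> carrier (L1 C)" by auto
    show "(I', c') \<in> ?J" if IJ: "(I, c) \<in> ?J" and I': "I' \<in> carrier (L2 C)" and c': "c' \<in> carrier (L1 C)"
      and le: "I' \<sqsubseteq>\<^bsub>L2 C\<^esub> I" "c' \<sqsubseteq>\<^sub>1 c" for I c I' c'
    proof -
      have I: "P2.ideal I" "c \<in> carrier (L1 C)" "I \<subseteq> D c" using IJ unfolding J by auto
      have "(a, b) \<in> D c'" if ab: "(a, b) \<in> I'" for a b
      proof -
        have abD: "(a, b) \<in> D c" using ab le(1) I(3) by auto
        then have abc: "a \<in> carrier (L1 C)" "b \<in> carrier (L1 C)" using P2.idealD(1,2)[OF D[OF I(2)]] by auto
        have "b \<star> c' \<sqsubseteq>\<^sub>1 b \<star> c" using abc c' I le by (intro mult_mono) auto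
        then have "a \<star> (b \<star> c') \<sqsubseteq>\<^sub>1 a \<star> (b \<star> c)" by (rule mult_mono[rotated -1]) (use abc c' I in auto)
        then show ?thesis
          using abD abc c' I x F1.le_trans[of "a \<star> (b \<star> c')" "a \<star> (b \<star> c)" x] by (simp add: D_iff)
      qed
      then show ?thesis using I' c' unfolding J by auto
    qed
    show "(\<Squnion>\<^bsub>L2 C\<^esub>A, c) \<in> ?J" if A: "A \<subseteq> carrier (L2 C)" and c: "c \<in> carrier (L1 C)"
      and *: "\<And>I. I \<in> A \<Longrightarrow> (I, c) \<in> ?J" for A c
    proof -
      have "\<Squnion>\<^bsub>L2 C\<^esub>A \<subseteq> D c"
        using m.X.Sup_le_iff[OF A, of "D c"] D[OF c] * unfolding J by simp
      moreover have "\<Squnion>\<^bsub>L2 C\<^esub>A \<in> carrier (L2 C)" by (rule m.X.sup_closed[OF A])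
      ultimately show ?thesis using c unfolding J by simp
    qed
    show "(I, \<Squnion>\<^sub>1B) \<in> ?J" if I: "I \<in> carrier (L2 C)" and B: "B \<subseteq> carrier (L1 C)"
      and *: "\<And>b. b \<in> B \<Longrightarrow> (I, b) \<in> ?J" for I B
    proof -
      have "(a, b) \<in> D (\<Squnion>\<^sub>1B)" if ab: "(a, b) \<in> I" for a b
      proof -
        have abc: "a \<in> carrier (L1 C)" "b \<in> carrier (L1 C)" using P2.idealD(1,2)[OF _ ab] I by auto
        have B1: "(\<lambda>y. b \<star> y) ` B \<subseteq> carrier (L1 C)" using B abc by auto
        have B2: "(\<lambda>y. a \<star> y) ` (\<lambda>y. b \<star> y) ` B \<subseteq> carrier (L1 C)" using B1 abc by auto
        have "a \<star> (b \<star> y) \<sqsubseteq>\<^sub>1 x" if "y \<in> B" for y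
          using *[OF that] ab abc unfolding J by (auto simp: D_iff[symmetric])
        then show ?thesis
          using mult_Sup[OF B abc(2)] mult_Sup[OF B1 abc(1)] F1.Sup_le_iff[OF B2 x] abc
          by (simp add: D_iff)
      qed
      then show ?thesis using I B unfolding J by auto
    qed
    show "(I \<sqinter>\<^bsub>L2 C\<^esub> lpr2 C (ls_d C z), c) \<in> ?J \<longleftrightarrow> (I, c \<sqinter>\<^sub>1 ls_r C z) \<in> ?J"
      if I: "I \<in> carrier (L2 C)" and c: "c \<in> carrier (L1 C)" and z: "z \<in> carrier (L0 C)" for I c z
    proof -
      let ?w = "ls_d C z"
      have w: "?w \<in> carrier (L1 C)" using z by simp
      have i: "P2.ideal I" "P2.ideal (P2.pr2 ?w)" using I w by auto
      have meet: "I \<sqinter>\<^bsub>L2 C\<^esub> lpr2 C ?w = I \<inter> P2.pr2 ?w"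
        using i by (simp add: lpr2_eq L2_eq P2.meet_P)
      have shift: "(a, b \<sqinter>\<^sub>1 ?w) \<in> D c \<longleftrightarrow> (a, b) \<in> D (c \<sqinter>\<^sub>1 ls_r C z)"
        if "a \<in> carrier (L1 C)" "b \<in> carrier (L1 C)" for a b
        using that z c by (simp add: D_iff mult_balance)
      have "I \<inter> P2.pr2 ?w \<subseteq> D c \<longleftrightarrow> I \<subseteq> D (c \<sqinter>\<^sub>1 ls_r C z)"
      proof
        assume h: "I \<inter> P2.pr2 ?w \<subseteq> D c"
        show "I \<subseteq> D (c \<sqinter>\<^sub>1 ls_r C z)"
        proof (rule subrelI)
          fix a b assume ab: "(a, b) \<in> I"
          note abc = P2.idealD(1,2)[OF i(1) ab]
          have "(a, b \<sqinter>\<^sub>1 ?w) \<in> I"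
            using P2.idealD(3)[OF i(1) ab, of a "b \<sqinter>\<^sub>1 ?w"] abc w by (simp add: F1.meet_left)
          moreover have "(a, b \<sqinter>\<^sub>1 ?w) \<in> P2.pr2 ?w"
            using P2.idealD(3)[OF P2.ideal_tens P2.in_tens, of "\<top>\<^bsub>L1 C\<^esub>" ?w a "b \<sqinter>\<^sub>1 ?w"] abc w
            by (simp add: F1.meet_right P2.pr2_eq)
          ultimately show "(a, b) \<in> D (c \<sqinter>\<^sub>1 ls_r C z)" using h shift[OF abc] by blast
        qed
      next
        assume h: "I \<subseteq> D (c \<sqinter>\<^sub>1 ls_r C z)"
        show "I \<inter> P2.pr2 ?w \<subseteq> D c"
        proof (rule subrelI)
          fix a b assume "(a, b) \<in> I \<inter> P2.pr2 ?w"
          then have ab: "(a, b) \<in> I" "(a, b) \<in> P2.tens \<top>\<^bsub>L1 C\<^esub> ?w" using w by (auto simp: P2.pr2_eq)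
          note abc = P2.idealD(1,2)[OF i(1) ab(1)]
          have "P2.tens a b = P2.tens a b \<inter> P2.tens \<top>\<^bsub>L1 C\<^esub> ?w"
            using ab(2) P2.tens_le_iff[OF P2.ideal_tens[of "\<top>\<^bsub>L1 C\<^esub>" ?w]] w by auto
          also have "\<dots> = P2.tens a (b \<sqinter>\<^sub>1 ?w)" using abc w by (simp add: P2.tens_Int)
          finally have "(a, b) \<in> D c \<longleftrightarrow> (a, b \<sqinter>\<^sub>1 ?w) \<in> D c"
            using P2.tens_le_iff[OF D[OF c], of a b] P2.tens_le_iff[OF D[OF c], of a "b \<sqinter>\<^sub>1 ?w"] by simp
          then show "(a, b) \<in> D c" using ab(1) h shift[OF abc] by blast
        qed
      qed
      then show ?thesis
        using I c z w P2.ideal_Int[OF i] unfolding J meet by simp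
    qed
  qed
qed

text \<open>
  The left-hand side is the join of the generators \<open>m\<^sup>*(p) \<otimes> q\<close> with \<open>pq \<le> x\<close>. Given
  \<open>(I, c)\<close> with \<open>m\<^sub>!(I) c \<le> x\<close>, the generator for \<open>p = m\<^sub>!(I)\<close> and \<open>q = c\<close> lies above
  \<open>I \<otimes> c\<close>.
\<close>

lemma assoc_left_eq:
  assumes x: "x \<in> carrier (L1 C)"
  shows "assoc_left x = {(I, c). P2.ideal I \<and> c \<in> carrier (L1 C) \<and> m.sh I \<star> c \<sqsubseteq>\<^sub>1 x}" (is "_ = ?J")
proof -
  let ?K = "ls_m C x"
  note K = m_ideal[OF x]
  let ?T = "(\<lambda>(p, q). P3.tens (ls_m C p) q) ` ?K"
  have T: "?T \<subseteq> carrier P3.P" using P2.ideal_sub[OF K] by (auto simp: P3.ideal_tens m_ideal)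
  have "assoc_left x = \<Squnion>\<^bsub>P3.P\<^esub>((\<lambda>(a, b). P3.pr1 (ls_m C a) \<sqinter>\<^bsub>P3.P\<^esub> P3.pr2 b) ` ?K)"
    using K by (simp add: pb_pair_def lpr12_eq lpr3_eq L3_eq)
  also have "(\<lambda>(a, b). P3.pr1 (ls_m C a) \<sqinter>\<^bsub>P3.P\<^esub> P3.pr2 b) ` ?K = ?T"
    by (rule image_cong[OF refl]) (use P2.ideal_sub[OF K] in \<open>auto simp: P3.pr_meet m_ideal\<close>)
  finally have eq: "assoc_left x = \<Squnion>\<^bsub>P3.P\<^esub>?T" .
  have J: "P3.ideal ?J" by (rule ideal_left[OF x])
  have S: "P3.ideal (\<Squnion>\<^bsub>P3.P\<^esub>?T)" using P3.PF.sup_closed[OF T] by simp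
  have "\<Squnion>\<^bsub>P3.P\<^esub>?T \<subseteq> ?J"
  proof -
    have "t \<subseteq> ?J" if "t \<in> ?T" for t
    proof -
      obtain p q where pq: "(p, q) \<in> ?K" "t = P3.tens (ls_m C p) q" using \<open>t \<in> ?T\<close> by auto
      note c = P2.idealD(1,2)[OF K pq(1)]
      have "m.sh (ls_m C p) \<star> q \<sqsubseteq>\<^sub>1 p \<star> q"
        using c m_ideal m.sh_f_le[of p] by (intro mult_mono) auto
      moreover have "p \<star> q \<sqsubseteq>\<^sub>1 x" using c pq x by (simp add: mult_le_iff)
      ultimately have "m.sh (ls_m C p) \<star> q \<sqsubseteq>\<^sub>1 x"
        using F1.le_trans[of "m.sh (ls_m C p) \<star> q" "p \<star> q" x] c x by (simp add: m_ideal)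
      then show ?thesis unfolding pq(2) P3.tens_le_iff[OF J] using c by (simp add: m_ideal)
    qed
    then show ?thesis using P3.PF.Sup_le_iff[OF T, of ?J] J by simp
  qed
  moreover have "?J \<subseteq> \<Squnion>\<^bsub>P3.P\<^esub>?T"
  proof (rule subrelI)
    fix I c assume "(I, c) \<in> ?J"
    then have I: "P2.ideal I" "c \<in> carrier (L1 C)" "m.sh I \<star> c \<sqsubseteq>\<^sub>1 x" by auto
    then have "(m.sh I, c) \<in> ?K" using x by (simp add: mult_le_iff)
    then have "P3.tens (ls_m C (m.sh I)) c \<in> ?T" by (intro image_eqI[of _ _ "(m.sh I, c)"]) simp_all
    then have "P3.tens (ls_m C (m.sh I)) c \<subseteq> \<Squnion>\<^bsub>P3.P\<^esub>?T" using P3.PF.sup_upper[OF T] by simp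
    then have "(ls_m C (m.sh I), c) \<in> \<Squnion>\<^bsub>P3.P\<^esub>?T" using P3.tens_le_iff[OF S] by simp
    then show "(I, c) \<in> \<Squnion>\<^bsub>P3.P\<^esub>?T"
      by (rule P3.idealD(3)[OF S]) (use I m.le_f_sh[of I] in simp_all)
  qed
  ultimately show ?thesis unfolding eq by simp
qed

text \<open>
  By distributivity the right-hand side is the join of the generators \<open>(p \<otimes> s) \<otimes> t\<close> with
  \<open>st \<le> q\<close> and \<open>pq \<le> x\<close> for some \<open>q\<close>; the best choice is \<open>q = st\<close>.
\<close>

lemma assoc_right_eq:
  assumes x: "x \<in> carrier (L1 C)"
  shows "assoc_right x =
    {(I, c). P2.ideal I \<and> c \<in> carrier (L1 C) \<and> (\<forall>(a, b)\<in>I. a \<star> (b \<star> c) \<sqsubseteq>\<^sub>1 x)}" (is "_ = ?J")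
proof -
  let ?K = "ls_m C x"
  note K = m_ideal[OF x]
  have J: "P3.ideal ?J" by (rule ideal_right[OF x])
  let ?T = "\<lambda>q. (\<lambda>(s, t). P3.tens (P2.pr2 s) t) ` ls_m C q"
  have T: "?T q \<subseteq> carrier P3.P" if "q \<in> carrier (L1 C)" for q
    using P2.ideal_sub[OF m_ideal[OF that]] by (auto simp: P3.ideal_tens)
  have inner: "pb_pair (L3 C) (L2 C) (\<lambda>c. lpr12 C (lpr2 C c)) (lpr3 C) (ls_m C q) = \<Squnion>\<^bsub>P3.P\<^esub>(?T q)"
    if q: "q \<in> carrier (L1 C)" for q
  proof -
    have "pb_pair (L3 C) (L2 C) (\<lambda>c. lpr12 C (lpr2 C c)) (lpr3 C) (ls_m C q) =
      \<Squnion>\<^bsub>P3.P\<^esub>((\<lambda>(a, b). P3.pr1 (P2.pr2 a) \<sqinter>\<^bsub>P3.P\<^esub> P3.pr2 b) ` ls_m C q)"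
      using m_ideal[OF q] by (simp add: pb_pair_def lpr12_eq lpr3_eq L3_eq lpr2_eq)
    also have "(\<lambda>(a, b). P3.pr1 (P2.pr2 a) \<sqinter>\<^bsub>P3.P\<^esub> P3.pr2 b) ` ls_m C q = ?T q"
      by (rule image_cong[OF refl]) (use P2.ideal_sub[OF m_ideal[OF q]] in \<open>auto simp: P3.pr_meet\<close>)
    finally show ?thesis .
  qed
  let ?W = "(\<lambda>(p, q). P3.pr1 (P2.pr1 p) \<sqinter>\<^bsub>P3.P\<^esub> \<Squnion>\<^bsub>P3.P\<^esub>(?T q)) ` ?K"
  have "assoc_right x = \<Squnion>\<^bsub>P3.P\<^esub>((\<lambda>(a, b). P3.pr1 (P2.pr1 a) \<sqinter>\<^bsub>P3.P\<^esub>
      pb_pair (L3 C) (L2 C) (\<lambda>c. lpr12 C (lpr2 C c)) (lpr3 C) (ls_m C b)) ` ?K)"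
    unfolding pb_pair_def[of "L3 C" "L2 C" "\<lambda>b. lpr12 C (lpr1 C b)"]
    using K by (simp add: lpr12_eq L3_eq lpr1_eq)
  also have "(\<lambda>(a, b). P3.pr1 (P2.pr1 a) \<sqinter>\<^bsub>P3.P\<^esub>
      pb_pair (L3 C) (L2 C) (\<lambda>c. lpr12 C (lpr2 C c)) (lpr3 C) (ls_m C b)) ` ?K = ?W"
    by (rule image_cong[OF refl]) (use P2.ideal_sub[OF K] inner in auto)
  finally have eq: "assoc_right x = \<Squnion>\<^bsub>P3.P\<^esub>?W" .
  have pr11: "P3.pr1 (P2.pr1 p) \<in> carrier P3.P" if "p \<in> carrier (L1 C)" for p using that by simp
  have W: "?W \<subseteq> carrier P3.P"
  proof
    fix w assume "w \<in> ?W"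
    then obtain p q where pq: "(p, q) \<in> ?K" "w = P3.pr1 (P2.pr1 p) \<sqinter>\<^bsub>P3.P\<^esub> \<Squnion>\<^bsub>P3.P\<^esub>(?T q)" by auto
    note c = P2.idealD(1,2)[OF K pq(1)]
    show "w \<in> carrier P3.P"
      unfolding pq(2) by (rule P3.PF.meet_closed[OF pr11[OF c(1)] P3.PF.sup_closed[OF T[OF c(2)]]])
  qed
  have S: "P3.ideal (\<Squnion>\<^bsub>P3.P\<^esub>?W)" using P3.PF.sup_closed[OF W] by simp
  have step: "P3.pr1 (P2.pr1 p) \<sqinter>\<^bsub>P3.P\<^esub> P3.tens (P2.pr2 s) t = P3.tens (P2.tens p s) t"
    if "p \<in> carrier (L1 C)" "s \<in> carrier (L1 C)" "t \<in> carrier (L1 C)" for p s t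
  proof -
    have "P2.pr1 p \<sqinter>\<^bsub>L2 C\<^esub> P2.pr2 s = P2.tens p s" using that by (simp add: L2_eq P2.pr_meet)
    then show ?thesis
      using that P3.tens_Int[of "P2.pr1 p" "\<top>\<^bsub>L1 C\<^esub>" "P2.pr2 s" t]
      by (simp add: P3.pr1_eq P3.meet_P P3.ideal_tens)
  qed
  have "\<Squnion>\<^bsub>P3.P\<^esub>?W \<subseteq> ?J"
  proof -
    have "w \<subseteq> ?J" if "w \<in> ?W" for w
    proof -
      obtain p q where pq: "(p, q) \<in> ?K" "w = P3.pr1 (P2.pr1 p) \<sqinter>\<^bsub>P3.P\<^esub> \<Squnion>\<^bsub>P3.P\<^esub>(?T q)"
        using \<open>w \<in> ?W\<close> by auto
      note c = P2.idealD(1,2)[OF K pq(1)]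
      have px: "p \<star> q \<sqsubseteq>\<^sub>1 x" using c pq x by (simp add: mult_le_iff)
      have w: "w = \<Squnion>\<^bsub>P3.P\<^esub>((\<lambda>t. P3.pr1 (P2.pr1 p) \<sqinter>\<^bsub>P3.P\<^esub> t) ` ?T q)"
        unfolding pq(2) by (rule P3.PF.meet_Sup_distrib[OF pr11[OF c(1)] T[OF c(2)]])
      have sub: "(\<lambda>t. P3.pr1 (P2.pr1 p) \<sqinter>\<^bsub>P3.P\<^esub> t) ` ?T q \<subseteq> carrier P3.P"
        using T[OF c(2)] pr11[OF c(1)] P3.PF.meet_closed by blast
      have "v \<subseteq> ?J" if "v \<in> (\<lambda>t. P3.pr1 (P2.pr1 p) \<sqinter>\<^bsub>P3.P\<^esub> t) ` ?T q" for v
      proof -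
        obtain s t where st: "(s, t) \<in> ls_m C q" "v = P3.pr1 (P2.pr1 p) \<sqinter>\<^bsub>P3.P\<^esub> P3.tens (P2.pr2 s) t"
          using \<open>v \<in> _\<close> by auto
        note c' = P2.idealD(1,2)[OF m_ideal[OF c(2)] st(1)]
        have v: "v = P3.tens (P2.tens p s) t" using st(2) step c c' by simp
        have "s \<star> t \<sqsubseteq>\<^sub>1 q" using st c' c by (simp add: mult_le_iff)
        then have "p \<star> (s \<star> t) \<sqsubseteq>\<^sub>1 p \<star> q" using c c' by (intro mult_mono) auto
        then have "p \<star> (s \<star> t) \<sqsubseteq>\<^sub>1 x" using F1.le_trans[OF _ px] c c' x by simp
        then have "P2.tens p s \<subseteq> {(a, b). a \<in> carrier (L1 C) \<and> b \<in> carrier (L1 C) \<and> a \<star> (b \<star> t) \<sqsubseteq>\<^sub>1 x}"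
          using P2.tens_le_iff[OF ideal_divide[OF x c'(2)]] c c' by simp
        then have "\<forall>(a, b)\<in>P2.tens p s. a \<star> (b \<star> t) \<sqsubseteq>\<^sub>1 x" by blast
        then show ?thesis
          unfolding v P3.tens_le_iff[OF J] using c c' by (simp add: P2.ideal_tens)
      qed
      then show ?thesis unfolding w using P3.PF.Sup_le_iff[OF sub, of ?J] J by simp
    qed
    then show ?thesis using P3.PF.Sup_le_iff[OF W, of ?J] J by simp
  qed
  moreover have "?J \<subseteq> \<Squnion>\<^bsub>P3.P\<^esub>?W"
  proof (rule subrelI)
    fix I c assume "(I, c) \<in> ?J"
    then have I: "P2.ideal I" "c \<in> carrier (L1 C)" "\<forall>(a, b)\<in>I. a \<star> (b \<star> c) \<sqsubseteq>\<^sub>1 x" by auto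
    have gens: "(P2.tens a b, c) \<in> \<Squnion>\<^bsub>P3.P\<^esub>?W" if ab: "(a, b) \<in> I" for a b
    proof -
      note abc = P2.idealD(1,2)[OF I(1) ab]
      have bc: "b \<star> c \<in> carrier (L1 C)" using abc I by simp
      have "(a, b \<star> c) \<in> ?K" using I(3) ab abc bc x by (auto simp: mult_le_iff)
      then have in_W: "P3.pr1 (P2.pr1 a) \<sqinter>\<^bsub>P3.P\<^esub> \<Squnion>\<^bsub>P3.P\<^esub>(?T (b \<star> c)) \<in> ?W"
        by (intro image_eqI[of _ _ "(a, b \<star> c)"]) simp_all
      have "P3.tens (P2.pr2 b) c \<in> ?T (b \<star> c)"
        using in_m_mult[OF abc(2) I(2)] by (intro image_eqI[of _ _ "(b, c)"]) simp_all
      then have "P3.tens (P2.pr2 b) c \<subseteq> \<Squnion>\<^bsub>P3.P\<^esub>(?T (b \<star> c))" using P3.PF.sup_upper[OF T[OF bc]] by simp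
      then have "P3.pr1 (P2.pr1 a) \<sqinter>\<^bsub>P3.P\<^esub> P3.tens (P2.pr2 b) c
          \<sqsubseteq>\<^bsub>P3.P\<^esub> P3.pr1 (P2.pr1 a) \<sqinter>\<^bsub>P3.P\<^esub> \<Squnion>\<^bsub>P3.P\<^esub>(?T (b \<star> c))"
        using abc I P3.PF.sup_closed[OF T[OF bc]] by (intro P3.PF.meet_mono) (simp_all add: P3.ideal_tens)
      then have "P3.tens (P2.tens a b) c \<subseteq> P3.pr1 (P2.pr1 a) \<sqinter>\<^bsub>P3.P\<^esub> \<Squnion>\<^bsub>P3.P\<^esub>(?T (b \<star> c))"
        using step abc I by simp
      also have "\<dots> \<subseteq> \<Squnion>\<^bsub>P3.P\<^esub>?W" using P3.PF.sup_upper[OF W in_W] by simp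
      finally show ?thesis using P3.tens_le_iff[OF S] by simp
    qed
    let ?G = "(\<lambda>(a, b). P2.tens a b) ` I"
    have "?G \<subseteq> carrier (L2 C)" using P2.ideal_sub[OF I(1)] by (auto simp: P2.ideal_tens)
    then have "(\<Squnion>\<^bsub>L2 C\<^esub>?G, c) \<in> \<Squnion>\<^bsub>P3.P\<^esub>?W"
      by (rule P3.idealD(4)[OF S _ I(2)]) (use gens in auto)
    then show "(I, c) \<in> \<Squnion>\<^bsub>P3.P\<^esub>?W" using P2.ideal_as_Sup[OF I(1)] by (simp add: L2_eq)
  qed
  ultimately show ?thesis unfolding eq by simp
qed

text \<open>
  The pairs \<open>(a \<otimes> b, c)\<close> decide both ideals, because every \<open>I\<close> is the join of its generators.
\<close>

lemma associativity_iff: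
  "(\<forall>x\<in>carrier (L1 C). assoc_left x = assoc_right x) \<longleftrightarrow>
   (\<forall>a\<in>carrier (L1 C). \<forall>b\<in>carrier (L1 C). \<forall>c\<in>carrier (L1 C). a \<star> b \<star> c = a \<star> (b \<star> c))"
  (is "?L \<longleftrightarrow> ?R")
proof
  assume L: ?L
  show ?R
  proof (intro ballI)
    fix a b c assume abc: "a \<in> carrier (L1 C)" "b \<in> carrier (L1 C)" "c \<in> carrier (L1 C)"
    show "a \<star> b \<star> c = a \<star> (b \<star> c)"
    proof (rule F1.eq_by_upper)
      fix x assume x: "x \<in> carrier (L1 C)"
      let ?D = "{(a, b). a \<in> carrier (L1 C) \<and> b \<in> carrier (L1 C) \<and> a \<star> (b \<star> c) \<sqsubseteq>\<^sub>1 x}"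
      have t: "P2.ideal (P2.tens a b)" using abc by (simp add: P2.ideal_tens)
      have "a \<star> b \<star> c \<sqsubseteq>\<^sub>1 x \<longleftrightarrow> (P2.tens a b, c) \<in> assoc_left x"
        using abc t by (simp add: assoc_left_eq[OF x] mult_eq)
      also have "\<dots> \<longleftrightarrow> (P2.tens a b, c) \<in> assoc_right x" using L x by simp
      also have "\<dots> \<longleftrightarrow> P2.tens a b \<subseteq> ?D"
        unfolding assoc_right_eq[OF x] using abc t P2.ideal_sub[OF t] by auto
      also have "\<dots> \<longleftrightarrow> a \<star> (b \<star> c) \<sqsubseteq>\<^sub>1 x"
        using P2.tens_le_iff[OF ideal_divide[OF x abc(3)]] abc by simp
      finally show "a \<star> b \<star> c \<sqsubseteq>\<^sub>1 x \<longleftrightarrow> a \<star> (b \<star> c) \<sqsubseteq>\<^sub>1 x" .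
    qed (use abc in auto)
  qed
next
  assume R: ?R
  show ?L
  proof
    fix x assume x: "x \<in> carrier (L1 C)"
    have "m.sh I \<star> c \<sqsubseteq>\<^sub>1 x \<longleftrightarrow> (\<forall>(a, b)\<in>I. a \<star> (b \<star> c) \<sqsubseteq>\<^sub>1 x)"
      if I: "P2.ideal I" and c: "c \<in> carrier (L1 C)" for I c
    proof -
      let ?G = "(\<lambda>(a, b). a \<star> b) ` I"
      have G: "?G \<subseteq> carrier (L1 C)" using P2.ideal_sub[OF I] by auto
      then have Gc: "(\<lambda>g. g \<star> c) ` ?G \<subseteq> carrier (L1 C)" using c by auto
      have "m.sh I \<star> c \<sqsubseteq>\<^sub>1 x \<longleftrightarrow> (\<forall>(a, b)\<in>I. a \<star> b \<star> c \<sqsubseteq>\<^sub>1 x)"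
        using m_sh_eq[OF I] Sup_mult[OF G c] F1.Sup_le_iff[OF Gc x] by auto
      also have "\<dots> \<longleftrightarrow> (\<forall>(a, b)\<in>I. a \<star> (b \<star> c) \<sqsubseteq>\<^sub>1 x)"
        by (rule ball_cong[OF refl]) (use R c P2.ideal_sub[OF I] in auto)
      finally show ?thesis .
    qed
    then show "assoc_left x = assoc_right x"
      unfolding assoc_left_eq[OF x] assoc_right_eq[OF x] by auto
  qed
qed

end

text \<open>
  The lattice operations depend on the carrier and the order alone, which \<open>O(C)\<close> shares with
  \<open>O(C\<^sub>1)\<close>.
\<close>

lemma
  assumes "carrier M = carrier L" "le M = le L"
  shows Sup_cong_order: "\<Squnion>\<^bsub>M\<^esub>A = \<Squnion>\<^bsub>L\<^esub>A" and meet_cong_order: "x \<sqinter>\<^bsub>M\<^esub> y = x \<sqinter>\<^bsub>L\<^esub> y"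
    and top_cong_order: "\<top>\<^bsub>M\<^esub> = \<top>\<^bsub>L\<^esub>"
  using assms
  by (simp_all add: sup_def meet_def inf_def top_def least_def greatest_def Upper_def Lower_def)

lemma frame_cong_order:
  assumes "frame L" "carrier M = carrier L" "le M = le L" "eq M = eq L"
  shows "frame M"
proof -
  interpret frame L by fact
  note Sup = Sup_cong_order[OF assms(2,3)] and meet = meet_cong_order[OF assms(2,3)]
  have least: "least M = least L" and greatest: "greatest M = greatest L"
    and Upper: "Upper M = Upper L" and Lower: "Lower M = Lower L"
    using assms(2,3) by (auto simp: fun_eq_iff least_def greatest_def Upper_def Lower_def)
  show ?thesis
    by (unfold_locales; (simp add: assms(2-4) Sup meet least greatest Upper Lower eq_is_equal
      sup_exists inf_exists meet_Sup_distrib le_antisym)?; (blast intro: le_trans)?)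
qed

lemma quantal_of_simps:
  "carrier (quantal_of C) = carrier (L1 C)" "le (quantal_of C) = le (L1 C)" "eq (quantal_of C) = eq (L1 C)"
  by (simp_all add: quantal_of_def)

lemmas quantal_of_order [simp] = quantal_of_simps
  Sup_cong_order[OF quantal_of_simps(1,2)] meet_cong_order[OF quantal_of_simps(1,2)]
  top_cong_order[OF quantal_of_simps(1,2)]

lemma (in unital_localic) etale_localic_categoryI:
  assumes assoc: "\<And>a b c. \<lbrakk>a \<in> carrier (L1 C); b \<in> carrier (L1 C); c \<in> carrier (L1 C)\<rbrakk>
    \<Longrightarrow> a \<star> b \<star> c = a \<star> (b \<star> c)"
  shows "etale_localic_category C"
proof -
  have "assoc_left x = assoc_right x" if "x \<in> carrier (L1 C)" for x
    using associativity_iff assoc that by blast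
  then show ?thesis
    unfolding etale_localic_category_def localic_category_def
    using frame1 frame0 u.hom d.hom r.hom m.hom u_d u_r m_r m_d m_1_ud m_ur_1 open_u open_m etale_d etale_r
    by (intro conjI ballI) assumption+
qed

locale etale_localic =
  fixes C :: "('a, 'b) loc_cat" (structure)
  assumes etale: "etale_localic_category C"

sublocale etale_localic \<subseteq> unital_localic C
  using etale unfolding etale_localic_category_def localic_category_def
  by (intro unital_localic.intro) blast+

context etale_localic
begin

lemma mult_assoc:
  assumes "a \<in> carrier (L1 C)" "b \<in> carrier (L1 C)" "c \<in> carrier (L1 C)"
  shows "a \<star> b \<star> c = a \<star> (b \<star> c)"
proof -
  have "localic_category C" using etale by (simp add: etale_localic_category_def)
  then have "\<forall>x\<in>carrier (L1 C). assoc_left x = assoc_right x"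
    unfolding localic_category_def by (elim conjE)
  then show ?thesis using associativity_iff assms by blast
qed

subsection \<open>Local bisections\<close>

text \<open>
  For \<open>f \<le> e\<close> the product \<open>af\<close> is the restriction \<open>a \<and> d\<^sup>*(u\<^sup>*(f))\<close> of \<open>a\<close> along \<open>d\<close>, and \<open>fa\<close>
  is the restriction along \<open>r\<close>. So the two factorizations in the definition of a partial isometry
  are the section properties for \<open>d\<close> and \<open>r\<close>.
\<close>

lemma bisection_iff: "a \<in> local_bisections C \<longleftrightarrow> d.sect a \<and> r.sect a"
proof
  assume a: "a \<in> local_bisections C"
  then have ac: "a \<in> carrier (L1 C)" by (simp add: partial_isometries_def)
  have ex: "\<exists>f\<in>carrier (L1 C). \<exists>g\<in>carrier (L1 C). f \<sqsubseteq>\<^sub>1 E \<and> g \<sqsubseteq>\<^sub>1 E \<and> b = g \<star> a \<and> b = a \<star> f"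
    if "b \<in> carrier (L1 C)" "b \<sqsubseteq>\<^sub>1 a" for b
    using a that by (simp add: partial_isometries_def qunit_eq)
  have "\<exists>z\<in>carrier (L0 C). b = a \<sqinter>\<^sub>1 ls_d C z" "\<exists>z\<in>carrier (L0 C). b = a \<sqinter>\<^sub>1 ls_r C z"
    if b: "b \<in> carrier (L1 C)" "b \<sqsubseteq>\<^sub>1 a" for b
  proof -
    obtain f g where fg: "f \<in> carrier (L1 C)" "g \<in> carrier (L1 C)" "f \<sqsubseteq>\<^sub>1 E" "g \<sqsubseteq>\<^sub>1 E" "b = g \<star> a" "b = a \<star> f"
      using ex[OF b] by blast
    have "b = a \<sqinter>\<^sub>1 ls_d C (ls_u C f)"
      using mult_u_sh[OF ac, of "ls_u C f"] fg by (simp add: below_E)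
    moreover have "b = a \<sqinter>\<^sub>1 ls_r C (ls_u C g)"
      using u_sh_mult[OF ac, of "ls_u C g"] fg by (simp add: below_E)
    ultimately show "\<exists>z\<in>carrier (L0 C). b = a \<sqinter>\<^sub>1 ls_d C z" "\<exists>z\<in>carrier (L0 C). b = a \<sqinter>\<^sub>1 ls_r C z"
      using fg(1,2) u.f_closed by blast+
  qed
  then show "d.sect a \<and> r.sect a" using d.sectionI[OF ac] r.sectionI[OF ac] by blast
next
  assume s: "d.sect a \<and> r.sect a"
  have ac: "a \<in> carrier (L1 C)" using s d.sectionD(1) by blast
  have "\<exists>f\<in>carrier (L1 C). \<exists>g\<in>carrier (L1 C). f \<sqsubseteq>\<^sub>1 E \<and> g \<sqsubseteq>\<^sub>1 E \<and> b = g \<star> a \<and> b = a \<star> f"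
    if b: "b \<in> carrier (L1 C)" "b \<sqsubseteq>\<^sub>1 a" for b
  proof (intro bexI conjI)
    show "b = u.sh (r.sh b) \<star> a" "b = a \<star> u.sh (d.sh b)"
      using s b ac d.sectionD(2)[OF _ b] r.sectionD(2)[OF _ b] by (simp_all add: mult_u_sh u_sh_mult)
  qed (use b u_sh_le_E in simp_all)
  then show "a \<in> local_bisections C"
    using ac by (simp add: partial_isometries_def qunit_eq)
qed

lemma bisection_closed: "a \<in> local_bisections C \<Longrightarrow> a \<in> carrier (L1 C)"
  by (simp add: partial_isometries_def)

text \<open>
  Cut \<open>a\<close> into sections of \<open>d\<close>, and each of these into sections of \<open>r\<close>.
\<close>

lemma Sup_bisections:
  assumes a: "a \<in> carrier (L1 C)"
  shows "\<Squnion>\<^sub>1{c \<in> local_bisections C. c \<sqsubseteq>\<^sub>1 a} = a" (is "\<Squnion>\<^sub>1?B = a")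
proof (rule F1.eq_by_upper)
  have B: "?B \<subseteq> carrier (L1 C)" using bisection_closed by blast
  show "\<Squnion>\<^sub>1?B \<in> carrier (L1 C)" using B by simp
  fix x assume x: "x \<in> carrier (L1 C)"
  show "\<Squnion>\<^sub>1?B \<sqsubseteq>\<^sub>1 x \<longleftrightarrow> a \<sqsubseteq>\<^sub>1 x"
  proof
    assume ax: "a \<sqsubseteq>\<^sub>1 x"
    show "\<Squnion>\<^sub>1?B \<sqsubseteq>\<^sub>1 x"
    proof (rule F1.sup_least[OF B x])
      fix c assume "c \<in> ?B"
      then have "c \<sqsubseteq>\<^sub>1 a" "c \<in> carrier (L1 C)" using B by auto
      then show "c \<sqsubseteq>\<^sub>1 x" using F1.le_trans[OF _ ax] a x by simp
    qed
  next
    assume "\<Squnion>\<^sub>1?B \<sqsubseteq>\<^sub>1 x"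
    then have *: "\<And>c. c \<in> ?B \<Longrightarrow> c \<sqsubseteq>\<^sub>1 x" using F1.Sup_le_iff[OF B x] by blast
    have "s \<sqsubseteq>\<^sub>1 x" if s: "d.sect s" "s \<sqsubseteq>\<^sub>1 a" for s
    proof -
      have sc: "s \<in> carrier (L1 C)" using d.sectionD(1)[OF s(1)] .
      have T: "{t. r.sect t \<and> t \<sqsubseteq>\<^sub>1 s} \<subseteq> carrier (L1 C)" using r.sectionD(1) by blast
      have "t \<sqsubseteq>\<^sub>1 x" if t: "r.sect t" "t \<sqsubseteq>\<^sub>1 s" for t
      proof -
        have tc: "t \<in> carrier (L1 C)" using r.sectionD(1)[OF t(1)] .
        have "t \<in> local_bisections C" using d.section_down[OF s(1) tc t(2)] t(1) by (simp add: bisection_iff)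
        moreover have "t \<sqsubseteq>\<^sub>1 a" using F1.le_trans[OF t(2) s(2) tc sc a] .
        ultimately show ?thesis using * by blast
      qed
      then show ?thesis using r.Sup_sections[OF sc] F1.Sup_le_iff[OF T x] by auto
    qed
    moreover have "{t. d.sect t \<and> t \<sqsubseteq>\<^sub>1 a} \<subseteq> carrier (L1 C)" using d.sectionD(1) by blast
    ultimately show "a \<sqsubseteq>\<^sub>1 x"
      using d.Sup_sections[OF a] F1.Sup_le_iff[of "{t. d.sect t \<and> t \<sqsubseteq>\<^sub>1 a}" x] x by auto
  qed
qed (rule a)

lemma pt_bisection:
  assumes p: "p \<in> pt (L1 C)" and a: "a \<in> carrier (L1 C)" "p a"
  obtains c where "c \<in> local_bisections C" "c \<sqsubseteq>\<^sub>1 a" "p c"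
proof -
  have B: "{c \<in> local_bisections C. c \<sqsubseteq>\<^sub>1 a} \<subseteq> carrier (L1 C)" using bisection_closed by blast
  show thesis using pt_Sup[OF p B] Sup_bisections[OF a(1)] a(2) that by auto
qed

text \<open>
  An element below \<open>ab\<close> is a join of products \<open>xy\<close> with \<open>x \<le> a\<close> and \<open>y \<le> b\<close>. Such an \<open>x\<close> is a
  restriction of \<open>a\<close> along \<open>d\<close>, which can be moved to \<open>y\<close> as a restriction along \<open>r\<close>; what
  remains of \<open>y\<close> is a restriction of \<open>b\<close> along \<open>d\<close>, so \<open>xy\<close> is a restriction of \<open>ab\<close> along \<open>d\<close>.
  Joins of restrictions are restrictions, and \<open>r\<close> is treated in the same way.
\<close>

lemma bisection_mult:
  assumes a: "a \<in> local_bisections C" and b: "b \<in> local_bisections C"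
  shows "a \<star> b \<in> local_bisections C"
proof -
  have sec: "d.sect a" "r.sect a" "d.sect b" "r.sect b" using a b bisection_iff by auto
  have ac: "a \<in> carrier (L1 C)" "b \<in> carrier (L1 C)" using a b bisection_closed by auto
  have d1: "\<exists>w\<in>carrier (L0 C). x \<star> y = (a \<star> b) \<sqinter>\<^sub>1 ls_d C w"
    if xy: "x \<in> carrier (L1 C)" "y \<in> carrier (L1 C)" "x \<sqsubseteq>\<^sub>1 a" "y \<sqsubseteq>\<^sub>1 b" for x y
  proof -
    let ?y = "y \<sqinter>\<^sub>1 ls_r C (d.sh x)"
    have yc: "?y \<in> carrier (L1 C)" using xy by simp
    have yb: "?y \<sqsubseteq>\<^sub>1 b" using F1.le_trans[OF F1.meet_left xy(4), of "ls_r C (d.sh x)"] xy ac by simp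
    have "x \<star> y = (a \<sqinter>\<^sub>1 ls_d C (d.sh x)) \<star> y" using d.sectionD(2)[OF sec(1) xy(1,3)] by simp
    also have "\<dots> = a \<star> ?y" using xy ac by (simp add: mult_balance)
    also have "\<dots> = a \<star> (b \<sqinter>\<^sub>1 ls_d C (d.sh ?y))" using d.sectionD(2)[OF sec(3) yc yb] by simp
    also have "\<dots> = (a \<star> b) \<sqinter>\<^sub>1 ls_d C (d.sh ?y)" using yc ac by (simp add: mult_meet_d)
    finally show ?thesis using yc d.sh_closed by blast
  qed
  have r1: "\<exists>w\<in>carrier (L0 C). x \<star> y = (a \<star> b) \<sqinter>\<^sub>1 ls_r C w"
    if xy: "x \<in> carrier (L1 C)" "y \<in> carrier (L1 C)" "x \<sqsubseteq>\<^sub>1 a" "y \<sqsubseteq>\<^sub>1 b" for x y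
  proof -
    let ?x = "x \<sqinter>\<^sub>1 ls_d C (r.sh y)"
    have xc: "?x \<in> carrier (L1 C)" using xy by simp
    have xa: "?x \<sqsubseteq>\<^sub>1 a" using F1.le_trans[OF F1.meet_left xy(3), of "ls_d C (r.sh y)"] xy ac by simp
    have "x \<star> y = x \<star> (b \<sqinter>\<^sub>1 ls_r C (r.sh y))" using r.sectionD(2)[OF sec(4) xy(2,4)] by simp
    also have "\<dots> = ?x \<star> b" using xy ac by (simp add: mult_balance)
    also have "\<dots> = (a \<sqinter>\<^sub>1 ls_r C (r.sh ?x)) \<star> b" using r.sectionD(2)[OF sec(2) xc xa] by simp
    also have "\<dots> = (a \<star> b) \<sqinter>\<^sub>1 ls_r C (r.sh ?x)" using xc ac by (simp add: mult_meet_r)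
    finally show ?thesis using xc r.sh_closed by blast
  qed
  have ab: "a \<star> b \<in> carrier (L1 C)" using ac by simp
  have ex: "\<exists>z\<in>carrier (L0 C). c = (a \<star> b) \<sqinter>\<^sub>1 h z"
    if c: "c \<in> carrier (L1 C)" "c \<sqsubseteq>\<^sub>1 a \<star> b" and h: "h \<in> frame_hom (L0 C) (L1 C)"
      and 1: "\<And>x y. \<lbrakk>x \<in> carrier (L1 C); y \<in> carrier (L1 C); x \<sqsubseteq>\<^sub>1 a; y \<sqsubseteq>\<^sub>1 b\<rbrakk>
        \<Longrightarrow> \<exists>w\<in>carrier (L0 C). x \<star> y = (a \<star> b) \<sqinter>\<^sub>1 h w"
    for c and h :: "'b \<Rightarrow> 'a"
  proof -
    let ?S = "{(x, y). x \<in> carrier (L1 C) \<and> y \<in> carrier (L1 C) \<and> x \<sqsubseteq>\<^sub>1 a \<and> y \<sqsubseteq>\<^sub>1 b \<and> x \<star> y \<sqsubseteq>\<^sub>1 c}"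
    have S: "(\<lambda>(x, y). x \<star> y) ` ?S \<subseteq> carrier (L1 C)" by auto
    let ?W = "{w \<in> carrier (L0 C). (a \<star> b) \<sqinter>\<^sub>1 h w \<sqsubseteq>\<^sub>1 c}"
    let ?z = "\<Squnion>\<^bsub>L0 C\<^esub>?W"
    have W: "?W \<subseteq> carrier (L0 C)" by blast
    have hW: "h ` ?W \<subseteq> carrier (L1 C)" and hW': "(\<lambda>w. (a \<star> b) \<sqinter>\<^sub>1 w) ` h ` ?W \<subseteq> carrier (L1 C)"
      using frame_homD(2)[OF h] ab by auto
    have z: "?z \<in> carrier (L0 C)" using W by simp
    have hz: "h ?z \<in> carrier (L1 C)" using frame_homD(2)[OF h z] .
    have eq: "(a \<star> b) \<sqinter>\<^sub>1 h ?z = \<Squnion>\<^sub>1((\<lambda>w. (a \<star> b) \<sqinter>\<^sub>1 w) ` h ` ?W)"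
      using frame_homD(3)[OF h W] F1.meet_Sup_distrib[OF ab hW] by simp
    have "c = (a \<star> b) \<sqinter>\<^sub>1 h ?z"
    proof (rule F1.le_antisym)
      show "(a \<star> b) \<sqinter>\<^sub>1 h ?z \<sqsubseteq>\<^sub>1 c" unfolding eq F1.Sup_le_iff[OF hW' c(1)] by blast
      have v_le: "v \<sqsubseteq>\<^sub>1 (a \<star> b) \<sqinter>\<^sub>1 h ?z" if "v \<in> (\<lambda>(x, y). x \<star> y) ` ?S" for v
      proof -
        obtain x y where v: "v = x \<star> y" and xy: "x \<in> carrier (L1 C)" "y \<in> carrier (L1 C)"
          "x \<sqsubseteq>\<^sub>1 a" "y \<sqsubseteq>\<^sub>1 b" "x \<star> y \<sqsubseteq>\<^sub>1 c" using \<open>v \<in> _\<close> by auto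
        obtain w where w: "w \<in> carrier (L0 C)" "x \<star> y = (a \<star> b) \<sqinter>\<^sub>1 h w" using 1[OF xy(1-4)] by blast
        then have "v \<in> (\<lambda>w. (a \<star> b) \<sqinter>\<^sub>1 w) ` h ` ?W" using v xy(5) by auto
        then show ?thesis unfolding eq by (rule F1.sup_upper[OF hW'])
      qed
      have "\<Squnion>\<^sub>1((\<lambda>(x, y). x \<star> y) ` ?S) \<sqsubseteq>\<^sub>1 (a \<star> b) \<sqinter>\<^sub>1 h ?z"
        by (rule F1.sup_least[OF S _ v_le]) (use ab hz in simp)
      then show "c \<sqsubseteq>\<^sub>1 (a \<star> b) \<sqinter>\<^sub>1 h ?z" using below_mult[OF ac c] by simp
    qed (use c ab hz in auto)
    then show ?thesis using z by blast
  qed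
  have "d.sect (a \<star> b)"
  proof (rule d.sectionI[OF ab])
    fix c assume "c \<in> carrier (L1 C)" "c \<sqsubseteq>\<^sub>1 a \<star> b"
    then show "\<exists>z\<in>carrier (L0 C). c = (a \<star> b) \<sqinter>\<^sub>1 ls_d C z"
      by (rule ex[OF _ _ d.hom]) (rule d1)
  qed
  moreover have "r.sect (a \<star> b)"
  proof (rule r.sectionI[OF ab])
    fix c assume "c \<in> carrier (L1 C)" "c \<sqsubseteq>\<^sub>1 a \<star> b"
    then show "\<exists>z\<in>carrier (L0 C). c = (a \<star> b) \<sqinter>\<^sub>1 ls_r C z"
      by (rule ex[OF _ _ r.hom]) (rule r1)
  qed
  ultimately show ?thesis by (simp add: bisection_iff)
qed

lemma lam_eq: "\<lambda>\<^sub>q\<^bsub>quantal_of C\<^esub> a = u.sh (d.sh a)" and rho_eq: "\<rho>\<^sub>q\<^bsub>quantal_of C\<^esub> a = u.sh (r.sh a)"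
  by (simp_all add: quantal_of_def)

text \<open>
  Multiplication by \<open>u\<^sub>!(z)\<close> is restriction to \<open>z\<close>. This reduces the axioms for \<open>\<lambda>\<close> and
  \<open>\<rho>\<close> to \<open>a \<le> d\<^sup>*(d\<^sub>!(a))\<close>, \<open>a \<le> r\<^sup>*(r\<^sub>!(a))\<close> and the formulas for \<open>d\<^sub>!(ab)\<close> and
  \<open>r\<^sub>!(ab)\<close>.
\<close>

theorem restriction_quantal_frame_quantal_of: "restriction_quantal_frame (quantal_of C)"
proof -
  interpret Q: frame "quantal_of C" by (rule frame_cong_order[OF frame1]) simp_all
  note simps = lam_eq rho_eq qunit_eq
  show ?thesis
  proof (intro restriction_quantal_frame.intro ehresmann_quantal_frame.intro
      ehresmann_quantal_frame_axioms.intro restriction_quantal_frame_axioms.intro)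
    show "frame (quantal_of C)" by (rule Q.frame_axioms)
    show "monoid \<lparr>carrier = carrier (quantal_of C), monoid.mult = (\<odot>\<^bsub>quantal_of C\<^esub>), one = \<e>\<^bsub>quantal_of C\<^esub>\<rparr>"
      by (rule monoidI) (simp_all add: qunit_eq mult_assoc mult_E E_mult)
    show "a \<star> \<Squnion>\<^bsub>quantal_of C\<^esub>S = \<Squnion>\<^bsub>quantal_of C\<^esub>((\<lambda>s. a \<star> s) ` S)"
      if "a \<in> carrier (quantal_of C)" "S \<subseteq> carrier (quantal_of C)" for a S
      using that by (simp add: mult_Sup)
    show "\<Squnion>\<^bsub>quantal_of C\<^esub>S \<star> a = \<Squnion>\<^bsub>quantal_of C\<^esub>((\<lambda>s. s \<star> a) ` S)"
      if "a \<in> carrier (quantal_of C)" "S \<subseteq> carrier (quantal_of C)" for a S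
      using that by (simp add: Sup_mult)
    show "\<lambda>\<^sub>q\<^bsub>quantal_of C\<^esub> a \<in> carrier (quantal_of C) \<and> \<lambda>\<^sub>q\<^bsub>quantal_of C\<^esub> a \<sqsubseteq>\<^bsub>quantal_of C\<^esub> \<e>\<^bsub>quantal_of C\<^esub>"
      "\<rho>\<^sub>q\<^bsub>quantal_of C\<^esub> a \<in> carrier (quantal_of C) \<and> \<rho>\<^sub>q\<^bsub>quantal_of C\<^esub> a \<sqsubseteq>\<^bsub>quantal_of C\<^esub> \<e>\<^bsub>quantal_of C\<^esub>"
      if "a \<in> carrier (quantal_of C)" for a
      using that u_sh_le_E by (simp_all add: simps)
    show "\<lambda>\<^sub>q\<^bsub>quantal_of C\<^esub> (\<Squnion>\<^bsub>quantal_of C\<^esub>S) = \<Squnion>\<^bsub>quantal_of C\<^esub>(qlam (quantal_of C) ` S)"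
      if "S \<subseteq> carrier (quantal_of C)" for S
    proof -
      have S: "S \<subseteq> carrier (L1 C)" "d.sh ` S \<subseteq> carrier (L0 C)" using that by auto
      show ?thesis using u.sh_Sup[OF S(2)] d.sh_Sup[OF S(1)] by (simp add: simps image_image)
    qed
    show "\<rho>\<^sub>q\<^bsub>quantal_of C\<^esub> (\<Squnion>\<^bsub>quantal_of C\<^esub>S) = \<Squnion>\<^bsub>quantal_of C\<^esub>(qrho (quantal_of C) ` S)"
      if "S \<subseteq> carrier (quantal_of C)" for S
    proof -
      have S: "S \<subseteq> carrier (L1 C)" "r.sh ` S \<subseteq> carrier (L0 C)" using that by auto
      show ?thesis using u.sh_Sup[OF S(2)] r.sh_Sup[OF S(1)] by (simp add: simps image_image)
    qed
    show "\<lambda>\<^sub>q\<^bsub>quantal_of C\<^esub> a = a \<and> \<rho>\<^sub>q\<^bsub>quantal_of C\<^esub> a = a"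
      if "a \<in> carrier (quantal_of C)" "a \<sqsubseteq>\<^bsub>quantal_of C\<^esub> \<e>\<^bsub>quantal_of C\<^esub>" for a
    proof -
      have a: "u.sh (ls_u C a) = a" using that by (simp add: below_E simps)
      have "ls_u C a \<in> carrier (L0 C)" using that by simp
      then have "d.sh a = ls_u C a" "r.sh a = ls_u C a"
        using d_sh_u_sh[of "ls_u C a"] r_sh_u_sh[of "ls_u C a"] a by simp_all
      then show ?thesis using a by (simp add: simps)
    qed
    show "\<rho>\<^sub>q\<^bsub>quantal_of C\<^esub> a \<star> a = a" if "a \<in> carrier (quantal_of C)" for a
      using that by (simp add: simps u_sh_mult F1.meet_absorb r.le_f_sh)
    show "a \<star> \<lambda>\<^sub>q\<^bsub>quantal_of C\<^esub> a = a" if "a \<in> carrier (quantal_of C)" for a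
      using that by (simp add: simps mult_u_sh F1.meet_absorb d.le_f_sh)
    show "\<lambda>\<^sub>q\<^bsub>quantal_of C\<^esub> (a \<star> b) = \<lambda>\<^sub>q\<^bsub>quantal_of C\<^esub> (\<lambda>\<^sub>q\<^bsub>quantal_of C\<^esub> a \<star> b)"
      if "a \<in> carrier (quantal_of C)" "b \<in> carrier (quantal_of C)" for a b
      using that by (simp add: simps u_sh_mult d_sh_mult)
    show "\<rho>\<^sub>q\<^bsub>quantal_of C\<^esub> (a \<star> b) = \<rho>\<^sub>q\<^bsub>quantal_of C\<^esub> (a \<star> \<rho>\<^sub>q\<^bsub>quantal_of C\<^esub> b)"
      if "a \<in> carrier (quantal_of C)" "b \<in> carrier (quantal_of C)" for a b
      using that by (simp add: simps mult_u_sh r_sh_mult)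
    show "\<exists>S\<subseteq>local_bisections C. \<top>\<^bsub>quantal_of C\<^esub> = \<Squnion>\<^bsub>quantal_of C\<^esub>S"
      using Sup_bisections[OF F1.top_closed]
      by (intro exI[of _ "{c \<in> local_bisections C. c \<sqsubseteq>\<^sub>1 \<top>\<^bsub>L1 C\<^esub>}"]) auto
    show "a \<star> b \<in> local_bisections C" if "a \<in> local_bisections C" "b \<in> local_bisections C" for a b
      using that by (rule bisection_mult)
  qed
qed

end

section \<open>The category \<open>EL\<^sub>k\<close>\<close>

lemma EL_homI:
  assumes L: "etale_localic_category L" and M: "etale_localic_category M"
    and "h \<in> carrier (L1 M) \<rightarrow>\<^sub>E carrier (L1 L)"
    and "\<And>A. A \<subseteq> carrier (L1 M) \<Longrightarrow> h (\<Squnion>\<^bsub>L1 M\<^esub>A) = \<Squnion>\<^bsub>L1 L\<^esub>(h ` A)"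
    and "\<And>a b. \<lbrakk>a \<in> carrier (L1 M); b \<in> carrier (L1 M)\<rbrakk> \<Longrightarrow> h (a \<star>\<^bsub>M\<^esub> b) = h a \<star>\<^bsub>L\<^esub> h b"
    and "h \<e>\<^bsub>quantal_of M\<^esub> = \<e>\<^bsub>quantal_of L\<^esub>"
    and "\<And>a. a \<in> carrier (L1 M) \<Longrightarrow> h (\<lambda>\<^sub>q\<^bsub>quantal_of M\<^esub> a) = \<lambda>\<^sub>q\<^bsub>quantal_of L\<^esub> (h a)"
    and "\<And>a. a \<in> carrier (L1 M) \<Longrightarrow> h (\<rho>\<^sub>q\<^bsub>quantal_of M\<^esub> a) = \<rho>\<^sub>q\<^bsub>quantal_of L\<^esub> (h a)"
    and "\<And>a. a \<in> local_bisections M \<Longrightarrow> h a \<in> local_bisections L"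
    and "k \<in> {2, 4} \<Longrightarrow> h \<top>\<^bsub>L1 M\<^esub> = \<top>\<^bsub>L1 L\<^esub>"
    and "\<And>a b. \<lbrakk>k \<in> {3, 4}; a \<in> carrier (L1 M); b \<in> carrier (L1 M)\<rbrakk> \<Longrightarrow> h (a \<sqinter>\<^bsub>L1 M\<^esub> b) = h a \<sqinter>\<^bsub>L1 L\<^esub> h b"
  shows "h \<in> EL_hom k L M"
proof -
  interpret L: etale_localic L by (rule etale_localic.intro[OF L])
  interpret M: etale_localic M by (rule etale_localic.intro[OF M])
  show ?thesis
    unfolding EL_hom_def rqf_hom_def quantal_of_order
    by (intro CollectI conjI L.restriction_quantal_frame_quantal_of M.restriction_quantal_frame_quantal_of
        allI ballI impI image_subsetI; fact assms)
qed

lemma EL_homD: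
  assumes "h \<in> EL_hom k L M"
  shows "h \<in> carrier (L1 M) \<rightarrow>\<^sub>E carrier (L1 L)"
    and "A \<subseteq> carrier (L1 M) \<Longrightarrow> h (\<Squnion>\<^bsub>L1 M\<^esub>A) = \<Squnion>\<^bsub>L1 L\<^esub>(h ` A)"
    and "\<lbrakk>a \<in> carrier (L1 M); b \<in> carrier (L1 M)\<rbrakk> \<Longrightarrow> h (a \<star>\<^bsub>M\<^esub> b) = h a \<star>\<^bsub>L\<^esub> h b"
    and "h \<e>\<^bsub>quantal_of M\<^esub> = \<e>\<^bsub>quantal_of L\<^esub>"
    and "a \<in> carrier (L1 M) \<Longrightarrow> h (\<lambda>\<^sub>q\<^bsub>quantal_of M\<^esub> a) = \<lambda>\<^sub>q\<^bsub>quantal_of L\<^esub> (h a)"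
    and "a \<in> carrier (L1 M) \<Longrightarrow> h (\<rho>\<^sub>q\<^bsub>quantal_of M\<^esub> a) = \<rho>\<^sub>q\<^bsub>quantal_of L\<^esub> (h a)"
    and "a \<in> local_bisections M \<Longrightarrow> h a \<in> local_bisections L"
    and "k \<in> {2, 4} \<Longrightarrow> h \<top>\<^bsub>L1 M\<^esub> = \<top>\<^bsub>L1 L\<^esub>"
    and "\<lbrakk>k \<in> {3, 4}; a \<in> carrier (L1 M); b \<in> carrier (L1 M)\<rbrakk> \<Longrightarrow> h (a \<sqinter>\<^bsub>L1 M\<^esub> b) = h a \<sqinter>\<^bsub>L1 L\<^esub> h b"
    and "a \<in> carrier (L1 M) \<Longrightarrow> h a \<in> carrier (L1 L)"
  using assms unfolding EL_hom_def rqf_hom_def quantal_of_order by (simp_all add: image_subset_iff, auto)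

lemma EL_id_hom:
  assumes L: "etale_localic_category L"
  shows "EL_id L \<in> EL_hom k L L"
proof -
  interpret L: etale_localic L by (rule etale_localic.intro[OF L])
  have im: "EL_id L ` A = A" if "A \<subseteq> carrier (L1 L)" for A
    using that unfolding EL_id_def by force
  have app: "EL_id L a = a" if "a \<in> carrier (L1 L)" for a using that by (simp add: EL_id_def)
  show ?thesis
  proof (rule EL_homI[OF L L])
    show "EL_id L \<in> carrier (L1 L) \<rightarrow>\<^sub>E carrier (L1 L)" by (auto simp: EL_id_def)
  qed (simp_all add: im app L.qunit_eq L.lam_eq L.rho_eq L.bisection_closed)
qed

lemma EL_comp_hom:
  assumes L: "etale_localic_category L" and M: "etale_localic_category M" and N: "etale_localic_category N"
    and f: "f \<in> EL_hom k L M" and g: "g \<in> EL_hom k M N"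
  shows "EL_comp N g f \<in> EL_hom k L N"
proof -
  interpret M: etale_localic M by (rule etale_localic.intro[OF M])
  interpret N: etale_localic N by (rule etale_localic.intro[OF N])
  note F = EL_homD[OF f] and G = EL_homD[OF g]
  have app: "EL_comp N g f a = f (g a)" if "a \<in> carrier (L1 N)" for a
    using that by (simp add: EL_comp_def compose_def)
  have im: "EL_comp N g f ` A = f ` g ` A" "g ` A \<subseteq> carrier (L1 M)" if "A \<subseteq> carrier (L1 N)" for A
    using that G(10) app by (auto simp: image_image subset_iff intro!: image_cong)
  show ?thesis
  proof (rule EL_homI[OF L N])
    show "EL_comp N g f \<in> carrier (L1 N) \<rightarrow>\<^sub>E carrier (L1 L)"
      using F(10) G(10) by (auto simp: EL_comp_def compose_def)
    show "EL_comp N g f (\<Squnion>\<^bsub>L1 N\<^esub>A) = \<Squnion>\<^bsub>L1 L\<^esub>(EL_comp N g f ` A)" if "A \<subseteq> carrier (L1 N)" for A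
      using that F(2) G(2) by (simp add: app im)
    show "EL_comp N g f (a \<star>\<^bsub>N\<^esub> b) = EL_comp N g f a \<star>\<^bsub>L\<^esub> EL_comp N g f b"
      if "a \<in> carrier (L1 N)" "b \<in> carrier (L1 N)" for a b
      using that F(3) G(3,10) by (simp add: app)
    show "EL_comp N g f \<e>\<^bsub>quantal_of N\<^esub> = \<e>\<^bsub>quantal_of L\<^esub>"
      using F(4) G(4) app[of "\<e>\<^bsub>quantal_of N\<^esub>"] by (simp add: N.qunit_eq)
    show "EL_comp N g f (\<lambda>\<^sub>q\<^bsub>quantal_of N\<^esub> a) = \<lambda>\<^sub>q\<^bsub>quantal_of L\<^esub> (EL_comp N g f a)"
      if "a \<in> carrier (L1 N)" for a
      using that F(5)[of "g a"] G(5)[of a] G(10)[of a] app[of "\<lambda>\<^sub>q\<^bsub>quantal_of N\<^esub> a"] app[of a] by (simp add: N.lam_eq)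
    show "EL_comp N g f (\<rho>\<^sub>q\<^bsub>quantal_of N\<^esub> a) = \<rho>\<^sub>q\<^bsub>quantal_of L\<^esub> (EL_comp N g f a)"
      if "a \<in> carrier (L1 N)" for a
      using that F(6)[of "g a"] G(6)[of a] G(10)[of a] app[of "\<rho>\<^sub>q\<^bsub>quantal_of N\<^esub> a"] app[of a] by (simp add: N.rho_eq)
    show "EL_comp N g f a \<in> local_bisections L" if "a \<in> local_bisections N" for a
      using F(7)[OF G(7)[OF that]] app[OF N.bisection_closed[OF that]] by simp
    show "EL_comp N g f \<top>\<^bsub>L1 N\<^esub> = \<top>\<^bsub>L1 L\<^esub>" if "k \<in> {2, 4}"
      using F(8)[OF that] G(8)[OF that] by (simp add: app)
    show "EL_comp N g f (a \<sqinter>\<^bsub>L1 N\<^esub> b) = EL_comp N g f a \<sqinter>\<^bsub>L1 L\<^esub> EL_comp N g f b"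
      if "k \<in> {3, 4}" "a \<in> carrier (L1 N)" "b \<in> carrier (L1 N)" for a b
      using that F(9)[OF that(1)] G(9)[OF that(1)] G(10) by (simp add: app)
  qed
qed

lemma EL_comp_id:
  assumes "f \<in> EL_hom k L M"
  shows "EL_comp M f (EL_id L) = f" "EL_comp M (EL_id M) f = f"
proof -
  note F = EL_homD(1,10)[OF assms]
  have ext: "f \<in> extensional (carrier (L1 M))" using F(1) by (simp add: PiE_def)
  show "EL_comp M f (EL_id L) = f" "EL_comp M (EL_id M) f = f"
    by (rule extensionalityI[OF _ ext];
        use F(2) in \<open>simp add: EL_comp_def EL_id_def compose_def\<close>)+
qed

lemma EL_comp_assoc:
  assumes "h \<in> EL_hom k N R"
  shows "EL_comp R h (EL_comp N g f) = EL_comp R (EL_comp R h g) f"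
  using EL_homD(10)[OF assms] by (auto simp: EL_comp_def compose_def fun_eq_iff restrict_def)

section \<open>Frames of opens\<close>

lemma set_frame_opens: "set_frame {U. openin X U} Union"
  by unfold_locales (auto intro: openin_Union)

lemma carrier_opens [simp]: "carrier (opens X) = {U. openin X U}" and le_opens [simp]: "le (opens X) = (\<subseteq>)"
  by (simp_all add: opens_def)

lemma frame_opens: "frame (opens X)"
  unfolding opens_def by (rule set_frame.frame[OF set_frame_opens])

lemma Sup_opens: "A \<subseteq> {U. openin X U} \<Longrightarrow> \<Squnion>\<^bsub>opens X\<^esub>A = \<Union>A"
  unfolding opens_def by (rule set_frame.Sup_eq[OF set_frame_opens])

lemma meet_opens: "\<lbrakk>openin X U; openin X V\<rbrakk> \<Longrightarrow> U \<sqinter>\<^bsub>opens X\<^esub> V = U \<inter> V"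
  unfolding opens_def by (rule set_frame.meet_eq[OF set_frame_opens]) simp_all

lemma top_opens: "\<top>\<^bsub>opens X\<^esub> = topspace X"
  unfolding opens_def by (rule set_frame.top_eq[OF set_frame_opens]) (auto dest: openin_subset)

lemma opens_map_apply: "openin Y V \<Longrightarrow> opens_map X Y f V = {x \<in> topspace X. f x \<in> V}"
  by (simp add: opens_map_def)

lemma opens_map_hom:
  assumes f: "continuous_map X Y f"
  shows "opens_map X Y f \<in> frame_hom (opens Y) (opens X)"
proof -
  have op: "openin X {x \<in> topspace X. f x \<in> V}" if "openin Y V" for V
    using openin_continuous_map_preimage[OF f that] .
  show ?thesis
    unfolding frame_hom_def
  proof (intro CollectI conjI allI ballI impI)
    show "opens_map X Y f \<in> carrier (opens Y) \<rightarrow>\<^sub>E carrier (opens X)"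
      using op by (auto simp: opens_map_def)
    show "opens_map X Y f (\<Squnion>\<^bsub>opens Y\<^esub>A) = \<Squnion>\<^bsub>opens X\<^esub>(opens_map X Y f ` A)" if "A \<subseteq> carrier (opens Y)" for A
    proof -
      have A: "A \<subseteq> {U. openin Y U}" using that by simp
      have im: "opens_map X Y f ` A = (\<lambda>V. {x \<in> topspace X. f x \<in> V}) ` A"
        by (rule image_cong[OF refl]) (use A in \<open>simp add: opens_map_apply subset_iff\<close>)
      have "opens_map X Y f ` A \<subseteq> {U. openin X U}" unfolding im using A op by blast
      moreover have "openin Y (\<Union>A)" using A by blast
      ultimately show ?thesis using A unfolding im by (auto simp: Sup_opens opens_map_apply)
    qed
    show "opens_map X Y f \<top>\<^bsub>opens Y\<^esub> = \<top>\<^bsub>opens X\<^esub>"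
      using continuous_map_funspace[OF f] by (auto simp: top_opens opens_map_apply)
    show "opens_map X Y f (U \<sqinter>\<^bsub>opens Y\<^esub> V) = opens_map X Y f U \<sqinter>\<^bsub>opens X\<^esub> opens_map X Y f V"
      if "U \<in> carrier (opens Y)" "V \<in> carrier (opens Y)" for U V
      using that op by (auto simp: meet_opens opens_map_apply openin_Int)
  qed
qed

lemma
  assumes f: "continuous_map X Y f" "open_map X Y f"
  shows open_loc_opens: "open_loc (opens X) (opens Y) (opens_map X Y f)"
    and left_adj_opens: "openin X U \<Longrightarrow> left_adj (opens X) (opens Y) (opens_map X Y f) U = f ` U"
proof -
  note hom = opens_map_hom[OF f(1)]
  have im: "openin Y (f ` U)" if "openin X U" for U using f(2) that by (simp add: open_map_def)
  note loc = open_locI[OF frame_opens frame_opens hom, where l = "\<lambda>U. f ` U"]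
  have adj: "f ` U \<sqsubseteq>\<^bsub>opens Y\<^esub> V \<longleftrightarrow> U \<sqsubseteq>\<^bsub>opens X\<^esub> opens_map X Y f V"
    if "U \<in> carrier (opens X)" "V \<in> carrier (opens Y)" for U V
    using that openin_subset[of X U] by (auto simp: opens_map_apply)
  have frob: "f ` (U \<sqinter>\<^bsub>opens X\<^esub> opens_map X Y f V) = f ` U \<sqinter>\<^bsub>opens Y\<^esub> V"
    if "U \<in> carrier (opens X)" "V \<in> carrier (opens Y)" for U V
  proof -
    have "openin X (opens_map X Y f V)" using frame_homD(2)[OF hom that(2)] by simp
    then show ?thesis
      using that openin_subset[of X U] im[of U] by (auto simp: meet_opens opens_map_apply)
  qed
  show "open_loc (opens X) (opens Y) (opens_map X Y f)"
    by (rule loc(1)[OF _ adj frob]) (use im in simp_all)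
  show "left_adj (opens X) (opens Y) (opens_map X Y f) U = f ` U" if "openin X U"
    by (rule loc(2)[OF _ adj frob]) (use im that in simp_all)
qed

lemma etale_loc_opens:
  assumes f: "local_homeomorphism X Y f"
  shows "etale_loc (opens X) (opens Y) (opens_map X Y f)"
  unfolding etale_loc_def
proof (intro conjI exI ballI)
  note cont = local_homeomorphism_continuous[OF f] and open_f = local_homeomorphism_open_map[OF f]
  show "open_loc (opens X) (opens Y) (opens_map X Y f)" by (rule open_loc_opens[OF cont open_f])
  let ?B = "{U. openin X U \<and> inj_on f U}"
  show "?B \<subseteq> carrier (opens X)" by auto
  have "\<Union>?B = topspace X"
    using local_homeomorphism_inj[OF f] by (auto dest: openin_subset)
  moreover have "?B \<subseteq> {U. openin X U}" by blast
  ultimately show "\<Squnion>\<^bsub>opens X\<^esub>?B = \<top>\<^bsub>opens X\<^esub>" by (simp only: Sup_opens top_opens)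
  fix U assume "U \<in> ?B"
  then have U: "openin X U" "inj_on f U" by auto
  have pre: "openin X (opens_map X Y f V)" if "openin Y V" for V
    using frame_homD(2)[OF opens_map_hom[OF cont], of V] that by simp
  show "(\<lambda>V. opens_map X Y f V \<sqinter>\<^bsub>opens X\<^esub> U) ` carrier (opens Y) = {A \<in> carrier (opens X). A \<sqsubseteq>\<^bsub>opens X\<^esub> U}"
  proof (intro equalityI subsetI)
    fix A assume "A \<in> (\<lambda>V. opens_map X Y f V \<sqinter>\<^bsub>opens X\<^esub> U) ` carrier (opens Y)"
    then obtain V where V: "openin Y V" "A = opens_map X Y f V \<sqinter>\<^bsub>opens X\<^esub> U" by auto
    then have "A = opens_map X Y f V \<inter> U" using pre[OF V(1)] U(1) by (simp add: meet_opens)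
    then show "A \<in> {A \<in> carrier (opens X). A \<sqsubseteq>\<^bsub>opens X\<^esub> U}" using pre[OF V(1)] U(1) by auto
  next
    fix A assume "A \<in> {A \<in> carrier (opens X). A \<sqsubseteq>\<^bsub>opens X\<^esub> U}"
    then have A: "openin X A" "A \<subseteq> U" by auto
    have fA: "openin Y (f ` A)" using open_f A(1) by (simp add: open_map_def)
    have "A = opens_map X Y f (f ` A) \<inter> U"
      using A U(2) openin_subset[OF A(1)] by (auto simp: opens_map_apply[OF fA] inj_on_def)
    then show "A \<in> (\<lambda>V. opens_map X Y f V \<sqinter>\<^bsub>opens X\<^esub> U) ` carrier (opens Y)"
      using fA pre[OF fA] U(1) by (intro image_eqI[of _ _ "f ` A"]) (simp_all add: meet_opens)
  qed
qed

lemma etale_frame_map_opens: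
  assumes f: "local_homeomorphism X Y f"
  shows "etale_frame_map (opens X) (opens Y) (opens_map X Y f)"
  by (intro etale_frame_map.intro open_frame_map.intro open_frame_map_axioms.intro
      etale_frame_map_axioms.intro frame_opens etale_loc_opens[OF f]
      open_loc_opens[OF local_homeomorphism_continuous[OF f] local_homeomorphism_open_map[OF f]])

text \<open>
  If \<open>U\<close> is a section and \<open>f(x) = f(y)\<close> in \<open>U\<close>, take a neighbourhood \<open>W\<close> of \<open>x\<close> on which \<open>f\<close>
  is injective: \<open>U \<inter> W\<close> is the restriction of \<open>U\<close> to \<open>f(U \<inter> W)\<close>, so it contains \<open>y\<close>.
\<close>

lemma sect_opens_iff:
  assumes f: "local_homeomorphism X Y f"
  shows "etale_frame_map.sect (opens X) (opens Y) (opens_map X Y f) U \<longleftrightarrow> openin X U \<and> inj_on f U"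
proof -
  note cont = local_homeomorphism_continuous[OF f] and open_f = local_homeomorphism_open_map[OF f]
  interpret F: etale_frame_map "opens X" "opens Y" "opens_map X Y f"
    by (rule etale_frame_map_opens[OF f])
  have res: "U \<sqinter>\<^bsub>opens X\<^esub> opens_map X Y f (F.sh V) = {x \<in> U. f x \<in> f ` V}"
    if "openin X U" "openin X V" for V
  proof -
    have fV: "openin Y (f ` V)" using open_f that(2) by (simp add: open_map_def)
    then have "openin X (opens_map X Y f (f ` V))" using F.f_closed[of "f ` V"] by simp
    then show ?thesis
      using that fV openin_subset[OF that(1)] by (auto simp: left_adj_opens[OF cont open_f] meet_opens opens_map_apply)
  qed
  show ?thesis
  proof
    assume s: "F.sect U"
    have U: "openin X U" using F.sectionD(1)[OF s] by simp
    have "x = y" if xy: "x \<in> U" "y \<in> U" "f x = f y" for x y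
    proof -
      obtain W where W: "openin X W" "x \<in> W" "inj_on f W"
        using local_homeomorphism_inj[OF f, of x] xy(1) openin_subset[OF U] by blast
      let ?V = "U \<inter> W"
      have V: "openin X ?V" using U W(1) by blast
      have "U \<sqinter>\<^bsub>opens X\<^esub> opens_map X Y f (F.sh ?V) = ?V"
        by (rule F.sectionD(2)[OF s]) (use V in simp_all)
      then have "{z \<in> U. f z \<in> f ` ?V} = ?V" unfolding res[OF U V] .
      moreover have "f y \<in> f ` ?V" using xy W(2) by (intro image_eqI[of _ _ x]) auto
      moreover note xy(2)
      ultimately have "y \<in> W" by blast
      then show ?thesis using W xy(3) by (simp add: inj_on_def)
    qed
    then show "openin X U \<and> inj_on f U" using U by (simp add: inj_on_def)
  next
    assume U: "openin X U \<and> inj_on f U"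
    have "V = {x \<in> U. f x \<in> f ` V}" if "V \<subseteq> U" for V
      using U that by (auto simp: inj_on_def)
    then show "F.sect U" unfolding F.sect_def using U res by simp
  qed
qed

section \<open>Etale topological categories\<close>

locale topological_cat =
  fixes C :: "('a, 'b) top_cat"
  assumes category: "topological_category C"
    and lh_d: "local_homeomorphism (T1 C) (T0 C) (ts_d C)"
    and lh_r: "local_homeomorphism (T1 C) (T0 C) (ts_r C)"
begin

lemma
  shows cont_u: "continuous_map (T0 C) (T1 C) (ts_u C)"
    and cont_d: "continuous_map (T1 C) (T0 C) (ts_d C)"
    and cont_r: "continuous_map (T1 C) (T0 C) (ts_r C)"
    and cont_m: "continuous_map (T2 C) (T1 C) (ts_m C)"
  using category by (auto simp: topological_category_def)

lemma topspace_T2: "topspace (T2 C) = composable C"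
  by (auto simp: T2_def composable_def)

lemma composable_iff [simp]:
  "(a, b) \<in> composable C \<longleftrightarrow> a \<in> topspace (T1 C) \<and> b \<in> topspace (T1 C) \<and> ts_d C a = ts_r C b"
  by (simp add: composable_def)

lemma
  shows u_in [simp]: "x \<in> topspace (T0 C) \<Longrightarrow> ts_u C x \<in> topspace (T1 C)"
    and d_in [simp]: "a \<in> topspace (T1 C) \<Longrightarrow> ts_d C a \<in> topspace (T0 C)"
    and r_in [simp]: "a \<in> topspace (T1 C) \<Longrightarrow> ts_r C a \<in> topspace (T0 C)"
  using continuous_map_funspace[OF cont_u] continuous_map_funspace[OF cont_d]
    continuous_map_funspace[OF cont_r] by auto

lemma m_in [simp]: "\<lbrakk>a \<in> topspace (T1 C); b \<in> topspace (T1 C); ts_d C a = ts_r C b\<rbrakk>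
    \<Longrightarrow> ts_m C (a, b) \<in> topspace (T1 C)"
  using continuous_map_funspace[OF cont_m] unfolding topspace_T2
  by (metis composable_iff funcset_mem)

lemma
  shows d_u [simp]: "x \<in> topspace (T0 C) \<Longrightarrow> ts_d C (ts_u C x) = x"
    and r_u [simp]: "x \<in> topspace (T0 C) \<Longrightarrow> ts_r C (ts_u C x) = x"
    and m_u_right [simp]: "a \<in> topspace (T1 C) \<Longrightarrow> ts_m C (a, ts_u C (ts_d C a)) = a"
    and m_u_left [simp]: "a \<in> topspace (T1 C) \<Longrightarrow> ts_m C (ts_u C (ts_r C a), a) = a"
  using category by (auto simp: topological_category_def)

lemma
  assumes "a \<in> topspace (T1 C)" "b \<in> topspace (T1 C)" "ts_d C a = ts_r C b"
  shows d_m [simp]: "ts_d C (ts_m C (a, b)) = ts_d C b"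
    and r_m [simp]: "ts_r C (ts_m C (a, b)) = ts_r C a"
proof -
  have "(a, b) \<in> composable C" using assms by simp
  then show "ts_d C (ts_m C (a, b)) = ts_d C b" "ts_r C (ts_m C (a, b)) = ts_r C a"
    using category unfolding topological_category_def by blast+
qed

lemma m_assoc:
  assumes "a \<in> topspace (T1 C)" "b \<in> topspace (T1 C)" "c \<in> topspace (T1 C)"
    "ts_d C a = ts_r C b" "ts_d C b = ts_r C c"
  shows "ts_m C (ts_m C (a, b), c) = ts_m C (a, ts_m C (b, c))"
proof -
  have "(a, b) \<in> composable C" "(b, c) \<in> composable C" using assms by simp_all
  then show ?thesis using category unfolding topological_category_def by blast
qed

lemma T2_nbhd:
  assumes "openin (T2 C) W" "(a, b) \<in> W"
  obtains X Y where "openin (T1 C) X" "openin (T1 C) Y" "a \<in> X" "b \<in> Y" "X \<times> Y \<inter> composable C \<subseteq> W"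
proof -
  obtain V where V: "openin (prod_topology (T1 C) (T1 C)) V" "W = V \<inter> composable C"
    using assms(1) unfolding T2_def openin_subtopology by blast
  then obtain X Y where "openin (T1 C) X" "openin (T1 C) Y" "a \<in> X" "b \<in> Y" "X \<times> Y \<subseteq> V"
    using assms(2) openin_prod_topology_alt[of "T1 C" "T1 C" V] by blast
  then show thesis using V(2) by (intro that) auto
qed

lemma openin_T2_box: "\<lbrakk>openin (T1 C) X; openin (T1 C) Y\<rbrakk> \<Longrightarrow> openin (T2 C) (X \<times> Y \<inter> composable C)"
  unfolding T2_def openin_subtopology by (blast intro: openin_prod_Times_iff[THEN iffD2])

text \<open>
  Where \<open>d\<close> is injective, openness of \<open>df\<close> gives openness of \<open>f\<close>. This applies to \<open>u\<close> and \<open>m\<close>,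
  because \<open>du = 1\<close> and \<open>dm = d\<pi>\<^sub>2\<close> are open.
\<close>

lemma open_map_by_d:
  assumes f: "continuous_map X (T1 C) f"
    and df: "\<And>V. openin X V \<Longrightarrow> openin (T0 C) (ts_d C ` f ` V)"
  shows "open_map X (T1 C) f"
  unfolding open_map_def
proof (intro allI impI)
  fix W assume W: "openin X W"
  show "openin (T1 C) (f ` W)"
  proof (subst openin_subopen, rule ballI)
    fix y assume "y \<in> f ` W"
    then obtain w where w: "w \<in> W" "y = f w" by blast
    have "y \<in> topspace (T1 C)" using w openin_subset[OF W] continuous_map_funspace[OF f] by auto
    then obtain U where U: "openin (T1 C) U" "y \<in> U" "inj_on (ts_d C) U"
      using local_homeomorphism_inj[OF lh_d] by blast
    define V where "V = W \<inter> {x \<in> topspace X. f x \<in> U}"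
    have V: "openin X V" unfolding V_def
      using W openin_continuous_map_preimage[OF f U(1)] by blast
    have VU: "f ` V \<subseteq> U" by (auto simp: V_def)
    let ?N = "U \<inter> {s \<in> topspace (T1 C). ts_d C s \<in> ts_d C ` f ` V}"
    have "openin (T1 C) ?N"
      using U(1) openin_continuous_map_preimage[OF cont_d df[OF V]] by blast
    moreover have "?N = f ` V"
      using VU U(3) openin_subset[OF U(1)] by (auto simp: inj_on_def subset_iff)
    moreover have "y \<in> f ` V" using w U(2) openin_subset[OF W] by (auto simp: V_def)
    moreover have "f ` V \<subseteq> f ` W" by (auto simp: V_def)
    ultimately show "\<exists>T. openin (T1 C) T \<and> y \<in> T \<and> T \<subseteq> f ` W" by metis
  qed
qed

lemma open_u: "open_map (T0 C) (T1 C) (ts_u C)"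
proof (rule open_map_by_d[OF cont_u])
  fix V assume V: "openin (T0 C) V"
  have "ts_d C ` ts_u C ` V = V" using openin_subset[OF V] by (force simp: image_image)
  then show "openin (T0 C) (ts_d C ` ts_u C ` V)" using V by simp
qed

lemma open_m: "open_map (T2 C) (T1 C) (ts_m C)"
proof (rule open_map_by_d[OF cont_m])
  fix W assume W: "openin (T2 C) W"
  show "openin (T0 C) (ts_d C ` ts_m C ` W)"
  proof (subst openin_subopen, rule ballI)
    fix z assume "z \<in> ts_d C ` ts_m C ` W"
    then obtain a b where ab: "(a, b) \<in> W" "z = ts_d C (ts_m C (a, b))" by auto
    then have comp: "(a, b) \<in> composable C" using openin_subset[OF W] by (auto simp: topspace_T2)
    then have z: "z = ts_d C b" using ab(2) by simp
    obtain X Y where XY: "openin (T1 C) X" "openin (T1 C) Y" "a \<in> X" "b \<in> Y" "X \<times> Y \<inter> composable C \<subseteq> W"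
      using T2_nbhd[OF W ab(1)] .
    have dX: "openin (T0 C) (ts_d C ` X)" using local_homeomorphism_open_map[OF lh_d] XY(1) by (simp add: open_map_def)
    let ?Y = "Y \<inter> {y \<in> topspace (T1 C). ts_r C y \<in> ts_d C ` X}"
    have "openin (T1 C) ?Y" using XY(2) openin_continuous_map_preimage[OF cont_r dX] by blast
    then have "openin (T0 C) (ts_d C ` ?Y)"
      using local_homeomorphism_open_map[OF lh_d] by (simp add: open_map_def)
    moreover have "z \<in> ts_d C ` ?Y"
    proof -
      have "ts_r C b \<in> ts_d C ` X" using XY(3) comp by (intro image_eqI[of _ _ a]) auto
      then show ?thesis using z XY(4) comp by auto
    qed
    moreover have "ts_d C ` ?Y \<subseteq> ts_d C ` ts_m C ` W"
    proof
      fix v assume "v \<in> ts_d C ` ?Y"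
      then obtain y x where y: "y \<in> Y" "y \<in> topspace (T1 C)" "v = ts_d C y" and x: "x \<in> X" "ts_r C y = ts_d C x"
        by auto
      have xc: "x \<in> topspace (T1 C)" using x(1) openin_subset[OF XY(1)] by blast
      then have "(x, y) \<in> W" using XY(5) x y by auto
      moreover have "v = ts_d C (ts_m C (x, y))" using x y xc by simp
      ultimately show "v \<in> ts_d C ` ts_m C ` W" by blast
    qed
    ultimately show "\<exists>T. openin (T0 C) T \<and> z \<in> T \<and> T \<subseteq> ts_d C ` ts_m C ` W" by blast
  qed
qed

lemma etale: "etale_topological_category C"
  using category lh_d lh_r open_u open_m by (simp add: etale_topological_category_def)

end

lemma topological_cat_if_etale: "etale_topological_category C \<Longrightarrow> topological_cat C"
  by (simp add: etale_topological_category_def topological_cat_def)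

section \<open>The functor \<open>\<Omega>\<close> on objects\<close>

context topological_cat
begin

abbreviation d_pre where "d_pre \<equiv> opens_map (T1 C) (T0 C) (ts_d C)"
abbreviation r_pre where "r_pre \<equiv> opens_map (T1 C) (T0 C) (ts_r C)"

sublocale B: pullback "opens (T1 C)" "opens (T1 C)" "opens (T0 C)" d_pre r_pre
proof -
  interpret T1: frame "opens (T1 C)" by (rule frame_opens)
  show "pullback (opens (T1 C)) (opens (T1 C)) (opens (T0 C)) d_pre r_pre"
    by unfold_locales
      (use frame_homD(2)[OF opens_map_hom[OF cont_d]] frame_homD(2)[OF opens_map_hom[OF cont_r]] in auto)
qed

lemma opens_L2_eq: "opens_L2 C = B.P"
  by (simp add: opens_L2_def)

lemma comparison_eq:
  assumes J: "B.ideal J"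
  shows "opens_comparison C J = (\<Union>(X, Y)\<in>J. X \<times> Y \<inter> composable C)"
proof -
  have J1: "openin (T1 C) X" "openin (T1 C) Y" if "(X, Y) \<in> J" for X Y
    using B.idealD(1,2)[OF J that] by auto
  have fst: "continuous_map (T2 C) (T1 C) fst" and snd: "continuous_map (T2 C) (T1 C) snd"
    unfolding T2_def by (auto intro: continuous_map_from_subtopology continuous_map_fst continuous_map_snd)
  have box: "opens_map (T2 C) (T1 C) fst X \<sqinter>\<^bsub>opens (T2 C)\<^esub> opens_map (T2 C) (T1 C) snd Y = X \<times> Y \<inter> composable C"
    if "(X, Y) \<in> J" for X Y
  proof -
    have "openin (T2 C) (opens_map (T2 C) (T1 C) fst X)" "openin (T2 C) (opens_map (T2 C) (T1 C) snd Y)"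
      using frame_homD(2)[OF opens_map_hom[OF fst], of X] frame_homD(2)[OF opens_map_hom[OF snd], of Y] J1[OF that]
      by simp_all
    then show ?thesis using J1[OF that] by (auto simp: meet_opens opens_map_apply topspace_T2)
  qed
  have im: "(\<lambda>(X, Y). opens_map (T2 C) (T1 C) fst X \<sqinter>\<^bsub>opens (T2 C)\<^esub> opens_map (T2 C) (T1 C) snd Y) ` J
      = (\<lambda>(X, Y). X \<times> Y \<inter> composable C) ` J"
    by (rule image_cong[OF refl]) (use box in auto)
  have "(\<lambda>(X, Y). X \<times> Y \<inter> composable C) ` J \<subseteq> {W. openin (T2 C) W}"
    using J1 openin_T2_box by auto
  then show ?thesis
    using J unfolding opens_comparison_def pb_pair_def opens_L2_eq by (simp add: im Sup_opens)
qed

text \<open>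
  The inverse of \<open>opens_comparison\<close>.
\<close>

definition boxes :: "('a \<times> 'a) set \<Rightarrow> ('a set \<times> 'a set) set" where
  "boxes W = {(X, Y). openin (T1 C) X \<and> openin (T1 C) Y \<and> X \<times> Y \<inter> composable C \<subseteq> W}"

lemma d_pre_apply: "openin (T0 C) V \<Longrightarrow> d_pre V = {a \<in> topspace (T1 C). ts_d C a \<in> V}"
  and r_pre_apply: "openin (T0 C) V \<Longrightarrow> r_pre V = {a \<in> topspace (T1 C). ts_r C a \<in> V}"
  by (simp_all add: opens_map_apply)

lemma openin_pre: "openin (T0 C) V \<Longrightarrow> openin (T1 C) (d_pre V)" "openin (T0 C) V \<Longrightarrow> openin (T1 C) (r_pre V)"
  using frame_homD(2)[OF opens_map_hom[OF cont_d], of V] frame_homD(2)[OF opens_map_hom[OF cont_r], of V]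
  by simp_all

lemma ideal_boxes: "B.ideal (boxes W)"
proof (rule B.idealI)
  show "boxes W \<subseteq> carrier (opens (T1 C)) \<times> carrier (opens (T1 C))" by (auto simp: boxes_def)
  show "(X', Y') \<in> boxes W" if "(X, Y) \<in> boxes W" "X' \<in> carrier (opens (T1 C))" "Y' \<in> carrier (opens (T1 C))"
    "X' \<sqsubseteq>\<^bsub>opens (T1 C)\<^esub> X" "Y' \<sqsubseteq>\<^bsub>opens (T1 C)\<^esub> Y" for X Y X' Y'
    using that by (auto simp: boxes_def)
  show "(\<Squnion>\<^bsub>opens (T1 C)\<^esub>A, Y) \<in> boxes W" if A: "A \<subseteq> carrier (opens (T1 C))"
    and Y: "Y \<in> carrier (opens (T1 C))" and *: "\<And>X. X \<in> A \<Longrightarrow> (X, Y) \<in> boxes W" for A Y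
  proof -
    have "openin (T1 C) (\<Union>A)" using A by auto
    moreover have "\<Union>A \<times> Y \<inter> composable C \<subseteq> W" using * by (auto simp: boxes_def)
    ultimately show ?thesis using A Y by (simp add: Sup_opens boxes_def)
  qed
  show "(X, \<Squnion>\<^bsub>opens (T1 C)\<^esub>A) \<in> boxes W" if X: "X \<in> carrier (opens (T1 C))"
    and A: "A \<subseteq> carrier (opens (T1 C))" and *: "\<And>Y. Y \<in> A \<Longrightarrow> (X, Y) \<in> boxes W" for X A
  proof -
    have "openin (T1 C) (\<Union>A)" using A by auto
    moreover have "X \<times> \<Union>A \<inter> composable C \<subseteq> W" using * by (auto simp: boxes_def)
    ultimately show ?thesis using A X by (simp add: Sup_opens boxes_def)
  qed
  show "(X \<sqinter>\<^bsub>opens (T1 C)\<^esub> d_pre V, Y) \<in> boxes W \<longleftrightarrow> (X, Y \<sqinter>\<^bsub>opens (T1 C)\<^esub> r_pre V) \<in> boxes W"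
    if "X \<in> carrier (opens (T1 C))" "Y \<in> carrier (opens (T1 C))" "V \<in> carrier (opens (T0 C))" for X Y V
  proof -
    have V: "openin (T0 C) V" and XY: "openin (T1 C) X" "openin (T1 C) Y" using that by auto
    have "(X \<inter> d_pre V) \<times> Y \<inter> composable C = X \<times> (Y \<inter> r_pre V) \<inter> composable C"
      by (auto simp: d_pre_apply[OF V] r_pre_apply[OF V])
    then show ?thesis
      using XY openin_pre[OF V] by (simp add: boxes_def meet_opens openin_Int)
  qed
qed

text \<open>
  Local injectivity of \<open>d\<close> enters here. On a box \<open>X\<^sub>1 \<times> Y\<^sub>1\<close> with \<open>d\<close> injective on \<open>X\<^sub>1\<close>,
  shrinking \<open>Y\<^sub>1\<close> to lie over a small subset of \<open>d(X\<^sub>1)\<close> is the same as shrinking \<open>X\<^sub>1\<close>. So a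
  cover of \<open>X\<^sub>1 \<times> Y\<^sub>1\<close> by boxes of \<open>J\<close> can be replaced by a cover that only cuts \<open>Y\<^sub>1\<close>, and \<open>J\<close>
  is closed under joins in the second variable.
\<close>

lemma box_in_ideal:
  assumes J: "B.ideal J" and X: "openin (T1 C) X" and Y: "openin (T1 C) Y"
    and cover: "X \<times> Y \<inter> composable C \<subseteq> (\<Union>(X, Y)\<in>J. X \<times> Y \<inter> composable C)"
  shows "(X, Y) \<in> J"
proof -
  note J1 = B.idealD(1,2)[OF J]
  have open_d: "openin (T0 C) (ts_d C ` V)" if "openin (T1 C) V" for V
    using local_homeomorphism_open_map[OF lh_d] that by (simp add: open_map_def)
  have local: "(X0, Y) \<in> J" if X0: "openin (T1 C) X0" "X0 \<subseteq> X" "inj_on (ts_d C) X0" for X0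
  proof -
    let ?Y0 = "Y \<inter> r_pre (ts_d C ` X0)"
    note dX0 = open_d[OF X0(1)]
    have Y0: "openin (T1 C) ?Y0" using Y openin_pre(2)[OF dX0] by blast
    let ?B = "{Y1. openin (T1 C) Y1 \<and> Y1 \<subseteq> ?Y0 \<and> (X0, Y1) \<in> J}"
    have "\<exists>Y1\<in>?B. y \<in> Y1" if y: "y \<in> ?Y0" for y
    proof -
      obtain x where x: "x \<in> X0" "ts_d C x = ts_r C y" using y by (auto simp: r_pre_apply[OF dX0])
      have c: "x \<in> topspace (T1 C)" "y \<in> topspace (T1 C)" using x y openin_subset[OF X0(1)] openin_subset[OF Y] by auto
      then have "(x, y) \<in> X \<times> Y \<inter> composable C" using x y X0(2) by auto
      then obtain X' Y' where J': "(X', Y') \<in> J" "x \<in> X'" "y \<in> Y'" using cover by blast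
      have o': "openin (T1 C) X'" "openin (T1 C) Y'" using J1[OF J'(1)] by auto
      let ?X1 = "X0 \<inter> X'"
      have X1: "openin (T1 C) ?X1" using X0(1) o' by blast
      note dX1 = open_d[OF X1]
      let ?Y1 = "Y' \<inter> ?Y0 \<inter> r_pre (ts_d C ` ?X1)"
      have Y1: "openin (T1 C) ?Y1" "openin (T1 C) (Y' \<inter> ?Y0)" using o' Y0 openin_pre(2)[OF dX1] by blast+
      have eqX: "X0 \<inter> d_pre (ts_d C ` ?X1) = ?X1"
        using X0(3) openin_subset[OF X0(1)] by (auto simp: d_pre_apply[OF dX1] inj_on_def)
      have "(?X1, Y' \<inter> ?Y0) \<in> J"
        by (rule B.idealD(3)[OF J J'(1)]) (use X1 Y1 in auto)
      then have "(X0 \<sqinter>\<^bsub>opens (T1 C)\<^esub> d_pre (ts_d C ` ?X1), Y' \<inter> ?Y0) \<in> J"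
        using X0(1) openin_pre(1)[OF dX1] eqX by (simp add: meet_opens)
      then have "(X0, (Y' \<inter> ?Y0) \<sqinter>\<^bsub>opens (T1 C)\<^esub> r_pre (ts_d C ` ?X1)) \<in> J"
        using B.idealD(6)[OF J, of X0 "Y' \<inter> ?Y0" "ts_d C ` ?X1"] X0(1) Y1(2) dX1 by simp
      then have "(X0, ?Y1) \<in> J" using Y1(2) openin_pre(2)[OF dX1] by (simp add: meet_opens)
      moreover have "y \<in> ?Y1"
      proof -
        have "ts_r C y \<in> ts_d C ` ?X1" using x J' by (intro image_eqI[of _ _ x]) auto
        then show ?thesis using y J' c by (simp add: r_pre_apply[OF dX1])
      qed
      ultimately show ?thesis using Y1(1) by (intro bexI[of _ ?Y1]) auto
    qed
    then have "\<Union>?B = ?Y0" by blast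
    moreover have "(X0, \<Squnion>\<^bsub>opens (T1 C)\<^esub>?B) \<in> J"
      by (rule B.idealD(5)[OF J]) (use X0(1) in auto)
    ultimately have "(X0, ?Y0) \<in> J" by (simp add: Sup_opens subset_iff)
    then have "(X0, Y \<sqinter>\<^bsub>opens (T1 C)\<^esub> r_pre (ts_d C ` X0)) \<in> J"
      using Y openin_pre(2)[OF dX0] by (simp add: meet_opens)
    then have "(X0 \<sqinter>\<^bsub>opens (T1 C)\<^esub> d_pre (ts_d C ` X0), Y) \<in> J"
      using B.idealD(6)[OF J, of X0 Y "ts_d C ` X0"] X0(1) Y dX0 by simp
    moreover have "X0 \<inter> d_pre (ts_d C ` X0) = X0"
      using openin_subset[OF X0(1)] by (auto simp: d_pre_apply[OF dX0])
    ultimately show ?thesis using X0(1) openin_pre(1)[OF dX0] by (simp add: meet_opens)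
  qed
  let ?A = "{X0. openin (T1 C) X0 \<and> X0 \<subseteq> X \<and> inj_on (ts_d C) X0}"
  have "\<Union>?A = X"
  proof (intro equalityI subsetI)
    fix x assume x: "x \<in> X"
    then obtain U where U: "openin (T1 C) U" "x \<in> U" "inj_on (ts_d C) U"
      using local_homeomorphism_inj[OF lh_d, of x] openin_subset[OF X] by blast
    then have "U \<inter> X \<in> ?A" using X by (auto intro: inj_on_subset)
    then show "x \<in> \<Union>?A" using x U(2) by blast
  qed blast
  moreover have "(\<Squnion>\<^bsub>opens (T1 C)\<^esub>?A, Y) \<in> J"
    by (rule B.idealD(4)[OF J]) (use Y local in auto)
  ultimately show ?thesis by (simp add: Sup_opens subset_iff)
qed

lemma boxes_comparison: "B.ideal J \<Longrightarrow> boxes (opens_comparison C J) = J"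
proof (intro equalityI subrelI)
  fix X Y assume J: "B.ideal J" and "(X, Y) \<in> boxes (opens_comparison C J)"
  then show "(X, Y) \<in> J" using box_in_ideal[OF J] by (auto simp: boxes_def comparison_eq[OF J])
next
  fix X Y assume J: "B.ideal J" and XY: "(X, Y) \<in> J"
  then show "(X, Y) \<in> boxes (opens_comparison C J)"
    using B.idealD(1,2)[OF J XY] by (auto simp: boxes_def comparison_eq[OF J])
qed

lemma comparison_boxes:
  assumes W: "openin (T2 C) W"
  shows "opens_comparison C (boxes W) = W"
proof (intro equalityI subsetI)
  fix w assume "w \<in> opens_comparison C (boxes W)"
  then show "w \<in> W" unfolding comparison_eq[OF ideal_boxes] by (auto simp: boxes_def)
next
  fix w assume w: "w \<in> W"
  obtain a b where ab: "w = (a, b)" by (cases w)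
  obtain X Y where "openin (T1 C) X" "openin (T1 C) Y" "a \<in> X" "b \<in> Y" "X \<times> Y \<inter> composable C \<subseteq> W"
    using T2_nbhd[OF W] w ab by blast
  moreover from this have "(X, Y) \<in> boxes W" by (simp add: boxes_def)
  moreover have "(a, b) \<in> composable C" using w ab openin_subset[OF W] by (auto simp: topspace_T2)
  ultimately show "w \<in> opens_comparison C (boxes W)"
    unfolding comparison_eq[OF ideal_boxes] ab by blast
qed

lemma openin_comparison: "B.ideal J \<Longrightarrow> openin (T2 C) (opens_comparison C J)"
proof -
  assume J: "B.ideal J"
  have "openin (T2 C) (X \<times> Y \<inter> composable C)" if "(X, Y) \<in> J" for X Y
    using B.idealD(1,2)[OF J that] openin_T2_box by simp
  then show ?thesis unfolding comparison_eq[OF J] by (intro openin_Union) auto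
qed

lemma boxes_le_iff:
  assumes W: "openin (T2 C) W" and J: "B.ideal J"
  shows "boxes W \<subseteq> J \<longleftrightarrow> W \<subseteq> opens_comparison C J"
proof
  assume "boxes W \<subseteq> J"
  then have "opens_comparison C (boxes W) \<subseteq> opens_comparison C J"
    unfolding comparison_eq[OF J] comparison_eq[OF ideal_boxes] by blast
  then show "W \<subseteq> opens_comparison C J" by (simp add: comparison_boxes[OF W])
next
  assume "W \<subseteq> opens_comparison C J"
  then have "boxes W \<subseteq> boxes (opens_comparison C J)" by (auto simp: boxes_def)
  then show "boxes W \<subseteq> J" by (simp add: boxes_comparison[OF J])
qed

lemma boxes_Int: "boxes (V \<inter> W) = boxes V \<inter> boxes W"
  by (auto simp: boxes_def)

lemma boxes_Union:
  assumes "\<W> \<subseteq> {W. openin (T2 C) W}"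
  shows "boxes (\<Union>\<W>) = \<Squnion>\<^bsub>B.P\<^esub>(boxes ` \<W>)"
proof (rule B.PF.eq_by_upper)
  have c: "boxes ` \<W> \<subseteq> carrier B.P" using ideal_boxes by auto
  show "boxes (\<Union>\<W>) \<in> carrier B.P" using ideal_boxes by simp
  show "\<Squnion>\<^bsub>B.P\<^esub>(boxes ` \<W>) \<in> carrier B.P" by (rule B.PF.sup_closed[OF c])
  fix K assume K: "K \<in> carrier B.P"
  then have K': "B.ideal K" by simp
  have o: "openin (T2 C) (\<Union>\<W>)" using assms by blast
  have "boxes (\<Union>\<W>) \<subseteq> K \<longleftrightarrow> (\<forall>W\<in>\<W>. W \<subseteq> opens_comparison C K)"
    unfolding boxes_le_iff[OF o K'] by blast
  also have "\<dots> \<longleftrightarrow> (\<forall>W\<in>\<W>. boxes W \<subseteq> K)"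
    by (rule ball_cong[OF refl]) (use assms boxes_le_iff[OF _ K'] in blast)
  finally show "boxes (\<Union>\<W>) \<sqsubseteq>\<^bsub>B.P\<^esub> K \<longleftrightarrow> \<Squnion>\<^bsub>B.P\<^esub>(boxes ` \<W>) \<sqsubseteq>\<^bsub>B.P\<^esub> K"
    using B.PF.Sup_le_iff[OF c K] by simp
qed

lemma tens_eq_boxes:
  assumes "openin (T1 C) X" "openin (T1 C) Y"
  shows "B.tens X Y = boxes (X \<times> Y \<inter> composable C)"
proof
  have t: "B.ideal (B.tens X Y)" using assms by (intro B.ideal_tens) auto
  show "B.tens X Y \<subseteq> boxes (X \<times> Y \<inter> composable C)"
    using assms by (subst B.tens_le_iff[OF ideal_boxes]) (simp add: boxes_def)
  show "boxes (X \<times> Y \<inter> composable C) \<subseteq> B.tens X Y"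
    unfolding boxes_le_iff[OF openin_T2_box[OF assms] t] comparison_eq[OF t] using B.in_tens[of X Y] by blast
qed

lemma Omega_simps [simp]:
  "L1 (Omega C) = opens (T1 C)" "L0 (Omega C) = opens (T0 C)"
  "ls_u (Omega C) = opens_map (T0 C) (T1 C) (ts_u C)" "ls_d (Omega C) = d_pre" "ls_r (Omega C) = r_pre"
  by (simp_all add: Omega_def)

lemma Omega_L2: "L2 (Omega C) = B.P" "lpr1 (Omega C) = B.pr1" "lpr2 (Omega C) = B.pr2"
  by (simp_all add: L2_def lpr1_def lpr2_def)

lemma m_pre_open: "openin (T1 C) V \<Longrightarrow> openin (T2 C) {w \<in> composable C. ts_m C w \<in> V}"
  using openin_continuous_map_preimage[OF cont_m] by (simp add: topspace_T2)

text \<open>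
  Evaluates the inverse of the comparison map in the definition of \<open>\<Omega>(m)\<close>.
\<close>

lemma Omega_m_eq:
  "ls_m (Omega C) = (\<lambda>V\<in>{V. openin (T1 C) V}. boxes {w \<in> composable C. ts_m C w \<in> V})"
proof -
  have inj: "inj_on (opens_comparison C) (carrier (opens_L2 C))"
    unfolding opens_L2_eq by (rule inj_on_inverseI[of _ boxes]) (simp add: boxes_comparison)
  have "inv_into (carrier (opens_L2 C)) (opens_comparison C) (opens_map (T2 C) (T1 C) (ts_m C) V)
      = boxes {w \<in> composable C. ts_m C w \<in> V}" if V: "openin (T1 C) V" for V
  proof (rule inv_into_f_eq[OF inj])
    show "boxes {w \<in> composable C. ts_m C w \<in> V} \<in> carrier (opens_L2 C)"
      unfolding opens_L2_eq using ideal_boxes by simp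
    show "opens_comparison C (boxes {w \<in> composable C. ts_m C w \<in> V}) = opens_map (T2 C) (T1 C) (ts_m C) V"
      by (simp add: opens_map_apply[OF V] topspace_T2 comparison_boxes[OF m_pre_open[OF V]])
  qed
  then show ?thesis by (auto simp: Omega_def intro!: restrict_ext)
qed

lemma Omega_m_apply: "openin (T1 C) V \<Longrightarrow> ls_m (Omega C) V = boxes {w \<in> composable C. ts_m C w \<in> V}"
  by (simp add: Omega_m_eq)

lemma in_Omega_m:
  assumes "openin (T1 C) V"
  shows "(X, Y) \<in> ls_m (Omega C) V \<longleftrightarrow> openin (T1 C) X \<and> openin (T1 C) Y \<and>
    (\<forall>a\<in>X. \<forall>b\<in>Y. ts_d C a = ts_r C b \<longrightarrow> ts_m C (a, b) \<in> V)"
proof -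
  have "X \<times> Y \<inter> composable C \<subseteq> {w \<in> composable C. ts_m C w \<in> V} \<longleftrightarrow>
      (\<forall>a\<in>X. \<forall>b\<in>Y. ts_d C a = ts_r C b \<longrightarrow> ts_m C (a, b) \<in> V)"
    if "X \<subseteq> topspace (T1 C)" "Y \<subseteq> topspace (T1 C)"
    using that by (auto simp: subset_iff)
  then show ?thesis
    unfolding Omega_m_apply[OF assms] boxes_def by (auto dest: openin_subset)
qed

lemma Omega_m_hom: "ls_m (Omega C) \<in> frame_hom (opens (T1 C)) B.P"
  unfolding frame_hom_def
proof (intro CollectI conjI allI ballI impI)
  let ?m = "\<lambda>V. {w \<in> composable C. ts_m C w \<in> V}"
  show "ls_m (Omega C) \<in> carrier (opens (T1 C)) \<rightarrow>\<^sub>E carrier B.P"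
    by (simp add: Omega_m_eq ideal_boxes)
  show "ls_m (Omega C) (\<Squnion>\<^bsub>opens (T1 C)\<^esub>A) = \<Squnion>\<^bsub>B.P\<^esub>(ls_m (Omega C) ` A)" if "A \<subseteq> carrier (opens (T1 C))" for A
  proof -
    have A: "A \<subseteq> {V. openin (T1 C) V}" using that by simp
    then have "openin (T1 C) (\<Union>A)" by blast
    then have "ls_m (Omega C) (\<Squnion>\<^bsub>opens (T1 C)\<^esub>A) = boxes (?m (\<Union>A))"
      using A by (simp add: Omega_m_apply Sup_opens)
    also have "?m (\<Union>A) = \<Union>(?m ` A)" by blast
    also have "boxes (\<Union>(?m ` A)) = \<Squnion>\<^bsub>B.P\<^esub>(boxes ` ?m ` A)"
      by (rule boxes_Union) (use A m_pre_open in blast)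
    also have "boxes ` ?m ` A = ls_m (Omega C) ` A"
      unfolding image_image by (rule image_cong[OF refl]) (use A Omega_m_apply in auto)
    finally show ?thesis .
  qed
  show "ls_m (Omega C) \<top>\<^bsub>opens (T1 C)\<^esub> = \<top>\<^bsub>B.P\<^esub>"
    unfolding top_opens B.top_P
    by (auto simp: in_Omega_m intro!: m_in dest: openin_subset[THEN subsetD])
  show "ls_m (Omega C) (U \<sqinter>\<^bsub>opens (T1 C)\<^esub> V) = ls_m (Omega C) U \<sqinter>\<^bsub>B.P\<^esub> ls_m (Omega C) V"
    if "U \<in> carrier (opens (T1 C))" "V \<in> carrier (opens (T1 C))" for U V
  proof -
    have "?m (U \<inter> V) = ?m U \<inter> ?m V" by blast
    then show ?thesis
      using that by (simp add: meet_opens Omega_m_apply openin_Int B.meet_P ideal_boxes boxes_Int)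
  qed
qed

text \<open>
  The direct image along the open map \<open>m\<close>, transported to the localic pullback.
\<close>

lemma
  shows open_loc_Omega_m: "open_loc B.P (opens (T1 C)) (ls_m (Omega C))"
    and left_adj_Omega_m: "B.ideal J \<Longrightarrow> left_adj B.P (opens (T1 C)) (ls_m (Omega C)) J = ts_m C ` opens_comparison C J"
proof -
  let ?m = "\<lambda>V. {w \<in> composable C. ts_m C w \<in> V}"
  let ?l = "\<lambda>J. ts_m C ` opens_comparison C J"
  have l: "openin (T1 C) (?l J)" if "B.ideal J" for J
    using open_m openin_comparison[OF that] by (simp add: open_map_def)
  have sub: "opens_comparison C J \<subseteq> composable C" if "B.ideal J" for J
    using openin_subset[OF openin_comparison[OF that]] by (simp add: topspace_T2)
  have adj: "?l J \<sqsubseteq>\<^bsub>opens (T1 C)\<^esub> V \<longleftrightarrow> J \<sqsubseteq>\<^bsub>B.P\<^esub> ls_m (Omega C) V"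
    if J: "J \<in> carrier B.P" and V: "V \<in> carrier (opens (T1 C))" for J V
  proof -
    have J': "B.ideal J" and V': "openin (T1 C) V" using J V by auto
    have "?l J \<subseteq> V \<longleftrightarrow> opens_comparison C J \<subseteq> opens_comparison C (boxes (?m V))"
      using sub[OF J'] by (auto simp: comparison_boxes[OF m_pre_open[OF V']])
    also have "\<dots> \<longleftrightarrow> J \<subseteq> boxes (?m V)"
      using boxes_le_iff[OF openin_comparison[OF J'] ideal_boxes[of "?m V"]] by (simp add: boxes_comparison[OF J'])
    finally show ?thesis by (simp add: Omega_m_apply[OF V'])
  qed
  have frob: "?l (J \<sqinter>\<^bsub>B.P\<^esub> ls_m (Omega C) V) = ?l J \<sqinter>\<^bsub>opens (T1 C)\<^esub> V"
    if J: "J \<in> carrier B.P" and V: "V \<in> carrier (opens (T1 C))" for J V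
  proof -
    have J': "B.ideal J" and V': "openin (T1 C) V" using J V by auto
    have "J \<inter> boxes (?m V) = boxes (opens_comparison C J \<inter> ?m V)"
      by (simp add: boxes_Int boxes_comparison[OF J'])
    then have "opens_comparison C (J \<sqinter>\<^bsub>B.P\<^esub> ls_m (Omega C) V) = opens_comparison C J \<inter> ?m V"
      using openin_comparison[OF J'] m_pre_open[OF V']
      by (simp add: Omega_m_apply[OF V'] B.meet_P[OF J' ideal_boxes] comparison_boxes openin_Int)
    then show ?thesis
      using sub[OF J'] l[OF J'] V' by (auto simp: meet_opens)
  qed
  note loc = open_locI[OF B.PF.frame_axioms frame_opens Omega_m_hom _ adj frob]
  show "open_loc B.P (opens (T1 C)) (ls_m (Omega C))" by (rule loc(1)) (use l in auto)
  show "left_adj B.P (opens (T1 C)) (ls_m (Omega C)) J = ts_m C ` opens_comparison C J" if "B.ideal J"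
    by (rule loc(2)) (use l that in auto)
qed

lemma unital_localic_Omega: "unital_localic (Omega C)"
proof (rule unital_localic.intro)
  show "frame (L1 (Omega C))" "frame (L0 (Omega C))" by (simp_all add: frame_opens)
  show "etale_loc (L1 (Omega C)) (L0 (Omega C)) (ls_d (Omega C))"
    "etale_loc (L1 (Omega C)) (L0 (Omega C)) (ls_r (Omega C))"
    using etale_loc_opens[OF lh_d] etale_loc_opens[OF lh_r] by simp_all
  show "open_loc (L0 (Omega C)) (L1 (Omega C)) (ls_u (Omega C))"
    using open_loc_opens[OF cont_u open_u] by simp
  show "open_loc (L2 (Omega C)) (L1 (Omega C)) (ls_m (Omega C))"
    using open_loc_Omega_m by (simp add: Omega_L2)
  let ?u = "opens_map (T0 C) (T1 C) (ts_u C)"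
  have u_pre: "?u V = {x \<in> topspace (T0 C). ts_u C x \<in> V}" "openin (T0 C) (?u V)" if "openin (T1 C) V" for V
    by (rule opens_map_apply[OF that]) (use frame_homD(2)[OF opens_map_hom[OF cont_u], of V] that in simp)
  fix z assume "z \<in> carrier (L0 (Omega C))"
  then have z: "openin (T0 C) z" by simp
  show "ls_u (Omega C) (ls_d (Omega C) z) = z" "ls_u (Omega C) (ls_r (Omega C) z) = z"
    using openin_pre[OF z] openin_subset[OF z] by (auto simp: u_pre d_pre_apply[OF z] r_pre_apply[OF z])
  have top: "openin (T1 C) (topspace (T1 C))" by simp
  show "ls_m (Omega C) (ls_r (Omega C) z) = lpr1 (Omega C) (ls_r (Omega C) z)"
  proof -
    have "{w \<in> composable C. ts_m C w \<in> r_pre z} = r_pre z \<times> topspace (T1 C) \<inter> composable C"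
      by (auto simp: r_pre_apply[OF z])
    then show ?thesis
      using openin_pre(2)[OF z]
      by (simp add: Omega_m_apply Omega_L2 B.pr1_eq top_opens tens_eq_boxes[OF _ top])
  qed
  show "ls_m (Omega C) (ls_d (Omega C) z) = lpr2 (Omega C) (ls_d (Omega C) z)"
  proof -
    have "{w \<in> composable C. ts_m C w \<in> d_pre z} = topspace (T1 C) \<times> d_pre z \<inter> composable C"
      by (auto simp: d_pre_apply[OF z])
    then show ?thesis
      using openin_pre(1)[OF z]
      by (simp add: Omega_m_apply Omega_L2 B.pr2_eq top_opens tens_eq_boxes[OF top])
  qed
next
  let ?u = "opens_map (T0 C) (T1 C) (ts_u C)"
  have u_pre: "?u V = {x \<in> topspace (T0 C). ts_u C x \<in> V}" "openin (T0 C) (?u V)" if "openin (T1 C) V" for V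
    by (rule opens_map_apply[OF that]) (use frame_homD(2)[OF opens_map_hom[OF cont_u], of V] that in simp)
  fix V assume "V \<in> carrier (L1 (Omega C))"
  then have V: "openin (T1 C) V" by simp
  let ?K = "ls_m (Omega C) V"
  have K: "B.ideal ?K" using Omega_m_apply[OF V] ideal_boxes by simp
  have K1: "openin (T1 C) X" "openin (T1 C) Y" if "(X, Y) \<in> ?K" for X Y
    using B.idealD(1,2)[OF K that] by auto
  have nbhd: "\<exists>X Y. (X, Y) \<in> ?K \<and> a \<in> X \<and> b \<in> Y"
    if ab: "(a, b) \<in> composable C" "ts_m C (a, b) \<in> V" for a b
  proof -
    have "(a, b) \<in> {w \<in> composable C. ts_m C w \<in> V}" using ab by blast
    then obtain X Y where "openin (T1 C) X" "openin (T1 C) Y" "a \<in> X" "b \<in> Y"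
      "X \<times> Y \<inter> composable C \<subseteq> {w \<in> composable C. ts_m C w \<in> V}"
      using T2_nbhd[OF m_pre_open[OF V]] by blast
    then show ?thesis unfolding Omega_m_apply[OF V] boxes_def by blast
  qed
  have Vc: "a \<in> topspace (T1 C)" if "a \<in> V" for a using that openin_subset[OF V] by blast
  show "pb_pair (L1 (Omega C)) (L2 (Omega C)) (\<lambda>b. b) (\<lambda>b. ls_d (Omega C) (ls_u (Omega C) b)) ?K = V"
  proof -
    let ?h = "\<lambda>(X, Y). X \<sqinter>\<^bsub>opens (T1 C)\<^esub> d_pre (?u Y)"
    have h: "?h (X, Y) = {a \<in> X. ts_u C (ts_d C a) \<in> Y}" "openin (T1 C) (?h (X, Y))" if XY: "(X, Y) \<in> ?K" for X Y
    proof -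
      note o = K1[OF XY]
      note ou = u_pre(2)[OF o(2)]
      note od = openin_pre(1)[OF ou]
      have "d_pre (?u Y) = {a \<in> topspace (T1 C). ts_d C a \<in> ?u Y}" by (rule d_pre_apply[OF ou])
      also have "\<dots> = {a \<in> topspace (T1 C). ts_u C (ts_d C a) \<in> Y}"
        by (simp add: u_pre(1)[OF o(2)] cong: conj_cong)
      finally show "?h (X, Y) = {a \<in> X. ts_u C (ts_d C a) \<in> Y}"
        using o od openin_subset[OF o(1)] by (auto simp: meet_opens)
      show "openin (T1 C) (?h (X, Y))" using o od by (simp add: meet_opens openin_Int)
    qed
    have "pb_pair (L1 (Omega C)) (L2 (Omega C)) (\<lambda>b. b) (\<lambda>b. ls_d (Omega C) (ls_u (Omega C) b)) ?K
        = \<Squnion>\<^bsub>opens (T1 C)\<^esub>(?h ` ?K)"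
      using K by (simp add: pb_pair_def Omega_L2)
    also have "\<dots> = \<Union>(?h ` ?K)" by (rule Sup_opens) (use h(2) in auto)
    also have "\<dots> = V"
    proof (intro equalityI subsetI)
      fix a assume "a \<in> \<Union>(?h ` ?K)"
      then obtain X Y where XY: "(X, Y) \<in> ?K" and a: "a \<in> X" "ts_u C (ts_d C a) \<in> Y" using h(1) by auto
      have ac: "a \<in> topspace (T1 C)" using a(1) openin_subset[OF K1(1)[OF XY]] by blast
      then have "ts_d C a = ts_r C (ts_u C (ts_d C a))" by simp
      then have "ts_m C (a, ts_u C (ts_d C a)) \<in> V"
        using XY a unfolding in_Omega_m[OF V] by blast
      then show "a \<in> V" using ac by simp
    next
      fix a assume a: "a \<in> V"
      have "\<exists>X Y. (X, Y) \<in> ?K \<and> a \<in> X \<and> ts_u C (ts_d C a) \<in> Y"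
        by (rule nbhd) (use a Vc[OF a] in simp_all)
      then obtain X Y where XY: "(X, Y) \<in> ?K" "a \<in> X" "ts_u C (ts_d C a) \<in> Y" by (elim exE conjE)
      then have "a \<in> ?h (X, Y)" using h(1)[OF XY(1)] by blast
      then show "a \<in> \<Union>(?h ` ?K)" using XY(1) by blast
    qed
    finally show ?thesis .
  qed
  show "pb_pair (L1 (Omega C)) (L2 (Omega C)) (\<lambda>b. ls_r (Omega C) (ls_u (Omega C) b)) (\<lambda>b. b) ?K = V"
  proof -
    let ?h = "\<lambda>(X, Y). r_pre (?u X) \<sqinter>\<^bsub>opens (T1 C)\<^esub> Y"
    have h: "?h (X, Y) = {a \<in> Y. ts_u C (ts_r C a) \<in> X}" "openin (T1 C) (?h (X, Y))" if XY: "(X, Y) \<in> ?K" for X Y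
    proof -
      note o = K1[OF XY]
      note ou = u_pre(2)[OF o(1)]
      note od = openin_pre(2)[OF ou]
      have "r_pre (?u X) = {a \<in> topspace (T1 C). ts_r C a \<in> ?u X}" by (rule r_pre_apply[OF ou])
      also have "\<dots> = {a \<in> topspace (T1 C). ts_u C (ts_r C a) \<in> X}"
        by (simp add: u_pre(1)[OF o(1)] cong: conj_cong)
      finally show "?h (X, Y) = {a \<in> Y. ts_u C (ts_r C a) \<in> X}"
        using o od openin_subset[OF o(2)] by (auto simp: meet_opens)
      show "openin (T1 C) (?h (X, Y))" using o od by (simp add: meet_opens openin_Int)
    qed
    have "pb_pair (L1 (Omega C)) (L2 (Omega C)) (\<lambda>b. ls_r (Omega C) (ls_u (Omega C) b)) (\<lambda>b. b) ?K
        = \<Squnion>\<^bsub>opens (T1 C)\<^esub>(?h ` ?K)"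
      using K by (simp add: pb_pair_def Omega_L2)
    also have "\<dots> = \<Union>(?h ` ?K)" by (rule Sup_opens) (use h(2) in auto)
    also have "\<dots> = V"
    proof (intro equalityI subsetI)
      fix a assume "a \<in> \<Union>(?h ` ?K)"
      then obtain X Y where XY: "(X, Y) \<in> ?K" and a: "a \<in> Y" "ts_u C (ts_r C a) \<in> X" using h(1) by auto
      have ac: "a \<in> topspace (T1 C)" using a(1) openin_subset[OF K1(2)[OF XY]] by blast
      then have "ts_d C (ts_u C (ts_r C a)) = ts_r C a" by simp
      then have "ts_m C (ts_u C (ts_r C a), a) \<in> V"
        using XY a unfolding in_Omega_m[OF V] by blast
      then show "a \<in> V" using ac by simp
    next
      fix a assume a: "a \<in> V"
      have "\<exists>X Y. (X, Y) \<in> ?K \<and> ts_u C (ts_r C a) \<in> X \<and> a \<in> Y"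
        by (rule nbhd) (use a Vc[OF a] in simp_all)
      then obtain X Y where XY: "(X, Y) \<in> ?K" "ts_u C (ts_r C a) \<in> X" "a \<in> Y" by (elim exE conjE)
      then have "a \<in> ?h (X, Y)" using h(1)[OF XY(1)] by blast
      then show "a \<in> \<Union>(?h ` ?K)" using XY(1) by blast
    qed
    finally show ?thesis .
  qed
qed

lemma Omega_mult:
  assumes "openin (T1 C) A" "openin (T1 C) B"
  shows "A \<star>\<^bsub>Omega C\<^esub> B = {ts_m C (a, b) |a b. a \<in> A \<and> b \<in> B \<and> ts_d C a = ts_r C b}"
proof -
  interpret O: unital_localic "Omega C" by (rule unital_localic_Omega)
  have t: "B.ideal (B.tens A B)" using assms by (intro B.ideal_tens) auto
  have "A \<star>\<^bsub>Omega C\<^esub> B = left_adj B.P (opens (T1 C)) (ls_m (Omega C)) (B.tens A B)"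
    using O.mult_eq[of A B] assms by (simp add: Omega_L2)
  also have "\<dots> = ts_m C ` opens_comparison C (B.tens A B)" by (rule left_adj_Omega_m[OF t])
  also have "\<dots> = ts_m C ` (A \<times> B \<inter> composable C)"
    by (simp only: tens_eq_boxes[OF assms] comparison_boxes[OF openin_T2_box[OF assms]])
  also have "\<dots> = {ts_m C (a, b) |a b. a \<in> A \<and> b \<in> B \<and> ts_d C a = ts_r C b}"
    using assms[THEN openin_subset] by (auto simp: image_iff subset_iff) blast
  finally show ?thesis .
qed

text \<open>
  Associativity has been reduced to products of opens, and these are computed elementwise.
\<close>

theorem etale_localic_Omega: "etale_localic_category (Omega C)"
proof -
  interpret O: unital_localic "Omega C" by (rule unital_localic_Omega)
  show ?thesis
  proof (rule O.etale_localic_categoryI)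
    fix X Y Z assume "X \<in> carrier (L1 (Omega C))" "Y \<in> carrier (L1 (Omega C))" "Z \<in> carrier (L1 (Omega C))"
    then have o: "openin (T1 C) X" "openin (T1 C) Y" "openin (T1 C) Z" by auto
    have XY: "openin (T1 C) (X \<star>\<^bsub>Omega C\<^esub> Y)" "openin (T1 C) (Y \<star>\<^bsub>Omega C\<^esub> Z)"
      using O.mult_closed[of X Y] O.mult_closed[of Y Z] o by simp_all
    have c: "x \<in> topspace (T1 C)" if "x \<in> X \<or> x \<in> Y \<or> x \<in> Z" for x
      using that o[THEN openin_subset] by blast
    show "X \<star>\<^bsub>Omega C\<^esub> Y \<star>\<^bsub>Omega C\<^esub> Z = X \<star>\<^bsub>Omega C\<^esub> (Y \<star>\<^bsub>Omega C\<^esub> Z)"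
      unfolding Omega_mult[OF XY(1) o(3)] Omega_mult[OF o(1) XY(2)]
      unfolding Omega_mult[OF o(1,2)] Omega_mult[OF o(2,3)]
    proof (intro equalityI subsetI)
      fix s assume "s \<in> {ts_m C (a, b) |a b. a \<in> {ts_m C (a, b) |a b. a \<in> X \<and> b \<in> Y \<and> ts_d C a = ts_r C b}
          \<and> b \<in> Z \<and> ts_d C a = ts_r C b}"
      then obtain x y z where xyz: "x \<in> X" "y \<in> Y" "z \<in> Z" "ts_d C x = ts_r C y"
        "ts_d C (ts_m C (x, y)) = ts_r C z" "s = ts_m C (ts_m C (x, y), z)" by auto
      then have "ts_d C y = ts_r C z" "s = ts_m C (x, ts_m C (y, z))" "ts_d C x = ts_r C (ts_m C (y, z))"
        using c m_assoc[of x y z] by auto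
      then show "s \<in> {ts_m C (a, b) |a b. a \<in> X \<and> b \<in> {ts_m C (a, b) |a b. a \<in> Y \<and> b \<in> Z \<and> ts_d C a = ts_r C b}
          \<and> ts_d C a = ts_r C b}" using xyz by blast
    next
      fix s assume "s \<in> {ts_m C (a, b) |a b. a \<in> X \<and> b \<in> {ts_m C (a, b) |a b. a \<in> Y \<and> b \<in> Z \<and> ts_d C a = ts_r C b}
          \<and> ts_d C a = ts_r C b}"
      then obtain x y z where xyz: "x \<in> X" "y \<in> Y" "z \<in> Z" "ts_d C y = ts_r C z"
        "ts_d C x = ts_r C (ts_m C (y, z))" "s = ts_m C (x, ts_m C (y, z))" by auto
      then have "ts_d C x = ts_r C y" "s = ts_m C (ts_m C (x, y), z)" "ts_d C (ts_m C (x, y)) = ts_r C z"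
        using c m_assoc[of x y z] by auto
      then show "s \<in> {ts_m C (a, b) |a b. a \<in> {ts_m C (a, b) |a b. a \<in> X \<and> b \<in> Y \<and> ts_d C a = ts_r C b}
          \<and> b \<in> Z \<and> ts_d C a = ts_r C b}" using xyz by blast
    qed
  qed
qed

sublocale O: etale_localic "Omega C"
  by (rule etale_localic.intro[OF etale_localic_Omega])

lemma Omega_unit: "\<e>\<^bsub>quantal_of (Omega C)\<^esub> = ts_u C ` topspace (T0 C)"
  by (simp add: O.qunit_eq left_adj_opens[OF cont_u open_u] top_opens)

lemma Omega_d_sh: "openin (T1 C) A \<Longrightarrow> O.d.sh A = ts_d C ` A"
  and Omega_r_sh: "openin (T1 C) A \<Longrightarrow> O.r.sh A = ts_r C ` A"
  and Omega_u_sh: "openin (T0 C) V \<Longrightarrow> O.u.sh V = ts_u C ` V"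
  using local_homeomorphism_open_map[OF lh_d] local_homeomorphism_open_map[OF lh_r]
  by (simp_all add: left_adj_opens cont_u cont_d cont_r open_u)

lemma Omega_lam: "openin (T1 C) A \<Longrightarrow> \<lambda>\<^sub>q\<^bsub>quantal_of (Omega C)\<^esub> A = ts_u C ` ts_d C ` A"
  and Omega_rho: "openin (T1 C) A \<Longrightarrow> \<rho>\<^sub>q\<^bsub>quantal_of (Omega C)\<^esub> A = ts_u C ` ts_r C ` A"
  using local_homeomorphism_open_map[OF lh_d] local_homeomorphism_open_map[OF lh_r]
    Omega_u_sh[of "ts_d C ` A"] Omega_u_sh[of "ts_r C ` A"] Omega_d_sh[of A] Omega_r_sh[of A]
  by (simp_all add: O.lam_eq O.rho_eq open_map_def)

lemma Omega_bisection_iff: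
  "A \<in> local_bisections (Omega C) \<longleftrightarrow> openin (T1 C) A \<and> inj_on (ts_d C) A \<and> inj_on (ts_r C) A"
  using sect_opens_iff[OF lh_d, of A] sect_opens_iff[OF lh_r, of A] by (auto simp: O.bisection_iff)

end

section \<open>The category \<open>ET\<^sub>k\<close>\<close>

lemma relational_coveringI:
  assumes "f1 \<in> topspace (T1 C) \<rightarrow>\<^sub>E Pow (topspace (T1 D))"
    and "f0 \<in> extensional (topspace (T0 C))" and "continuous_map (T0 C) (T0 D) f0"
    and "\<And>a b. \<lbrakk>a \<in> topspace (T1 C); b \<in> f1 a\<rbrakk> \<Longrightarrow> ts_d D b = f0 (ts_d C a) \<and> ts_r D b = f0 (ts_r C a)"
    and "\<And>a b s t. \<lbrakk>(a, b) \<in> composable C; (s, t) \<in> composable D; s \<in> f1 a; t \<in> f1 b\<rbrakk>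
      \<Longrightarrow> ts_m D (s, t) \<in> f1 (ts_m C (a, b))"
    and "\<And>a b s. \<lbrakk>a \<in> topspace (T1 C); b \<in> topspace (T1 C); ts_d C a = ts_d C b \<or> ts_r C a = ts_r C b;
      s \<in> f1 a; s \<in> f1 b\<rbrakk> \<Longrightarrow> a = b"
    and "\<And>q s. \<lbrakk>q \<in> topspace (T0 C); s \<in> topspace (T1 D); ts_d D s = f0 q\<rbrakk>
      \<Longrightarrow> \<exists>t\<in>topspace (T1 C). ts_d C t = q \<and> s \<in> f1 t"
    and "\<And>q s. \<lbrakk>q \<in> topspace (T0 C); s \<in> topspace (T1 D); ts_r D s = f0 q\<rbrakk>
      \<Longrightarrow> \<exists>t\<in>topspace (T1 C). ts_r C t = q \<and> s \<in> f1 t"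
    and "\<And>A. openin (T1 D) A \<Longrightarrow> openin (T1 C) {x \<in> topspace (T1 C). f1 x \<inter> A \<noteq> {}}"
    and "\<And>t. t \<in> topspace (T0 C) \<Longrightarrow> ts_u D (f0 t) \<in> f1 (ts_u C t)"
  shows "relational_covering C D f1 f0"
  unfolding relational_covering_def
proof (intro conjI)
  show "\<forall>(a, b)\<in>composable C. \<forall>(s, t)\<in>composable D.
      s \<in> f1 a \<and> t \<in> f1 b \<longrightarrow> ts_m D (s, t) \<in> f1 (ts_m C (a, b))"
    using assms(5) by auto
  show "\<forall>a\<in>topspace (T1 C). \<forall>b\<in>topspace (T1 C).
        (ts_d C a = ts_d C b \<or> ts_r C a = ts_r C b) \<and> f1 a \<inter> f1 b \<noteq> {} \<longrightarrow> a = b"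
  proof (intro ballI impI, elim conjE)
    fix a b assume ab: "a \<in> topspace (T1 C)" "b \<in> topspace (T1 C)" "ts_d C a = ts_d C b \<or> ts_r C a = ts_r C b"
      "f1 a \<inter> f1 b \<noteq> {}"
    then obtain s where "s \<in> f1 a" "s \<in> f1 b" by blast
    then show "a = b" by (rule assms(6)[OF ab(1-3)])
  qed
qed (use assms(1-4,7-) in \<open>simp_all\<close>)

lemma relational_coveringD:
  assumes "relational_covering C D f1 f0"
  shows "f1 \<in> topspace (T1 C) \<rightarrow>\<^sub>E Pow (topspace (T1 D))"
    and "f0 \<in> extensional (topspace (T0 C))" and "continuous_map (T0 C) (T0 D) f0"
    and "\<lbrakk>a \<in> topspace (T1 C); s \<in> f1 a\<rbrakk> \<Longrightarrow> ts_d D s = f0 (ts_d C a) \<and> ts_r D s = f0 (ts_r C a)"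
    and "\<lbrakk>(a, b) \<in> composable C; (s, s') \<in> composable D; s \<in> f1 a; s' \<in> f1 b\<rbrakk>
      \<Longrightarrow> ts_m D (s, s') \<in> f1 (ts_m C (a, b))"
    and "\<lbrakk>a \<in> topspace (T1 C); b \<in> topspace (T1 C); ts_d C a = ts_d C b \<or> ts_r C a = ts_r C b;
      s \<in> f1 a; s \<in> f1 b\<rbrakk> \<Longrightarrow> a = b"
    and "\<lbrakk>q \<in> topspace (T0 C); s \<in> topspace (T1 D); ts_d D s = f0 q\<rbrakk>
      \<Longrightarrow> \<exists>t\<in>topspace (T1 C). ts_d C t = q \<and> s \<in> f1 t"
    and "\<lbrakk>q \<in> topspace (T0 C); s \<in> topspace (T1 D); ts_r D s = f0 q\<rbrakk>
      \<Longrightarrow> \<exists>t\<in>topspace (T1 C). ts_r C t = q \<and> s \<in> f1 t"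
    and "openin (T1 D) A \<Longrightarrow> openin (T1 C) {x \<in> topspace (T1 C). f1 x \<inter> A \<noteq> {}}"
    and "q \<in> topspace (T0 C) \<Longrightarrow> ts_u D (f0 q) \<in> f1 (ts_u C q)"
    and "\<lbrakk>a \<in> topspace (T1 C); s \<in> f1 a\<rbrakk> \<Longrightarrow> s \<in> topspace (T1 D)"
    and "q \<in> topspace (T0 C) \<Longrightarrow> f0 q \<in> topspace (T0 D)"
proof -
  note R = assms[unfolded relational_covering_def]
  note R2 = R[THEN conjunct2] note R3 = R2[THEN conjunct2] note R4 = R3[THEN conjunct2]
  note R5 = R4[THEN conjunct2] note R6 = R5[THEN conjunct2] note R7 = R6[THEN conjunct2]
  note R8 = R7[THEN conjunct2] note R9 = R8[THEN conjunct2]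
  show 1: "f1 \<in> topspace (T1 C) \<rightarrow>\<^sub>E Pow (topspace (T1 D))" using R[THEN conjunct1] .
  show "f0 \<in> extensional (topspace (T0 C))" using R2[THEN conjunct1] .
  show 3: "continuous_map (T0 C) (T0 D) f0" using R3[THEN conjunct1] .
  show "ts_d D s = f0 (ts_d C a) \<and> ts_r D s = f0 (ts_r C a)" if "a \<in> topspace (T1 C)" "s \<in> f1 a"
    using R4[THEN conjunct1] that by simp
  show "ts_m D (s, s') \<in> f1 (ts_m C (a, b))"
    if "(a, b) \<in> composable C" "(s, s') \<in> composable D" "s \<in> f1 a" "s' \<in> f1 b"
    using R5[THEN conjunct1] that by fast
  show "a = b" if "a \<in> topspace (T1 C)" "b \<in> topspace (T1 C)" "ts_d C a = ts_d C b \<or> ts_r C a = ts_r C b"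
      "s \<in> f1 a" "s \<in> f1 b"
    using R6[THEN conjunct1, rule_format, of a b] that by blast
  show "\<exists>t\<in>topspace (T1 C). ts_d C t = q \<and> s \<in> f1 t"
    if "q \<in> topspace (T0 C)" "s \<in> topspace (T1 D)" "ts_d D s = f0 q"
    using R7[THEN conjunct1] that by simp
  show "\<exists>t\<in>topspace (T1 C). ts_r C t = q \<and> s \<in> f1 t"
    if "q \<in> topspace (T0 C)" "s \<in> topspace (T1 D)" "ts_r D s = f0 q"
    using R7[THEN conjunct1] that by simp
  show "openin (T1 C) {x \<in> topspace (T1 C). f1 x \<inter> A \<noteq> {}}" if "openin (T1 D) A"
    using R8[THEN conjunct1] that by simp
  show "ts_u D (f0 q) \<in> f1 (ts_u C q)" if "q \<in> topspace (T0 C)"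
    using R9 that by simp
  show "s \<in> topspace (T1 D)" if "a \<in> topspace (T1 C)" "s \<in> f1 a" using 1 that by (auto simp: PiE_def Pi_def)
  show "f0 q \<in> topspace (T0 D)" if "q \<in> topspace (T0 C)" using continuous_map_funspace[OF 3] that by auto
qed

lemma ET_hom_iff:
  "f \<in> ET_hom k C D \<longleftrightarrow> relational_covering C D (fst f) (snd f) \<and>
     (k \<in> {2, 4} \<longrightarrow> (\<forall>c\<in>topspace (T1 C). fst f c \<noteq> {})) \<and>
     (k \<in> {3, 4} \<longrightarrow> (\<forall>c\<in>topspace (T1 C). \<forall>s\<in>fst f c. \<forall>t\<in>fst f c. s = t))"
  by (cases f) (simp add: ET_hom_def)

lemma ET_hom_nonempty:
  assumes f: "f \<in> ET_hom k C D" and k: "k \<in> {2, 4}" and c: "c \<in> topspace (T1 C)"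
  shows "fst f c \<noteq> {}"
  using f[unfolded ET_hom_iff, THEN conjunct2, THEN conjunct1, THEN mp, OF k] c by (rule bspec)

lemma ET_hom_single_valued:
  "\<lbrakk>f \<in> ET_hom k C D; k \<in> {3, 4}; c \<in> topspace (T1 C); s \<in> fst f c; t \<in> fst f c\<rbrakk> \<Longrightarrow> s = t"
  unfolding ET_hom_iff by blast

lemma ET_id_hom:
  assumes "etale_topological_category C"
  shows "ET_id C \<in> ET_hom k C C"
proof -
  interpret C: topological_cat C by (rule topological_cat_if_etale[OF assms])
  have "relational_covering C C (fst (ET_id C)) (snd (ET_id C))"
  proof (rule relational_coveringI)
    show "continuous_map (T0 C) (T0 C) (snd (ET_id C))"
      by (rule continuous_map_eq[of _ _ id]) (auto simp: ET_id_def)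
    show "openin (T1 C) {x \<in> topspace (T1 C). fst (ET_id C) x \<inter> A \<noteq> {}}" if A: "openin (T1 C) A" for A
    proof -
      have "{x \<in> topspace (T1 C). fst (ET_id C) x \<inter> A \<noteq> {}} = A"
        using openin_subset[OF A] by (auto simp: ET_id_def)
      then show ?thesis using A by simp
    qed
  qed (auto simp: ET_id_def)
  then show ?thesis by (simp add: ET_hom_iff) (simp add: ET_id_def)
qed

lemma ET_comp_hom:
  assumes f: "f \<in> ET_hom k C D" and g: "g \<in> ET_hom k D E"
    and C: "etale_topological_category C" and D: "etale_topological_category D"
  shows "ET_comp C g f \<in> ET_hom k C E"
proof -
  interpret C: topological_cat C by (rule topological_cat_if_etale[OF C])
  interpret D: topological_cat D by (rule topological_cat_if_etale[OF D])
  note F = relational_coveringD[OF f[unfolded ET_hom_iff, THEN conjunct1]]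
  note G = relational_coveringD[OF g[unfolded ET_hom_iff, THEN conjunct1]]
  have fst: "s \<in> fst (ET_comp C g f) a \<longleftrightarrow> (\<exists>b\<in>fst f a. s \<in> fst g b)" if "a \<in> topspace (T1 C)" for a s
    using that by (simp add: ET_comp_def)
  have snd: "snd (ET_comp C g f) x = snd g (snd f x)" if "x \<in> topspace (T0 C)" for x
    using that by (simp add: ET_comp_def compose_def)
  have "relational_covering C E (fst (ET_comp C g f)) (snd (ET_comp C g f))"
  proof (rule relational_coveringI)
    show "fst (ET_comp C g f) \<in> topspace (T1 C) \<rightarrow>\<^sub>E Pow (topspace (T1 E))"
    proof (rule PiE_I)
      fix x assume x: "x \<in> topspace (T1 C)"
      show "fst (ET_comp C g f) x \<in> Pow (topspace (T1 E))"
        using fst[OF x] F(11)[OF x] G(11) by blast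
    qed (simp add: ET_comp_def)
    show "snd (ET_comp C g f) \<in> extensional (topspace (T0 C))" by (simp add: ET_comp_def)
    show "continuous_map (T0 C) (T0 E) (snd (ET_comp C g f))"
      by (rule continuous_map_eq[OF continuous_map_compose[OF F(3) G(3)]]) (simp add: snd)
    show "ts_d E s = snd (ET_comp C g f) (ts_d C a) \<and> ts_r E s = snd (ET_comp C g f) (ts_r C a)"
      if a: "a \<in> topspace (T1 C)" and s: "s \<in> fst (ET_comp C g f) a" for a s
    proof -
      obtain b where b: "b \<in> fst f a" "s \<in> fst g b" using s fst[OF a] by blast
      show ?thesis using F(4)[OF a b(1)] G(4)[OF F(11)[OF a b(1)] b(2)] a by (simp add: snd)
    qed
    show "ts_m E (s, t) \<in> fst (ET_comp C g f) (ts_m C (a, b))"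
      if ab: "(a, b) \<in> composable C" and st: "(s, t) \<in> composable E"
        "s \<in> fst (ET_comp C g f) a" "t \<in> fst (ET_comp C g f) b" for a b s t
    proof -
      have c: "a \<in> topspace (T1 C)" "b \<in> topspace (T1 C)" "ts_d C a = ts_r C b" using ab by auto
      obtain x where x: "x \<in> fst f a" "s \<in> fst g x" using st(2) fst[OF c(1)] by blast
      obtain y where y: "y \<in> fst f b" "t \<in> fst g y" using st(3) fst[OF c(2)] by blast
      have xy: "(x, y) \<in> composable D"
        using F(11)[OF c(1) x(1)] F(11)[OF c(2) y(1)] F(4)[OF c(1) x(1)] F(4)[OF c(2) y(1)] c(3) by simp
      show ?thesis
        using fst[OF C.m_in[OF c]] F(5)[OF ab xy x(1) y(1)] G(5)[OF xy st(1) x(2) y(2)] by blast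
    qed
    show "a = b"
      if a: "a \<in> topspace (T1 C)" and b: "b \<in> topspace (T1 C)" and e: "ts_d C a = ts_d C b \<or> ts_r C a = ts_r C b"
        and s: "s \<in> fst (ET_comp C g f) a" "s \<in> fst (ET_comp C g f) b" for a b s
    proof -
      obtain x where x: "x \<in> fst f a" "s \<in> fst g x" using s(1) fst[OF a] by blast
      obtain y where y: "y \<in> fst f b" "s \<in> fst g y" using s(2) fst[OF b] by blast
      have "ts_d D x = ts_d D y \<or> ts_r D x = ts_r D y"
        using F(4)[OF a x(1)] F(4)[OF b y(1)] e by auto
      then have "x = y" by (rule G(6)[OF F(11)[OF a x(1)] F(11)[OF b y(1)] _ x(2) y(2)])
      then show ?thesis using F(6)[OF a b e x(1)] y(1) by simp
    qed
    show "\<exists>t\<in>topspace (T1 C). ts_d C t = q \<and> s \<in> fst (ET_comp C g f) t"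
      if q: "q \<in> topspace (T0 C)" and s: "s \<in> topspace (T1 E)" "ts_d E s = snd (ET_comp C g f) q" for q s
    proof -
      obtain y where y: "y \<in> topspace (T1 D)" "ts_d D y = snd f q" "s \<in> fst g y"
        using G(7)[OF F(12)[OF q] s(1)] s(2) snd[OF q] by auto
      obtain t where t: "t \<in> topspace (T1 C)" "ts_d C t = q" "y \<in> fst f t"
        using F(7)[OF q y(1,2)] by blast
      then show ?thesis using fst[OF t(1)] y(3) by blast
    qed
    show "\<exists>t\<in>topspace (T1 C). ts_r C t = q \<and> s \<in> fst (ET_comp C g f) t"
      if q: "q \<in> topspace (T0 C)" and s: "s \<in> topspace (T1 E)" "ts_r E s = snd (ET_comp C g f) q" for q s
    proof -
      obtain y where y: "y \<in> topspace (T1 D)" "ts_r D y = snd f q" "s \<in> fst g y"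
        using G(8)[OF F(12)[OF q] s(1)] s(2) snd[OF q] by auto
      obtain t where t: "t \<in> topspace (T1 C)" "ts_r C t = q" "y \<in> fst f t"
        using F(8)[OF q y(1,2)] by blast
      then show ?thesis using fst[OF t(1)] y(3) by blast
    qed
    show "openin (T1 C) {x \<in> topspace (T1 C). fst (ET_comp C g f) x \<inter> A \<noteq> {}}" if A: "openin (T1 E) A" for A
    proof -
      have "{x \<in> topspace (T1 C). fst (ET_comp C g f) x \<inter> A \<noteq> {}}
          = {x \<in> topspace (T1 C). fst f x \<inter> {y \<in> topspace (T1 D). fst g y \<inter> A \<noteq> {}} \<noteq> {}}"
      proof (rule Collect_cong, rule conj_cong[OF refl])
        fix x assume x: "x \<in> topspace (T1 C)"
        show "fst (ET_comp C g f) x \<inter> A \<noteq> {} \<longleftrightarrow> fst f x \<inter> {y \<in> topspace (T1 D). fst g y \<inter> A \<noteq> {}} \<noteq> {}"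
          using fst[OF x] F(11)[OF x] by blast
      qed
      then show ?thesis using F(9)[OF G(9)[OF A]] by simp
    qed
    show "ts_u E (snd (ET_comp C g f) t) \<in> fst (ET_comp C g f) (ts_u C t)" if t: "t \<in> topspace (T0 C)" for t
      using fst[OF C.u_in[OF t]] F(10)[OF t] G(10)[OF F(12)[OF t]] snd[OF t] by auto
  qed
  moreover have "fst (ET_comp C g f) c \<noteq> {}" if k: "k \<in> {2, 4}" and c: "c \<in> topspace (T1 C)" for c
  proof -
    obtain b where b: "b \<in> fst f c" using ET_hom_nonempty[OF f k c] by blast
    obtain s where "s \<in> fst g b" using ET_hom_nonempty[OF g k F(11)[OF c b]] by blast
    then show ?thesis using b fst[OF c] by blast
  qed
  moreover have "s = t" if k: "k \<in> {3, 4}" and c: "c \<in> topspace (T1 C)"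
    and st: "s \<in> fst (ET_comp C g f) c" "t \<in> fst (ET_comp C g f) c" for c s t
  proof -
    obtain x where x: "x \<in> fst f c" "s \<in> fst g x" using st(1) fst[OF c] by blast
    obtain y where y: "y \<in> fst f c" "t \<in> fst g y" using st(2) fst[OF c] by blast
    have "x = y" by (rule ET_hom_single_valued[OF f k c x(1) y(1)])
    then show ?thesis using ET_hom_single_valued[OF g k F(11)[OF c x(1)] x(2)] y(2) by simp
  qed
  ultimately show ?thesis unfolding ET_hom_iff by blast
qed

lemma ET_comp_id:
  assumes f: "f \<in> ET_hom k C D"
  shows "ET_comp C f (ET_id C) = f" "ET_comp C (ET_id D) f = f"
proof -
  note F = relational_coveringD[OF f[unfolded ET_hom_iff, THEN conjunct1]]
  have ext: "fst f \<in> extensional (topspace (T1 C))" using F(1) by (simp add: PiE_def)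
  show "ET_comp C f (ET_id C) = f" "ET_comp C (ET_id D) f = f"
  proof (rule_tac [!] prod_eqI)
    show "fst (ET_comp C f (ET_id C)) = fst f"
      by (rule extensionalityI[OF _ ext]) (simp_all add: ET_comp_def ET_id_def)
    show "snd (ET_comp C f (ET_id C)) = snd f"
      by (rule extensionalityI[OF _ F(2)]) (simp_all add: ET_comp_def ET_id_def compose_def)
    show "fst (ET_comp C (ET_id D) f) = fst f"
    proof (rule extensionalityI[OF _ ext])
      fix x assume x: "x \<in> topspace (T1 C)"
      have "(\<Union>b\<in>fst f x. fst (ET_id D) b) = (\<Union>b\<in>fst f x. {b})"
        by (rule SUP_cong[OF refl]) (use F(11)[OF x] in \<open>simp add: ET_id_def\<close>)
      then show "fst (ET_comp C (ET_id D) f) x = fst f x" using x by (simp add: ET_comp_def)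
    qed (simp add: ET_comp_def)
    show "snd (ET_comp C (ET_id D) f) = snd f"
      by (rule extensionalityI[OF _ F(2)]) (use F(12) in \<open>simp_all add: ET_comp_def ET_id_def compose_def\<close>)
  qed
qed

lemma ET_comp_assoc:
  assumes f: "f \<in> ET_hom k C D"
  shows "ET_comp C h (ET_comp C g f) = ET_comp C (ET_comp D h g) f"
proof (rule prod_eqI)
  note F = relational_coveringD[OF f[unfolded ET_hom_iff, THEN conjunct1]]
  show "fst (ET_comp C h (ET_comp C g f)) = fst (ET_comp C (ET_comp D h g) f)"
    unfolding ET_comp_def using F(11) by (simp, intro restrict_ext) auto
  show "snd (ET_comp C h (ET_comp C g f)) = snd (ET_comp C (ET_comp D h g) f)"
    unfolding ET_comp_def compose_def using F(12) by (simp, intro restrict_ext) auto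
qed

section \<open>The functor \<open>\<Omega>\<close> on morphisms\<close>

lemma Omega_map_apply:
  "openin (T1 D) A \<Longrightarrow> Omega_map C D f A = {x \<in> topspace (T1 C). fst f x \<inter> A \<noteq> {}}"
  by (simp add: Omega_map_def)

text \<open>
  A factorization \<open>pq\<close> of an element of \<open>f(x)\<close> lifts to \<open>x\<close>: lift \<open>q\<close> to some \<open>z\<close> with
  \<open>d(z) = d(x)\<close>, then \<open>p\<close> to some \<open>y\<close> with \<open>d(y) = r(z)\<close>. Now \<open>pq\<close> belongs to \<open>f(yz)\<close> too,
  and \<open>x = yz\<close> because \<open>d(x) = d(yz)\<close>. Similar liftings of single elements settle \<open>\<lambda>\<close> and
  \<open>\<rho>\<close>. The top is preserved when \<open>f\<close> is at least single-valued, and binary meets when it is at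
  most single-valued.
\<close>

lemma Omega_map_hom:
  assumes f: "f \<in> ET_hom k C D" and C: "etale_topological_category C" and D: "etale_topological_category D"
  shows "Omega_map C D f \<in> EL_hom k (Omega C) (Omega D)"
proof -
  interpret C: topological_cat C by (rule topological_cat_if_etale[OF C])
  interpret D: topological_cat D by (rule topological_cat_if_etale[OF D])
  note F = relational_coveringD[OF f[unfolded ET_hom_iff, THEN conjunct1]]
  let ?h = "Omega_map C D f"
  have h: "x \<in> ?h A \<longleftrightarrow> x \<in> topspace (T1 C) \<and> (\<exists>s\<in>fst f x. s \<in> A)" if "openin (T1 D) A" for x A
    using that by (auto simp: Omega_map_apply)
  have op: "openin (T1 C) (?h A)" if "openin (T1 D) A" for A
    using F(9)[OF that] that by (simp add: Omega_map_apply)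
  have mult_open: "openin (T1 D) (A \<star>\<^bsub>Omega D\<^esub> B)" if "openin (T1 D) A" "openin (T1 D) B" for A B
    using D.O.mult_closed[of A B] that by simp
  \<comment> \<open>The unit at \<open>d(x)\<close> is related to the same unit of \<open>D\<close> as \<open>x\<close>.\<close>
  have unit: "x = ts_u C (ts_d C x)" if x: "x \<in> topspace (T1 C)" and v: "v \<in> topspace (T0 D)" "ts_u D v \<in> fst f x" for x v
  proof -
    have "v = snd f (ts_d C x)" using F(4)[OF x v(2)] v(1) by simp
    then have "ts_u D v \<in> fst f (ts_u C (ts_d C x))" using F(10)[of "ts_d C x"] x by simp
    then show ?thesis by (intro F(6)[OF x _ _ v(2)]) (use x in simp_all)
  qed
  have unit_open: "openin (T1 D) (ts_u D ` V)" if "openin (T0 D) V" for V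
    using D.open_u that by (simp add: open_map_def)
  show ?thesis
  proof (rule EL_homI[OF C.etale_localic_Omega D.etale_localic_Omega])
    show "?h \<in> carrier (L1 (Omega D)) \<rightarrow>\<^sub>E carrier (L1 (Omega C))"
      using op by (auto simp: Omega_map_def)
    show "?h (\<Squnion>\<^bsub>L1 (Omega D)\<^esub>A) = \<Squnion>\<^bsub>L1 (Omega C)\<^esub>(?h ` A)" if "A \<subseteq> carrier (L1 (Omega D))" for A
    proof -
      have A: "A \<subseteq> {U. openin (T1 D) U}" using that by simp
      then have hA: "?h ` A \<subseteq> {U. openin (T1 C) U}" using op by blast
      have UA: "openin (T1 D) (\<Union>A)" using A by blast
      have hB: "?h B = {x \<in> topspace (T1 C). \<exists>s\<in>fst f x. s \<in> B}" if "openin (T1 D) B" for B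
        using h[OF that] by blast
      have im: "?h ` A = (\<lambda>B. {x \<in> topspace (T1 C). \<exists>s\<in>fst f x. s \<in> B}) ` A"
        by (rule image_cong[OF refl hB]) (use A in blast)
      have "?h (\<Union>A) = \<Union>(?h ` A)" unfolding im hB[OF UA] by blast
      then show ?thesis by (simp add: Sup_opens[OF A] Sup_opens[OF hA])
    qed
    show "?h (A \<star>\<^bsub>Omega D\<^esub> B) = ?h A \<star>\<^bsub>Omega C\<^esub> ?h B"
      if "A \<in> carrier (L1 (Omega D))" "B \<in> carrier (L1 (Omega D))" for A B
    proof -
      have o: "openin (T1 D) A" "openin (T1 D) B" using that by auto
      note sub = openin_subset[OF o(1), THEN subsetD] openin_subset[OF o(2), THEN subsetD]
      show ?thesis
        unfolding C.Omega_mult[OF op[OF o(1)] op[OF o(2)]]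
      proof (intro equalityI subsetI)
        fix x assume "x \<in> ?h (A \<star>\<^bsub>Omega D\<^esub> B)"
        then obtain p q where x: "x \<in> topspace (T1 C)" and pq: "p \<in> A" "q \<in> B" "ts_d D p = ts_r D q"
          "ts_m D (p, q) \<in> fst f x"
          unfolding h[OF mult_open[OF o]] unfolding D.Omega_mult[OF o] by blast
        note pc = sub(1)[OF pq(1)] and qc = sub(2)[OF pq(2)]
        have "ts_d D q = snd f (ts_d C x)" using F(4)[OF x pq(4)] D.d_m[OF pc qc pq(3)] by simp
        then obtain z where z: "z \<in> topspace (T1 C)" "ts_d C z = ts_d C x" "q \<in> fst f z"
          using F(7)[OF _ qc, of "ts_d C x"] x by auto
        have "ts_d D p = snd f (ts_r C z)" using F(4)[OF z(1,3)] pq(3) by simp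
        then obtain y where y: "y \<in> topspace (T1 C)" "ts_d C y = ts_r C z" "p \<in> fst f y"
          using F(7)[OF _ pc, of "ts_r C z"] z(1) by auto
        have "ts_m D (p, q) \<in> fst f (ts_m C (y, z))"
          by (rule F(5)) (use y z pc qc pq(3) in simp_all)
        then have "x = ts_m C (y, z)"
          by (intro F(6)[OF x _ _ pq(4)]) (use y z in simp_all)
        moreover have "y \<in> ?h A" "z \<in> ?h B" using h o y z pq(1,2) by blast+
        ultimately show "x \<in> {ts_m C (a, b) |a b. a \<in> ?h A \<and> b \<in> ?h B \<and> ts_d C a = ts_r C b}"
          using y(2) by blast
      next
        fix x assume "x \<in> {ts_m C (a, b) |a b. a \<in> ?h A \<and> b \<in> ?h B \<and> ts_d C a = ts_r C b}"
        then obtain y z where yz: "x = ts_m C (y, z)" "y \<in> ?h A" "z \<in> ?h B" "ts_d C y = ts_r C z" by blast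
        obtain p where y: "y \<in> topspace (T1 C)" and p: "p \<in> fst f y" "p \<in> A" using yz(2) h[OF o(1)] by blast
        obtain q where z: "z \<in> topspace (T1 C)" and q: "q \<in> fst f z" "q \<in> B" using yz(3) h[OF o(2)] by blast
        have pq: "ts_d D p = ts_r D q" using F(4)[OF y p(1)] F(4)[OF z q(1)] yz(4) by simp
        have "ts_m D (p, q) \<in> fst f x"
          unfolding yz(1) by (rule F(5)) (use y z yz(4) pq p q sub in simp_all)
        moreover have "ts_m D (p, q) \<in> A \<star>\<^bsub>Omega D\<^esub> B" unfolding D.Omega_mult[OF o] using p q pq by blast
        moreover have "x \<in> topspace (T1 C)" using yz(1,4) y z by simp
        ultimately show "x \<in> ?h (A \<star>\<^bsub>Omega D\<^esub> B)" unfolding h[OF mult_open[OF o]] by blast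
      qed
    qed
    show "?h \<e>\<^bsub>quantal_of (Omega D)\<^esub> = \<e>\<^bsub>quantal_of (Omega C)\<^esub>"
      unfolding C.Omega_unit D.Omega_unit
    proof (intro equalityI subsetI)
      have o: "openin (T1 D) (ts_u D ` topspace (T0 D))" by (rule unit_open) simp
      fix x assume "x \<in> ?h (ts_u D ` topspace (T0 D))"
      then obtain v where v: "x \<in> topspace (T1 C)" "v \<in> topspace (T0 D)" "ts_u D v \<in> fst f x"
        unfolding h[OF o] by blast
      then show "x \<in> ts_u C ` topspace (T0 C)" using unit[OF v] by (intro image_eqI[of _ _ "ts_d C x"]) simp_all
    next
      have o: "openin (T1 D) (ts_u D ` topspace (T0 D))" by (rule unit_open) simp
      fix x assume "x \<in> ts_u C ` topspace (T0 C)"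
      then obtain t where "t \<in> topspace (T0 C)" "x = ts_u C t" by blast
      then show "x \<in> ?h (ts_u D ` topspace (T0 D))"
        unfolding h[OF o] using F(10)[of t] F(12)[of t] by auto
    qed
    show "?h (\<lambda>\<^sub>q\<^bsub>quantal_of (Omega D)\<^esub> A) = \<lambda>\<^sub>q\<^bsub>quantal_of (Omega C)\<^esub> (?h A)"
      if "A \<in> carrier (L1 (Omega D))" for A
    proof -
      have A: "openin (T1 D) A" using that by simp
      note sub = openin_subset[OF A, THEN subsetD]
      have dA: "openin (T0 D) (ts_d D ` A)"
        using local_homeomorphism_open_map[OF D.lh_d] A by (simp add: open_map_def)
      show ?thesis
        unfolding C.Omega_lam[OF op[OF A]] D.Omega_lam[OF A]
      proof (intro equalityI subsetI)
        fix x assume "x \<in> ?h (ts_u D ` ts_d D ` A)"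
        then obtain a where x: "x \<in> topspace (T1 C)" and a: "a \<in> A" "ts_u D (ts_d D a) \<in> fst f x"
          unfolding h[OF unit_open[OF dA]] by blast
        note ac = sub[OF a(1)]
        have eq: "x = ts_u C (ts_d C x)" by (rule unit[OF x D.d_in[OF ac] a(2)])
        have "ts_d D a = snd f (ts_d C x)" using F(4)[OF x a(2)] ac by simp
        then obtain y where y: "y \<in> topspace (T1 C)" "ts_d C y = ts_d C x" "a \<in> fst f y"
          using F(7)[OF _ ac, of "ts_d C x"] x by auto
        then have "y \<in> ?h A" using h[OF A] a(1) by blast
        then show "x \<in> ts_u C ` ts_d C ` ?h A" using eq y(2) by (metis image_eqI)
      next
        fix x assume "x \<in> ts_u C ` ts_d C ` ?h A"
        then obtain y where y: "y \<in> ?h A" "x = ts_u C (ts_d C y)" by blast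
        then obtain a where a: "y \<in> topspace (T1 C)" "a \<in> fst f y" "a \<in> A" using h[OF A] by blast
        have "ts_u D (ts_d D a) \<in> fst f x" using F(10)[of "ts_d C y"] F(4)[OF a(1,2)] a(1) y(2) by simp
        then show "x \<in> ?h (ts_u D ` ts_d D ` A)"
          unfolding h[OF unit_open[OF dA]] using a y(2) by auto
      qed
    qed
    show "?h (\<rho>\<^sub>q\<^bsub>quantal_of (Omega D)\<^esub> A) = \<rho>\<^sub>q\<^bsub>quantal_of (Omega C)\<^esub> (?h A)"
      if "A \<in> carrier (L1 (Omega D))" for A
    proof -
      have A: "openin (T1 D) A" using that by simp
      note sub = openin_subset[OF A, THEN subsetD]
      have rA: "openin (T0 D) (ts_r D ` A)"
        using local_homeomorphism_open_map[OF D.lh_r] A by (simp add: open_map_def)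
      show ?thesis
        unfolding C.Omega_rho[OF op[OF A]] D.Omega_rho[OF A]
      proof (intro equalityI subsetI)
        fix x assume "x \<in> ?h (ts_u D ` ts_r D ` A)"
        then obtain a where x: "x \<in> topspace (T1 C)" and a: "a \<in> A" "ts_u D (ts_r D a) \<in> fst f x"
          unfolding h[OF unit_open[OF rA]] by blast
        note ac = sub[OF a(1)]
        have eq: "x = ts_u C (ts_d C x)" by (rule unit[OF x D.r_in[OF ac] a(2)])
        have "ts_r D a = snd f (ts_d C x)" using F(4)[OF x a(2)] ac by simp
        then obtain y where y: "y \<in> topspace (T1 C)" "ts_r C y = ts_d C x" "a \<in> fst f y"
          using F(8)[OF _ ac, of "ts_d C x"] x by auto
        then have "y \<in> ?h A" using h[OF A] a(1) by blast
        then show "x \<in> ts_u C ` ts_r C ` ?h A" using eq y(2) by (metis image_eqI)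
      next
        fix x assume "x \<in> ts_u C ` ts_r C ` ?h A"
        then obtain y where y: "y \<in> ?h A" "x = ts_u C (ts_r C y)" by blast
        then obtain a where a: "y \<in> topspace (T1 C)" "a \<in> fst f y" "a \<in> A" using h[OF A] by blast
        have "ts_u D (ts_r D a) \<in> fst f x" using F(10)[of "ts_r C y"] F(4)[OF a(1,2)] a(1) y(2) by simp
        then show "x \<in> ?h (ts_u D ` ts_r D ` A)"
          unfolding h[OF unit_open[OF rA]] using a y(2) by auto
      qed
    qed
    show "?h A \<in> local_bisections (Omega C)" if "A \<in> local_bisections (Omega D)" for A
    proof -
      have A: "openin (T1 D) A" "inj_on (ts_d D) A" "inj_on (ts_r D) A"
        using that unfolding D.Omega_bisection_iff by auto
      have "x = y" if xy: "x \<in> ?h A" "y \<in> ?h A" and e: "ts_d C x = ts_d C y \<or> ts_r C x = ts_r C y" for x y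
      proof -
        obtain s where s: "x \<in> topspace (T1 C)" "s \<in> fst f x" "s \<in> A" using xy(1) h[OF A(1)] by blast
        obtain t where t: "y \<in> topspace (T1 C)" "t \<in> fst f y" "t \<in> A" using xy(2) h[OF A(1)] by blast
        have "ts_d D s = ts_d D t \<or> ts_r D s = ts_r D t" using F(4)[OF s(1,2)] F(4)[OF t(1,2)] e by auto
        then have "s = t" using A(2,3) s(3) t(3) by (auto simp: inj_on_def)
        then show ?thesis using F(6)[OF s(1) t(1) e s(2)] t(2) by simp
      qed
      then show ?thesis unfolding C.Omega_bisection_iff using op[OF A(1)] by (auto intro!: inj_onI)
    qed
    show "?h \<top>\<^bsub>L1 (Omega D)\<^esub> = \<top>\<^bsub>L1 (Omega C)\<^esub>" if k: "k \<in> {2, 4}"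
    proof -
      have "fst f x \<noteq> {}" if "x \<in> topspace (T1 C)" for x by (rule ET_hom_nonempty[OF f k that])
      then have "x \<in> ?h (topspace (T1 D)) \<longleftrightarrow> x \<in> topspace (T1 C)" for x
        unfolding h[OF openin_topspace] using F(11) by blast
      then show ?thesis by (auto simp: top_opens)
    qed
    show "?h (A \<sqinter>\<^bsub>L1 (Omega D)\<^esub> B) = ?h A \<sqinter>\<^bsub>L1 (Omega C)\<^esub> ?h B"
      if k: "k \<in> {3, 4}" and AB: "A \<in> carrier (L1 (Omega D))" "B \<in> carrier (L1 (Omega D))" for A B
    proof -
      have o: "openin (T1 D) A" "openin (T1 D) B" "openin (T1 D) (A \<inter> B)" using AB by auto
      have sv: "s = t" if "x \<in> topspace (T1 C)" "s \<in> fst f x" "t \<in> fst f x" for x s t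
        by (rule ET_hom_single_valued[OF f k that])
      have "x \<in> ?h (A \<inter> B) \<longleftrightarrow> x \<in> ?h A \<inter> ?h B" for x
        unfolding Int_iff[of x] h[OF o(1)] h[OF o(2)] h[OF o(3)] using sv[of x] by blast
      then show ?thesis using o op by (auto simp: meet_opens)
    qed
  qed
qed

lemma Omega_map_id:
  shows "Omega_map C C (ET_id C) = EL_id (Omega C)"
proof -
  have "{x \<in> topspace (T1 C). fst (ET_id C) x \<inter> A \<noteq> {}} = A" if "openin (T1 C) A" for A
    using openin_subset[OF that] by (auto simp: ET_id_def)
  then show ?thesis unfolding Omega_map_def EL_id_def by (intro ext) (simp add: Omega_def restrict_def)
qed

lemma Omega_map_comp:
  assumes f: "f \<in> ET_hom k C D" and g: "g \<in> ET_hom k D E"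
  shows "Omega_map C E (ET_comp C g f) = EL_comp (Omega E) (Omega_map D E g) (Omega_map C D f)"
proof (rule extensionalityI)
  note F = relational_coveringD[OF f[unfolded ET_hom_iff, THEN conjunct1]]
  note G = relational_coveringD[OF g[unfolded ET_hom_iff, THEN conjunct1]]
  show "Omega_map C E (ET_comp C g f) \<in> extensional {A. openin (T1 E) A}" by (simp add: Omega_map_def)
  show "EL_comp (Omega E) (Omega_map D E g) (Omega_map C D f) \<in> extensional {A. openin (T1 E) A}"
    by (simp add: EL_comp_def Omega_def)
  fix A assume "A \<in> {A. openin (T1 E) A}"
  then have A: "openin (T1 E) A" by simp
  have gA: "openin (T1 D) {y \<in> topspace (T1 D). fst g y \<inter> A \<noteq> {}}" by (rule G(9)[OF A])
  have "EL_comp (Omega E) (Omega_map D E g) (Omega_map C D f) A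
      = {x \<in> topspace (T1 C). fst f x \<inter> {y \<in> topspace (T1 D). fst g y \<inter> A \<noteq> {}} \<noteq> {}}"
    using A by (simp add: EL_comp_def compose_def Omega_map_apply[OF A] Omega_map_apply[OF gA] Omega_def)
  also have "\<dots> = {x \<in> topspace (T1 C). fst (ET_comp C g f) x \<inter> A \<noteq> {}}"
  proof (rule Collect_cong, rule conj_cong[OF refl])
    fix x assume x: "x \<in> topspace (T1 C)"
    then have "fst (ET_comp C g f) x = (\<Union>b\<in>fst f x. fst g b)" by (simp add: ET_comp_def)
    then show "fst f x \<inter> {y \<in> topspace (T1 D). fst g y \<inter> A \<noteq> {}} \<noteq> {} \<longleftrightarrow> fst (ET_comp C g f) x \<inter> A \<noteq> {}"
      using F(11)[OF x] by blast
  qed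
  finally show "Omega_map C E (ET_comp C g f) A = EL_comp (Omega E) (Omega_map D E g) (Omega_map C D f) A"
    by (simp add: Omega_map_apply[OF A])
qed

section \<open>The functor \<open>Pt\<close> on objects\<close>

lemma Pt_simps [simp]:
  "T1 (Pt C) = pt_space (L1 C)" "T0 (Pt C) = pt_space (L0 C)"
  "ts_u (Pt C) = pt_map (L1 C) (ls_u C)" "ts_d (Pt C) = pt_map (L0 C) (ls_d C)"
  "ts_r (Pt C) = pt_map (L0 C) (ls_r C)"
  by (simp_all add: Pt_def)

context etale_localic
begin

abbreviation ptd where "ptd p \<equiv> pt_map (L0 C) (ls_d C) p"
abbreviation ptr where "ptr p \<equiv> pt_map (L0 C) (ls_r C) p"

lemma topspace_Pt [simp]: "topspace (pt_space (L1 C)) = pt (L1 C)" "topspace (pt_space (L0 C)) = pt (L0 C)"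
  by (simp_all add: topspace_pt_space frame1 frame0)

lemma ptd_in [simp]: "p \<in> pt (L1 C) \<Longrightarrow> ptd p \<in> pt (L0 C)"
  and ptr_in [simp]: "p \<in> pt (L1 C) \<Longrightarrow> ptr p \<in> pt (L0 C)"
  and ptu_in [simp]: "x \<in> pt (L0 C) \<Longrightarrow> pt_map (L1 C) (ls_u C) x \<in> pt (L1 C)"
  by (rule pt_map_in_pt; use frame1 frame0 d.hom r.hom u.hom in blast)+

lemma composable_Pt: "(p, q) \<in> composable (Pt C) \<longleftrightarrow> p \<in> pt (L1 C) \<and> q \<in> pt (L1 C) \<and> ptd p = ptr q"
  by (auto simp: composable_def)

lemma composable_PtD: "\<lbrakk>ptd p = ptr q; z \<in> carrier (L0 C)\<rbrakk> \<Longrightarrow> p (ls_d C z) = q (ls_r C z)"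
  by (metis pt_map_apply)

text \<open>
  \<open>pair_pt\<close> inverts the comparison between the points of the pullback and the pairs of points.
\<close>

lemma Pt_m_eq:
  assumes pq: "p \<in> pt (L1 C)" "q \<in> pt (L1 C)" "ptd p = ptr q"
  shows "ts_m (Pt C) (p, q) = pt_map (L1 C) (ls_m C) (P2.pair_pt p q)"
proof -
  note bal = composable_PtD[OF pq(3)]
  have inj: "inj_on (pt_comparison C) (pt (L2 C))"
  proof (rule inj_on_inverseI[of _ "\<lambda>(p, q). P2.pair_pt p q"])
    fix s assume "s \<in> pt (L2 C)"
    then show "(\<lambda>(p, q). P2.pair_pt p q) (pt_comparison C s) = s"
      by (simp add: pt_comparison_def lpr1_eq lpr2_eq L2_eq P2.pair_pt_pt_map)
  qed
  have "inv_into (pt (L2 C)) (pt_comparison C) (p, q) = P2.pair_pt p q"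
  proof (rule inv_into_f_eq[OF inj])
    show "P2.pair_pt p q \<in> pt (L2 C)" unfolding L2_eq by (rule P2.pair_pt[OF pq(1,2) bal])
    show "pt_comparison C (P2.pair_pt p q) = (p, q)"
      unfolding pt_comparison_def lpr1_eq lpr2_eq
      using P2.pt_map_pr_pair_pt[OF pq(1,2) bal] by simp
  qed
  then show ?thesis by (simp add: Pt_def)
qed

lemma Pt_m_in:
  assumes pq: "p \<in> pt (L1 C)" "q \<in> pt (L1 C)" "ptd p = ptr q"
  shows "ts_m (Pt C) (p, q) \<in> pt (L1 C)"
  unfolding Pt_m_eq[OF pq]
  by (rule pt_map_in_pt[OF frame1 m.hom])
    (simp add: L2_eq P2.pair_pt[OF pq(1,2) composable_PtD[OF pq(3)]])

lemma Pt_m_apply: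
  assumes pq: "p \<in> pt (L1 C)" "q \<in> pt (L1 C)" "ptd p = ptr q" and c: "c \<in> carrier (L1 C)"
  shows "ts_m (Pt C) (p, q) c \<longleftrightarrow> (\<exists>a\<in>carrier (L1 C). \<exists>b\<in>carrier (L1 C). a \<star> b \<sqsubseteq>\<^sub>1 c \<and> p a \<and> q b)"
proof -
  have "ts_m (Pt C) (p, q) c \<longleftrightarrow> (\<exists>(a, b)\<in>ls_m C c. p a \<and> q b)"
    unfolding Pt_m_eq[OF pq] using c P2.pair_pt_apply[OF m_ideal[OF c]] by simp
  also have "\<dots> \<longleftrightarrow> (\<exists>a\<in>carrier (L1 C). \<exists>b\<in>carrier (L1 C). a \<star> b \<sqsubseteq>\<^sub>1 c \<and> p a \<and> q b)"
  proof -
    have "(a, b) \<in> ls_m C c \<longleftrightarrow> a \<in> carrier (L1 C) \<and> b \<in> carrier (L1 C) \<and> a \<star> b \<sqsubseteq>\<^sub>1 c" for a b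
      using P2.idealD(1,2)[OF m_ideal[OF c], of a b] mult_le_iff[OF _ _ c, of a b] by blast
    then show ?thesis unfolding Bex_def split_paired_Ex prod.case by blast
  qed
  finally show ?thesis .
qed

lemma Pt_m_mult:
  assumes pq: "p \<in> pt (L1 C)" "q \<in> pt (L1 C)" "ptd p = ptr q"
    and "a \<in> carrier (L1 C)" "b \<in> carrier (L1 C)" "p a" "q b"
  shows "ts_m (Pt C) (p, q) (a \<star> b)"
  unfolding Pt_m_apply[OF pq mult_closed[OF assms(4,5)]]
  using assms(4-) mult_closed F1.le_refl by blast

lemma
  assumes pq: "p \<in> pt (L1 C)" "q \<in> pt (L1 C)" "ptd p = ptr q"
  shows ptd_m: "ptd (ts_m (Pt C) (p, q)) = ptd q" and ptr_m: "ptr (ts_m (Pt C) (p, q)) = ptr p"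
proof -
  note mi = Pt_m_in[OF pq]
  note bal = composable_PtD[OF pq(3)]
  have ap: "ts_m (Pt C) (p, q) c = P2.pair_pt p q (ls_m C c)" if "c \<in> carrier (L1 C)" for c
    using that by (simp add: Pt_m_eq[OF pq])
  show "ptd (ts_m (Pt C) (p, q)) = ptd q"
  proof (rule pt_eqI[OF ptd_in[OF mi] ptd_in[OF pq(2)]])
    fix z assume z: "z \<in> carrier (L0 C)"
    then show "ptd (ts_m (Pt C) (p, q)) z = ptd q z"
      using fun_cong[OF P2.pt_map_pr_pair_pt(2)[OF pq(1,2) bal], of "ls_d C z"]
      by (simp add: ap m_d lpr2_eq)
  qed
  show "ptr (ts_m (Pt C) (p, q)) = ptr p"
  proof (rule pt_eqI[OF ptr_in[OF mi] ptr_in[OF pq(1)]])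
    fix z assume z: "z \<in> carrier (L0 C)"
    then show "ptr (ts_m (Pt C) (p, q)) z = ptr p z"
      using fun_cong[OF P2.pt_map_pr_pair_pt(1)[OF pq(1,2) bal], of "ls_r C z"]
      by (simp add: ap m_r lpr1_eq)
  qed
qed

lemma ptd_ptu [simp]: "x \<in> pt (L0 C) \<Longrightarrow> ptd (pt_map (L1 C) (ls_u C) x) = x"
proof (rule pt_eqI)
  fix z assume "x \<in> pt (L0 C)" "z \<in> carrier (L0 C)"
  then show "ptd (pt_map (L1 C) (ls_u C) x) z = x z" by (simp add: u_d)
qed simp_all

lemma ptr_ptu [simp]: "x \<in> pt (L0 C) \<Longrightarrow> ptr (pt_map (L1 C) (ls_u C) x) = x"
proof (rule pt_eqI)
  fix z assume "x \<in> pt (L0 C)" "z \<in> carrier (L0 C)"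
  then show "ptr (pt_map (L1 C) (ls_u C) x) z = x z" by (simp add: u_r)
qed simp_all

text \<open>
  The unit law of \<open>C\<close> represents \<open>c\<close> as a join; its value at \<open>p\<close> is the value of the product of
  \<open>p\<close> with a unit at \<open>c\<close>.
\<close>

lemma Pt_unit_right:
  assumes p: "p \<in> pt (L1 C)"
  shows "ts_m (Pt C) (p, pt_map (L1 C) (ls_u C) (ptd p)) = p"
proof -
  let ?u = "pt_map (L1 C) (ls_u C) (ptd p)"
  have u: "?u \<in> pt (L1 C)" "ptd p = ptr ?u" using p by simp_all
  show ?thesis
  proof (rule pt_eqI[OF Pt_m_in[OF p u] p])
    fix c assume c: "c \<in> carrier (L1 C)"
    let ?h = "\<lambda>(x, y). x \<sqinter>\<^sub>1 ls_d C (ls_u C y)"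
    have sub: "?h ` ls_m C c \<subseteq> carrier (L1 C)" using P2.ideal_sub[OF m_ideal[OF c]] by auto
    have rep: "\<Squnion>\<^sub>1(?h ` ls_m C c) = c" using m_1_ud[OF c] c m_ideal by (simp add: pb_pair_def)
    have "p c \<longleftrightarrow> (\<exists>w\<in>ls_m C c. p (?h w))" using pt_Sup[OF p sub] rep by simp
    also have "\<dots> \<longleftrightarrow> (\<exists>(x, y)\<in>ls_m C c. p x \<and> ?u y)"
    proof (rule bex_cong[OF refl], clarify)
      fix x y assume "(x, y) \<in> ls_m C c"
      then show "p (x \<sqinter>\<^sub>1 ls_d C (ls_u C y)) \<longleftrightarrow> p x \<and> ?u y"
        using P2.idealD(1,2)[OF m_ideal[OF c], of x y] pt_meet[OF p] by simp
    qed
    also have "\<dots> \<longleftrightarrow> ts_m (Pt C) (p, ?u) c"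
      unfolding Pt_m_eq[OF p u] using c P2.pair_pt_apply[OF m_ideal[OF c]] by simp
    finally show "ts_m (Pt C) (p, ?u) c = p c" by simp
  qed
qed

lemma Pt_unit_left:
  assumes p: "p \<in> pt (L1 C)"
  shows "ts_m (Pt C) (pt_map (L1 C) (ls_u C) (ptr p), p) = p"
proof -
  let ?u = "pt_map (L1 C) (ls_u C) (ptr p)"
  have u: "?u \<in> pt (L1 C)" "ptd ?u = ptr p" using p by simp_all
  show ?thesis
  proof (rule pt_eqI[OF Pt_m_in[OF u(1) p u(2)] p])
    fix c assume c: "c \<in> carrier (L1 C)"
    let ?h = "\<lambda>(x, y). ls_r C (ls_u C x) \<sqinter>\<^sub>1 y"
    have sub: "?h ` ls_m C c \<subseteq> carrier (L1 C)" using P2.ideal_sub[OF m_ideal[OF c]] by auto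
    have rep: "\<Squnion>\<^sub>1(?h ` ls_m C c) = c" using m_ur_1[OF c] c m_ideal by (simp add: pb_pair_def)
    have "p c \<longleftrightarrow> (\<exists>w\<in>ls_m C c. p (?h w))" using pt_Sup[OF p sub] rep by simp
    also have "\<dots> \<longleftrightarrow> (\<exists>(x, y)\<in>ls_m C c. ?u x \<and> p y)"
    proof (rule bex_cong[OF refl], clarify)
      fix x y assume "(x, y) \<in> ls_m C c"
      then show "p (ls_r C (ls_u C x) \<sqinter>\<^sub>1 y) \<longleftrightarrow> ?u x \<and> p y"
        using P2.idealD(1,2)[OF m_ideal[OF c], of x y] pt_meet[OF p] by simp
    qed
    also have "\<dots> \<longleftrightarrow> ts_m (Pt C) (?u, p) c"
      unfolding Pt_m_eq[OF u(1) p u(2)] using c P2.pair_pt_apply[OF m_ideal[OF c]] by simp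
    finally show "ts_m (Pt C) (?u, p) c = p c" by simp
  qed
qed

lemma Pt_assoc:
  assumes p: "p \<in> pt (L1 C)" and q: "q \<in> pt (L1 C)" and s: "s \<in> pt (L1 C)"
    and pq: "ptd p = ptr q" and qs: "ptd q = ptr s"
  shows "ts_m (Pt C) (ts_m (Pt C) (p, q), s) = ts_m (Pt C) (p, ts_m (Pt C) (q, s))"
proof -
  let ?pq = "ts_m (Pt C) (p, q)" and ?qs = "ts_m (Pt C) (q, s)"
  note 1 = Pt_m_in[OF p q pq] and 2 = Pt_m_in[OF q s qs]
  have 3: "ptd ?pq = ptr s" and 4: "ptd p = ptr ?qs"
    using ptd_m[OF p q pq] ptr_m[OF q s qs] pq qs by simp_all
  show ?thesis
  proof (rule pt_eqI[OF Pt_m_in[OF 1 s 3] Pt_m_in[OF p 2 4]], rule iffI)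
    fix x assume x: "x \<in> carrier (L1 C)"
    {
      assume "ts_m (Pt C) (?pq, s) x"
      then obtain y c where y: "y \<in> carrier (L1 C)" "c \<in> carrier (L1 C)" "y \<star> c \<sqsubseteq>\<^sub>1 x" "?pq y" "s c"
        unfolding Pt_m_apply[OF 1 s 3 x] by blast
      then obtain a b where ab: "a \<in> carrier (L1 C)" "b \<in> carrier (L1 C)" "a \<star> b \<sqsubseteq>\<^sub>1 y" "p a" "q b"
        unfolding Pt_m_apply[OF p q pq y(1)] by blast
      have "a \<star> b \<star> c \<sqsubseteq>\<^sub>1 y \<star> c" using ab y by (intro mult_mono) auto
      then have "a \<star> (b \<star> c) \<sqsubseteq>\<^sub>1 x" using F1.le_trans[OF _ y(3)] ab y x mult_assoc by simp
      then show "ts_m (Pt C) (p, ?qs) x"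
        unfolding Pt_m_apply[OF p 2 4 x] using Pt_m_mult[OF q s qs ab(2) y(2) ab(5) y(5)] ab y mult_closed by blast
    next
      assume "ts_m (Pt C) (p, ?qs) x"
      then obtain a y where y: "a \<in> carrier (L1 C)" "y \<in> carrier (L1 C)" "a \<star> y \<sqsubseteq>\<^sub>1 x" "p a" "?qs y"
        unfolding Pt_m_apply[OF p 2 4 x] by blast
      then obtain b c where bc: "b \<in> carrier (L1 C)" "c \<in> carrier (L1 C)" "b \<star> c \<sqsubseteq>\<^sub>1 y" "q b" "s c"
        unfolding Pt_m_apply[OF q s qs y(2)] by blast
      have "a \<star> (b \<star> c) \<sqsubseteq>\<^sub>1 a \<star> y" using bc y by (intro mult_mono) auto
      then have "a \<star> b \<star> c \<sqsubseteq>\<^sub>1 x" using F1.le_trans[OF _ y(3)] bc y x mult_assoc by simp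
      then show "ts_m (Pt C) (?pq, s) x"
        unfolding Pt_m_apply[OF 1 s 3 x] using Pt_m_mult[OF p q pq y(1) bc(1) y(4) bc(4)] bc y mult_closed by blast
    }
  qed
qed

lemma openin_Pt: "openin (pt_space (L1 C)) U \<longleftrightarrow> (\<exists>a\<in>carrier (L1 C). U = {p \<in> pt (L1 C). p a})"
  by (rule openin_pt_space[OF frame1])

lemma openin_Pt_basic: "a \<in> carrier (L1 C) \<Longrightarrow> openin (pt_space (L1 C)) {p \<in> pt (L1 C). p a}"
  unfolding openin_Pt by blast

lemma continuous_Pt_m: "continuous_map (T2 (Pt C)) (T1 (Pt C)) (ts_m (Pt C))"
proof -
  have top: "topspace (T2 (Pt C)) = composable (Pt C)" by (auto simp: T2_def composable_def)
  show ?thesis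
    unfolding continuous_map_def top
  proof (intro conjI allI impI)
    show "ts_m (Pt C) \<in> composable (Pt C) \<rightarrow> topspace (T1 (Pt C))"
    proof
      fix w assume w: "w \<in> composable (Pt C)"
      obtain p q where pq: "w = (p, q)" by (cases w)
      show "ts_m (Pt C) w \<in> topspace (T1 (Pt C))" using w Pt_m_in unfolding pq composable_Pt by simp
    qed
    fix U assume "openin (T1 (Pt C)) U"
    then obtain c where c: "c \<in> carrier (L1 C)" "U = {p \<in> pt (L1 C). p c}" using openin_Pt by auto
    let ?V = "\<Union>(a, b)\<in>ls_m C c. {p \<in> pt (L1 C). p a} \<times> {p \<in> pt (L1 C). p b}"
    have "openin (prod_topology (T1 (Pt C)) (T1 (Pt C))) ({p \<in> pt (L1 C). p a} \<times> {p \<in> pt (L1 C). p b})"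
      if "(a, b) \<in> ls_m C c" for a b
      using P2.idealD(1,2)[OF m_ideal[OF c(1)] that] openin_Pt_basic by (simp add: openin_prod_Times_iff)
    then have V: "openin (prod_topology (T1 (Pt C)) (T1 (Pt C))) ?V" by (intro openin_Union) auto
    have "w \<in> composable (Pt C) \<and> ts_m (Pt C) w \<in> U \<longleftrightarrow> w \<in> ?V \<inter> composable (Pt C)" for w
    proof (cases w)
      case (Pair p q)
      show ?thesis
      proof (cases "w \<in> composable (Pt C)")
        case True
        then have pq: "p \<in> pt (L1 C)" "q \<in> pt (L1 C)" "ptd p = ptr q" using Pair composable_Pt by auto
        have "ts_m (Pt C) (p, q) c \<longleftrightarrow> (\<exists>(a, b)\<in>ls_m C c. p a \<and> q b)"
          unfolding Pt_m_eq[OF pq] using c(1) P2.pair_pt_apply[OF m_ideal[OF c(1)]] by simp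
        then show ?thesis using True Pt_m_in[OF pq] pq(1,2) unfolding c(2) Pair by blast
      qed blast
    qed
    then have "{w \<in> composable (Pt C). ts_m (Pt C) w \<in> U} = ?V \<inter> composable (Pt C)" by blast
    then show "openin (T2 (Pt C)) {w \<in> composable (Pt C). ts_m (Pt C) w \<in> U}"
      unfolding T2_def openin_subtopology using V by blast
  qed
qed

theorem topological_cat_Pt: "topological_cat (Pt C)"
proof
  show "topological_category (Pt C)"
    unfolding topological_category_def
  proof (intro conjI)
    show "continuous_map (T0 (Pt C)) (T1 (Pt C)) (ts_u (Pt C))"
      using continuous_pt_map[OF frame0 frame1 u.hom] by simp
    show "continuous_map (T1 (Pt C)) (T0 (Pt C)) (ts_d (Pt C))" "continuous_map (T1 (Pt C)) (T0 (Pt C)) (ts_r (Pt C))"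
      using continuous_pt_map[OF frame1 frame0] d.hom r.hom by simp_all
    show "\<forall>(a, b)\<in>composable (Pt C).
        ts_r (Pt C) (ts_m (Pt C) (a, b)) = ts_r (Pt C) a \<and> ts_d (Pt C) (ts_m (Pt C) (a, b)) = ts_d (Pt C) b"
      using ptd_m ptr_m composable_Pt by auto
    show "\<forall>a b c. (a, b) \<in> composable (Pt C) \<and> (b, c) \<in> composable (Pt C) \<longrightarrow>
        ts_m (Pt C) (ts_m (Pt C) (a, b), c) = ts_m (Pt C) (a, ts_m (Pt C) (b, c))"
      using Pt_assoc composable_Pt by simp
  qed (use continuous_Pt_m Pt_unit_left Pt_unit_right in simp_all)
qed (simp_all add: d.local_homeomorphism_pt_map r.local_homeomorphism_pt_map)

text \<open>
  The factors are obtained by lifting along \<open>d\<close>. First \<open>d(s)\<close> is lifted to a point \<open>q\<close> in a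
  bisection \<open>y\<close> below \<open>b\<close>, cut down so that \<open>r(q)\<close> lies in \<open>d\<^sub>!(x)\<close> for a bisection \<open>x\<close> below
  \<open>a\<close>; then \<open>r(q)\<close> is lifted to a point \<open>p\<close> in \<open>x\<close>. As \<open>pq\<close> and \<open>s\<close> are points in the bisection
  \<open>xy\<close> with the same image under \<open>d\<close>, they are equal.
\<close>

lemma Pt_factor:
  assumes s: "s \<in> pt (L1 C)" and a: "a \<in> carrier (L1 C)" and b: "b \<in> carrier (L1 C)" and sab: "s (a \<star> b)"
  obtains p q where "p \<in> pt (L1 C)" "q \<in> pt (L1 C)" "ptd p = ptr q" "p a" "q b" "s = ts_m (Pt C) (p, q)"
proof -
  let ?A = "{c \<in> local_bisections C. c \<sqsubseteq>\<^sub>1 a}" and ?B = "{c \<in> local_bisections C. c \<sqsubseteq>\<^sub>1 b}"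
  have A: "?A \<subseteq> carrier (L1 C)" and B: "?B \<subseteq> carrier (L1 C)" using bisection_closed by auto
  have Ab: "(\<lambda>x. x \<star> b) ` ?A \<subseteq> carrier (L1 C)" using A b by auto
  obtain x where x: "x \<in> local_bisections C" "x \<sqsubseteq>\<^sub>1 a" "s (x \<star> b)"
    using pt_Sup[OF s Ab] Sup_mult[OF A b] Sup_bisections[OF a] sab by auto
  have xc: "x \<in> carrier (L1 C)" using bisection_closed[OF x(1)] .
  have xB: "(\<lambda>y. x \<star> y) ` ?B \<subseteq> carrier (L1 C)" using B xc by auto
  obtain y where y: "y \<in> local_bisections C" "y \<sqsubseteq>\<^sub>1 b" "s (x \<star> y)"
    using pt_Sup[OF s xB] mult_Sup[OF B xc] Sup_bisections[OF b] x(3) by auto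
  have yc: "y \<in> carrier (L1 C)" using bisection_closed[OF y(1)] .
  let ?y = "y \<sqinter>\<^sub>1 ls_r C (d.sh x)"
  have y'c: "?y \<in> carrier (L1 C)" using xc yc by simp
  have y's: "d.sect ?y"
    using d.section_down[of y ?y] y(1) y'c F1.meet_left[OF yc] xc unfolding bisection_iff by simp
  have "s (ls_d C (d.sh (x \<star> y)))"
    using pt_mono[OF frame1 s d.le_f_sh[of "x \<star> y"]] y(3) xc yc by simp
  then have "ptd s (d.sh ?y)" using d_sh_mult[OF xc yc] y'c by simp
  then obtain q where q: "q \<in> pt (L1 C)" "q ?y" "ptd q = ptd s"
    using d.section_pt_lift[OF y's ptd_in[OF s]] by blast
  then have qy: "q y" "q (ls_r C (d.sh x))" using pt_meet[OF q(1) yc, of "ls_r C (d.sh x)"] xc by auto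
  have "ptr q (d.sh x)" using qy(2) xc by simp
  then obtain p where p: "p \<in> pt (L1 C)" "p x" "ptd p = ptr q"
    using d.section_pt_lift[of x "ptr q"] x(1) ptr_in[OF q(1)] unfolding bisection_iff by blast
  have m: "ts_m (Pt C) (p, q) \<in> pt (L1 C)" by (rule Pt_m_in[OF p(1) q(1) p(3)])
  have sect: "d.sect (x \<star> y)" using bisection_mult[OF x(1) y(1)] by (simp add: bisection_iff)
  have "s = ts_m (Pt C) (p, q)"
    using d.section_pt_unique[OF sect s y(3) m Pt_m_mult[OF p(1) q(1) p(3) xc yc p(2) qy(1)]]
      ptd_m[OF p(1) q(1) p(3)] q(3) by simp
  moreover have "p a" using pt_mono[OF frame1 p(1) x(2) xc a p(2)] .
  moreover have "q b" using pt_mono[OF frame1 q(1) y(2) yc b qy(1)] .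
  ultimately show thesis using that p q by blast
qed

end

section \<open>The functor \<open>Pt\<close> on morphisms\<close>

locale el_morphism =
  S: etale_localic L + T: etale_localic M
  for L :: "('a, 'b) loc_cat" and M :: "('c, 'd) loc_cat" +
  fixes k :: nat and f :: "'c \<Rightarrow> 'a"
  assumes f_hom: "f \<in> EL_hom k L M"
begin

abbreviation f0 where "f0 \<equiv> EL_obj_map L M f"
abbreviation F0 where "F0 x \<equiv> pt_map (L0 M) f0 x"

lemmas f_closed [simp] = EL_homD(10)[OF f_hom]
lemmas f_Sup = EL_homD(2)[OF f_hom]
lemmas f_mult = EL_homD(3)[OF f_hom]
lemmas f_bisection = EL_homD(7)[OF f_hom]

lemma f_E: "f T.E = S.E"
  using EL_homD(4)[OF f_hom] by (simp add: S.qunit_eq T.qunit_eq)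

lemma f_mono:
  assumes "x \<in> carrier (L1 M)" "y \<in> carrier (L1 M)" "x \<sqsubseteq>\<^sub>1\<^bsub>M\<^esub> y"
  shows "f x \<sqsubseteq>\<^sub>1\<^bsub>L\<^esub> f y"
proof -
  have "\<Squnion>\<^bsub>L1 M\<^esub>{x, y} = y"
    by (rule T.F1.eq_by_upper) (use assms T.F1.le_trans[OF assms(3)] in \<open>auto simp: T.F1.Sup_le_iff\<close>)
  then have "\<Squnion>\<^bsub>L1 L\<^esub>{f x, f y} = f y" using f_Sup[of "{x, y}"] assms by simp
  then show ?thesis using S.F1.sup_upper[of "{f x, f y}" "f x"] assms by simp
qed

lemma f0_apply: "z \<in> carrier (L0 M) \<Longrightarrow> f0 z = S.d.sh (f (T.u.sh z))"
  by (simp add: EL_obj_map_def)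

lemma f0_closed [simp]: "z \<in> carrier (L0 M) \<Longrightarrow> f0 z \<in> carrier (L0 L)"
  by (simp add: f0_apply)

text \<open>
  The elements below \<open>e\<close> are the \<open>u\<^sub>!(z)\<close>, and \<open>f\<close> maps elements below \<open>e\<close> to such elements;
  \<open>z\<close> is recovered from \<open>u\<^sub>!(z)\<close> by \<open>d\<^sub>!\<close>.
\<close>

lemma f_u_sh:
  assumes z: "z \<in> carrier (L0 M)"
  shows "f (T.u.sh z) = S.u.sh (f0 z)"
proof -
  let ?x = "f (T.u.sh z)"
  have x: "?x \<in> carrier (L1 L)" using z by simp
  have "?x \<sqsubseteq>\<^sub>1\<^bsub>L\<^esub> S.E" using f_mono[OF _ _ T.u_sh_le_E[OF z]] z by (simp add: f_E)
  then have e: "S.u.sh (ls_u L ?x) = ?x" by (rule S.below_E[OF x])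
  then have "S.d.sh ?x = ls_u L ?x" using S.d_sh_u_sh[of "ls_u L ?x"] x by simp
  then show ?thesis using e z by (simp add: f0_apply)
qed

text \<open>
  Restriction along \<open>d\<close> is a product: \<open>a \<and> d\<^sup>*(z) = a u\<^sub>!(z)\<close>.
\<close>

lemma f_meet_d:
  assumes "a \<in> carrier (L1 M)" "z \<in> carrier (L0 M)"
  shows "f (a \<sqinter>\<^sub>1\<^bsub>M\<^esub> ls_d M z) = f a \<sqinter>\<^sub>1\<^bsub>L\<^esub> ls_d L (f0 z)"
  using f_mult[of a "T.u.sh z"] assms by (simp add: T.mult_u_sh S.mult_u_sh f_u_sh)

lemma f_meet_r:
  assumes "a \<in> carrier (L1 M)" "z \<in> carrier (L0 M)"
  shows "f (a \<sqinter>\<^sub>1\<^bsub>M\<^esub> ls_r M z) = f a \<sqinter>\<^sub>1\<^bsub>L\<^esub> ls_r L (f0 z)"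
  using f_mult[of "T.u.sh z" a] assms by (simp add: T.u_sh_mult S.u_sh_mult f_u_sh)

lemma f0_d_sh:
  assumes a: "a \<in> carrier (L1 M)" shows "f0 (T.d.sh a) = S.d.sh (f a)"
proof -
  have eq: "S.u.sh (f0 (T.d.sh a)) = S.u.sh (S.d.sh (f a))"
    using EL_homD(5)[OF f_hom a] f_u_sh[of "T.d.sh a"] a by (simp add: S.lam_eq T.lam_eq)
  have "f0 (T.d.sh a) = ls_u L (S.u.sh (f0 (T.d.sh a)))" using a by simp
  also have "\<dots> = S.d.sh (f a)" unfolding eq using a by simp
  finally show ?thesis .
qed

lemma f0_r_sh:
  assumes a: "a \<in> carrier (L1 M)" shows "f0 (T.r.sh a) = S.r.sh (f a)"
proof -
  have eq: "S.u.sh (f0 (T.r.sh a)) = S.u.sh (S.r.sh (f a))"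
    using EL_homD(6)[OF f_hom a] f_u_sh[of "T.r.sh a"] a by (simp add: S.rho_eq T.rho_eq)
  have "f0 (T.r.sh a) = ls_u L (S.u.sh (f0 (T.r.sh a)))" using a by simp
  also have "\<dots> = S.r.sh (f a)" unfolding eq using a by simp
  finally show ?thesis .
qed

lemma f0_hom: "f0 \<in> frame_hom (L0 M) (L0 L)"
  unfolding frame_hom_def
proof (intro CollectI conjI allI ballI impI)
  show "f0 \<in> carrier (L0 M) \<rightarrow>\<^sub>E carrier (L0 L)"
    using f0_closed by (auto simp: EL_obj_map_def)
  show "f0 (\<Squnion>\<^bsub>L0 M\<^esub>A) = \<Squnion>\<^bsub>L0 L\<^esub>(f0 ` A)" if A: "A \<subseteq> carrier (L0 M)" for A
  proof -
    have c: "T.u.sh ` A \<subseteq> carrier (L1 M)" "f ` T.u.sh ` A \<subseteq> carrier (L1 L)" using A by auto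
    have "S.d.sh ` f ` T.u.sh ` A = f0 ` A"
      unfolding image_image by (rule image_cong[OF refl]) (use A in \<open>auto simp: f0_apply\<close>)
    then show ?thesis
      using A T.u.sh_Sup[OF A] f_Sup[OF c(1)] S.d.sh_Sup[OF c(2)] by (simp add: f0_apply)
  qed
  show "f0 \<top>\<^bsub>L0 M\<^esub> = \<top>\<^bsub>L0 L\<^esub>" by (simp add: f0_apply f_E)
  show "f0 (x \<sqinter>\<^bsub>L0 M\<^esub> y) = f0 x \<sqinter>\<^bsub>L0 L\<^esub> f0 y" if "x \<in> carrier (L0 M)" "y \<in> carrier (L0 M)" for x y
  proof -
    have "T.u.sh (x \<sqinter>\<^bsub>L0 M\<^esub> y) = T.u.sh x \<sqinter>\<^sub>1\<^bsub>M\<^esub> ls_d M y"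
      using that T.u_sh_d[of "x \<sqinter>\<^bsub>L0 M\<^esub> y"] T.u_sh_d[of x] by (simp add: T.d.f_meet T.F1.meet_assoc)
    then show ?thesis
      using that by (simp add: f0_apply[of "x \<sqinter>\<^bsub>L0 M\<^esub> y"] f_meet_d S.d.frobenius) (simp add: f0_apply)
  qed
qed

lemma F0_in [simp]: "x \<in> pt (L0 L) \<Longrightarrow> F0 x \<in> pt (L0 M)"
  by (rule pt_map_in_pt[OF T.frame0 f0_hom])

text \<open>
  The points over \<open>q\<close>, described without choosing bisections: they are the points over
  \<open>f\<^sub>0(d(q))\<close> all of whose neighbourhoods are neighbourhoods of \<open>q\<close> after applying \<open>f\<close>.
\<close>

definition above :: "('a \<Rightarrow> bool) \<Rightarrow> ('c \<Rightarrow> bool) \<Rightarrow> bool" where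
  "above q p \<longleftrightarrow> p \<in> pt (L1 M) \<and> T.ptd p = F0 (S.ptd q) \<and> (\<forall>a\<in>carrier (L1 M). p a \<longrightarrow> q (f a))"

lemma above_unique:
  assumes c: "c \<in> local_bisections M" and p: "p \<in> pt (L1 M)" "p c" and p': "p' \<in> pt (L1 M)" "p' c"
    and e: "T.ptd p = T.ptd p'"
  shows "p = p'"
  using T.d.section_pt_unique[OF _ p p' e] c by (simp add: T.bisection_iff)

lemma Pt_point:
  assumes q: "q \<in> pt (L1 L)" and c: "c \<in> local_bisections M" and qc: "q (f c)"
  shows "Pt_point L M f q c \<in> pt (L1 M)" "Pt_point L M f q c c"
    "T.ptd (Pt_point L M f q c) = F0 (S.ptd q)"
proof -
  have cc: "c \<in> carrier (L1 M)" by (rule T.bisection_closed[OF c])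
  have "q (ls_d L (S.d.sh (f c)))"
    using pt_mono[OF S.frame1 q S.d.le_f_sh[of "f c"]] qc cc by simp
  then have "F0 (S.ptd q) (T.d.sh c)" using cc by (simp add: f0_d_sh)
  then obtain p where p: "p \<in> pt (L1 M)" "p c" "T.ptd p = F0 (S.ptd q)"
    using T.d.section_pt_lift[of c "F0 (S.ptd q)"] c q by (auto simp: T.bisection_iff)
  have "Pt_point L M f q c = p"
    unfolding Pt_point_def
  proof (rule the_equality)
    show "p' = p" if "p' \<in> pt (L1 M) \<and> p' c \<and> T.ptd p' = F0 (S.ptd q)" for p'
      using above_unique[OF c _ _ p(1,2)] that p(3) by simp
  qed (use p in simp)
  then show "Pt_point L M f q c \<in> pt (L1 M)" "Pt_point L M f q c c"
    "T.ptd (Pt_point L M f q c) = F0 (S.ptd q)" using p by simp_all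
qed

text \<open>
  If \<open>p\<^sub>c\<close> lies in \<open>a\<close> then it lies in \<open>c \<and> a\<close>, which is a restriction of \<open>c\<close> along \<open>d\<close>; the
  image under \<open>f\<close> is the corresponding restriction of \<open>f(c)\<close>, and \<open>q\<close> lies in it.
\<close>

lemma Pt_point_above:
  assumes q: "q \<in> pt (L1 L)" and c: "c \<in> local_bisections M" and qc: "q (f c)"
  shows "above q (Pt_point L M f q c)"
  unfolding above_def
proof (intro conjI ballI impI)
  let ?p = "Pt_point L M f q c"
  note p = Pt_point[OF assms]
  show "?p \<in> pt (L1 M)" "T.ptd ?p = F0 (S.ptd q)" using p by simp_all
  fix a assume a: "a \<in> carrier (L1 M)" "?p a"
  have cc: "c \<in> carrier (L1 M)" by (rule T.bisection_closed[OF c])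
  let ?b = "c \<sqinter>\<^sub>1\<^bsub>M\<^esub> a"
  have b: "?b \<in> carrier (L1 M)" using a cc by simp
  have eq: "c \<sqinter>\<^sub>1\<^bsub>M\<^esub> ls_d M (T.d.sh ?b) = ?b"
    using T.d.sectionD(2)[OF _ b T.F1.meet_left[OF cc a(1)]] c by (simp add: T.bisection_iff)
  have "?p ?b" using pt_meet[OF p(1) cc a(1)] p(2) a(2) by simp
  then have "T.ptd ?p (T.d.sh ?b)" using pt_mono[OF T.frame1 p(1) T.d.le_f_sh[OF b]] b by simp
  then have "q (ls_d L (f0 (T.d.sh ?b)))" unfolding p(3) using b by simp
  then have "q (f c \<sqinter>\<^sub>1\<^bsub>L\<^esub> ls_d L (f0 (T.d.sh ?b)))" using pt_meet[OF q] qc b cc by simp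
  then have "q (f ?b)" using f_meet_d[OF cc, of "T.d.sh ?b"] eq b by simp
  then show "q (f a)"
    using pt_mono[OF S.frame1 q f_mono[OF b a(1) T.F1.meet_right[OF cc a(1)]]] a b by simp
qed

lemma Pt_map_fst:
  assumes q: "q \<in> pt (L1 L)"
  shows "p \<in> fst (Pt_map L M f) q \<longleftrightarrow> above q p"
proof
  assume "p \<in> fst (Pt_map L M f) q"
  then show "above q p" using q Pt_point_above[OF q] by (auto simp: Pt_map_def)
next
  assume p: "above q p"
  then have pp: "p \<in> pt (L1 M)" by (simp add: above_def)
  obtain c where c: "c \<in> local_bisections M" "p c"
    using T.pt_bisection[OF pp T.F1.top_closed pt_top[OF pp]] by blast
  have "q (f c)" using p c T.bisection_closed by (simp add: above_def)
  moreover from this have "p = Pt_point L M f q c"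
    using above_unique[OF c(1) pp c(2)] Pt_point[OF q c(1)] p by (simp add: above_def)
  ultimately show "p \<in> fst (Pt_map L M f) q" using q c(1) by (auto simp: Pt_map_def)
qed

lemma Pt_map_snd: "x \<in> pt (L0 L) \<Longrightarrow> snd (Pt_map L M f) x = F0 x"
  by (simp add: Pt_map_def)

text \<open>
  The formula that recovers \<open>f\<close> from its effect on points. Writing \<open>a\<close> as a join of bisections
  gives a bisection \<open>c\<close> below \<open>a\<close> with \<open>q\<close> in \<open>f(c)\<close>, and \<open>p\<^sub>c\<close> is the required point.
\<close>

lemma f_iff_above:
  assumes q: "q \<in> pt (L1 L)" and a: "a \<in> carrier (L1 M)"
  shows "q (f a) \<longleftrightarrow> (\<exists>p. above q p \<and> p a)"
proof
  assume qa: "q (f a)"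
  let ?B = "{c \<in> local_bisections M. c \<sqsubseteq>\<^sub>1\<^bsub>M\<^esub> a}"
  have B: "?B \<subseteq> carrier (L1 M)" using T.bisection_closed by blast
  then have fB: "f ` ?B \<subseteq> carrier (L1 L)" by auto
  obtain c where c: "c \<in> local_bisections M" "c \<sqsubseteq>\<^sub>1\<^bsub>M\<^esub> a" "q (f c)"
    using qa f_Sup[OF B] T.Sup_bisections[OF a] pt_Sup[OF q fB] by auto
  have "Pt_point L M f q c a"
    using pt_mono[OF T.frame1 Pt_point(1)[OF q c(1,3)] c(2) T.bisection_closed[OF c(1)] a Pt_point(2)[OF q c(1,3)]] .
  then show "\<exists>p. above q p \<and> p a" using Pt_point_above[OF q c(1,3)] by blast
next
  assume "\<exists>p. above q p \<and> p a"
  then show "q (f a)" using a by (auto simp: above_def)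
qed

text \<open>
  The definition of \<open>above\<close> refers to \<open>d\<close>. For \<open>r\<close>, apply \<open>f_iff_above\<close> to a restriction along
  \<open>r\<close> of a bisection around \<open>p\<close>: the point that it provides is \<open>p\<close>, because it lies in the same
  bisection over the same object.
\<close>

lemma above_ptr:
  assumes q: "q \<in> pt (L1 L)" and p: "above q p"
  shows "T.ptr p = F0 (S.ptr q)"
proof -
  have pp: "p \<in> pt (L1 M)" using p by (simp add: above_def)
  have pf: "q (f a)" if "a \<in> carrier (L1 M)" "p a" for a using p that by (simp add: above_def)
  obtain c where c: "c \<in> local_bisections M" "p c"
    using T.pt_bisection[OF pp T.F1.top_closed pt_top[OF pp]] by blast
  have cc: "c \<in> carrier (L1 M)" by (rule T.bisection_closed[OF c(1)])
  show ?thesis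
  proof (rule pt_eqI[OF T.ptr_in[OF pp] F0_in[OF S.ptr_in[OF q]]])
    fix z assume z: "z \<in> carrier (L0 M)"
    let ?b = "c \<sqinter>\<^sub>1\<^bsub>M\<^esub> ls_r M z"
    have b: "?b \<in> carrier (L1 M)" using cc z by simp
    have qb: "q (f ?b) \<longleftrightarrow> q (f c) \<and> q (ls_r L (f0 z))"
      using f_meet_r[OF cc z] pt_meet[OF q] cc z by simp
    have "p (ls_r M z) \<longleftrightarrow> q (ls_r L (f0 z))"
    proof
      assume "p (ls_r M z)"
      then have "p ?b" using c(2) pt_meet[OF pp cc, of "ls_r M z"] z by simp
      then show "q (ls_r L (f0 z))" using pf[OF b] qb by simp
    next
      assume "q (ls_r L (f0 z))"
      then have "q (f ?b)" using qb pf[OF cc c(2)] by simp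
      then obtain p' where p': "above q p'" "p' ?b" using f_iff_above[OF q b] by blast
      have pp': "p' \<in> pt (L1 M)" using p'(1) by (simp add: above_def)
      then have p'2: "p' c" "p' (ls_r M z)" using p'(2) pt_meet[OF pp' cc, of "ls_r M z"] z by simp_all
      have "p = p'" by (rule above_unique[OF c(1) pp c(2) pp' p'2(1)]) (use p p'(1) in \<open>simp add: above_def\<close>)
      then show "p (ls_r M z)" using p'2(2) by simp
    qed
    then show "T.ptr p z = F0 (S.ptr q) z" using z by simp
  qed
qed

text \<open>
  If \<open>c\<close> is a bisection then so is \<open>f(c)\<close>; hence points in \<open>f(c)\<close> are determined by their images
  under \<open>d\<close> or \<open>r\<close>, and objects in \<open>d\<^sub>!(f(c))\<close> and \<open>r\<^sub>!(f(c))\<close> lift to them. Openness of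
  inverse images and the conditions of the types come from \<open>f_iff_above\<close>.
\<close>

theorem Pt_map_hom: "Pt_map L M f \<in> ET_hom k (Pt L) (Pt M)"
proof -
  interpret PL: topological_cat "Pt L" by (rule S.topological_cat_Pt)
  interpret PM: topological_cat "Pt M" by (rule T.topological_cat_Pt)
  have aboveD: "p \<in> pt (L1 M)" "T.ptd p = F0 (S.ptd q)" "\<And>a. \<lbrakk>a \<in> carrier (L1 M); p a\<rbrakk> \<Longrightarrow> q (f a)"
    if "above q p" for q p using that by (auto simp: above_def)
  have bis: "\<exists>c. c \<in> local_bisections M \<and> s c" if s: "s \<in> pt (L1 M)" for s
    using T.pt_bisection[OF s T.F1.top_closed pt_top[OF s]] by blast
  have "relational_covering (Pt L) (Pt M) (fst (Pt_map L M f)) (snd (Pt_map L M f))"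
  proof (rule relational_coveringI)
    show "fst (Pt_map L M f) \<in> topspace (T1 (Pt L)) \<rightarrow>\<^sub>E Pow (topspace (T1 (Pt M)))"
    proof (rule PiE_I)
      fix q assume "q \<in> topspace (T1 (Pt L))"
      then have "q \<in> pt (L1 L)" by simp
      then show "fst (Pt_map L M f) q \<in> Pow (topspace (T1 (Pt M)))"
        using Pt_map_fst[of q] aboveD(1) by auto
    qed (simp add: Pt_map_def)
    show "snd (Pt_map L M f) \<in> extensional (topspace (T0 (Pt L)))" by (simp add: Pt_map_def)
    show "continuous_map (T0 (Pt L)) (T0 (Pt M)) (snd (Pt_map L M f))"
      by (rule continuous_map_eq[of _ _ "pt_map (L0 M) f0"])
        (simp_all add: continuous_pt_map[OF S.frame0 T.frame0 f0_hom] Pt_map_snd)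
    show "ts_d (Pt M) p = snd (Pt_map L M f) (ts_d (Pt L) q) \<and> ts_r (Pt M) p = snd (Pt_map L M f) (ts_r (Pt L) q)"
      if "q \<in> topspace (T1 (Pt L))" "p \<in> fst (Pt_map L M f) q" for q p
    proof -
      have q: "q \<in> pt (L1 L)" using that(1) by simp
      have p: "above q p" using that(2) Pt_map_fst[OF q] by simp
      show ?thesis using aboveD(2)[OF p] above_ptr[OF q p] q by (simp add: Pt_map_snd)
    qed
    show "ts_m (Pt M) (s, t) \<in> fst (Pt_map L M f) (ts_m (Pt L) (a, b))"
      if ab: "(a, b) \<in> composable (Pt L)" and st: "(s, t) \<in> composable (Pt M)"
        and mem: "s \<in> fst (Pt_map L M f) a" "t \<in> fst (Pt_map L M f) b" for a b s t
    proof -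
      have a: "a \<in> pt (L1 L)" "b \<in> pt (L1 L)" "S.ptd a = S.ptr b" using ab S.composable_Pt by auto
      have s: "s \<in> pt (L1 M)" "t \<in> pt (L1 M)" "T.ptd s = T.ptr t" using st T.composable_Pt by auto
      have as: "above a s" and bt: "above b t" using mem Pt_map_fst a(1,2) by auto
      note m = S.Pt_m_in[OF a]
      have "above (ts_m (Pt L) (a, b)) (ts_m (Pt M) (s, t))"
        unfolding above_def
      proof (intro conjI ballI impI)
        show "ts_m (Pt M) (s, t) \<in> pt (L1 M)" by (rule T.Pt_m_in[OF s])
        show "T.ptd (ts_m (Pt M) (s, t)) = F0 (S.ptd (ts_m (Pt L) (a, b)))"
          using S.ptd_m[OF a] T.ptd_m[OF s] aboveD(2)[OF bt] by simp
        fix c assume c: "c \<in> carrier (L1 M)" "ts_m (Pt M) (s, t) c"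
        then obtain x y where xy: "x \<in> carrier (L1 M)" "y \<in> carrier (L1 M)" "x \<star>\<^bsub>M\<^esub> y \<sqsubseteq>\<^sub>1\<^bsub>M\<^esub> c" "s x" "t y"
          using T.Pt_m_apply[OF s c(1)] by blast
        have "f x \<star>\<^bsub>L\<^esub> f y \<sqsubseteq>\<^sub>1\<^bsub>L\<^esub> f c"
          using f_mono[OF _ c(1) xy(3)] xy(1,2) f_mult[OF xy(1,2)] by simp
        then show "ts_m (Pt L) (a, b) (f c)"
          using S.Pt_m_apply[OF a f_closed[OF c(1)]] aboveD(3)[OF as xy(1,4)] aboveD(3)[OF bt xy(2,5)]
            f_closed[OF xy(1)] f_closed[OF xy(2)] by blast
      qed
      then show ?thesis using Pt_map_fst[OF m] by simp
    qed
    show "a = b"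
      if ab: "a \<in> topspace (T1 (Pt L))" "b \<in> topspace (T1 (Pt L))"
        and e: "ts_d (Pt L) a = ts_d (Pt L) b \<or> ts_r (Pt L) a = ts_r (Pt L) b"
        and s: "s \<in> fst (Pt_map L M f) a" "s \<in> fst (Pt_map L M f) b" for a b s
    proof -
      have a: "a \<in> pt (L1 L)" and b: "b \<in> pt (L1 L)" using ab by auto
      have as: "above a s" and bs: "above b s" using s Pt_map_fst a b by auto
      obtain c where c: "c \<in> local_bisections M" "s c" using bis[OF aboveD(1)[OF as]] by blast
      have "a (f c)" "b (f c)" using aboveD(3)[OF as _ c(2)] aboveD(3)[OF bs _ c(2)] T.bisection_closed[OF c(1)] by auto
      moreover have "S.d.sect (f c)" "S.r.sect (f c)" using f_bisection[OF c(1)] by (simp_all add: S.bisection_iff)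
      ultimately show ?thesis
        using e S.d.section_pt_unique[OF _ a _ b] S.r.section_pt_unique[OF _ a _ b] by auto
    qed
    show "\<exists>t\<in>topspace (T1 (Pt L)). ts_d (Pt L) t = q \<and> s \<in> fst (Pt_map L M f) t"
      if qs: "q \<in> topspace (T0 (Pt L))" "s \<in> topspace (T1 (Pt M))" "ts_d (Pt M) s = snd (Pt_map L M f) q" for q s
    proof -
      have q: "q \<in> pt (L0 L)" and s: "s \<in> pt (L1 M)" using qs(1,2) by auto
      have ds: "T.ptd s = F0 q" using qs(3) q by (simp add: Pt_map_snd)
      obtain c where c: "c \<in> local_bisections M" "s c" using bis[OF s] by blast
      have cc: "c \<in> carrier (L1 M)" by (rule T.bisection_closed[OF c(1)])
      have "T.ptd s (T.d.sh c)" using pt_mono[OF T.frame1 s T.d.le_f_sh[OF cc]] c(2) cc by simp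
      then have "q (S.d.sh (f c))" unfolding ds using cc by (simp add: f0_d_sh)
      then obtain t where t: "t \<in> pt (L1 L)" "t (f c)" "S.ptd t = q"
        using S.d.section_pt_lift[of "f c" q] f_bisection[OF c(1)] q by (auto simp: S.bisection_iff)
      note p = Pt_point[OF t(1) c(1) t(2)]
      have "s = Pt_point L M f t c" by (rule above_unique[OF c(1) s c(2) p(1,2)]) (simp add: p(3) ds t(3))
      then have "s \<in> fst (Pt_map L M f) t" using Pt_map_fst[OF t(1)] Pt_point_above[OF t(1) c(1) t(2)] by simp
      then show ?thesis using t by auto
    qed
    show "\<exists>t\<in>topspace (T1 (Pt L)). ts_r (Pt L) t = q \<and> s \<in> fst (Pt_map L M f) t"
      if qs: "q \<in> topspace (T0 (Pt L))" "s \<in> topspace (T1 (Pt M))" "ts_r (Pt M) s = snd (Pt_map L M f) q" for q s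
    proof -
      have q: "q \<in> pt (L0 L)" and s: "s \<in> pt (L1 M)" using qs(1,2) by auto
      have rs: "T.ptr s = F0 q" using qs(3) q by (simp add: Pt_map_snd)
      obtain c where c: "c \<in> local_bisections M" "s c" using bis[OF s] by blast
      have cc: "c \<in> carrier (L1 M)" by (rule T.bisection_closed[OF c(1)])
      have "T.ptr s (T.r.sh c)" using pt_mono[OF T.frame1 s T.r.le_f_sh[OF cc]] c(2) cc by simp
      then have "q (S.r.sh (f c))" unfolding rs using cc by (simp add: f0_r_sh)
      then obtain t where t: "t \<in> pt (L1 L)" "t (f c)" "S.ptr t = q"
        using S.r.section_pt_lift[of "f c" q] f_bisection[OF c(1)] q by (auto simp: S.bisection_iff)
      note p = Pt_point[OF t(1) c(1) t(2)] and pa = Pt_point_above[OF t(1) c(1) t(2)]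
      have "T.ptr (Pt_point L M f t c) = T.ptr s" using above_ptr[OF t(1) pa] rs t(3) by simp
      then have "s = Pt_point L M f t c"
        using T.r.section_pt_unique[OF _ p(1,2) s c(2)] c(1) by (simp add: T.bisection_iff)
      then have "s \<in> fst (Pt_map L M f) t" using Pt_map_fst[OF t(1)] pa by simp
      then show ?thesis using t by auto
    qed
    show "openin (T1 (Pt L)) {q \<in> topspace (T1 (Pt L)). fst (Pt_map L M f) q \<inter> A \<noteq> {}}"
      if A: "openin (T1 (Pt M)) A" for A
    proof -
      obtain a where a: "a \<in> carrier (L1 M)" "A = {p \<in> pt (L1 M). p a}" using A T.openin_Pt by auto
      have "fst (Pt_map L M f) q \<inter> A \<noteq> {} \<longleftrightarrow> q (f a)" if q: "q \<in> pt (L1 L)" for q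
      proof -
        have "fst (Pt_map L M f) q \<inter> A \<noteq> {} \<longleftrightarrow> (\<exists>p. p \<in> fst (Pt_map L M f) q \<and> p \<in> A)" by blast
        then show ?thesis unfolding Pt_map_fst[OF q] a(2) f_iff_above[OF q a(1)] using aboveD(1) by blast
      qed
      then have "{q \<in> topspace (T1 (Pt L)). fst (Pt_map L M f) q \<inter> A \<noteq> {}} = {q \<in> pt (L1 L). q (f a)}"
        by auto
      then show ?thesis using S.openin_Pt_basic[OF f_closed[OF a(1)]] by simp
    qed
    show "ts_u (Pt M) (snd (Pt_map L M f) t) \<in> fst (Pt_map L M f) (ts_u (Pt L) t)"
      if "t \<in> topspace (T0 (Pt L))" for t
    proof -
      have t: "t \<in> pt (L0 L)" using that by simp
      let ?q = "pt_map (L1 L) (ls_u L) t" and ?p = "pt_map (L1 M) (ls_u M) (F0 t)"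
      have q: "?q \<in> pt (L1 L)" using t by simp
      have "above ?q ?p"
        unfolding above_def
      proof (intro conjI ballI impI)
        show "?p \<in> pt (L1 M)" "T.ptd ?p = F0 (S.ptd ?q)" using t by simp_all
        fix a assume a: "a \<in> carrier (L1 M)" "?p a"
        let ?b = "a \<sqinter>\<^sub>1\<^bsub>M\<^esub> T.E"
        have ub: "T.u.sh (ls_u M a) = ?b" using a(1) by (rule T.u_sh_u)
        have b: "?b \<in> carrier (L1 M)" using a by simp
        have "t (f0 (ls_u M a))" using a by simp
        moreover have "f0 (ls_u M a) = ls_u L (f ?b)"
          using f_u_sh[of "ls_u M a"] S.u_u_sh[of "f0 (ls_u M a)"] a(1) ub by simp
        ultimately have "?q (f ?b)" using b by simp
        then show "?q (f a)"
          using pt_mono[OF S.frame1 q f_mono[OF b a(1) T.F1.meet_left[OF a(1)]]] a b by simp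
      qed
      then show ?thesis using Pt_map_fst[OF q] t by (simp add: Pt_map_snd)
    qed
  qed
  moreover have "fst (Pt_map L M f) q \<noteq> {}" if k: "k \<in> {2, 4}" and "q \<in> topspace (T1 (Pt L))" for q
  proof -
    have q: "q \<in> pt (L1 L)" using that(2) by simp
    have "q (f \<top>\<^bsub>L1 M\<^esub>)" using EL_homD(8)[OF f_hom k] pt_top[OF q] by simp
    then show ?thesis using f_iff_above[OF q T.F1.top_closed] Pt_map_fst[OF q] by auto
  qed
  moreover have "s = t" if k: "k \<in> {3, 4}" and "q \<in> topspace (T1 (Pt L))"
    and st: "s \<in> fst (Pt_map L M f) q" "t \<in> fst (Pt_map L M f) q" for q s t
  proof -
    have q: "q \<in> pt (L1 L)" using that(2) by simp
    have qs: "above q s" and qt: "above q t" using st Pt_map_fst[OF q] by auto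
    obtain c where c: "c \<in> local_bisections M" "s c" using bis[OF aboveD(1)[OF qs]] by blast
    obtain c' where c': "c' \<in> local_bisections M" "t c'" using bis[OF aboveD(1)[OF qt]] by blast
    have cc: "c \<in> carrier (L1 M)" "c' \<in> carrier (L1 M)" using T.bisection_closed c(1) c'(1) by auto
    have "q (f (c \<sqinter>\<^sub>1\<^bsub>M\<^esub> c'))"
      using EL_homD(9)[OF f_hom k cc] aboveD(3)[OF qs cc(1) c(2)] aboveD(3)[OF qt cc(2) c'(2)]
        pt_meet[OF q, of "f c" "f c'"] cc by simp
    then obtain p where p: "above q p" "p (c \<sqinter>\<^sub>1\<^bsub>M\<^esub> c')"
      using f_iff_above[OF q T.F1.meet_closed[OF cc]] by blast
    then have pc: "p c" "p c'" using pt_meet[OF aboveD(1)[OF p(1)] cc] by auto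
    have "s = p"
      by (rule above_unique[OF c(1) aboveD(1)[OF qs] c(2) aboveD(1)[OF p(1)] pc(1)])
        (simp add: aboveD(2)[OF qs] aboveD(2)[OF p(1)])
    moreover have "t = p"
      by (rule above_unique[OF c'(1) aboveD(1)[OF qt] c'(2) aboveD(1)[OF p(1)] pc(2)])
        (simp add: aboveD(2)[OF qt] aboveD(2)[OF p(1)])
    ultimately show ?thesis by simp
  qed
  ultimately show ?thesis unfolding ET_hom_iff by blast
qed

lemma Pt_map_ext:
  "fst (Pt_map L M f) \<in> extensional (pt (L1 L))" "snd (Pt_map L M f) \<in> extensional (pt (L0 L))"
  by (simp_all add: Pt_map_def)

end

lemma Pt_map_id:
  assumes L: "etale_localic_category L"
  shows "Pt_map L L (EL_id L) = ET_id (Pt L)"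
proof -
  interpret S: etale_localic L by (rule etale_localic.intro[OF L])
  interpret el_morphism L L 1 "EL_id L"
    by unfold_locales (rule EL_id_hom[OF L])
  have app: "EL_id L a = a" if "a \<in> carrier (L1 L)" for a using that by (simp add: EL_id_def)
  have F0: "F0 x = x" if x: "x \<in> pt (L0 L)" for x
  proof (rule pt_eqI[OF F0_in[OF x] x])
    fix z assume "z \<in> carrier (L0 L)"
    then show "F0 x z = x z" by (simp add: f0_apply app)
  qed
  have above: "above q p \<longleftrightarrow> p = q" if q: "q \<in> pt (L1 L)" for q p
  proof
    assume p: "above q p"
    then have pp: "p \<in> pt (L1 L)" and dp: "S.ptd p = S.ptd q" using F0 q by (auto simp: above_def)
    obtain c where c: "c \<in> local_bisections L" "p c"
      using S.pt_bisection[OF pp S.F1.top_closed pt_top[OF pp]] by blast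
    have "q c" using p c S.bisection_closed[OF c(1)] app by (auto simp: above_def)
    then show "p = q" by (rule above_unique[OF c(1) pp c(2) q _ dp])
  next
    assume "p = q"
    then show "above q p" using q F0 app by (simp add: above_def)
  qed
  show ?thesis
  proof (rule prod_eqI)
    show "fst (Pt_map L L (EL_id L)) = fst (ET_id (Pt L))"
    proof (rule extensionalityI[OF Pt_map_ext(1)])
      show "fst (ET_id (Pt L)) \<in> extensional (pt (L1 L))" by (simp add: ET_id_def)
      fix q assume q: "q \<in> pt (L1 L)"
      then show "fst (Pt_map L L (EL_id L)) q = fst (ET_id (Pt L)) q"
        using Pt_map_fst[OF q] above[OF q] by (auto simp: ET_id_def)
    qed
    show "snd (Pt_map L L (EL_id L)) = snd (ET_id (Pt L))"
    proof (rule extensionalityI[OF Pt_map_ext(2)])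
      show "snd (ET_id (Pt L)) \<in> extensional (pt (L0 L))" by (simp add: ET_id_def)
      fix x assume x: "x \<in> pt (L0 L)"
      then show "snd (Pt_map L L (EL_id L)) x = snd (ET_id (Pt L)) x"
        using F0[OF x] by (simp add: ET_id_def Pt_map_snd)
    qed
  qed
qed

text \<open>
  Given a point \<open>p\<close> above \<open>q\<close> for the composite, \<open>f_iff_above\<close> applied to a bisection around \<open>p\<close>
  produces an intermediate point \<open>b\<close> and a point above \<open>b\<close> in the same bisection, which is \<open>p\<close>.
\<close>

lemma Pt_map_comp:
  assumes L: "etale_localic_category L" and M: "etale_localic_category M" and N: "etale_localic_category N"
    and f: "f \<in> EL_hom k L M" and g: "g \<in> EL_hom k M N"
  shows "Pt_map L N (EL_comp N g f) = ET_comp (Pt L) (Pt_map M N g) (Pt_map L M f)"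
proof -
  interpret L: etale_localic L by (rule etale_localic.intro[OF L])
  interpret M: etale_localic M by (rule etale_localic.intro[OF M])
  interpret N: etale_localic N by (rule etale_localic.intro[OF N])
  interpret f: el_morphism L M k f by unfold_locales (rule f)
  interpret g: el_morphism M N k g by unfold_locales (rule g)
  interpret h: el_morphism L N k "EL_comp N g f"
    by unfold_locales (rule EL_comp_hom[OF L M N f g])
  have app: "EL_comp N g f a = f (g a)" if "a \<in> carrier (L1 N)" for a
    using that by (simp add: EL_comp_def compose_def)
  have obj: "h.f0 z = f.f0 (g.f0 z)" if z: "z \<in> carrier (L0 N)" for z
    using z g.f_u_sh[OF z] by (simp add: h.f0_apply app f.f0_apply)
  have F0: "h.F0 x = g.F0 (f.F0 x)" if x: "x \<in> pt (L0 L)" for x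
  proof (rule pt_eqI[OF h.F0_in[OF x] g.F0_in[OF f.F0_in[OF x]]])
    fix z assume "z \<in> carrier (L0 N)"
    then show "h.F0 x z = g.F0 (f.F0 x) z" by (simp add: obj)
  qed
  have above: "h.above q p \<longleftrightarrow> (\<exists>b. f.above q b \<and> g.above b p)" if q: "q \<in> pt (L1 L)" for q p
  proof
    assume p: "h.above q p"
    then have pp: "p \<in> pt (L1 N)" and dp: "N.ptd p = g.F0 (f.F0 (L.ptd q))"
      and hp: "\<And>a. \<lbrakk>a \<in> carrier (L1 N); p a\<rbrakk> \<Longrightarrow> q (f (g a))"
      using F0 q app by (auto simp: h.above_def)
    obtain c where c: "c \<in> local_bisections N" "p c"
      using N.pt_bisection[OF pp N.F1.top_closed pt_top[OF pp]] by blast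
    have cc: "c \<in> carrier (L1 N)" by (rule N.bisection_closed[OF c(1)])
    obtain b where b: "f.above q b" "b (g c)"
      using hp[OF cc c(2)] f.f_iff_above[OF q g.f_closed[OF cc]] by blast
    have bp: "b \<in> pt (L1 M)" and db: "M.ptd b = f.F0 (L.ptd q)" using b(1) by (auto simp: f.above_def)
    obtain p' where p': "g.above b p'" "p' c" using b(2) g.f_iff_above[OF bp cc] by blast
    have "p' \<in> pt (L1 N)" "N.ptd p = N.ptd p'" using p'(1) dp db by (auto simp: g.above_def)
    then have "p = p'" using g.above_unique[OF c(1) pp c(2), of p'] p'(2) by simp
    then show "\<exists>b. f.above q b \<and> g.above b p" using b(1) p'(1) by blast
  next
    assume "\<exists>b. f.above q b \<and> g.above b p"
    then obtain b where "f.above q b" "g.above b p" by blast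
    then show "h.above q p" using q by (simp add: h.above_def f.above_def g.above_def F0 app)
  qed
  show ?thesis
  proof (rule prod_eqI)
    show "fst (Pt_map L N (EL_comp N g f)) = fst (ET_comp (Pt L) (Pt_map M N g) (Pt_map L M f))"
    proof (rule extensionalityI[OF h.Pt_map_ext(1)])
      show "fst (ET_comp (Pt L) (Pt_map M N g) (Pt_map L M f)) \<in> extensional (pt (L1 L))"
        by (simp add: ET_comp_def)
      fix q assume q: "q \<in> pt (L1 L)"
      have "p \<in> fst (ET_comp (Pt L) (Pt_map M N g) (Pt_map L M f)) q \<longleftrightarrow> (\<exists>b. f.above q b \<and> g.above b p)" for p
      proof -
        have "b \<in> pt (L1 M)" if "f.above q b" for b using that by (simp add: f.above_def)
        then have "(\<exists>b\<in>fst (Pt_map L M f) q. p \<in> fst (Pt_map M N g) b) \<longleftrightarrow> (\<exists>b. f.above q b \<and> g.above b p)"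
          unfolding Bex_def f.Pt_map_fst[OF q] using g.Pt_map_fst by blast
        then show ?thesis using q by (simp add: ET_comp_def)
      qed
      then show "fst (Pt_map L N (EL_comp N g f)) q = fst (ET_comp (Pt L) (Pt_map M N g) (Pt_map L M f)) q"
        using h.Pt_map_fst[OF q] above[OF q] by blast
    qed
    show "snd (Pt_map L N (EL_comp N g f)) = snd (ET_comp (Pt L) (Pt_map M N g) (Pt_map L M f))"
    proof (rule extensionalityI[OF h.Pt_map_ext(2)])
      show "snd (ET_comp (Pt L) (Pt_map M N g) (Pt_map L M f)) \<in> extensional (pt (L0 L))"
        by (simp add: ET_comp_def)
      fix x assume x: "x \<in> pt (L0 L)"
      then show "snd (Pt_map L N (EL_comp N g f)) x = snd (ET_comp (Pt L) (Pt_map M N g) (Pt_map L M f)) x"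
        using F0[OF x] by (simp add: ET_comp_def compose_def h.Pt_map_snd f.Pt_map_snd g.Pt_map_snd)
    qed
  qed
qed

section \<open>The unit\<close>

definition point_at :: "'a topology \<Rightarrow> 'a \<Rightarrow> 'a set \<Rightarrow> bool" where
  "point_at X a = (\<lambda>B\<in>{B. openin X B}. a \<in> B)"

lemma point_at_apply [simp]: "openin X B \<Longrightarrow> point_at X a B \<longleftrightarrow> a \<in> B"
  by (simp add: point_at_def)

lemma point_at_in:
  assumes a: "a \<in> topspace X"
  shows "point_at X a \<in> pt (opens X)"
proof (rule ptI)
  show "point_at X a \<in> extensional (carrier (opens X))" by (simp add: point_at_def)
  show "point_at X a (\<Squnion>\<^bsub>opens X\<^esub>A) \<longleftrightarrow> (\<exists>B\<in>A. point_at X a B)" if "A \<subseteq> carrier (opens X)" for A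
  proof -
    have A: "A \<subseteq> {B. openin X B}" using that by simp
    then have "openin X (\<Union>A)" by blast
    then have "point_at X a (\<Squnion>\<^bsub>opens X\<^esub>A) \<longleftrightarrow> (\<exists>B\<in>A. a \<in> B)" by (simp add: Sup_opens[OF A])
    also have "\<dots> \<longleftrightarrow> (\<exists>B\<in>A. point_at X a B)" by (rule bex_cong[OF refl]) (use A in auto)
    finally show ?thesis .
  qed
  show "point_at X a \<top>\<^bsub>opens X\<^esub>" using a by (simp add: top_opens)
  show "point_at X a (B \<sqinter>\<^bsub>opens X\<^esub> B') \<longleftrightarrow> point_at X a B \<and> point_at X a B'"
    if "B \<in> carrier (opens X)" "B' \<in> carrier (opens X)" for B B'
    using that by (simp add: meet_opens openin_Int)
qed

lemma pt_map_point_at: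
  assumes f: "continuous_map X Y f" and a: "a \<in> topspace X"
  shows "pt_map (opens Y) (opens_map X Y f) (point_at X a) = point_at Y (f a)"
proof (rule pt_eqI)
  show "pt_map (opens Y) (opens_map X Y f) (point_at X a) \<in> pt (opens Y)"
    by (rule pt_map_in_pt[OF frame_opens opens_map_hom[OF f] point_at_in[OF a]])
  show "point_at Y (f a) \<in> pt (opens Y)"
    by (rule point_at_in) (use continuous_map_funspace[OF f] a in auto)
  fix V assume V: "V \<in> carrier (opens Y)"
  then have "openin X (opens_map X Y f V)" using frame_homD(2)[OF opens_map_hom[OF f]] by simp
  then show "pt_map (opens Y) (opens_map X Y f) (point_at X a) V = point_at Y (f a) V"
    using V a by (simp add: opens_map_apply)
qed

text \<open>
  A point of \<open>\<Omega>(X)\<close> lies in some open set \<open>U\<close> on which \<open>f\<close> is injective; if its image is given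
  by \<open>q\<close>, it is given by the element of \<open>U\<close> over \<open>q\<close>.
\<close>

lemma pt_over_point_at:
  assumes f: "local_homeomorphism X Y f" and s: "s \<in> pt (opens X)"
    and e: "pt_map (opens Y) (opens_map X Y f) s = point_at Y q"
  shows "\<exists>t\<in>topspace X. f t = q \<and> s = point_at X t"
proof -
  note cont = local_homeomorphism_continuous[OF f] and open_f = local_homeomorphism_open_map[OF f]
  interpret F: etale_frame_map "opens X" "opens Y" "opens_map X Y f"
    by (rule etale_frame_map_opens[OF f])
  obtain U where U: "F.sect U" "s U"
    using F.pt_section[OF s F.X.top_closed pt_top[OF s]] by blast
  have Uc: "U \<in> carrier (opens X)" by (rule F.sectionD(1)[OF U(1)])
  then have oU: "openin X U" by simp
  have fU: "openin Y (f ` U)" using open_f oU by (simp add: open_map_def)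
  have "s (opens_map X Y f (F.sh U))"
    by (rule pt_mono[OF frame_opens s F.le_f_sh[OF Uc] Uc F.f_closed[OF F.sh_closed[OF Uc]] U(2)])
  then have "point_at Y q (f ` U)"
    using fU unfolding e[symmetric] by (simp add: left_adj_opens[OF cont open_f oU])
  then obtain t where t: "t \<in> U" "f t = q" using fU by auto
  have tX: "t \<in> topspace X" using t(1) openin_subset[OF oU] by blast
  have "s = point_at X t"
    by (rule F.section_pt_unique[OF U(1) s U(2) point_at_in[OF tX]])
      (use t oU e pt_map_point_at[OF cont tX] in simp_all)
  then show ?thesis using t(2) tX by blast
qed

lemma unit_map_fst: "a \<in> topspace (T1 C) \<Longrightarrow> fst (unit_map C) a = {point_at (T1 C) a}"
  and unit_map_snd: "x \<in> topspace (T0 C) \<Longrightarrow> snd (unit_map C) x = point_at (T0 C) x"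
  by (simp_all add: unit_map_def point_at_def)

context topological_cat
begin

abbreviation p1 where "p1 \<equiv> point_at (T1 C)"
abbreviation p0 where "p0 \<equiv> point_at (T0 C)"

lemma p1_in: "a \<in> topspace (T1 C) \<Longrightarrow> p1 a \<in> pt (L1 (Omega C))"
  and p0_in: "x \<in> topspace (T0 C) \<Longrightarrow> p0 x \<in> pt (L0 (Omega C))"
  by (simp_all add: point_at_in)

lemma ptd_p1: "a \<in> topspace (T1 C) \<Longrightarrow> O.ptd (p1 a) = p0 (ts_d C a)"
  and ptr_p1: "a \<in> topspace (T1 C) \<Longrightarrow> O.ptr (p1 a) = p0 (ts_r C a)"
  and ptu_p0: "x \<in> topspace (T0 C) \<Longrightarrow> pt_map (L1 (Omega C)) (ls_u (Omega C)) (p0 x) = p1 (ts_u C x)"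
  by (simp_all add: pt_map_point_at cont_d cont_r cont_u)

lemma Pt_m_p1:
  assumes ab: "a \<in> topspace (T1 C)" "b \<in> topspace (T1 C)" "ts_d C a = ts_r C b"
  shows "ts_m (Pt (Omega C)) (p1 a, p1 b) = p1 (ts_m C (a, b))"
proof -
  have c: "p1 a \<in> pt (L1 (Omega C))" "p1 b \<in> pt (L1 (Omega C))" "O.ptd (p1 a) = O.ptr (p1 b)"
    using ab p1_in ptd_p1 ptr_p1 by metis+
  show ?thesis
  proof (rule pt_eqI[OF O.Pt_m_in[OF c] p1_in[OF m_in[OF ab]]])
    fix V assume V: "V \<in> carrier (L1 (Omega C))"
    then have oV: "openin (T1 C) V" by simp
    have "ts_m (Pt (Omega C)) (p1 a, p1 b) V \<longleftrightarrow> ts_m C (a, b) \<in> V"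
    proof
      assume "ts_m (Pt (Omega C)) (p1 a, p1 b) V"
      then obtain A B where AB: "A \<in> carrier (L1 (Omega C))" "B \<in> carrier (L1 (Omega C))"
        "A \<star>\<^bsub>Omega C\<^esub> B \<sqsubseteq>\<^sub>1\<^bsub>Omega C\<^esub> V" "p1 a A" "p1 b B"
        unfolding O.Pt_m_apply[OF c V] by blast
      then have o: "openin (T1 C) A" "openin (T1 C) B" "a \<in> A" "b \<in> B" by simp_all
      have "ts_m C (a, b) \<in> A \<star>\<^bsub>Omega C\<^esub> B"
        unfolding Omega_mult[OF o(1,2)] using o(3,4) ab(3) by blast
      then show "ts_m C (a, b) \<in> V" using AB(3) by auto
    next
      assume "ts_m C (a, b) \<in> V"
      then have "(a, b) \<in> {w \<in> composable C. ts_m C w \<in> V}" using ab by simp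
      then obtain A B where AB: "openin (T1 C) A" "openin (T1 C) B" "a \<in> A" "b \<in> B"
        "A \<times> B \<inter> composable C \<subseteq> {w \<in> composable C. ts_m C w \<in> V}"
        using T2_nbhd[OF m_pre_open[OF oV]] by blast
      have cA: "x \<in> topspace (T1 C)" if "x \<in> A \<or> x \<in> B" for x
        using that openin_subset[OF AB(1)] openin_subset[OF AB(2)] by blast
      have "A \<star>\<^bsub>Omega C\<^esub> B \<subseteq> V"
        unfolding Omega_mult[OF AB(1,2)] using AB(5) cA by (auto simp: subset_iff)
      then show "ts_m (Pt (Omega C)) (p1 a, p1 b) V"
        unfolding O.Pt_m_apply[OF c V] using AB by (intro bexI[of _ A] bexI[of _ B]) simp_all
    qed
    then show "ts_m (Pt (Omega C)) (p1 a, p1 b) V = p1 (ts_m C (a, b)) V" using oV by simp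
  qed
qed

text \<open>
  Two elements over the same object with the same neighbourhood filter agree, because \<open>d\<close> and \<open>r\<close>
  are injective on small neighbourhoods; the lifting axioms are \<open>pt_over_point_at\<close>.
\<close>

theorem unit_map_hom: "unit_map C \<in> ET_hom k C (Pt (Omega C))"
proof -
  have "relational_covering C (Pt (Omega C)) (fst (unit_map C)) (snd (unit_map C))"
  proof (rule relational_coveringI)
    show "fst (unit_map C) \<in> topspace (T1 C) \<rightarrow>\<^sub>E Pow (topspace (T1 (Pt (Omega C))))"
    proof (rule PiE_I)
      fix a assume a: "a \<in> topspace (T1 C)"
      have "p1 a \<in> topspace (pt_space (L1 (Omega C)))" unfolding O.topspace_Pt by (rule p1_in[OF a])
      then show "fst (unit_map C) a \<in> Pow (topspace (T1 (Pt (Omega C))))" using a by (simp add: unit_map_fst)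
    qed (simp add: unit_map_def)
    show "snd (unit_map C) \<in> extensional (topspace (T0 C))" by (simp add: unit_map_def)
    show "continuous_map (T0 C) (T0 (Pt (Omega C))) (snd (unit_map C))"
      unfolding continuous_map_def
    proof (intro conjI allI impI)
      show "snd (unit_map C) \<in> topspace (T0 C) \<rightarrow> topspace (T0 (Pt (Omega C)))"
      proof
        fix x assume x: "x \<in> topspace (T0 C)"
        have "p0 x \<in> topspace (pt_space (L0 (Omega C)))" unfolding O.topspace_Pt by (rule p0_in[OF x])
        then show "snd (unit_map C) x \<in> topspace (T0 (Pt (Omega C)))" using x by (simp add: unit_map_snd)
      qed
      fix U assume "openin (T0 (Pt (Omega C))) U"
      then obtain V where V: "V \<in> carrier (L0 (Omega C))" "U = {p \<in> pt (L0 (Omega C)). p V}"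
        using openin_pt_space[OF O.frame0] by auto
      then have oV: "openin (T0 C) V" by simp
      have "{x \<in> topspace (T0 C). snd (unit_map C) x \<in> U} = V"
        using oV openin_subset[OF oV] p0_in by (auto simp: V(2) unit_map_snd)
      then show "openin (T0 C) {x \<in> topspace (T0 C). snd (unit_map C) x \<in> U}" using oV by simp
    qed
    show "ts_d (Pt (Omega C)) s = snd (unit_map C) (ts_d C a) \<and> ts_r (Pt (Omega C)) s = snd (unit_map C) (ts_r C a)"
      if a: "a \<in> topspace (T1 C)" and s: "s \<in> fst (unit_map C) a" for a s
      using s ptd_p1[OF a] ptr_p1[OF a] a unfolding Pt_simps by (simp only: unit_map_fst[OF a] singleton_iff unit_map_snd d_in r_in)
    show "ts_m (Pt (Omega C)) (s, t) \<in> fst (unit_map C) (ts_m C (a, b))"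
      if ab: "(a, b) \<in> composable C" and st: "s \<in> fst (unit_map C) a" "t \<in> fst (unit_map C) b" for a b s t
    proof -
      have c: "a \<in> topspace (T1 C)" "b \<in> topspace (T1 C)" "ts_d C a = ts_r C b" using ab by auto
      show ?thesis using st Pt_m_p1[OF c] by (simp add: unit_map_fst c m_in[OF c])
    qed
    show "a = b"
      if a: "a \<in> topspace (T1 C)" and b: "b \<in> topspace (T1 C)" and e: "ts_d C a = ts_d C b \<or> ts_r C a = ts_r C b"
        and s: "s \<in> fst (unit_map C) a" "s \<in> fst (unit_map C) b" for a b s
    proof -
      have p: "p1 a = p1 b" using s by (simp add: unit_map_fst a b)
      obtain U where U: "openin (T1 C) U" "a \<in> U" "inj_on (ts_d C) U" using local_homeomorphism_inj[OF lh_d a] by blast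
      obtain V where V: "openin (T1 C) V" "a \<in> V" "inj_on (ts_r C) V" using local_homeomorphism_inj[OF lh_r a] by blast
      have "b \<in> U" "b \<in> V" using fun_cong[OF p, of U] fun_cong[OF p, of V] U V by simp_all
      then show ?thesis using e U V by (auto simp: inj_on_def)
    qed
    show "\<exists>t\<in>topspace (T1 C). ts_d C t = q \<and> s \<in> fst (unit_map C) t"
      if q: "q \<in> topspace (T0 C)" and s': "s \<in> topspace (T1 (Pt (Omega C)))"
        and e: "ts_d (Pt (Omega C)) s = snd (unit_map C) q" for q s
    proof -
      have s: "s \<in> pt (L1 (Omega C))" using s' unfolding Pt_simps O.topspace_Pt .
      have ds: "O.ptd s = p0 q" using e unfolding Pt_simps unit_map_snd[OF q] .
      have "\<exists>t\<in>topspace (T1 C). ts_d C t = q \<and> s = p1 t"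
        by (rule pt_over_point_at[OF lh_d]) (use s ds in simp_all)
      then show ?thesis by (auto simp: unit_map_fst)
    qed
    show "\<exists>t\<in>topspace (T1 C). ts_r C t = q \<and> s \<in> fst (unit_map C) t"
      if q: "q \<in> topspace (T0 C)" and s': "s \<in> topspace (T1 (Pt (Omega C)))"
        and e: "ts_r (Pt (Omega C)) s = snd (unit_map C) q" for q s
    proof -
      have s: "s \<in> pt (L1 (Omega C))" using s' unfolding Pt_simps O.topspace_Pt .
      have ds: "O.ptr s = p0 q" using e unfolding Pt_simps unit_map_snd[OF q] .
      have "\<exists>t\<in>topspace (T1 C). ts_r C t = q \<and> s = p1 t"
        by (rule pt_over_point_at[OF lh_r]) (use s ds in simp_all)
      then show ?thesis by (auto simp: unit_map_fst)
    qed
    show "openin (T1 C) {x \<in> topspace (T1 C). fst (unit_map C) x \<inter> A \<noteq> {}}"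
      if A: "openin (T1 (Pt (Omega C))) A" for A
    proof -
      obtain V where V: "V \<in> carrier (L1 (Omega C))" "A = {p \<in> pt (L1 (Omega C)). p V}"
        using A O.openin_Pt by auto
      then have oV: "openin (T1 C) V" by simp
      have "{x \<in> topspace (T1 C). fst (unit_map C) x \<inter> A \<noteq> {}} = V"
        using oV openin_subset[OF oV] p1_in by (auto simp: V(2) unit_map_fst)
      then show ?thesis using oV by simp
    qed
    show "ts_u (Pt (Omega C)) (snd (unit_map C) t) \<in> fst (unit_map C) (ts_u C t)" if t: "t \<in> topspace (T0 C)" for t
      using ptu_p0[OF t] unfolding Pt_simps unit_map_snd[OF t] unit_map_fst[OF u_in[OF t]] by simp
  qed
  then show ?thesis unfolding ET_hom_iff by (auto simp: unit_map_fst)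
qed

end

text \<open>
  The points above the neighbourhood filter of \<open>x\<close> are the neighbourhood filters of the elements of
  \<open>f(x)\<close>: if \<open>p\<close> is above it and \<open>c\<close> is a bisection around \<open>p\<close>, then \<open>c\<close> contains some
  \<open>y \<in> f(x)\<close>, and in \<open>c\<close> a point is determined by its image under \<open>d\<close>.
\<close>

lemma unit_map_natural:
  assumes C: "etale_topological_category C" and D: "etale_topological_category D" and f: "f \<in> ET_hom k C D"
  shows "ET_comp C (Pt_map (Omega C) (Omega D) (Omega_map C D f)) (unit_map C) = ET_comp C (unit_map D) f"
proof -
  interpret C: topological_cat C by (rule topological_cat_if_etale[OF C])
  interpret D: topological_cat D by (rule topological_cat_if_etale[OF D])
  let ?g = "Omega_map C D f"
  interpret g: el_morphism "Omega C" "Omega D" k ?g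
    by unfold_locales (rule Omega_map_hom[OF f C D])
  note F = relational_coveringD[OF f[unfolded ET_hom_iff, THEN conjunct1]]
  have obj: "g.f0 V = {t \<in> topspace (T0 C). snd f t \<in> V}" if V: "openin (T0 D) V" for V
  proof -
    have uV: "openin (T1 D) (ts_u D ` V)" using D.open_u V by (simp add: open_map_def)
    have gV: "openin (T1 C) (?g (ts_u D ` V))" using g.f_closed[of "ts_u D ` V"] uV by simp
    have Vc: "v \<in> topspace (T0 D)" if "v \<in> V" for v using that openin_subset[OF V] by blast
    have "g.f0 V = ts_d C ` {x \<in> topspace (T1 C). fst f x \<inter> ts_u D ` V \<noteq> {}}"
      using g.f0_apply[of V] V D.Omega_u_sh[OF V] C.Omega_d_sh[OF gV] by (simp add: Omega_map_apply[OF uV])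
    also have "\<dots> = {t \<in> topspace (T0 C). snd f t \<in> V}"
    proof (intro equalityI subsetI)
      fix t assume "t \<in> ts_d C ` {x \<in> topspace (T1 C). fst f x \<inter> ts_u D ` V \<noteq> {}}"
      then obtain x v where x: "x \<in> topspace (T1 C)" "t = ts_d C x" "v \<in> V" "ts_u D v \<in> fst f x" by blast
      then have "snd f t = v" using F(4)[OF x(1,4)] Vc[OF x(3)] by simp
      then show "t \<in> {t \<in> topspace (T0 C). snd f t \<in> V}" using x by simp
    next
      fix t assume t: "t \<in> {t \<in> topspace (T0 C). snd f t \<in> V}"
      then have "ts_u D (snd f t) \<in> fst f (ts_u C t)" using F(10) by simp
      then have "ts_u C t \<in> {x \<in> topspace (T1 C). fst f x \<inter> ts_u D ` V \<noteq> {}}" using t by auto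
      moreover have "t = ts_d C (ts_u C t)" using t by simp
      ultimately show "t \<in> ts_d C ` {x \<in> topspace (T1 C). fst f x \<inter> ts_u D ` V \<noteq> {}}" by blast
    qed
    finally show ?thesis .
  qed
  have F0: "g.F0 (C.p0 t) = D.p0 (snd f t)" if t: "t \<in> topspace (T0 C)" for t
  proof (rule pt_eqI[OF g.F0_in[OF C.p0_in[OF t]] D.p0_in[OF F(12)[OF t]]])
    fix V assume V: "V \<in> carrier (L0 (Omega D))"
    then have oV: "openin (T0 D) V" by simp
    have "openin (T0 C) (g.f0 V)" using g.f0_closed[OF V] by simp
    then have "C.p0 t (g.f0 V) \<longleftrightarrow> snd f t \<in> V" using t by (simp add: obj[OF oV])
    then show "g.F0 (C.p0 t) V = D.p0 (snd f t) V" using V oV by simp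
  qed
  have above: "g.above (C.p1 x) p \<longleftrightarrow> (\<exists>y\<in>fst f x. p = D.p1 y)" if x: "x \<in> topspace (T1 C)" for x p
  proof -
    have base: "g.F0 (C.O.ptd (C.p1 x)) = D.p0 (snd f (ts_d C x))"
      using C.ptd_p1[OF x] F0[of "ts_d C x"] x by simp
    have mem: "C.p1 x (?g A) \<longleftrightarrow> fst f x \<inter> A \<noteq> {}" if A: "A \<in> carrier (L1 (Omega D))" for A
    proof -
      have oA: "openin (T1 D) A" using A by simp
      have "openin (T1 C) (?g A)" using g.f_closed[OF A] by simp
      then show ?thesis using x by (simp add: Omega_map_apply[OF oA])
    qed
    have ptd: "D.O.ptd (D.p1 y) = D.p0 (snd f (ts_d C x))" if "y \<in> fst f x" for y
      using D.ptd_p1[OF F(11)[OF x that]] F(4)[OF x that] by simp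
    show ?thesis
    proof
      assume p: "g.above (C.p1 x) p"
      then have pp: "p \<in> pt (L1 (Omega D))" and dp: "D.O.ptd p = D.p0 (snd f (ts_d C x))"
        and hp: "\<And>a. \<lbrakk>a \<in> carrier (L1 (Omega D)); p a\<rbrakk> \<Longrightarrow> C.p1 x (?g a)"
        unfolding g.above_def base by blast+
      obtain c where c: "c \<in> local_bisections (Omega D)" "p c"
        using D.O.pt_bisection[OF pp D.O.F1.top_closed pt_top[OF pp]] by blast
      have cc: "c \<in> carrier (L1 (Omega D))" by (rule D.O.bisection_closed[OF c(1)])
      obtain y where y: "y \<in> fst f x" "y \<in> c" using hp[OF cc c(2)] mem[OF cc] by blast
      have yc: "D.p1 y c" using y(2) cc by simp
      have "p = D.p1 y"
        by (rule g.above_unique[OF c(1) pp c(2) D.p1_in[OF F(11)[OF x y(1)]] yc])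
          (use dp ptd[OF y(1)] in metis)
      then show "\<exists>y\<in>fst f x. p = D.p1 y" using y(1) by blast
    next
      assume "\<exists>y\<in>fst f x. p = D.p1 y"
      then obtain y where y: "y \<in> fst f x" "p = D.p1 y" by blast
      show "g.above (C.p1 x) p"
        unfolding g.above_def base
      proof (intro conjI ballI impI)
        show "p \<in> pt (L1 (Omega D))" unfolding y(2) by (rule D.p1_in[OF F(11)[OF x y(1)]])
        show "D.O.ptd p = D.p0 (snd f (ts_d C x))" unfolding y(2) by (rule ptd[OF y(1)])
        fix a assume a: "a \<in> carrier (L1 (Omega D))" "p a"
        then have "y \<in> a" using y(2) by simp
        then show "C.p1 x (?g a)" unfolding mem[OF a(1)] using y(1) by blast
      qed
    qed
  qed
  show ?thesis
  proof (rule prod_eqI)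
    show "fst (ET_comp C (Pt_map (Omega C) (Omega D) ?g) (unit_map C)) = fst (ET_comp C (unit_map D) f)"
    proof (rule extensionalityI[of _ "topspace (T1 C)"])
      fix x assume x: "x \<in> topspace (T1 C)"
      have "fst (ET_comp C (Pt_map (Omega C) (Omega D) ?g) (unit_map C)) x
          = fst (Pt_map (Omega C) (Omega D) ?g) (C.p1 x)"
        using x by (simp add: ET_comp_def unit_map_fst)
      also have "\<dots> = {p. \<exists>y\<in>fst f x. p = D.p1 y}"
        using g.Pt_map_fst[OF C.p1_in[OF x]] above[OF x] by blast
      also have "\<dots> = (\<Union>y\<in>fst f x. {D.p1 y})" by blast
      also have "\<dots> = (\<Union>y\<in>fst f x. fst (unit_map D) y)"
        by (rule SUP_cong[OF refl]) (use F(11)[OF x] in \<open>simp add: unit_map_fst\<close>)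
      also have "\<dots> = fst (ET_comp C (unit_map D) f) x" using x by (simp add: ET_comp_def)
      finally show "fst (ET_comp C (Pt_map (Omega C) (Omega D) ?g) (unit_map C)) x = fst (ET_comp C (unit_map D) f) x" .
    qed (simp_all add: ET_comp_def)
    show "snd (ET_comp C (Pt_map (Omega C) (Omega D) ?g) (unit_map C)) = snd (ET_comp C (unit_map D) f)"
    proof (rule extensionalityI[of _ "topspace (T0 C)"])
      fix x assume x: "x \<in> topspace (T0 C)"
      have "snd (ET_comp C (Pt_map (Omega C) (Omega D) ?g) (unit_map C)) x = g.F0 (C.p0 x)"
        using x g.Pt_map_snd[OF C.p0_in[OF x]] by (simp add: ET_comp_def compose_def unit_map_snd)
      also have "\<dots> = snd (ET_comp C (unit_map D) f) x"
        using F0[OF x] x F(12)[OF x] by (simp add: ET_comp_def compose_def unit_map_snd)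
      finally show "snd (ET_comp C (Pt_map (Omega C) (Omega D) ?g) (unit_map C)) x = snd (ET_comp C (unit_map D) f) x" .
    qed (simp_all add: ET_comp_def)
  qed
qed

section \<open>The counit and the adjunction\<close>

definition counit_map :: "('a, 'b) loc_cat \<Rightarrow> 'a \<Rightarrow> ('a \<Rightarrow> bool) set" where
  "counit_map L = (\<lambda>a\<in>carrier (L1 L). {p \<in> pt (L1 L). p a})"

context etale_localic
begin

text \<open>
  For a point \<open>p\<close> in \<open>e\<close> the values at \<open>c\<close> and at \<open>d\<^sup>*(u\<^sup>*(c))\<close> agree, since the two elements
  have the same meet with \<open>e\<close>. So \<open>p\<close> is the unit at \<open>d(p)\<close>.
\<close>

lemma pt_map_u_image:
  assumes z: "z \<in> carrier (L0 C)"
  shows "pt_map (L1 C) (ls_u C) ` {q \<in> pt (L0 C). q z} = {p \<in> pt (L1 C). p (u.sh z)}"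
proof (intro equalityI subsetI)
  fix p assume "p \<in> pt_map (L1 C) (ls_u C) ` {q \<in> pt (L0 C). q z}"
  then obtain q where "q \<in> pt (L0 C)" "q z" "p = pt_map (L1 C) (ls_u C) q" by blast
  then show "p \<in> {p \<in> pt (L1 C). p (u.sh z)}" using z by simp
next
  fix p assume "p \<in> {p \<in> pt (L1 C). p (u.sh z)}"
  then have p: "p \<in> pt (L1 C)" "p (u.sh z)" by auto
  then have pE: "p E" "p (ls_d C z)"
    using u_sh_d[OF z] pt_meet[OF p(1), of E "ls_d C z"] z by simp_all
  have "p = pt_map (L1 C) (ls_u C) (ptd p)"
  proof (rule pt_eqI[OF p(1)])
    show "pt_map (L1 C) (ls_u C) (ptd p) \<in> pt (L1 C)" using p by simp
    fix c assume c: "c \<in> carrier (L1 C)"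
    have "c \<sqinter>\<^sub>1 E = E \<sqinter>\<^sub>1 ls_d C (ls_u C c)" using u_sh_u[OF c] u_sh_d[of "ls_u C c"] c by simp
    then have "p c \<longleftrightarrow> p (ls_d C (ls_u C c))"
      using pt_meet[OF p(1) c, of E] pt_meet[OF p(1), of E "ls_d C (ls_u C c)"] pE(1) c by simp
    then show "p c = pt_map (L1 C) (ls_u C) (ptd p) c" using c by simp
  qed
  moreover have "ptd p \<in> {q \<in> pt (L0 C). q z}" using p pE z by simp
  ultimately show "p \<in> pt_map (L1 C) (ls_u C) ` {q \<in> pt (L0 C). q z}" by blast
qed

lemma counit_apply: "a \<in> carrier (L1 C) \<Longrightarrow> counit_map C a = {p \<in> pt (L1 C). p a}"
  by (simp add: counit_map_def)

text \<open>
  Points preserve joins and finite meets, so the counit does; it is compatible with products by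
  \<open>Pt_factor\<close>, and with \<open>\<lambda>\<close> and \<open>\<rho>\<close> because \<open>d\<^sub>!\<close>, \<open>r\<^sub>!\<close> and \<open>u\<^sub>!\<close> are images on
  points.
\<close>

theorem counit_map_hom: "counit_map C \<in> EL_hom k (Omega (Pt C)) C"
proof -
  interpret PT: topological_cat "Pt C" by (rule topological_cat_Pt)
  have op: "openin (T1 (Pt C)) {p \<in> pt (L1 C). p a}" if "a \<in> carrier (L1 C)" for a
    using openin_Pt_basic[OF that] by simp
  have c: "pt_map (L1 C) (ls_u C) ` pt (L0 C) = {p \<in> pt (L1 C). p E}"
  proof -
    have "{q \<in> pt (L0 C). q \<top>\<^bsub>L0 C\<^esub>} = pt (L0 C)" using pt_top by blast
    then show ?thesis using pt_map_u_image[of "\<top>\<^bsub>L0 C\<^esub>"] by simp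
  qed
  show ?thesis
  proof (rule EL_homI[OF PT.etale_localic_Omega etale])
    show "counit_map C \<in> carrier (L1 C) \<rightarrow>\<^sub>E carrier (L1 (Omega (Pt C)))"
      using op by (auto simp: counit_map_def)
    show "counit_map C (\<Squnion>\<^sub>1A) = \<Squnion>\<^bsub>L1 (Omega (Pt C))\<^esub>(counit_map C ` A)" if A: "A \<subseteq> carrier (L1 C)" for A
    proof -
      have im: "counit_map C ` A = (\<lambda>a. {p \<in> pt (L1 C). p a}) ` A"
        by (rule image_cong[OF refl]) (use A counit_apply in auto)
      have "counit_map C ` A \<subseteq> {U. openin (T1 (Pt C)) U}" unfolding im using op A by blast
      then have "\<Squnion>\<^bsub>L1 (Omega (Pt C))\<^esub>(counit_map C ` A) = \<Union>(counit_map C ` A)" by (simp add: Sup_opens)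
      also have "\<dots> = {p \<in> pt (L1 C). p (\<Squnion>\<^sub>1A)}" unfolding im using pt_Sup[OF _ A] by auto
      finally show ?thesis using A by (simp add: counit_apply)
    qed
    show "counit_map C (a \<star> b) = counit_map C a \<star>\<^bsub>Omega (Pt C)\<^esub> counit_map C b"
      if a: "a \<in> carrier (L1 C)" and b: "b \<in> carrier (L1 C)" for a b
      unfolding counit_apply[OF a] counit_apply[OF b] counit_apply[OF mult_closed[OF a b]]
        PT.Omega_mult[OF op[OF a] op[OF b]]
    proof (intro equalityI subsetI)
      fix s assume "s \<in> {p \<in> pt (L1 C). p (a \<star> b)}"
      then obtain p q where "p \<in> pt (L1 C)" "q \<in> pt (L1 C)" "ptd p = ptr q" "p a" "q b" "s = ts_m (Pt C) (p, q)"
        using Pt_factor[OF _ a b] by blast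
      then show "s \<in> {ts_m (Pt C) (x, y) |x y. x \<in> {p \<in> pt (L1 C). p a} \<and> y \<in> {p \<in> pt (L1 C). p b}
          \<and> ts_d (Pt C) x = ts_r (Pt C) y}" unfolding Pt_simps by blast
    next
      fix s assume "s \<in> {ts_m (Pt C) (x, y) |x y. x \<in> {p \<in> pt (L1 C). p a} \<and> y \<in> {p \<in> pt (L1 C). p b}
          \<and> ts_d (Pt C) x = ts_r (Pt C) y}"
      then obtain p q where pq: "p \<in> pt (L1 C)" "q \<in> pt (L1 C)" "ptd p = ptr q" "p a" "q b" "s = ts_m (Pt C) (p, q)"
        unfolding Pt_simps by blast
      then show "s \<in> {p \<in> pt (L1 C). p (a \<star> b)}"
        using Pt_m_in[OF pq(1-3)] Pt_m_mult[OF pq(1-3) a b pq(4,5)] by simp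
    qed
    show "counit_map C \<e>\<^bsub>quantal_of C\<^esub> = \<e>\<^bsub>quantal_of (Omega (Pt C))\<^esub>"
      using c by (simp add: PT.Omega_unit qunit_eq counit_apply)
    show "counit_map C (\<lambda>\<^sub>q\<^bsub>quantal_of C\<^esub> a) = \<lambda>\<^sub>q\<^bsub>quantal_of (Omega (Pt C))\<^esub> (counit_map C a)"
      "counit_map C (\<rho>\<^sub>q\<^bsub>quantal_of C\<^esub> a) = \<rho>\<^sub>q\<^bsub>quantal_of (Omega (Pt C))\<^esub> (counit_map C a)"
      if a: "a \<in> carrier (L1 C)" for a
      using a pt_map_u_image d.pt_map_image[OF a] r.pt_map_image[OF a]
      unfolding counit_apply[OF a] PT.Omega_lam[OF op[OF a]] PT.Omega_rho[OF op[OF a]]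
      by (simp_all add: lam_eq rho_eq counit_apply)
    show "counit_map C a \<in> local_bisections (Omega (Pt C))" if a: "a \<in> local_bisections C" for a
    proof -
      have s: "d.sect a" "r.sect a" using a by (auto simp: bisection_iff)
      have ac: "a \<in> carrier (L1 C)" by (rule bisection_closed[OF a])
      show ?thesis
        unfolding PT.Omega_bisection_iff counit_apply[OF ac]
        using op[OF ac] d.section_pt_unique[OF s(1)] r.section_pt_unique[OF s(2)] by (auto simp: inj_on_def)
    qed
    show "counit_map C \<top>\<^bsub>L1 C\<^esub> = \<top>\<^bsub>L1 (Omega (Pt C))\<^esub>"
      using pt_top by (auto simp: counit_apply top_opens)
    show "counit_map C (a \<sqinter>\<^sub>1 b) = counit_map C a \<sqinter>\<^bsub>L1 (Omega (Pt C))\<^esub> counit_map C b"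
      if "a \<in> carrier (L1 C)" "b \<in> carrier (L1 C)" for a b
    proof -
      have "{p \<in> pt (L1 C). p (a \<sqinter>\<^sub>1 b)} = {p \<in> pt (L1 C). p a} \<inter> {p \<in> pt (L1 C). p b}"
        using pt_meet[OF _ that] by blast
      then show ?thesis
        using that op meet_opens[OF op[OF that(1)] op[OF that(2)]] by (simp add: counit_apply)
    qed
  qed
qed

text \<open>
  A point above the neighbourhood filter of \<open>q\<close>, with respect to the counit, is a point over \<open>d(q)\<close>
  all of whose neighbourhoods contain \<open>q\<close>; inside a bisection around it, it equals \<open>q\<close>.
\<close>

theorem triangle_identity:
  "ET_comp (Pt C) (Pt_map (Omega (Pt C)) C (counit_map C)) (unit_map (Pt C)) = ET_id (Pt C)"
proof -
  interpret PT: topological_cat "Pt C" by (rule topological_cat_Pt)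
  interpret e: el_morphism "Omega (Pt C)" C 1 "counit_map C"
    by unfold_locales (rule counit_map_hom)
  have in1: "p \<in> topspace (T1 (Pt C)) \<longleftrightarrow> p \<in> pt (L1 C)" and in0: "x \<in> topspace (T0 (Pt C)) \<longleftrightarrow> x \<in> pt (L0 C)" for p x
    by simp_all
  have op0: "openin (T0 (Pt C)) {x \<in> pt (L0 C). x z}" if "z \<in> carrier (L0 C)" for z
    using openin_pt_space[OF frame0] that by auto
  have op1: "openin (T1 (Pt C)) {p \<in> pt (L1 C). p a}" if "a \<in> carrier (L1 C)" for a
    using openin_Pt_basic[OF that] by simp
  have obj: "e.f0 z = {x \<in> pt (L0 C). x z}" if z: "z \<in> carrier (L0 C)" for z
  proof -
    have uz: "u.sh z \<in> carrier (L1 C)" using z by simp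
    have "e.f0 z = PT.O.d.sh {p \<in> pt (L1 C). p (u.sh z)}"
      using e.f0_apply[OF z] counit_apply[OF uz] by simp
    also have "\<dots> = ts_d (Pt C) ` {p \<in> pt (L1 C). p (u.sh z)}" by (rule PT.Omega_d_sh[OF op1[OF uz]])
    also have "\<dots> = {x \<in> pt (L0 C). x z}" using d.pt_map_image[OF uz] z by simp
    finally show ?thesis .
  qed
  have F0: "e.F0 (PT.p0 x) = x" if x: "x \<in> pt (L0 C)" for x
  proof (rule pt_eqI[OF e.F0_in[OF PT.p0_in] x])
    show "x \<in> topspace (T0 (Pt C))" using x in0 by simp
    fix z assume z: "z \<in> carrier (L0 C)"
    then show "e.F0 (PT.p0 x) z = x z" using x op0[OF z] by (simp add: obj)
  qed
  have above: "e.above (PT.p1 q) p \<longleftrightarrow> p = q" if q: "q \<in> pt (L1 C)" for p q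
  proof -
    have q1: "q \<in> topspace (T1 (Pt C))" using q by simp
    have base: "e.F0 (PT.O.ptd (PT.p1 q)) = ptd q"
      using PT.ptd_p1[OF q1] F0[OF ptd_in[OF q]] by simp
    have mem: "PT.p1 q (counit_map C a) \<longleftrightarrow> q a" if a: "a \<in> carrier (L1 C)" for a
      using op1[OF a] q by (simp add: counit_apply[OF a])
    show ?thesis
    proof
      assume p: "e.above (PT.p1 q) p"
      then have pp: "p \<in> pt (L1 C)" and dp: "ptd p = ptd q"
        and hp: "\<And>a. \<lbrakk>a \<in> carrier (L1 C); p a\<rbrakk> \<Longrightarrow> PT.p1 q (counit_map C a)"
        unfolding e.above_def base by blast+
      obtain c where c: "c \<in> local_bisections C" "p c"
        using pt_bisection[OF pp F1.top_closed pt_top[OF pp]] by blast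
      have "q c" using hp[OF bisection_closed[OF c(1)] c(2)] mem[OF bisection_closed[OF c(1)]] by simp
      then show "p = q" by (rule e.above_unique[OF c(1) pp c(2) q _ dp])
    next
      assume "p = q"
      then show "e.above (PT.p1 q) p" unfolding e.above_def base using q mem by blast
    qed
  qed
  show ?thesis
  proof (rule prod_eqI)
    show "fst (ET_comp (Pt C) (Pt_map (Omega (Pt C)) C (counit_map C)) (unit_map (Pt C))) = fst (ET_id (Pt C))"
    proof (rule extensionalityI[of _ "topspace (T1 (Pt C))"])
      fix q assume q1: "q \<in> topspace (T1 (Pt C))"
      then have q: "q \<in> pt (L1 C)" using in1 by simp
      have "fst (ET_comp (Pt C) (Pt_map (Omega (Pt C)) C (counit_map C)) (unit_map (Pt C))) q
          = fst (Pt_map (Omega (Pt C)) C (counit_map C)) (PT.p1 q)"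
        using q1 by (simp add: ET_comp_def unit_map_fst del: Pt_simps)
      also have "\<dots> = {q}" using e.Pt_map_fst[OF PT.p1_in[OF q1]] above[OF q] by blast
      finally show "fst (ET_comp (Pt C) (Pt_map (Omega (Pt C)) C (counit_map C)) (unit_map (Pt C))) q = fst (ET_id (Pt C)) q"
        using q1 by (simp add: ET_id_def del: Pt_simps)
    qed (simp_all add: ET_comp_def ET_id_def)
    show "snd (ET_comp (Pt C) (Pt_map (Omega (Pt C)) C (counit_map C)) (unit_map (Pt C))) = snd (ET_id (Pt C))"
    proof (rule extensionalityI[of _ "topspace (T0 (Pt C))"])
      fix x assume x0: "x \<in> topspace (T0 (Pt C))"
      then have x: "x \<in> pt (L0 C)" using in0 by simp
      show "snd (ET_comp (Pt C) (Pt_map (Omega (Pt C)) C (counit_map C)) (unit_map (Pt C))) x = snd (ET_id (Pt C)) x"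
        using x0 F0[OF x] e.Pt_map_snd[OF PT.p0_in[OF x0]]
        by (simp add: ET_comp_def ET_id_def compose_def unit_map_snd del: Pt_simps)
    qed (simp_all add: ET_comp_def ET_id_def)
  qed
qed

end

text \<open>
  The composite of \<open>\<Omega>(f)\<close> with the counit is a solution by naturality of the unit and the triangle
  identity. For uniqueness, \<open>f_iff_above\<close> expresses a solution \<open>h\<close> by the values of \<open>Pt(h)\<close> on the
  image of the unit, and these are given by \<open>f\<close>.
\<close>

theorem unit_map_universal:
  assumes C: "etale_topological_category C" and L: "etale_localic_category L" and f: "f \<in> ET_hom k C (Pt L)"
  shows "\<exists>!g. g \<in> EL_hom k (Omega C) L \<and> ET_comp C (Pt_map (Omega C) L g) (unit_map C) = f"
proof -
  interpret C: topological_cat C by (rule topological_cat_if_etale[OF C])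
  interpret L: etale_localic L by (rule etale_localic.intro[OF L])
  interpret PT: topological_cat "Pt L" by (rule L.topological_cat_Pt)
  let ?g = "EL_comp L (counit_map L) (Omega_map C (Pt L) f)"
  note Of = Omega_map_hom[OF f C PT.etale]
  note e = L.counit_map_hom[of k]
  have g: "?g \<in> EL_hom k (Omega C) L"
    by (rule EL_comp_hom[OF C.etale_localic_Omega PT.etale_localic_Omega L Of e])
  let ?Pe = "Pt_map (Omega (Pt L)) L (counit_map L)" and ?PO = "Pt_map (Omega C) (Omega (Pt L)) (Omega_map C (Pt L) f)"
  have "ET_comp C (Pt_map (Omega C) L ?g) (unit_map C) = ET_comp C (ET_comp (Pt (Omega C)) ?Pe ?PO) (unit_map C)"
    by (simp only: Pt_map_comp[OF C.etale_localic_Omega PT.etale_localic_Omega L Of e])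
  also have "\<dots> = ET_comp C ?Pe (ET_comp C ?PO (unit_map C))"
    by (rule ET_comp_assoc[OF C.unit_map_hom, symmetric])
  also have "ET_comp C ?PO (unit_map C) = ET_comp C (unit_map (Pt L)) f"
    by (rule unit_map_natural[OF C PT.etale f])
  also have "ET_comp C ?Pe (ET_comp C (unit_map (Pt L)) f) = ET_comp C (ET_comp (Pt L) ?Pe (unit_map (Pt L))) f"
    by (rule ET_comp_assoc[OF f])
  also have "\<dots> = f" unfolding L.triangle_identity by (rule ET_comp_id(2)[OF f])
  finally have gf: "ET_comp C (Pt_map (Omega C) L ?g) (unit_map C) = f" .
  have determined: "h a = {x \<in> topspace (T1 C). \<exists>p\<in>fst f x. p a}"
    if h: "h \<in> EL_hom k (Omega C) L" and hf: "ET_comp C (Pt_map (Omega C) L h) (unit_map C) = f"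
      and a: "a \<in> carrier (L1 L)" for h a
  proof -
    interpret h: el_morphism "Omega C" L k h by unfold_locales (rule h)
    have o: "openin (T1 C) (h a)" using h.f_closed[OF a] by simp
    have "x \<in> h a \<longleftrightarrow> (\<exists>p\<in>fst f x. p a)" if x: "x \<in> topspace (T1 C)" for x
    proof -
      have "x \<in> h a \<longleftrightarrow> C.p1 x (h a)" using o by simp
      also have "\<dots> \<longleftrightarrow> (\<exists>p\<in>fst (Pt_map (Omega C) L h) (C.p1 x). p a)"
        using h.f_iff_above[OF C.p1_in[OF x] a] h.Pt_map_fst[OF C.p1_in[OF x]] by blast
      also have "fst (Pt_map (Omega C) L h) (C.p1 x) = fst f x"
        unfolding hf[symmetric] using x by (simp add: ET_comp_def unit_map_fst)
      finally show ?thesis .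
    qed
    then show ?thesis using openin_subset[OF o] by blast
  qed
  show ?thesis
  proof (rule ex1I[of _ ?g])
    show "?g \<in> EL_hom k (Omega C) L \<and> ET_comp C (Pt_map (Omega C) L ?g) (unit_map C) = f" using g gf by blast
    fix h assume h: "h \<in> EL_hom k (Omega C) L \<and> ET_comp C (Pt_map (Omega C) L h) (unit_map C) = f"
    have ext: "h' \<in> extensional (carrier (L1 L))" if "h' \<in> EL_hom k (Omega C) L" for h'
      using EL_homD(1)[OF that] by (simp add: PiE_def)
    show "h = ?g"
    proof (rule extensionalityI[OF ext ext])
      fix a assume a: "a \<in> carrier (L1 L)"
      show "h a = ?g a" using determined[of h a] determined[OF g gf a] h a by simp
    qed (use h g in blast)+
  qed
qed

theorem theorem1p5:
  fixes k :: nat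
    and C :: "('a1, 'a0) top_cat" and C' :: "('b1, 'b0) top_cat"
    and C'' :: "('c1, 'c0) top_cat" and C''' :: "('d1, 'd0) top_cat"
    and L :: "('e1, 'e0) loc_cat" and L' :: "('f1, 'f0) loc_cat"
    and L'' :: "('g1, 'g0) loc_cat" and L''' :: "('h1, 'h0) loc_cat"
  assumes "k \<in> {1, 2, 3, 4}"
    and "etale_topological_category C" and "etale_topological_category C'"
    and "etale_topological_category C''" and "etale_topological_category C'''"
    and "etale_localic_category L" and "etale_localic_category L'"
    and "etale_localic_category L''" and "etale_localic_category L'''"
  shows
    "\<comment> \<open>\<open>ET\<^sub>k\<close> is a category\<close>
     (ET_id C \<in> ET_hom k C C \<and>
      (\<forall>f\<in>ET_hom k C C'. \<forall>g\<in>ET_hom k C' C''. ET_comp C g f \<in> ET_hom k C C'') \<and>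
      (\<forall>f\<in>ET_hom k C C'. ET_comp C f (ET_id C) = f \<and> ET_comp C (ET_id C') f = f) \<and>
      (\<forall>f\<in>ET_hom k C C'. \<forall>g\<in>ET_hom k C' C''. \<forall>h\<in>ET_hom k C'' C'''.
         ET_comp C h (ET_comp C g f) = ET_comp C (ET_comp C' h g) f)) \<and>
     \<comment> \<open>\<open>EL\<^sub>k\<close> is a category\<close>
     (EL_id L \<in> EL_hom k L L \<and>
      (\<forall>f\<in>EL_hom k L L'. \<forall>g\<in>EL_hom k L' L''. EL_comp L'' g f \<in> EL_hom k L L'') \<and>
      (\<forall>f\<in>EL_hom k L L'. EL_comp L' f (EL_id L) = f \<and> EL_comp L' (EL_id L') f = f) \<and>
      (\<forall>f\<in>EL_hom k L L'. \<forall>g\<in>EL_hom k L' L''. \<forall>h\<in>EL_hom k L'' L'''.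
         EL_comp L''' h (EL_comp L'' g f) = EL_comp L''' (EL_comp L''' h g) f)) \<and>
     \<comment> \<open>\<open>\<Omega>\<^sub>k : ET\<^sub>k \<rightarrow> EL\<^sub>k\<close> is a functor\<close>
     (etale_localic_category (Omega C) \<and>
      (\<forall>f\<in>ET_hom k C C'. Omega_map C C' f \<in> EL_hom k (Omega C) (Omega C')) \<and>
      Omega_map C C (ET_id C) = EL_id (Omega C) \<and>
      (\<forall>f\<in>ET_hom k C C'. \<forall>g\<in>ET_hom k C' C''.
         Omega_map C C'' (ET_comp C g f) =
           EL_comp (Omega C'') (Omega_map C' C'' g) (Omega_map C C' f))) \<and>
     \<comment> \<open>\<open>Pt\<^sub>k : EL\<^sub>k \<rightarrow> ET\<^sub>k\<close> is a functor\<close>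
     (etale_topological_category (Pt L) \<and>
      (\<forall>f\<in>EL_hom k L L'. Pt_map L L' f \<in> ET_hom k (Pt L) (Pt L')) \<and>
      Pt_map L L (EL_id L) = ET_id (Pt L) \<and>
      (\<forall>f\<in>EL_hom k L L'. \<forall>g\<in>EL_hom k L' L''.
         Pt_map L L'' (EL_comp L'' g f) =
           ET_comp (Pt L) (Pt_map L' L'' g) (Pt_map L L' f))) \<and>
     \<comment> \<open>\<open>unit_map\<close> is a natural transformation from the identity to \<open>Pt\<^sub>k \<circ> \<Omega>\<^sub>k\<close>\<close>
     (unit_map C \<in> ET_hom k C (Pt (Omega C)) \<and>
      (\<forall>f\<in>ET_hom k C C'.
         ET_comp C (Pt_map (Omega C) (Omega C') (Omega_map C C' f)) (unit_map C) =
           ET_comp C (unit_map C') f)) \<and>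
     \<comment> \<open>its components are universal, i.e. it is the unit of an adjunction with \<open>\<Omega>\<^sub>k\<close> left
         adjoint to \<open>Pt\<^sub>k\<close>\<close>
     (\<forall>f\<in>ET_hom k C (Pt L).
        \<exists>!g. g \<in> EL_hom k (Omega C) L \<and> ET_comp C (Pt_map (Omega C) L g) (unit_map C) = f) \<and>
     \<comment> \<open>the unit is single-valued and given by membership\<close>
     (\<forall>a\<in>topspace (T1 C). \<exists>p. fst (unit_map C) a = {p} \<and>
        (\<forall>B. openin (T1 C) B \<longrightarrow> (p B \<longleftrightarrow> a \<in> B))) \<and>
     (\<forall>x\<in>topspace (T0 C). \<forall>B. openin (T0 C) B \<longrightarrow> (snd (unit_map C) x B \<longleftrightarrow> x \<in> B))"
proof (intro conjI ballI impI allI)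
  note C = assms(2) and C' = assms(3) and L = assms(6) and L' = assms(7) and L'' = assms(8)
  interpret C: topological_cat C by (rule topological_cat_if_etale[OF C])
  interpret L: etale_localic L by (rule etale_localic.intro[OF L])
  show "ET_id C \<in> ET_hom k C C" by (rule ET_id_hom[OF C])
  show "ET_comp C g f \<in> ET_hom k C C''" if "f \<in> ET_hom k C C'" "g \<in> ET_hom k C' C''" for f g
    by (rule ET_comp_hom[OF that C C'])
  show "ET_comp C f (ET_id C) = f" "ET_comp C (ET_id C') f = f" if "f \<in> ET_hom k C C'" for f
    by (rule ET_comp_id[OF that])+
  show "ET_comp C h (ET_comp C g f) = ET_comp C (ET_comp C' h g) f"
    if "f \<in> ET_hom k C C'" for f and g :: "('b1 \<Rightarrow> 'c1 set) \<times> ('b0 \<Rightarrow> 'c0)" and h :: "('c1 \<Rightarrow> 'd1 set) \<times> ('c0 \<Rightarrow> 'd0)"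
    by (rule ET_comp_assoc[OF that])
  show "EL_id L \<in> EL_hom k L L" by (rule EL_id_hom[OF L])
  show "EL_comp L'' g f \<in> EL_hom k L L''" if "f \<in> EL_hom k L L'" "g \<in> EL_hom k L' L''" for f g
    by (rule EL_comp_hom[OF L L' L'' that])
  show "EL_comp L' f (EL_id L) = f" "EL_comp L' (EL_id L') f = f" if "f \<in> EL_hom k L L'" for f
    by (rule EL_comp_id[OF that])+
  show "EL_comp L''' h (EL_comp L'' g f) = EL_comp L''' (EL_comp L''' h g) f"
    if "h \<in> EL_hom k L'' L'''" for f :: "'f1 \<Rightarrow> 'e1" and g :: "'g1 \<Rightarrow> 'f1" and h
    by (rule EL_comp_assoc[OF that])
  show "etale_localic_category (Omega C)" by (rule C.etale_localic_Omega)
  show "Omega_map C C' f \<in> EL_hom k (Omega C) (Omega C')" if "f \<in> ET_hom k C C'" for f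
    by (rule Omega_map_hom[OF that C C'])
  show "Omega_map C C (ET_id C) = EL_id (Omega C)" by (rule Omega_map_id)
  show "Omega_map C C'' (ET_comp C g f) = EL_comp (Omega C'') (Omega_map C' C'' g) (Omega_map C C' f)"
    if "f \<in> ET_hom k C C'" "g \<in> ET_hom k C' C''" for f g
    by (rule Omega_map_comp[OF that])
  show "etale_topological_category (Pt L)" by (rule topological_cat.etale[OF L.topological_cat_Pt])
  show "Pt_map L L' f \<in> ET_hom k (Pt L) (Pt L')" if "f \<in> EL_hom k L L'" for f
  proof -
    interpret L': etale_localic L' by (rule etale_localic.intro[OF L'])
    interpret el_morphism L L' k f by unfold_locales (rule that)
    show ?thesis by (rule Pt_map_hom)
  qed
  show "Pt_map L L (EL_id L) = ET_id (Pt L)" by (rule Pt_map_id[OF L])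
  show "Pt_map L L'' (EL_comp L'' g f) = ET_comp (Pt L) (Pt_map L' L'' g) (Pt_map L L' f)"
    if "f \<in> EL_hom k L L'" "g \<in> EL_hom k L' L''" for f g
    by (rule Pt_map_comp[OF L L' L'' that])
  show "unit_map C \<in> ET_hom k C (Pt (Omega C))" by (rule C.unit_map_hom)
  show "ET_comp C (Pt_map (Omega C) (Omega C') (Omega_map C C' f)) (unit_map C) = ET_comp C (unit_map C') f"
    if "f \<in> ET_hom k C C'" for f
    by (rule unit_map_natural[OF C C' that])
  show "\<exists>!g. g \<in> EL_hom k (Omega C) L \<and> ET_comp C (Pt_map (Omega C) L g) (unit_map C) = f"
    if "f \<in> ET_hom k C (Pt L)" for f
    by (rule unit_map_universal[OF C L that])
  show "\<exists>p. fst (unit_map C) a = {p} \<and> (\<forall>B. openin (T1 C) B \<longrightarrow> (p B \<longleftrightarrow> a \<in> B))"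
    if "a \<in> topspace (T1 C)" for a
    using that by (intro exI[of _ "point_at (T1 C) a"]) (simp add: unit_map_fst)
  show "snd (unit_map C) x B \<longleftrightarrow> x \<in> B" if "x \<in> topspace (T0 C)" "openin (T0 C) B" for x B
    using that by (simp add: unit_map_snd)
qed

end
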